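(* Let $z_1<\dots<z_p$ be real numbers, $p\ge2$, and $\alpha_1,\dots,\alpha_p,\gamma$ complex numbers with positive real parts. Then, with the rows and columns indexed by $\mathcal Z_n^{p-1}$ in the same order, $$\det\Big[\int_{\mathbb U_{\mathbf l}}\Phi(t,z)\,\omega_{\mathbf m}(t,z)\Big]_{\mathbf l,\mathbf m\in\mathcal Z_n^{p-1}} =\prod_{s=0}^{n-1}\Big[\frac{\Gamma((s+1)\gamma)^{p-1}}{\Gamma(\gamma)^{p-1}}\frac{\Gamma(1+\alpha_p+s\gamma)\prod_{j=1}^{p-1}\Gamma(\alpha_j+s\gamma)}{\Gamma(1+\sum_{j=1}^p\alpha_j+(2n-2-s)\gamma)}\Big]^{\binom{p+n-s-3}{p-2}}$$ $$\times\exp\Big(i\pi\binom{p+n-2}{p-1}\sum_{s=1}^p(s-1)\alpha_s\Big)\prod_{1\le a<b\le p}(z_b-z_a)^{(\alpha_a+\alpha_b)\binom{p+n-2}{p-1}+2\gamma\binom{p+n-2}{p}}.$$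
   Context: For $t\in\mathbb R^n$, $$\Phi(t,z)=\prod_{s=1}^p\prod_{i=1}^n(t_i-z_s)^{\alpha_s}\prod_{1\le i<j\le n}(t_j-t_i)^{2\gamma},$$ where every power $x^{\alpha_s}$ and $x^{2\gamma}$ uses the branch with $-\pi/2<\arg x<3\pi/2$. $\mathcal Z_n^p=\{\mathbf l=(l_1,\dots,l_p)\in\mathbb Z^p: l_i\ge0,\ l_1+\dots+l_p=n\}$. Set $\mathbf l^s=l_1+\dots+l_s$ and $\mathbf l^0=0$, and $\Gamma_{\mathbf m,s}=\{\mathbf m^{s-1}+1,\dots,\mathbf m^s\}$. For $\mathbf m\in\mathcal Z_n^p$, $$\omega_{\mathbf m}=\Big(\sum_{\sigma\in S_n}\prod_{s=1}^p\frac{1}{m_s!}\prod_{j\in\Gamma_{\mathbf m,s}}\frac{1}{t_{\sigma_j}-z_s}\Big)dt_1\wedge\dots\wedge dt_n,$$ and $\mathbf m\in\mathcal Z_n^{p-1}$ is identified with $(\mathbf m,0)\in\mathcal Z_n^p$. For $\mathbf l\in\mathcal Z_n^{p-1}$, $$\mathbb U_{\mathbf l}=\{t\in\mathbb R^n: z_s\le t_{\mathbf l^{s-1}+1}\le\dots\le t_{\mathbf l^s}\le z_{s+1}\text{ for }s=1,\dots,p-1\},$$ with the standard orientation of $\mathbb R^n$. *)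

theory Defs
  imports "HOL-Analysis.Analysis"
begin

text \<open>Branch of the logarithm with argument in the open interval (-pi/2, 3pi/2).\<close>
definition br_log :: "complex \<Rightarrow> complex" where
  "br_log x = (if Im (Ln x) \<le> - pi / 2 then Ln x + 2 * pi * \<i> else Ln x)"

text \<open>Power x^a using that branch (value at x = 0 irrelevant; set to 0).\<close>
definition br_pow :: "complex \<Rightarrow> complex \<Rightarrow> complex" where
  "br_pow x a = (if x = 0 then 0 else exp (a * br_log x))"

definition Zset :: "nat \<Rightarrow> nat \<Rightarrow> (nat \<Rightarrow> nat) set" where
  "Zset n k = {l. (\<forall>i. i \<notin> {1..k} \<longrightarrow> l i = 0) \<and> (\<Sum>i=1..k. l i) = n}"

definition psum :: "(nat \<Rightarrow> nat) \<Rightarrow> nat \<Rightarrow> nat" where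
  "psum l s = (\<Sum>i=1..s. l i)"

definition Gam :: "(nat \<Rightarrow> nat) \<Rightarrow> nat \<Rightarrow> nat set" where
  "Gam m s = {psum m (s - 1) + 1 .. psum m s}"

definition Phi :: "nat \<Rightarrow> nat \<Rightarrow> (nat \<Rightarrow> real) \<Rightarrow> (nat \<Rightarrow> complex) \<Rightarrow> complex
    \<Rightarrow> (nat \<Rightarrow> real) \<Rightarrow> complex" where
  "Phi n p z \<alpha> \<gamma> t =
     (\<Prod>s=1..p. \<Prod>i=1..n. br_pow (complex_of_real (t i - z s)) (\<alpha> s)) *
     (\<Prod>i=1..n. \<Prod>j\<in>{i<..n}. br_pow (complex_of_real (t j - t i)) (2 * \<gamma>))"

text \<open>Coefficient of omega_m with respect to dt_1 \<and> ... \<and> dt_n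
  (m in Z_n^{p-1} is identified with (m,0) in Z_n^p).\<close>
definition omega :: "nat \<Rightarrow> nat \<Rightarrow> (nat \<Rightarrow> real) \<Rightarrow> (nat \<Rightarrow> nat) \<Rightarrow> (nat \<Rightarrow> real) \<Rightarrow> complex" where
  "omega n p z m t =
     (\<Sum>\<sigma> | \<sigma> permutes {1..n}.
        \<Prod>s=1..p. (1 / of_nat (fact (m s))) *
          (\<Prod>j\<in>Gam m s. 1 / complex_of_real (t (\<sigma> j) - z s)))"

definition Uset :: "nat \<Rightarrow> nat \<Rightarrow> (nat \<Rightarrow> real) \<Rightarrow> (nat \<Rightarrow> nat) \<Rightarrow> (nat \<Rightarrow> real) set" where
  "Uset n p z l = {t. \<forall>s\<in>{1..p-1}.
      (\<forall>j\<in>Gam l s. z s \<le> t j \<and> t j \<le> z (s + 1)) \<and>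
      (\<forall>j\<in>{psum l (s - 1) + 1 ..< psum l s}. t j \<le> t (j + 1))}"

abbreviation Rn :: "nat \<Rightarrow> (nat \<Rightarrow> real) measure" where
  "Rn n \<equiv> PiM {1..n} (\<lambda>_. lborel)"

text \<open>Determinant of a square matrix indexed by a finite set S (Leibniz formula);
  independent of the chosen ordering of S.\<close>
definition det_on :: "'i set \<Rightarrow> ('i \<Rightarrow> 'i \<Rightarrow> 'a::comm_ring_1) \<Rightarrow> 'a" where
  "det_on S M = (\<Sum>\<pi> | \<pi> permutes S. of_int (sign \<pi>) * (\<Prod>i\<in>S. M i (\<pi> i)))"

end

theory Submission
  imports Defs "HOL-Real_Asymp.Real_Asymp"
begin

text \<open>On \<open>Uset l\<close> the phase of \<open>Phi\<close> is constant, so each row reduces to an integral of the positive-type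
  weight \<open>Psi\<close> built from the powers of absolute values. Put \<open>c\<^sub>s = z\<^sub>p - z\<^sub>s\<close>, \<open>f\<^sub>s = 1 / (t - z\<^sub>s)\<close>,
  \<open>g\<^sub>s = c\<^sub>s f\<^sub>s\<close> and \<open>h\<^sub>s = (z\<^sub>p - t) f\<^sub>s = g\<^sub>s - 1\<close>. Replacing \<open>\<alpha>\<^sub>p\<close> by \<open>\<alpha>\<^sub>p + 1\<close> replaces symmetric products of
  the \<open>f\<^sub>s\<close> by symmetric products of the \<open>h\<^sub>s\<close>. With \<open>u\<^sub>s = g\<^sub>s - g\<^sub>1 = h\<^sub>s - h\<^sub>1\<close>, the products of
  \<open>h\<^sub>1\<close> and the \<open>u\<^sub>s\<close> are expressed through products of \<open>g\<^sub>1\<close> and the \<open>u\<^sub>s\<close> by the integration by parts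
  that comes from differentiating \<open>(t\<^sub>i - z\<^sub>p) Psi\<close>, and the transition matrix is triangular in the number of
  factors with index 1. This gives the determinant for \<open>\<alpha>\<^sub>p + 1\<close> as an explicit multiple of the determinant for \<open>\<alpha>\<^sub>p\<close>.

  Iterating \<open>K\<close> times and letting \<open>K\<close> tend to infinity, the substitution \<open>t\<^sub>i = z\<^sub>s + c\<^sub>s y\<^sub>i / K\<close> makes the rescaled matrix
  converge to a diagonal one, whose entries are products of Laguerre--Selberg integrals \<open>Lag\<close>. For two points this
  expresses Selberg's integral \<open>Sel n a b\<close> through \<open>Lag n a\<close>; its symmetry in \<open>a\<close> and \<open>b\<close> determines the dependence of
  \<open>Lag n a\<close> on \<open>a\<close>, and the translation \<open>y\<^sub>i = y\<^sub>1 + w\<^sub>i\<close> yields \<open>Lag n 1 = Lag (n - 1) (1 + 2 \<gamma>) / n\<close>, which fixes the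
  constant by induction on \<open>n\<close>.\<close>

section \<open>Determinants indexed by a finite set\<close>

text \<open>The factor (t_i - z_p) in the integration by parts has two effects. It raises the
  exponent at z_p to \<alpha>_p + 1, so boundary terms vanish as soon as Re \<alpha>_p > -1, and it
  turns the logarithmic derivative into a combination of 1 and the g_s, while the poles on t_i = t_j
  cancel under symmetrisation. Expressing h-words by g-words directly would mix letters of all
  indices; the u_s are common to both alphabets, so only index 1 changes and one diagonal
  coefficient per column is needed, a sum of Chu-Vandermonde type with a product form. A recursion
  by itself fixes the determinant only up to a factor periodic in \<alpha>_p, hence the asymptotics.
  The powers of K that normalise the rows add up to exactly what the Gamma quotients require, and an
  off-diagonal entry dies because a pole at a point other than the one its variable approaches
  leaves a factor 1/K uncompensated. Selberg's integral is no input: the same argument for two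
  points expresses it through \<open>Lag\<close>, and b = 1 is the choice that makes its symmetry an
  equation for \<open>Lag\<close> alone.\<close>

lemma det_on_cong:
  assumes "\<And>i j. i \<in> S \<Longrightarrow> j \<in> S \<Longrightarrow> M i j = N i j"
  shows "det_on S M = det_on S N"
  unfolding det_on_def
proof (intro sum.cong refl)
  fix \<pi> assume "\<pi> \<in> {\<pi>. \<pi> permutes S}"
  then have "(\<Prod>i\<in>S. M i (\<pi> i)) = (\<Prod>i\<in>S. N i (\<pi> i))"
    by (intro prod.cong refl assms) (auto simp: permutes_in_image)
  then show "of_int (sign \<pi>) * (\<Prod>i\<in>S. M i (\<pi> i)) = of_int (sign \<pi>) * (\<Prod>i\<in>S. N i (\<pi> i))" by simp
qed

lemma det_on_scale:
  "det_on S (\<lambda>i j. r i * M i j * c j) = (\<Prod>i\<in>S. r i) * (\<Prod>i\<in>S. c i) * det_on S M"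
proof -
  have "(\<Prod>i\<in>S. c (\<pi> i)) = (\<Prod>i\<in>S. c i)" if "\<pi> permutes S" for \<pi>
    using prod.permute[OF that, of c] by (simp add: o_def)
  then show ?thesis unfolding det_on_def
    by (simp add: prod.distrib sum_distrib_left mult_ac)
qed

lemma det_on_permute_rows:
  assumes "finite S" "\<tau> permutes S"
  shows "det_on S (\<lambda>i j. M (\<tau> i) j) = of_int (sign \<tau>) * det_on S M"
proof -
  have "det_on S (\<lambda>i j. M (\<tau> i) j)
      = (\<Sum>\<pi> | \<pi> permutes S. of_int (sign (\<pi> \<circ> \<tau>)) * (\<Prod>i\<in>S. M (\<tau> i) ((\<pi> \<circ> \<tau>) i)))"
    unfolding det_on_def by (rule sum_permutations_compose_right[OF assms(2)])
  also have "\<dots> = (\<Sum>\<pi> | \<pi> permutes S. of_int (sign \<tau>) * (of_int (sign \<pi>) * (\<Prod>i\<in>S. M i (\<pi> i))))"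
  proof (intro sum.cong refl)
    fix \<pi> assume "\<pi> \<in> {\<pi>. \<pi> permutes S}"
    then have \<pi>: "\<pi> permutes S" by simp
    have "(\<Prod>i\<in>S. M (\<tau> i) ((\<pi> \<circ> \<tau>) i)) = (\<Prod>i\<in>S. M i (\<pi> i))"
      using prod.permute[OF assms(2), of "\<lambda>i. M i (\<pi> i)"] by (simp add: o_def)
    moreover have "sign (\<pi> \<circ> \<tau>) = sign \<pi> * sign \<tau>"
      using assms \<pi> by (intro sign_compose permutes_imp_permutation) auto
    ultimately show "of_int (sign (\<pi> \<circ> \<tau>)) * (\<Prod>i\<in>S. M (\<tau> i) ((\<pi> \<circ> \<tau>) i))
        = of_int (sign \<tau>) * (of_int (sign \<pi>) * (\<Prod>i\<in>S. M i (\<pi> i)))" by simp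
  qed
  finally show ?thesis by (simp add: det_on_def sum_distrib_left)
qed

text \<open>Swapping the two rows changes nothing and yet flips the sign, so twice the determinant
  is 0; the sort constraints serve to cancel this 2.\<close>

lemma det_on_equal_rows:
  fixes M :: "'i \<Rightarrow> 'i \<Rightarrow> 'a :: {comm_ring_1, ring_char_0, idom}"
  assumes "finite S" "a \<in> S" "b \<in> S" "a \<noteq> b" "\<And>j. j \<in> S \<Longrightarrow> M a j = M b j"
  shows "det_on S M = 0"
proof -
  let ?\<tau> = "Transposition.transpose a b"
  have \<tau>: "?\<tau> permutes S" using assms by (simp add: permutes_swap_id)
  have "det_on S M = det_on S (\<lambda>i j. M (?\<tau> i) j)"
    by (rule det_on_cong) (auto simp: Transposition.transpose_def assms(5))
  also have "\<dots> = - det_on S M"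
    using det_on_permute_rows[OF assms(1) \<tau>, of M] assms(4) by (simp add: sign_swap_id)
  finally have "det_on S M + det_on S M = 0" by (metis add.right_inverse)
  then have "2 * det_on S M = 0" unfolding mult_2 by assumption
  then show ?thesis by simp
qed

text \<open>Multiplying out the row sums gives a sum over all maps of \<open>S\<close> to itself. A
  map that is not injective produces two equal rows; the injective ones are the permutations, and
  their signs factor out.\<close>

lemma det_on_mult:
  fixes A B :: "'i \<Rightarrow> 'i \<Rightarrow> 'a :: {comm_ring_1, ring_char_0, idom}"
  assumes S: "finite S"
  shows "det_on S (\<lambda>i j. \<Sum>k\<in>S. A i k * B k j) = det_on S A * det_on S B"
proof -
  let ?F = "PiE S (\<lambda>_. S)"
  have "det_on S (\<lambda>i j. \<Sum>k\<in>S. A i k * B k j)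
     = (\<Sum>\<pi> | \<pi> permutes S. of_int (sign \<pi>) * (\<Sum>f\<in>?F. \<Prod>i\<in>S. A i (f i) * B (f i) (\<pi> i)))"
    unfolding det_on_def by (simp add: prod_sum_PiE[OF S] S)
  also have "\<dots> = (\<Sum>f\<in>?F. (\<Prod>i\<in>S. A i (f i)) * det_on S (\<lambda>i j. B (f i) j))"
    unfolding det_on_def sum_distrib_left
    by (subst sum.swap) (simp add: prod.distrib mult_ac)
  also have "\<dots> = (\<Sum>f\<in>{f\<in>?F. inj_on f S}. (\<Prod>i\<in>S. A i (f i)) * det_on S (\<lambda>i j. B (f i) j))"
  proof (rule sum.mono_neutral_right)
    show "finite ?F" using S by (simp add: finite_PiE)
    show "\<forall>f\<in>?F - {f\<in>?F. inj_on f S}. (\<Prod>i\<in>S. A i (f i)) * det_on S (\<lambda>i j. B (f i) j) = 0"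
    proof
      fix f assume "f \<in> ?F - {f\<in>?F. inj_on f S}"
      then obtain a b where "a \<in> S" "b \<in> S" "a \<noteq> b" "f a = f b" by (auto simp: inj_on_def)
      then have "det_on S (\<lambda>i j. B (f i) j) = 0"
        by (intro det_on_equal_rows[OF S, of a b]) auto
      then show "(\<Prod>i\<in>S. A i (f i)) * det_on S (\<lambda>i j. B (f i) j) = 0" by simp
    qed
  qed auto
  also have "\<dots> = (\<Sum>\<pi> | \<pi> permutes S. (\<Prod>i\<in>S. A i (\<pi> i)) * det_on S (\<lambda>i j. B (\<pi> i) j))"
  \<comment> \<open>Maps in \<open>PiE\<close> are \<open>undefined\<close> off \<open>S\<close>,
    permutations are the identity there; the two witnesses switch between these conventions.\<close>
  proof (rule sum.reindex_bij_witness[where i="\<lambda>\<pi>. restrict \<pi> S" and j="\<lambda>f x. if x \<in> S then f x else x"])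
    fix f assume f: "f \<in> {f\<in>?F. inj_on f S}"
    show "restrict (\<lambda>x. if x \<in> S then f x else x) S = f" using f by (auto simp: PiE_def extensional_def fun_eq_iff)
    have "bij_betw f S S" using f endo_inj_surj[OF S, of f] by (auto simp: bij_betw_def)
    then have "bij_betw (\<lambda>x. if x \<in> S then f x else x) S S" by (subst bij_betw_cong[where g=f]) auto
    then show "(\<lambda>x. if x \<in> S then f x else x) \<in> {\<pi>. \<pi> permutes S}" by (auto intro!: bij_imp_permutes)
    have "det_on S (\<lambda>i j. B (if i \<in> S then f i else i) j) = det_on S (\<lambda>i j. B (f i) j)"
      by (rule det_on_cong) auto
    then show "(\<Prod>i\<in>S. A i (if i \<in> S then f i else i)) * det_on S (\<lambda>i j. B (if i \<in> S then f i else i) j)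
        = (\<Prod>i\<in>S. A i (f i)) * det_on S (\<lambda>i j. B (f i) j)" by simp
  next
    fix \<pi> assume "\<pi> \<in> {\<pi>. \<pi> permutes S}"
    then have \<pi>: "\<pi> permutes S" by simp
    show "(\<lambda>x. if x \<in> S then restrict \<pi> S x else x) = \<pi>"
      using \<pi> by (auto simp: fun_eq_iff permutes_def)
    show "restrict \<pi> S \<in> {f\<in>?F. inj_on f S}"
      using \<pi> by (auto simp: permutes_in_image permutes_inj_on inj_on_restrict_eq)
  qed
  also have "\<dots> = (\<Sum>\<pi> | \<pi> permutes S. (\<Prod>i\<in>S. A i (\<pi> i)) * (of_int (sign \<pi>) * det_on S B))"
    by (intro sum.cong refl) (simp add: det_on_permute_rows[OF S])
  also have "\<dots> = det_on S A * det_on S B"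
    by (simp add: det_on_def[of S A] sum_distrib_left mult_ac)
  finally show ?thesis .
qed

text \<open>\<open>key\<close> ranks the indices, and ties between different indices count as zero
  entries. A non-identity permutation with nonzero product would lower no key and raise one, while a
  permutation preserves the sum of all keys.\<close>

lemma det_on_triangular:
  fixes key :: "'i \<Rightarrow> nat"
  assumes S: "finite S"
    and tri: "\<And>i j. i \<in> S \<Longrightarrow> j \<in> S \<Longrightarrow> i \<noteq> j \<Longrightarrow> \<not> key i < key j \<Longrightarrow> M i j = 0"
  shows "det_on S M = (\<Prod>i\<in>S. M i i)"
proof -
  have "(\<Prod>i\<in>S. M i (\<pi> i)) = 0" if \<pi>: "\<pi> permutes S" and ne: "\<pi> \<noteq> id" for \<pi>
  proof (rule ccontr)
    assume nz: "(\<Prod>i\<in>S. M i (\<pi> i)) \<noteq> 0"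
    have nz': "M i (\<pi> i) \<noteq> 0" if "i \<in> S" for i
      using nz prod_zero[OF S, of "\<lambda>i. M i (\<pi> i)"] that by metis
    have lt: "key i < key (\<pi> i)" if "i \<in> S" "\<pi> i \<noteq> i" for i
      using tri[of i "\<pi> i"] nz'[OF that(1)] that \<pi> by (auto simp: permutes_in_image)
    obtain a where a: "\<pi> a \<noteq> a" using ne by (auto simp: fun_eq_iff)
    then have aS: "a \<in> S" using \<pi> by (meson permutes_not_in)
    have "(\<Sum>i\<in>S. key i) < (\<Sum>i\<in>S. key (\<pi> i))"
      using S aS lt[OF aS a] lt by (intro sum_strict_mono_ex1) (auto, metis le_less)
    moreover have "(\<Sum>i\<in>S. key (\<pi> i)) = (\<Sum>i\<in>S. key i)"
      using sum.permute[OF \<pi>, of key] by (simp add: o_def)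
    ultimately show False by simp
  qed
  then have "det_on S M = (\<Sum>\<pi>\<in>{id}. of_int (sign \<pi>) * (\<Prod>i\<in>S. M i (\<pi> i)))"
    unfolding det_on_def by (intro sum.mono_neutral_right) (auto simp: S permutes_id finite_permutations)
  then show ?thesis by (simp add: sign_id)
qed

text \<open>The coefficients must not depend on the argument \<open>l\<close>, which is the row
  index. Linear combinations in this sense are column operations: a relation that holds for every
  domain of integration with the same coefficients is of this kind.\<close>

definition in_lc :: "('m \<Rightarrow> 'r \<Rightarrow> complex) \<Rightarrow> 'm set \<Rightarrow> ('r \<Rightarrow> complex) \<Rightarrow> bool" where
  "in_lc w S v \<longleftrightarrow> (\<exists>c. \<forall>l. v l = (\<Sum>m\<in>S. c m * w m l))"

lemma in_lc_zero: "in_lc w S (\<lambda>l. 0)"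
  unfolding in_lc_def by (rule exI[of _ "\<lambda>_. 0"]) simp

lemma in_lc_add: "in_lc w S u \<Longrightarrow> in_lc w S v \<Longrightarrow> in_lc w S (\<lambda>l. u l + v l)"
  unfolding in_lc_def
  by (elim exE, rule_tac x="\<lambda>m. c m + ca m" in exI) (simp add: sum.distrib algebra_simps)

lemma in_lc_cmult: "in_lc w S u \<Longrightarrow> in_lc w S (\<lambda>l. a * u l)"
  unfolding in_lc_def
  by (elim exE, rule_tac x="\<lambda>m. a * c m" in exI) (simp add: sum_distrib_left mult.assoc)

lemma in_lc_diff: "in_lc w S u \<Longrightarrow> in_lc w S v \<Longrightarrow> in_lc w S (\<lambda>l. u l - v l)"
  using in_lc_add[of w S u "\<lambda>l. (-1) * v l"] in_lc_cmult[of w S v "-1"] by simp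

lemma in_lc_base: "finite S \<Longrightarrow> m \<in> S \<Longrightarrow> in_lc w S (w m)"
  unfolding in_lc_def
  by (rule exI[of _ "\<lambda>m'. if m' = m then 1 else 0"]) (simp add: if_distrib[of "\<lambda>x. x * _"] cong: if_cong)

lemma in_lc_mono:
  assumes "finite S'" "S \<subseteq> S'" "in_lc w S u" shows "in_lc w S' u"
proof -
  from assms(3) obtain c where c: "\<And>l. u l = (\<Sum>m\<in>S. c m * w m l)" by (auto simp: in_lc_def)
  have "u l = (\<Sum>m\<in>S'. (if m \<in> S then c m else 0) * w m l)" for l
    unfolding c using assms(1,2) by (intro sum.mono_neutral_cong_left) auto
  then show ?thesis by (auto simp: in_lc_def)
qed

lemma in_lc_sum: "(\<And>i. i \<in> I \<Longrightarrow> in_lc w S (v i)) \<Longrightarrow> in_lc w S (\<lambda>l. \<Sum>i\<in>I. v i l)"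
  by (induction I rule: infinite_finite_induct) (auto intro: in_lc_zero in_lc_add)

lemma in_lc_sum_mset:
  "(\<And>i. i \<in># I \<Longrightarrow> in_lc w S (v i)) \<Longrightarrow> in_lc w S (\<lambda>l. \<Sum>i\<in>#I. v i l)"
  by (induction I) (auto intro: in_lc_zero in_lc_add)

text \<open>The transition matrix between the two families of columns is triangular for
  \<open>key\<close>, with diagonal \<open>d\<close>.\<close>

lemma det_on_in_lc:
  fixes key :: "'i \<Rightarrow> nat" and v v' :: "'i \<Rightarrow> 'i \<Rightarrow> complex"
  assumes S: "finite S"
    and lc: "\<And>m. m \<in> S \<Longrightarrow> in_lc v {m'\<in>S. key m' < key m} (\<lambda>l. v' m l - d m * v m l)"
  shows "det_on S (\<lambda>l m. v' m l) = (\<Prod>m\<in>S. d m) * det_on S (\<lambda>l m. v m l)"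
proof -
  obtain c where c: "\<And>m l. m \<in> S \<Longrightarrow> v' m l - d m * v m l = (\<Sum>m'\<in>{m'\<in>S. key m' < key m}. c m m' * v m' l)"
    using lc unfolding in_lc_def by metis
  define L where "L m' m = (if m' = m then d m else if key m' < key m then c m m' else 0)" for m' m
  have "v' m l = (\<Sum>m'\<in>S. v m' l * L m' m)" if "m \<in> S" for m l
  proof -
    have "(\<Sum>m'\<in>S. v m' l * L m' m) = v m l * L m m + (\<Sum>m'\<in>S - {m}. v m' l * L m' m)"
      using S that by (simp add: sum.remove)
    also have "(\<Sum>m'\<in>S - {m}. v m' l * L m' m) = (\<Sum>m'\<in>{m'\<in>S. key m' < key m}. c m m' * v m' l)"
      using S by (intro sum.mono_neutral_cong_right) (auto simp: L_def)
    finally show ?thesis using c[OF that, of l] by (simp add: L_def algebra_simps)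
  qed
  then have "det_on S (\<lambda>l m. v' m l) = det_on S (\<lambda>l m. \<Sum>m'\<in>S. v m' l * L m' m)"
    by (intro det_on_cong) auto
  also have "\<dots> = det_on S (\<lambda>l m. v m l) * det_on S L"
    using det_on_mult[OF S, of "\<lambda>l m. v m l" L] by simp
  also have "det_on S L = (\<Prod>m\<in>S. L m m)"
    using S by (rule det_on_triangular[where key=key]) (auto simp: L_def)
  finally show ?thesis by (simp add: L_def)
qed

lemma tendsto_det_on:
  fixes M :: "nat \<Rightarrow> 'i \<Rightarrow> 'i \<Rightarrow> complex"
  assumes "\<And>i j. i \<in> S \<Longrightarrow> j \<in> S \<Longrightarrow> (\<lambda>K. M K i j) \<longlonglongrightarrow> N i j"
  shows "(\<lambda>K. det_on S (M K)) \<longlonglongrightarrow> det_on S N"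
  unfolding det_on_def
proof (rule tendsto_sum)
  fix \<pi> assume "\<pi> \<in> {\<pi>. \<pi> permutes S}"
  then have "(\<lambda>K. \<Prod>i\<in>S. M K i (\<pi> i)) \<longlonglongrightarrow> (\<Prod>i\<in>S. N i (\<pi> i))"
    by (intro tendsto_prod assms) (auto simp: permutes_in_image)
  then show "(\<lambda>K. of_int (sign \<pi>) * (\<Prod>i\<in>S. M K i (\<pi> i)))
      \<longlonglongrightarrow> of_int (sign \<pi>) * (\<Prod>i\<in>S. N i (\<pi> i))" by (rule tendsto_mult_left)
qed

text \<open>A permutation of \<open>insert a S\<close> is a permutation of \<open>S\<close> followed
  by a transposition of \<open>a\<close> with some \<open>b\<close>, and here \<open>b\<close> must
  lie in the fibre of \<open>a\<close>. The count later cancels the factors 1/m_s! of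
  \<open>omega\<close>.\<close>

lemma card_permutes_fibre:
  fixes f :: "'a \<Rightarrow> 'b"
  assumes "finite A" "finite V" "f ` A \<subseteq> V"
  shows "card {\<sigma>. \<sigma> permutes A \<and> (\<forall>x\<in>A. f (\<sigma> x) = f x)} = (\<Prod>v\<in>V. fact (card {x\<in>A. f x = v}))"
  using assms(1,3)
proof (induction A rule: finite_induct)
  case empty
  have "{\<sigma>. \<sigma> permutes {} \<and> (\<forall>x\<in>{}. f (\<sigma> x) = f x)} = {id}" by auto
  then show ?case by simp
next
  case (insert a S)
  let ?P = "{q. q permutes S \<and> (\<forall>x\<in>S. f (q x) = f x)}"
  let ?B = "{b \<in> insert a S. f b = f a}"
  have "{\<sigma>. \<sigma> permutes insert a S \<and> (\<forall>x\<in>insert a S. f (\<sigma> x) = f x)} = (\<lambda>(b, q). Transposition.transpose a b \<circ> q) ` (?B \<times> ?P)"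
    (is "?L = ?R")
  proof
    show "?L \<subseteq> ?R"
    proof
      fix \<sigma> assume "\<sigma> \<in> ?L"
      then have \<sigma>: "\<sigma> permutes insert a S" and fx: "\<And>x. x \<in> insert a S \<Longrightarrow> f (\<sigma> x) = f x" by auto
      obtain b q where bq: "\<sigma> = Transposition.transpose a b \<circ> q" "b \<in> insert a S" "q permutes S"
        using \<sigma> permutes_insert[of a S] by (auto simp: set_eq_iff)
      have qa: "q a = a" using bq(3) insert.hyps(2) by (simp add: permutes_not_in)
      have fb: "f b = f a" using fx[of a] by (simp add: bq(1) qa)
      have "f (q x) = f x" if "x \<in> S" for x
        using fx[of x] that fb by (auto simp: bq(1) Transposition.transpose_def split: if_splits)
      then show "\<sigma> \<in> ?R" using bq fb by (intro image_eqI[of _ _ "(b, q)"]) auto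
    qed
    show "?R \<subseteq> ?L"
    proof
      fix \<sigma> assume "\<sigma> \<in> ?R"
      then obtain b q where bq: "\<sigma> = Transposition.transpose a b \<circ> q" "b \<in> insert a S" "f b = f a" "q permutes S"
        "\<And>x. x \<in> S \<Longrightarrow> f (q x) = f x" by auto
      have "\<sigma> permutes insert a S" using permutes_insert[of a S] bq by (auto simp: set_eq_iff)
      moreover have "q a = a" using bq(4) insert.hyps(2) by (simp add: permutes_not_in)
      then have "f (\<sigma> x) = f x" if "x \<in> insert a S" for x
        using that bq(3,5) by (auto simp: bq(1) Transposition.transpose_def)
      ultimately show "\<sigma> \<in> ?L" by auto
    qed
  qed
  moreover have "inj_on (\<lambda>(b, q). Transposition.transpose a b \<circ> q) (?B \<times> ?P)"
  proof (rule inj_onI, clarify)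
    fix b q b' q' assume q: "q permutes S" "q' permutes S" and eq: "Transposition.transpose a b \<circ> q = Transposition.transpose a b' \<circ> q'"
    have "q a = a" "q' a = a" using q insert.hyps(2) by (simp_all add: permutes_not_in)
    then have "b = b'" using fun_cong[OF eq, of a] by simp
    moreover have "q = q'"
    proof
      fix x show "q x = q' x"
        using fun_cong[OF eq, of x] \<open>b = b'\<close> by (metis comp_apply transpose_involutory)
    qed
    ultimately show "b = b' \<and> q = q'" by simp
  qed
  ultimately have "card ?L = card ?B * card ?P" for L by (simp add: card_image card_cartesian_product)
  then have c: "card {\<sigma>. \<sigma> permutes insert a S \<and> (\<forall>x\<in>insert a S. f (\<sigma> x) = f x)} = card ?B * (\<Prod>v\<in>V. fact (card {x\<in>S. f x = v}))"
    using insert by simp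
  have fa: "f a \<in> V" using insert.prems by simp
  have B: "?B = insert a {x\<in>S. f x = f a}" by auto
  have "(\<Prod>v\<in>V. fact (card {x\<in>insert a S. f x = v}) :: nat)
     = fact (card ?B) * (\<Prod>v\<in>V-{f a}. fact (card {x\<in>S. f x = v}))"
  proof -
    have "{x. (x = a \<or> x \<in> S) \<and> f x = v} = {x\<in>S. f x = v}" if "v \<noteq> f a" for v using that by auto
    then show ?thesis using fa assms(2) by (simp add: prod.remove[of _ "f a"])
  qed
  also have "fact (card ?B) = card ?B * fact (card {x\<in>S. f x = f a})"
    unfolding B using insert.hyps by simp
  also have "card ?B * fact (card {x\<in>S. f x = f a}) * (\<Prod>v\<in>V-{f a}. fact (card {x\<in>S. f x = v}))
     = card ?B * (\<Prod>v\<in>V. fact (card {x\<in>S. f x = v}))"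
    using fa assms(2) by (simp add: prod.remove[of _ "f a"] mult.assoc)
  finally show ?case using c by simp
qed

section \<open>Compositions\<close>

lemma Zset_le: "m \<in> Zset n q \<Longrightarrow> s \<in> {1..q} \<Longrightarrow> m s \<le> n"
  unfolding Zset_def using member_le_sum[of s "{1..q}" m] by auto

lemma finite_Zset [simp]: "finite (Zset n q)"
proof -
  have "Zset n q \<subseteq> {f. \<forall>x. (x \<in> {1..q} \<longrightarrow> f x \<in> {..n}) \<and> (x \<notin> {1..q} \<longrightarrow> f x = 0)}"
    using Zset_le by (auto simp: Zset_def)
  then show ?thesis
    using finite_set_of_finite_funs[of "{1..q}" "{..n}" "0::nat"] by (meson finite_subset finite_atLeastAtMost finite_atMost)
qed

text \<open>Cuts a coordinate into units: unit \<open>i\<close>, counted from 0, of coordinate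
  \<open>s\<close> is present exactly when \<open>i < m s\<close>. This is the origin of the
  exponents \<open>card (Zset (n - 1 - i) q)\<close>, and so of the binomials
  \<open>(p + n - s - 3) choose (p - 2)\<close> in the theorem.\<close>

lemma Zset_tail:
  assumes s: "s \<in> {1..q}" and i: "i < n"
  shows "bij_betw (\<lambda>m. m(s := m s + Suc i)) (Zset (n - 1 - i) q) {m \<in> Zset n q. i < m s}"
proof (rule bij_betw_byWitness[where f'="\<lambda>m. m(s := m s - Suc i)"])
  have upd: "(\<Sum>j=1..q. (m(s := x)) j) + m s = (\<Sum>j=1..q. m j) + x" for m :: "nat \<Rightarrow> nat" and x
    using s by (simp add: sum.remove[of _ s])
  show "(\<lambda>m. m(s := m s + Suc i)) ` Zset (n - 1 - i) q \<subseteq> {m \<in> Zset n q. i < m s}"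
  proof safe
    fix m assume m: "m \<in> Zset (n - 1 - i) q"
    then have "(\<Sum>j=1..q. (m(s := m s + Suc i)) j) = n" using upd[of m "m s + Suc i"] i by (simp add: Zset_def)
    then show "m(s := m s + Suc i) \<in> Zset n q" using m s by (auto simp: Zset_def)
  qed simp
  show "(\<lambda>m. m(s := m s - Suc i)) ` {m \<in> Zset n q. i < m s} \<subseteq> Zset (n - 1 - i) q"
  proof safe
    fix m assume m: "m \<in> Zset n q" "i < m s"
    then have "(\<Sum>j=1..q. (m(s := m s - Suc i)) j) = n - 1 - i"
      using upd[of m "m s - Suc i"] i by (simp add: Zset_def)
    then show "m(s := m s - Suc i) \<in> Zset (n - 1 - i) q" using m s by (auto simp: Zset_def)
  qed
qed (auto simp: fun_eq_iff)

lemma Zset_tail_sum: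
  assumes s: "s \<in> {1..q}"
  shows "(\<Sum>m\<in>Zset n q. \<Sum>i<m s. F i m) = (\<Sum>i<n. \<Sum>m\<in>Zset (n - 1 - i) q. F i (m(s := m s + Suc i)))"
proof -
  have "(\<Sum>m\<in>Zset n q. \<Sum>i<m s. F i m) = (\<Sum>m\<in>Zset n q. \<Sum>i | i \<in> {..<n} \<and> i < m s. F i m)"
    using Zset_le[OF _ s, where n=n] by (intro sum.cong refl) (auto simp: order.strict_trans2)
  also have "\<dots> = (\<Sum>i<n. \<Sum>m | m \<in> Zset n q \<and> i < m s. F i m)" by (rule sum.swap_restrict) auto
  also have "\<dots> = (\<Sum>i<n. \<Sum>m\<in>Zset (n - 1 - i) q. F i (m(s := m s + Suc i)))"
  proof (rule sum.cong[OF refl])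
    fix i assume "i \<in> {..<n}"
    then have "bij_betw (\<lambda>m. m(s := m s + Suc i)) (Zset (n - 1 - i) q) {m \<in> Zset n q. i < m s}"
      by (intro Zset_tail[OF s]) simp
    from sum.reindex_bij_betw[OF this, of "F i"]
    show "(\<Sum>m | m \<in> Zset n q \<and> i < m s. F i m) = (\<Sum>m\<in>Zset (n - 1 - i) q. F i (m(s := m s + Suc i)))" by simp
  qed
  finally show ?thesis .
qed

lemma Zset_tail_prod:
  fixes r :: "nat \<Rightarrow> 'a :: comm_monoid_mult"
  assumes s: "s \<in> {1..q}"
  shows "(\<Prod>m\<in>Zset n q. \<Prod>i<m s. r i) = (\<Prod>i<n. r i ^ card (Zset (n - 1 - i) q))"
proof -
  have "(\<Prod>m\<in>Zset n q. \<Prod>i<m s. r i) = (\<Prod>m\<in>Zset n q. \<Prod>i | i \<in> {..<n} \<and> i < m s. r i)"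
    using Zset_le[OF _ s, where n=n] by (intro prod.cong refl) (auto simp: order.strict_trans2)
  also have "\<dots> = (\<Prod>i<n. \<Prod>m | m \<in> Zset n q \<and> i < m s. r i)" by (rule prod.swap_restrict) auto
  also have "\<dots> = (\<Prod>i<n. r i ^ card (Zset (n - 1 - i) q))"
    using bij_betw_same_card[OF Zset_tail[OF s]] by (intro prod.cong refl) simp
  finally show ?thesis .
qed

text \<open>Split by whether the last coordinate vanishes; a positive one is the layer
  \<open>i = 0\<close> of \<open>Zset_tail\<close>.\<close>

lemma card_Zset_rec: "card (Zset (Suc n) (Suc q)) = card (Zset (Suc n) q) + card (Zset n (Suc q))"
proof -
  have "Zset (Suc n) (Suc q) = Zset (Suc n) q \<union> {m \<in> Zset (Suc n) (Suc q). 0 < m (Suc q)}"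
    by (auto simp: Zset_def not_less_eq_eq le_Suc_eq) 
  moreover have "Zset (Suc n) q \<inter> {m \<in> Zset (Suc n) (Suc q). 0 < m (Suc q)} = {}"
    by (auto simp: Zset_def)
  ultimately have "card (Zset (Suc n) (Suc q)) = card (Zset (Suc n) q) + card {m \<in> Zset (Suc n) (Suc q). 0 < m (Suc q)}"
    by (metis (no_types, lifting) card_Un_disjoint finite_Un finite_Zset)
  also have "card {m \<in> Zset (Suc n) (Suc q). 0 < m (Suc q)} = card (Zset n (Suc q))"
    using bij_betw_same_card[OF Zset_tail[of "Suc q" "Suc q" 0 "Suc n"]] by simp
  finally show ?thesis .
qed

lemma Zset_0: "Zset 0 q = {\<lambda>_. 0}"
proof -
  have "m x = 0" if "m \<in> Zset 0 q" for m x
    using that Zset_le[OF that, of x] by (cases "x \<in> {1..q}") (auto simp: Zset_def)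
  then have "m = (\<lambda>_. 0)" if "m \<in> Zset 0 q" for m using that by (intro ext) blast
  moreover have "(\<lambda>_. 0) \<in> Zset 0 q" by (simp add: Zset_def)
  ultimately show ?thesis by blast
qed

lemma Zset_Suc_0: "Zset (Suc n) 0 = {}"
  by (auto simp: Zset_def)

lemma card_Zset: "card (Zset n (Suc q)) = (n + q) choose q"
proof (induction q arbitrary: n)
  case 0
  show ?case by (induction n) (auto simp: card_Zset_rec Zset_0 Zset_Suc_0)
next
  case (Suc q)
  show ?case by (induction n) (auto simp: card_Zset_rec[of _ "Suc q"] Zset_0 Suc)
qed

text \<open>Hockey-stick identity. The boundary term stands on the left so that no subtraction of
  naturals occurs; it vanishes for \<open>a \<le> b\<close>.\<close>

lemma sum_choose_shift: "(\<Sum>j<n. (j + a) choose b) + (a choose Suc b) = (n + a) choose Suc b"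
  by (induction n) auto

lemma sum_choose_diag: "a \<le> b \<Longrightarrow> (\<Sum>j<n. (j + a) choose b) = (n + a) choose Suc b"
  using sum_choose_shift[of a b n] by (simp add: binomial_eq_0)

lemma sum_Zset_coord:
  assumes s: "s \<in> {1..Suc q}"
  shows "(\<Sum>m\<in>Zset n (Suc q). m s) = (n + q) choose Suc q"
proof -
  have "(\<Sum>m\<in>Zset n (Suc q). m s) = (\<Sum>m\<in>Zset n (Suc q). \<Sum>i<m s. 1)" by simp
  also have "\<dots> = (\<Sum>i<n. (n - 1 - i + q) choose q)"
    unfolding Zset_tail_sum[OF s] by (simp add: card_Zset)
  also have "\<dots> = (\<Sum>j<n. (j + q) choose q)"
    using sum.nat_diff_reindex[of "\<lambda>j. (j + q) choose q" n] by simp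
  finally show ?thesis using sum_choose_diag[of q q n] by simp
qed

lemma sum_Zset_coord_mult:
  assumes s: "s \<in> {1..Suc q}" "r \<in> {1..Suc q}" "r \<noteq> s"
  shows "(\<Sum>m\<in>Zset n (Suc q). m r * m s) = (n + q) choose Suc (Suc q)"
proof -
  have "(\<Sum>m\<in>Zset n (Suc q). m r * m s) = (\<Sum>m\<in>Zset n (Suc q). \<Sum>i<m r. m s)" by simp
  also have "\<dots> = (\<Sum>i<n. (n - 1 - i + q) choose Suc q)"
    unfolding Zset_tail_sum[OF s(2)] using s(3) by (simp add: sum_Zset_coord[OF s(1)])
  also have "\<dots> = (\<Sum>j<n. (j + q) choose Suc q)"
    using sum.nat_diff_reindex[of "\<lambda>j. (j + q) choose Suc q" n] by simp
  finally show ?thesis using sum_choose_diag[of q "Suc q" n] by simp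
qed

lemma sum_Zset_coord_choose_2:
  assumes s: "s \<in> {1..Suc q}"
  shows "(\<Sum>m\<in>Zset n (Suc q). m s choose 2) = (n + q) choose Suc (Suc q)"
proof -
  \<comment> \<open>Written as a sum over \<open>i < k\<close>, the binomial has the shape required
    by \<open>Zset_tail_sum\<close>; after the shift by \<open>Suc i\<close> the summand is again a
    plain coordinate.\<close>
  have "(k choose 2) = (\<Sum>i<k. k - Suc i)" for k
    using sum.nat_diff_reindex[of "\<lambda>j. j" k] sum_choose_shift[of 0 1 k] by (simp add: numeral_2_eq_2)
  then have "(\<Sum>m\<in>Zset n (Suc q). m s choose 2) = (\<Sum>m\<in>Zset n (Suc q). \<Sum>i<m s. m s - Suc i)" by simp
  also have "\<dots> = (\<Sum>i<n. (n - 1 - i + q) choose Suc q)"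
    unfolding Zset_tail_sum[OF s] by (simp add: sum_Zset_coord[OF s])
  also have "\<dots> = (\<Sum>j<n. (j + q) choose Suc q)"
    using sum.nat_diff_reindex[of "\<lambda>j. (j + q) choose Suc q" n] by simp
  finally show ?thesis using sum_choose_diag[of q "Suc q" n] by simp
qed

lemma sum_card_Zset: "(\<Sum>i<n. card (Zset (n - 1 - i) (Suc q))) = (n + q) choose Suc q"
  using sum.nat_diff_reindex[of "\<lambda>j. (j + q) choose q" n] sum_choose_diag[of q q n]
  by (simp add: card_Zset)

text \<open>The coefficient of 2 \<gamma> in the growth exponent of the determinant. It has to agree
  with the exponent \<open>nb' * (p - 1)\<close> that the row factors produce in
  \<open>prod_rowf\<close>.\<close>

lemma sum_card_Zset_weighted:
  "(\<Sum>i<n. card (Zset (n - 1 - i) (Suc q)) * (n - 1 - i)) = Suc q * ((n + q) choose Suc (Suc q))"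
proof -
  have *: "((j + q) choose q) * j = Suc q * ((j + q) choose Suc q)" for j
    using binomial_absorb_comp[of "j + q" q] binomial_absorption[of q "j + q"]
    by (metis add_diff_cancel_right' mult.commute)
  have "(\<Sum>i<n. card (Zset (n - 1 - i) (Suc q)) * (n - 1 - i)) = (\<Sum>j<n. ((j + q) choose q) * j)"
    using sum.nat_diff_reindex[of "\<lambda>j. ((j + q) choose q) * j" n] by (simp add: card_Zset)
  also have "\<dots> = Suc q * (\<Sum>j<n. (j + q) choose Suc q)" unfolding * by (rule sum_distrib_left[symmetric])
  finally show ?thesis using sum_choose_diag[of q "Suc q" n] by simp
qed

text \<open>The index of the block \<open>Gam l s\<close> that contains \<open>i\<close>.\<close>

definition site :: "(nat \<Rightarrow> nat) \<Rightarrow> nat \<Rightarrow> nat" where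
  "site l i = (LEAST s. i \<le> psum l s)"

lemma psum_Suc: "psum l (Suc s) = psum l s + l (Suc s)"
  by (simp add: psum_def)

lemma psum_0 [simp]: "psum l 0 = 0"
  by (simp add: psum_def)

lemma psum_mono: "a \<le> b \<Longrightarrow> psum l a \<le> psum l b"
  by (rule lift_Suc_mono_le[of "psum l"]) (simp add: psum_Suc)

lemma psum_Zset: "l \<in> Zset n q \<Longrightarrow> psum l q = n"
  by (simp add: Zset_def psum_def)

lemma site_iff:
  assumes "i \<ge> 1" "i \<le> psum l q"
  shows "site l i = s \<longleftrightarrow> s \<ge> 1 \<and> i \<in> Gam l s"
proof -
  have 1: "i \<le> psum l (site l i)" unfolding site_def using assms(2) by (rule LeastI)
  have 2: "\<not> i \<le> psum l s" if "s < site l i" for s using that unfolding site_def by (rule not_less_Least)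
  have 3: "site l i \<ge> 1" using 1 assms(1) by (cases "site l i") auto
  have "s = site l i" if "s \<ge> 1" "i \<in> Gam l s"
  proof (rule antisym)
    show "s \<le> site l i"
    proof (rule ccontr)
      assume "\<not> s \<le> site l i"
      then have "psum l (site l i) \<le> psum l (s - 1)" by (intro psum_mono) auto
      then show False using 1 that by (auto simp: Gam_def)
    qed
    show "site l i \<le> s" unfolding site_def using that by (intro Least_le) (auto simp: Gam_def)
  qed
  moreover have "i \<in> Gam l (site l i)"
    using 1 2[of "site l i - 1"] 3 by (auto simp: Gam_def)
  ultimately show ?thesis using 3 by auto
qed

context
  fixes l n q assumes l: "l \<in> Zset n q"
begin

lemma site_range: "i \<in> {1..n} \<Longrightarrow> site l i \<in> {1..q}"
proof -
  assume i: "i \<in> {1..n}"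
  have "site l i \<ge> 1" using site_iff[of i l q "site l i"] i psum_Zset[OF l] by auto
  moreover have "site l i \<le> q" unfolding site_def using i psum_Zset[OF l] by (intro Least_le) auto
  ultimately show ?thesis by auto
qed

lemma Gam_eq_site: "s \<in> {1..q} \<Longrightarrow> Gam l s = {i \<in> {1..n}. site l i = s}"
proof -
  assume s: "s \<in> {1..q}"
  have "Gam l s \<subseteq> {1..n}" using psum_mono[of s q l] s psum_Zset[OF l] by (auto simp: Gam_def)
  then show ?thesis using site_iff[of _ l q s] s psum_Zset[OF l] by auto
qed

lemma card_site_eq: "s \<in> {1..q} \<Longrightarrow> card {i \<in> {1..n}. site l i = s} = l s"
proof -
  assume s: "s \<in> {1..q}"
  have "psum l s = psum l (s - 1) + l s" using psum_Suc[of l "s - 1"] s by simp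
  then have "card (Gam l s) = l s" by (simp add: Gam_def)
  then show ?thesis using Gam_eq_site[OF s] by simp
qed

lemma site_mono: "i \<le> j \<Longrightarrow> i \<in> {1..n} \<Longrightarrow> j \<in> {1..n} \<Longrightarrow> site l i \<le> site l j"
  unfolding site_def using psum_Zset[OF l]
  by (intro Least_le) (auto intro: order_trans LeastI[of "\<lambda>s. j \<le> psum l s" q])

lemma prod_site:
  fixes g :: "nat \<Rightarrow> 'a :: comm_monoid_mult"
  shows "(\<Prod>i=1..n. g (site l i)) = (\<Prod>s=1..q. g s ^ l s)"
proof -
  have "(\<Prod>i=1..n. g (site l i)) = (\<Prod>s=1..q. \<Prod>i\<in>{i\<in>{1..n}. site l i = s}. g (site l i))"
    using site_range by (intro prod.group[symmetric]) auto
  also have "\<dots> = (\<Prod>s=1..q. g s ^ l s)"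
    using card_site_eq by (intro prod.cong refl) simp
  finally show ?thesis .
qed

text \<open>Sites increase weakly with the index, so a pair \<open>i < j\<close> has sites
  \<open>r \<le> s\<close>. Grouped by the two sites, one block contributes its unordered pairs, and
  two different blocks contribute each of their mixed pairs once.\<close>

lemma prod_site_pairs:
  fixes G :: "nat \<Rightarrow> nat \<Rightarrow> 'a :: comm_monoid_mult"
  shows "(\<Prod>i=1..n. \<Prod>j\<in>{i<..n}. G (site l i) (site l j))
     = (\<Prod>s=1..q. G s s ^ (l s choose 2)) * (\<Prod>s=1..q. \<Prod>r=1..<s. G r s ^ (l r * l s))"
proof -
  define P where "P = (SIGMA i:{1..n}. {i<..n})"
  define R where "R = (SIGMA s:{1..q}. {1..s})"
  have fin: "finite P" "finite R" by (auto simp: P_def R_def)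
  have "(\<Prod>i=1..n. \<Prod>j\<in>{i<..n}. G (site l i) (site l j)) = (\<Prod>(i,j)\<in>P. G (site l i) (site l j))"
    unfolding P_def by (rule prod.Sigma) auto
  also have "\<dots> = (\<Prod>y\<in>R. \<Prod>(i,j)\<in>{x\<in>P. (case x of (i,j) \<Rightarrow> (site l j, site l i)) = y}. G (site l i) (site l j))"
    using site_range site_mono by (intro prod.group[symmetric] fin) (auto simp: P_def R_def)
  also have "\<dots> = (\<Prod>(s,r)\<in>R. G r s ^ (if r = s then l s choose 2 else l r * l s))"
  proof (intro prod.cong refl, clarify)
    fix s r assume "(s, r) \<in> R"
    then have sr: "s \<in> {1..q}" "r \<in> {1..q}" "r \<le> s" by (auto simp: R_def)
    let ?X = "{x\<in>P. (case x of (i,j) \<Rightarrow> (site l j, site l i)) = (s, r)}"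
    have "(\<Prod>(i,j)\<in>?X. G (site l i) (site l j)) = (\<Prod>x\<in>?X. G r s)"
      by (intro prod.cong refl) auto
    also have "\<dots> = G r s ^ card ?X" by simp
    also have "card ?X = (if r = s then l s choose 2 else l r * l s)"
    proof (cases "r = s")
      case True
      let ?A = "psum l (s - 1)"
      have 1: "psum l s = ?A + l s" using psum_Suc[of l "s - 1"] sr by simp
      have G: "{i\<in>{1..n}. site l i = s} = {?A+1..?A + l s}"
        using Gam_eq_site[OF sr(1)] 1 by (simp add: Gam_def)
      have "?X = {(i,j). i \<in> {i\<in>{1..n}. site l i = s} \<and> j \<in> {i\<in>{1..n}. site l i = s} \<and> i < j}"
        using True by (auto simp: P_def)
      also have "\<dots> = (SIGMA i:{?A+1..?A + l s}. {i<..?A + l s})" unfolding G by auto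
      finally have "?X = (SIGMA i:{?A+1..?A + l s}. {i<..?A + l s})" .
      then have "card ?X = (\<Sum>i\<in>{?A+1..?A + l s}. ?A + l s - i)" by simp
      also have "\<dots> = (\<Sum>j<l s. l s - Suc j)"
        by (rule sum.reindex_bij_witness[where i="\<lambda>j. ?A + 1 + j" and j="\<lambda>i. i - (?A + 1)"]) auto
      also have "\<dots> = (l s choose 2)"
        using sum.nat_diff_reindex[of "\<lambda>j. j" "l s"] sum_choose_shift[of 0 1 "l s"] by (simp add: numeral_2_eq_2)
      finally show ?thesis using True by simp
    next
      case False
      have "?X = Gam l r \<times> Gam l s"
      proof -
        have "i < j" if "site l i = r" "site l j = s" "i \<in> {1..n}" "j \<in> {1..n}" for i j
          using site_mono[of j i] that False sr(3) by (cases "i < j") auto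
        then show ?thesis unfolding Gam_eq_site[OF sr(1)] Gam_eq_site[OF sr(2)] by (auto simp: P_def)
      qed
      then show ?thesis using False card_site_eq sr Gam_eq_site by (simp add: card_cartesian_product)
    qed
    finally show "(\<Prod>(i,j)\<in>?X. G (site l i) (site l j)) = G r s ^ (if r = s then l s choose 2 else l r * l s)" .
  qed
  also have "\<dots> = (\<Prod>s=1..q. \<Prod>r=1..s. G r s ^ (if r = s then l s choose 2 else l r * l s))"
    unfolding R_def by (rule prod.Sigma[symmetric]) auto
  also have "\<dots> = (\<Prod>s=1..q. G s s ^ (l s choose 2) * (\<Prod>r=1..<s. G r s ^ (l r * l s)))"
  proof (intro prod.cong refl)
    fix s assume "s \<in> {1..q}"
    then have "{1..s} = insert s {1..<s}" by auto
    then show "(\<Prod>r=1..s. G r s ^ (if r = s then l s choose 2 else l r * l s)) = G s s ^ (l s choose 2) * (\<Prod>r=1..<s. G r s ^ (l r * l s))"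
      by (simp add: prod.cong[of "{1..<s}" "{1..<s}" _ "\<lambda>r. G r s ^ (l r * l s)"])
  qed
  finally show ?thesis by (simp add: prod.distrib)
qed

end

section \<open>The recursion in the last exponent\<close>

text \<open>Letters name functions of one variable: \<open>LT\<close> is the constant 1, and \<open>LF s\<close>, \<open>LG s\<close>, \<open>LH s\<close>, \<open>LU s\<close> are
  \<open>f\<^sub>s\<close>, \<open>g\<^sub>s\<close>, \<open>h\<^sub>s\<close>, \<open>u\<^sub>s\<close>. A multiset of \<open>n\<close> letters stands for the symmetrised product, and \<open>pair_term\<close> is what
  the symmetrised interaction \<open>2 \<gamma> / (t\<^sub>i - t\<^sub>j)\<close> contributes to the integration by parts.\<close>

datatype letter = LT | LF nat | LG nat | LH nat | LU nat

definition letters :: "nat \<Rightarrow> letter set" where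
  "letters q = {LT} \<union> LF ` {1..q} \<union> LG ` {1..q} \<union> LH ` {1..q} \<union> LU ` {1..q}"

primrec pair_term :: "(letter multiset \<Rightarrow> 'r \<Rightarrow> complex) \<Rightarrow> letter multiset \<Rightarrow> 'r \<Rightarrow> letter \<Rightarrow> complex" where
  "pair_term V N l LT = V (add_mset LT (add_mset LT N)) l"
| "pair_term V N l (LG s) = 2 * V (add_mset LT (add_mset (LG s) N)) l - V (add_mset (LG s) (add_mset (LG s) N)) l"
| "pair_term V N l (LU s) = 2 * V (add_mset LT (add_mset (LU s) N)) l - V (add_mset (LU s) (add_mset (LU s) N)) l
     - 2 * V (add_mset (LG 1) (add_mset (LU s) N)) l"
| "pair_term V N l (LF s) = 0"
| "pair_term V N l (LH s) = 0"

text \<open>A composition is read as the multiset that contains \<open>s\<close> with multiplicity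
  \<open>m s\<close>; its finite support is what makes \<open>Abs_multiset\<close> faithful.\<close>

lemma Abs_multiset_count_Zset:
  assumes "m \<in> Zset n q" shows "count (Abs_multiset m) = m"
proof -
  have "{x. 0 < m x} \<subseteq> {1..q}" using assms by (force simp: Zset_def)
  then show ?thesis by (intro count_Abs_multiset) (auto intro: finite_subset)
qed

lemma count_in_Zset:
  assumes "size M = n" "set_mset M \<subseteq> {1..q}" shows "count M \<in> Zset n q"
proof -
  have "(\<Sum>i=1..q. count M i) = (\<Sum>i\<in>set_mset M. count M i)"
    using assms(2) by (intro sum.mono_neutral_right) (auto simp: count_eq_zero_iff)
  then have "(\<Sum>i=1..q. count M i) = n" using assms(1) by (simp add: size_multiset_overloaded_eq)
  moreover have "count M i = 0" if "i \<notin> {1..q}" for i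
    using that assms(2) by (auto simp: count_eq_zero_iff)
  ultimately show ?thesis by (simp add: Zset_def)
qed

lemma set_mset_Abs_Zset: "m \<in> Zset n q \<Longrightarrow> set_mset (Abs_multiset m) \<subseteq> {1..q}"
proof
  fix x assume m: "m \<in> Zset n q" and x: "x \<in># Abs_multiset m"
  have "count (Abs_multiset m) x \<noteq> 0" using x by simp
  then have "m x \<noteq> 0" unfolding Abs_multiset_count_Zset[OF m] .
  moreover have "i \<notin> {1..q} \<Longrightarrow> m i = 0" for i using m unfolding Zset_def mem_Collect_eq by (elim conjE allE impE)
  ultimately show "x \<in> {1..q}" by metis
qed

lemma size_Abs_Zset:
  assumes m: "m \<in> Zset n q" shows "size (Abs_multiset m) = n"
proof -
  have "size (Abs_multiset m) = (\<Sum>i\<in>set_mset (Abs_multiset m). m i)"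
    unfolding size_multiset_overloaded_eq Abs_multiset_count_Zset[OF m] ..
  also have "\<dots> = (\<Sum>i=1..q. m i)"
    using set_mset_Abs_Zset[OF m] Abs_multiset_count_Zset[OF m]
    by (intro sum.mono_neutral_left) (auto simp: set_mset_def)
  finally show ?thesis using m by (simp add: Zset_def)
qed

lemma sum_mset_affine: "(\<Sum>x\<in>#M. c - f x - d) = of_nat (size M) * (c - d) - (\<Sum>x\<in>#M. f x :: complex)"
  by (induction M) (auto simp: algebra_simps)

lemma in_lc_comp: "in_lc w S v \<Longrightarrow> in_lc (\<lambda>m l. w m (f l)) S (\<lambda>l. v (f l))"
  unfolding in_lc_def by blast

text \<open>Only linear relations between words enter the algebra, so the integrals are replaced by
  an arbitrary \<open>V\<close>. The argument of type \<open>'r\<close> is the row, and no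
  coefficient depends on it. \<open>UG\<close> and \<open>UH\<close> say that \<open>LU\<close> has
  the same meaning in both alphabets; passing from \<open>LG\<close> to \<open>LH\<close> then
  concerns index 1 only, which is \<open>HG\<close>. In the application \<open>a\<close> is
  \<open>1 + \<alpha> p\<close>.\<close>

locale sym_rec =
  fixes V :: "letter multiset \<Rightarrow> 'r \<Rightarrow> complex" and n q :: nat and \<alpha> :: "nat \<Rightarrow> complex" and \<gamma> a A :: complex
  assumes q1: "q \<ge> 1"
    and A: "A = a + (\<Sum>s=1..q. \<alpha> s)"
    and UG: "\<And>N s l. size N + 1 = n \<Longrightarrow> set_mset N \<subseteq> letters q \<Longrightarrow> s \<in> {1..q} \<Longrightarrow>
        V (add_mset (LU s) N) l = V (add_mset (LG s) N) l - V (add_mset (LG 1) N) l"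
    and UH: "\<And>N s l. size N + 1 = n \<Longrightarrow> set_mset N \<subseteq> letters q \<Longrightarrow> s \<in> {1..q} \<Longrightarrow>
        V (add_mset (LU s) N) l = V (add_mset (LH s) N) l - V (add_mset (LH 1) N) l"
    and HG: "\<And>N l. size N + 1 = n \<Longrightarrow> set_mset N \<subseteq> letters q \<Longrightarrow>
        V (add_mset (LH 1) N) l = V (add_mset (LG 1) N) l - V (add_mset LT N) l"
    and IBP: "\<And>N l. size N + 1 = n \<Longrightarrow> set_mset N \<subseteq> {LT} \<union> LG ` {1..q} \<union> LU ` {1..q} \<Longrightarrow>
        A * V (add_mset LT N) l - (\<Sum>s=1..q. \<alpha> s * V (add_mset (LG s) N) l)
        + \<gamma> * (\<Sum>b\<in>#N. pair_term V (N - {#b#}) l b) = 0"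
    and nz: "\<And>j::nat. A + of_nat j * \<gamma> \<noteq> 0"
begin

text \<open>Used with \<open>LG\<close> or \<open>LH\<close> for \<open>P\<close>. When each
  \<open>LU s\<close> is expanded as \<open>P s - P 1\<close>, the branch that always takes
  \<open>P s\<close> is the pure word, and every other branch has gained letters \<open>P 1\<close>.
  The induction moves letters from \<open>B\<close> to \<open>M\<close>, which must therefore be
  arbitrary.\<close>

lemma word_in_lc:
  assumes P: "\<And>N s l. size N + 1 = n \<Longrightarrow> set_mset N \<subseteq> letters q \<Longrightarrow> s \<in> {1..q} \<Longrightarrow>
        V (add_mset (LU s) N) l = V (add_mset (P s) N) l - V (add_mset (P 1) N) l"
    and Pl: "\<And>s. s \<in> {1..q} \<Longrightarrow> P s \<in> letters q"
    and "size M + size B = n" "set_mset M \<subseteq> {1..q}" "set_mset B \<subseteq> {1..q}"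
  shows "in_lc (\<lambda>m. V (image_mset P (Abs_multiset m))) {m \<in> Zset n q. count M 1 < m 1}
      (\<lambda>l. V (image_mset P M + image_mset LU B) l - V (image_mset P (M + B)) l)"
  using assms(3-5)
proof (induction B arbitrary: M)
  case empty
  show ?case by (simp add: in_lc_zero)
next
  case (add s B)
  let ?w = "\<lambda>m. V (image_mset P (Abs_multiset m))"
  let ?Z = "{m \<in> Zset n q. count M 1 < m 1}"
  have s: "s \<in> {1..q}" using add.prems by simp
  have 1: "1 \<in> {1..q}" using q1 by simp
  let ?N = "image_mset P M + image_mset LU B"
  have N: "size ?N + 1 = n" "set_mset ?N \<subseteq> letters q"
  proof -
    have "P ` set_mset M \<subseteq> letters q" using add.prems(2) Pl by blast
    moreover have "LU ` set_mset B \<subseteq> letters q" using add.prems(3) by (auto simp: letters_def)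
    ultimately show "set_mset ?N \<subseteq> letters q" by simp
  qed (use add.prems in simp)
  have eq: "V (image_mset P M + image_mset LU (add_mset s B)) l
      = V (image_mset P (add_mset s M) + image_mset LU B) l - V (image_mset P (add_mset 1 M) + image_mset LU B) l" for l
    using P[OF N s, of l] by simp
  have i1: "in_lc ?w ?Z (\<lambda>l. V (image_mset P (add_mset s M) + image_mset LU B) l - V (image_mset P (add_mset s M + B)) l)"
    by (rule in_lc_mono[OF _ _ add.IH]) (use add.prems s in auto)
  have i2: "in_lc ?w ?Z (\<lambda>l. V (image_mset P (add_mset 1 M) + image_mset LU B) l - V (image_mset P (add_mset 1 M + B)) l)"
    by (rule in_lc_mono[OF _ _ add.IH]) (use add.prems 1 in auto)
  \<comment> \<open>The induction hypothesis controls only the difference from this pure word. The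
    word itself is one of the basis words, as it contains more letters of index 1 than
    \<open>M\<close>.\<close>
  have "in_lc ?w ?Z (?w (count (add_mset 1 M + B)))"
  proof (intro in_lc_base)
    have "count (add_mset 1 M + B) \<in> Zset n q"
    proof (rule count_in_Zset)
      show "set_mset (add_mset 1 M + B) \<subseteq> {1..q}" using add.prems 1 by simp
    qed (use add.prems in simp)
    then show "count (add_mset 1 M + B) \<in> ?Z" by simp
  qed simp
  then have i3: "in_lc ?w ?Z (V (image_mset P (add_mset 1 M + B)))" by (simp add: count_inverse)
  show ?case
    using in_lc_diff[OF in_lc_diff[OF i1 i2] i3] unfolding eq by (simp add: algebra_simps)
qed

text \<open>The words of the mixed basis. Between \<open>c = LG 1\<close> and
  \<open>c = LH 1\<close> only the first block of letters changes.\<close>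

definition bw :: "letter \<Rightarrow> (nat \<Rightarrow> nat) \<Rightarrow> letter multiset" where
  "bw c m = replicate_mset (m 1) c + image_mset LU (Abs_multiset (m(1 := 0)))"

lemma drop_first:
  assumes "m \<in> Zset n q"
  shows "m(1 := 0) \<in> Zset (n - m 1) q" "Abs_multiset m = replicate_mset (m 1) 1 + Abs_multiset (m(1 := 0))"
    "m 1 \<le> n"
proof -
  have "(\<Sum>j=1..q. (m(1 := 0)) j) + m 1 = (\<Sum>j=1..q. m j)"
    using q1 by (simp add: sum.remove[of _ 1])
  then show Z: "m(1 := 0) \<in> Zset (n - m 1) q" using assms by (auto simp: Zset_def)
  show "Abs_multiset m = replicate_mset (m 1) 1 + Abs_multiset (m(1 := 0))"
    by (rule multiset_eqI) (simp only: count_union count_replicate_mset Abs_multiset_count_Zset[OF assms] Abs_multiset_count_Zset[OF Z], simp)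
  show "m 1 \<le> n" using Zset_le[OF assms] q1 by simp
qed

lemma set_mset_drop_first: "m \<in> Zset n q \<Longrightarrow> set_mset (Abs_multiset (m(1 := 0))) \<subseteq> {2..q}"
proof
  fix x assume m: "m \<in> Zset n q" and x: "x \<in># Abs_multiset (m(1 := 0))"
  have "x \<in> {1..q}" using set_mset_Abs_Zset[OF drop_first(1)[OF m]] x by auto
  moreover have "count (Abs_multiset (m(1 := 0))) 1 = 0"
    unfolding Abs_multiset_count_Zset[OF drop_first(1)[OF m]] by simp
  then have "x \<noteq> 1" using x by (auto simp: count_eq_zero_iff)
  ultimately show "x \<in> {2..q}" by auto
qed

text \<open>The key is \<open>n - m 1\<close> because the corrections in \<open>word_in_lc\<close>
  have a larger first coordinate. The map \<open>f\<close> translates the row index of the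
  determinant into the index type of \<open>V\<close>.\<close>

lemma det_word_unitriangular:
  assumes P: "\<And>N s l. size N + 1 = n \<Longrightarrow> set_mset N \<subseteq> letters q \<Longrightarrow> s \<in> {1..q} \<Longrightarrow>
        V (add_mset (LU s) N) l = V (add_mset (P s) N) l - V (add_mset (P 1) N) l"
    and Pl: "\<And>s. s \<in> {1..q} \<Longrightarrow> P s \<in> letters q"
  shows "det_on (Zset n q) (\<lambda>l m. V (bw (P 1) m) (f l))
       = det_on (Zset n q) (\<lambda>l m. V (image_mset P (Abs_multiset m)) (f l))"
proof -
  have "det_on (Zset n q) (\<lambda>l m. V (bw (P 1) m) (f l))
     = (\<Prod>m\<in>Zset n q. 1) * det_on (Zset n q) (\<lambda>l m. V (image_mset P (Abs_multiset m)) (f l))"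
  proof (rule det_on_in_lc[where key="\<lambda>m. n - m 1" and v="\<lambda>m l. V (image_mset P (Abs_multiset m)) (f l)" and v'="\<lambda>m l. V (bw (P 1) m) (f l)"])
    fix m assume m: "m \<in> Zset n q"
    note d = drop_first[OF m]
    have "in_lc (\<lambda>m. V (image_mset P (Abs_multiset m))) {m' \<in> Zset n q. count (replicate_mset (m 1) (1::nat)) 1 < m' 1}
      (\<lambda>l. V (image_mset P (replicate_mset (m 1) 1) + image_mset LU (Abs_multiset (m(1:=0)))) l
         - V (image_mset P (replicate_mset (m 1) 1 + Abs_multiset (m(1:=0)))) l)"
    proof (rule word_in_lc[OF P Pl])
      show "size (replicate_mset (m 1) (1::nat)) + size (Abs_multiset (m(1 := 0))) = n"
        using size_Abs_Zset[OF d(1)] d(3) by (simp only: size_replicate_mset)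
      show "set_mset (replicate_mset (m 1) 1) \<subseteq> {1..q}" using q1 by auto
    qed (use set_mset_Abs_Zset[OF d(1)] in auto)
    then have "in_lc (\<lambda>m. V (image_mset P (Abs_multiset m))) {m' \<in> Zset n q. m 1 < m' 1}
      (\<lambda>l. V (bw (P 1) m) l - V (image_mset P (Abs_multiset m)) l)"
      by (simp add: bw_def d(2))
    moreover have "{m' \<in> Zset n q. m 1 < m' 1} = {m' \<in> Zset n q. n - m' 1 < n - m 1}"
    proof (intro Collect_cong conj_cong refl)
      fix m' assume "m' \<in> Zset n q"
      then show "(m 1 < m' 1) = (n - m' 1 < n - m 1)"
        using drop_first(3)[of m'] d(3) by linarith
    qed
    ultimately show "in_lc (\<lambda>m l. V (image_mset P (Abs_multiset m)) (f l)) {m' \<in> Zset n q. n - m' 1 < n - m 1}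
        (\<lambda>l. V (bw (P 1) m) (f l) - 1 * V (image_mset P (Abs_multiset m)) (f l))"
      using in_lc_comp[of _ _ _ f] by simp
  qed simp
  then show ?thesis by simp
qed

definition X :: "nat \<Rightarrow> nat \<Rightarrow> nat multiset \<Rightarrow> 'r \<Rightarrow> complex" where
  "X j k B = V (replicate_mset j LT + replicate_mset k (LG 1) + image_mset LU B)"

text \<open>This is \<open>IBP\<close> for the word with one \<open>LT\<close> removed, once each
  \<open>LG s\<close> is rewritten as \<open>LU s\<close> plus \<open>LG 1\<close>. In the
  coefficient on the left each remaining \<open>LT\<close> contributes \<gamma> and each other
  letter 2 \<gamma>, in total \<open>j + 2 * k + 2 * size B = 2 * n - j - 2\<close> times
  \<gamma>.\<close>

lemma X_rec:
  assumes n: "Suc j + k + size B = n" and B: "set_mset B \<subseteq> {2..q}"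
  shows "(A + of_nat (2 * n - j - 2) * \<gamma>) * X (Suc j) k B l
     = ((\<Sum>s=1..q. \<alpha> s) + (2 * of_nat (size B) + of_nat k) * \<gamma>) * X j (Suc k) B l
       + (\<Sum>s=2..q. \<alpha> s * X j k (add_mset s B) l) + \<gamma> * (\<Sum>s\<in>#B. X j k (add_mset s B) l)"
proof -
  let ?N = "replicate_mset j LT + replicate_mset k (LG 1) + image_mset LU B"
  have N: "size ?N + 1 = n" using n by simp
  have N1: "set_mset ?N \<subseteq> {LT} \<union> LG ` {1..q} \<union> LU ` {1..q}" using B q1 by (force split: if_splits)
  then have N2: "set_mset ?N \<subseteq> letters q" by (auto simp: letters_def)
  have T: "V (add_mset LT ?N) l = X (Suc j) k B l" by (simp add: X_def)
  have G1: "V (add_mset (LG 1) ?N) l = X j (Suc k) B l" by (simp add: X_def)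
  have U: "V (add_mset (LU s) ?N) l = X j k (add_mset s B) l" for s by (simp add: X_def)
  have Gs: "V (add_mset (LG s) ?N) l = X j k (add_mset s B) l + X j (Suc k) B l" if "s \<in> {1..q}" for s
    using UG[OF N N2 that, of l] unfolding U G1 by simp
  have "(\<Sum>s=1..q. \<alpha> s * V (add_mset (LG s) ?N) l)
      = (\<Sum>s=1..q. \<alpha> s * X j k (add_mset s B) l) + (\<Sum>s=1..q. \<alpha> s) * X j (Suc k) B l"
    unfolding sum_distrib_right sum.distrib[symmetric] by (intro sum.cong refl) (simp only: Gs distrib_left)
  also have "(\<Sum>s=1..q. \<alpha> s * X j k (add_mset s B) l) = (\<Sum>s=2..q. \<alpha> s * X j k (add_mset s B) l)"
  proof (rule sum.mono_neutral_right)
    \<comment> \<open>By \<open>UG\<close> with \<open>s = 1\<close> a word that contains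
      \<open>LU 1\<close> is zero, so the sum may start at 2.\<close>
    have "X j k (add_mset 1 B) l = 0" using Gs[of 1] q1 unfolding G1 by simp
    then show "\<forall>s\<in>{1..q} - {2..q}. \<alpha> s * X j k (add_mset s B) l = 0"
      by (metis (no_types, lifting) Diff_iff One_nat_def Suc_1 Suc_leI atLeastAtMost_iff le_neq_implies_less mult_zero_right)
  qed auto
  finally have S: "(\<Sum>s=1..q. \<alpha> s * V (add_mset (LG s) ?N) l)
      = (\<Sum>s=2..q. \<alpha> s * X j k (add_mset s B) l) + (\<Sum>s=1..q. \<alpha> s) * X j (Suc k) B l" .
  have p1: "pair_term V (?N - {#LT#}) l LT = X (Suc j) k B l" if "j > 0"
    using that by (cases j) (simp_all add: X_def)
  have p2: "pair_term V (?N - {#LG 1#}) l (LG 1) = 2 * X (Suc j) k B l - X j (Suc k) B l" if "k > 0"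
    using that by (cases k) (simp_all add: X_def add_mset_commute)
  have p3: "pair_term V (?N - {#LU s#}) l (LU s) = 2 * X (Suc j) k B l - X j k (add_mset s B) l - 2 * X j (Suc k) B l"
    if s: "s \<in># B" for s
  proof -
    obtain B' where B': "B = add_mset s B'" using s by (metis multi_member_split)
    show ?thesis by (simp add: X_def B' add_mset_commute)
  qed
  have "(\<Sum>b\<in>#?N. pair_term V (?N - {#b#}) l b)
      = of_nat j * X (Suc j) k B l + of_nat k * (2 * X (Suc j) k B l - X j (Suc k) B l)
       + (\<Sum>s\<in>#B. 2 * X (Suc j) k B l - X j k (add_mset s B) l - 2 * X j (Suc k) B l)"
  proof -
    have "(\<Sum>b\<in>#replicate_mset j LT. pair_term V (?N - {#b#}) l b) = of_nat j * X (Suc j) k B l"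
      using p1 by (cases "j = 0") auto
    moreover have "(\<Sum>b\<in>#replicate_mset k (LG 1). pair_term V (?N - {#b#}) l b) = of_nat k * (2 * X (Suc j) k B l - X j (Suc k) B l)"
      using p2 by (cases "k = 0") auto
    moreover have "(\<Sum>b\<in>#image_mset LU B. pair_term V (?N - {#b#}) l b)
       = (\<Sum>s\<in>#B. 2 * X (Suc j) k B l - X j k (add_mset s B) l - 2 * X j (Suc k) B l)"
      unfolding image_mset.compositionality o_def using p3 by (intro arg_cong[of _ _ sum_mset] image_mset_cong)
    ultimately show ?thesis by (simp only: image_mset_union sum_mset.union)
  qed
  also have "(\<Sum>s\<in>#B. 2 * X (Suc j) k B l - X j k (add_mset s B) l - 2 * X j (Suc k) B l)
      = of_nat (size B) * (2 * X (Suc j) k B l - 2 * X j (Suc k) B l) - (\<Sum>s\<in>#B. X j k (add_mset s B) l)"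
    by (rule sum_mset_affine)
  finally have Q: "(\<Sum>b\<in>#?N. pair_term V (?N - {#b#}) l b) = of_nat j * X (Suc j) k B l + of_nat k * (2 * X (Suc j) k B l - X j (Suc k) B l)
      + (of_nat (size B) * (2 * X (Suc j) k B l - 2 * X j (Suc k) B l) - (\<Sum>s\<in>#B. X j k (add_mset s B) l))" .
  have e: "2 * n - j - 2 = j + 2 * k + 2 * size B" using n by simp
  show ?thesis using IBP[OF N N1, of l] unfolding T S Q e by (simp add: algebra_simps)
qed

text \<open>While letters \<open>LT\<close> are traded for \<open>LG 1\<close>, their total number
  \<kappa> stays fixed, and for a word with \<open>Suc j\<close> letters \<open>LT\<close> the
  quotient of the leading coefficients in \<open>X_rec\<close> is
  \<open>cc \<kappa> - (j + 1) * \<gamma>\<close> over \<open>top - (j + 1) * \<gamma>\<close>. So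
  \<open>Lam j \<kappa>\<close> is the leading coefficient of a word with \<open>j\<close> letters
  \<open>LT\<close>, and \<open>Th i j \<kappa>\<close> that of a word with \<open>i\<close> letters
  \<open>LH 1\<close> as well.\<close>

definition top :: complex where "top = A + (2 * of_nat n - 1) * \<gamma>"
definition cc :: "nat \<Rightarrow> complex" where "cc \<kappa> = (\<Sum>s=1..q. \<alpha> s) + (2 * of_nat n - of_nat \<kappa>) * \<gamma>"
definition Lam :: "nat \<Rightarrow> nat \<Rightarrow> complex" where
  "Lam j \<kappa> = (\<Prod>r=1..j. (cc \<kappa> - of_nat r * \<gamma>) / (top - of_nat r * \<gamma>))"
definition Th :: "nat \<Rightarrow> nat \<Rightarrow> nat \<Rightarrow> complex" where
  "Th i j \<kappa> = Lam j \<kappa> * (\<Prod>s<i. (top - cc \<kappa> - of_nat s * \<gamma>) / (top - of_nat (Suc j + s) * \<gamma>))"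

lemma top_nz: "r < 2 * n \<Longrightarrow> top - of_nat r * \<gamma> \<noteq> 0"
proof -
  assume "r < 2 * n"
  then have "top - of_nat r * \<gamma> = A + of_nat (2 * n - 1 - r) * \<gamma>"
    by (simp add: top_def of_nat_diff algebra_simps)
  then show ?thesis using nz by simp
qed

lemma Lam_Suc: "Lam (Suc j) \<kappa> = Lam j \<kappa> * ((cc \<kappa> - of_nat (Suc j) * \<gamma>) / (top - of_nat (Suc j) * \<gamma>))"
  by (simp add: Lam_def)

text \<open>The relation \<open>HG\<close> on the level of leading coefficients; the product in
  \<open>Th\<close> is the closed form of the alternating sum of \<open>Lam\<close> that it
  generates. With \<open>d r\<close> for \<open>top - r * \<gamma>\<close>, a common denominator
  reduces it to \<open>d (Suc j + i) - (cc \<kappa> - (j + 1) * \<gamma>) = top - cc \<kappa> - i *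
  \<gamma>\<close>.\<close>

lemma Th_Suc:
  assumes "i + j < 2 * n - 1"
  shows "Th (Suc i) j \<kappa> = Th i j \<kappa> - Th i (Suc j) \<kappa>"
proof -
  define d where "d r = top - of_nat r * \<gamma>" for r
  have dnz: "d r \<noteq> 0" if "r < 2 * n" for r using top_nz[OF that] by (simp add: d_def)
  define N where "N = (\<Prod>s<i. top - cc \<kappa> - of_nat s * \<gamma>)"
  have D1: "(\<Prod>s<Suc i. d (Suc j + s)) = (\<Prod>s<i. d (Suc j + s)) * d (Suc j + i)" by simp
  have D2: "(\<Prod>s<Suc i. d (Suc j + s)) = d (Suc j) * (\<Prod>s<i. d (Suc (Suc j) + s))"
    by (simp only: prod.lessThan_Suc_shift) simp
  define D where "D = (\<Prod>s<Suc i. d (Suc j + s))"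
  have Dnz: "D \<noteq> 0" using assms unfolding D_def by (auto intro!: dnz)
  have n1: "d (Suc j + i) \<noteq> 0" "d (Suc j) \<noteq> 0" using assms by (auto intro!: dnz)
  have P1: "(\<Prod>s<i. d (Suc j + s)) = D / d (Suc j + i)" unfolding D_def D1 using n1 by simp
  have P2: "(\<Prod>s<i. d (Suc (Suc j) + s)) = D / d (Suc j)" unfolding D_def D2 using n1 by simp
  have T1: "Th i j \<kappa> = Lam j \<kappa> * (N / (D / d (Suc j + i)))"
    unfolding Th_def prod_dividef N_def[symmetric] d_def[symmetric] P1 ..
  have T2: "Th i (Suc j) \<kappa> = Lam j \<kappa> * ((cc \<kappa> - of_nat (Suc j) * \<gamma>) / d (Suc j)) * (N / (D / d (Suc j)))"
    unfolding Th_def prod_dividef N_def[symmetric] d_def[symmetric] P2 Lam_Suc ..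
  have T3: "Th (Suc i) j \<kappa> = Lam j \<kappa> * (N * (top - cc \<kappa> - of_nat i * \<gamma>) / D)"
    unfolding Th_def prod_dividef d_def[symmetric] D_def[symmetric] by (simp add: N_def)
  have "d (Suc j + i) - (cc \<kappa> - of_nat (Suc j) * \<gamma>) = top - cc \<kappa> - of_nat i * \<gamma>"
    by (simp add: d_def algebra_simps)
  then have e: "top - cc \<kappa> - of_nat i * \<gamma> = d (Suc j + i) - (cc \<kappa> - of_nat (Suc j) * \<gamma>)" ..
  have "L * (N' * (e - C) / D') = L * (N' / (D' / e)) - L * (C / g) * (N' / (D' / g))"
    if "D' \<noteq> 0" "e \<noteq> 0" "g \<noteq> 0" for L N' e C D' g :: complex using that by (simp add: field_simps)
  from this[OF Dnz n1] show ?thesis unfolding T1 T2 T3 e .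
qed

lemma base_in_lc:
  assumes "k + size B = n" "set_mset B \<subseteq> {2..q}" "k < \<kappa>"
  shows "in_lc (\<lambda>m. V (bw (LG 1) m)) {m \<in> Zset n q. m 1 < \<kappa>} (X 0 k B)"
proof -
  let ?m = "count (replicate_mset k 1 + B)"
  have m: "?m \<in> Zset n q" using assms q1 by (intro count_in_Zset) (auto split: if_splits)
  have m1: "?m 1 = k" using assms(2) by (auto simp: count_eq_zero_iff)
  have "?m(1 := 0) = count B" using assms(2) by (auto simp: fun_eq_iff count_eq_zero_iff)
  then have "V (bw (LG 1) ?m) = X 0 k B" unfolding bw_def m1 X_def by (simp add: count_inverse)
  then show ?thesis
    using in_lc_base[of "{m \<in> Zset n q. m 1 < \<kappa>}" ?m "\<lambda>m. V (bw (LG 1) m)"] m m1 assms(3) by simp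
qed

text \<open>One use of \<open>X_rec\<close> either turns an \<open>LT\<close> into
  \<open>LG 1\<close>, which keeps their total and multiplies the leading coefficient, or turns it
  into some \<open>LU s\<close>, which lowers the total and ends in words below the
  threshold.\<close>

lemma X_in_lc:
  assumes "j + k + size B = n" "set_mset B \<subseteq> {2..q}"
  shows "in_lc (\<lambda>m. V (bw (LG 1) m)) {m \<in> Zset n q. m 1 < j + k} (\<lambda>l. X j k B l - Lam j (j + k) * X 0 (j + k) B l)"
  using assms
proof (induction j arbitrary: k B)
  case 0
  then show ?case by (simp add: Lam_def in_lc_zero)
next
  case (Suc j)
  let ?L = "in_lc (\<lambda>m. V (bw (LG 1) m)) {m \<in> Zset n q. m 1 < Suc j + k}"
  define d where "d = A + of_nat (2 * n - j - 2) * \<gamma>"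
  define c where "c = (\<Sum>s=1..q. \<alpha> s) + (2 * of_nat (size B) + of_nat k) * \<gamma>"
  have dnz: "d \<noteq> 0" using nz by (simp add: d_def)
  have e1: "2 * n - j - 2 = j + 2 * k + 2 * size B" using Suc.prems(1) by simp
  have e2: "of_nat n = (1 + of_nat j + of_nat k + of_nat (size B) :: complex)"
    using arg_cong[OF Suc.prems(1), of "of_nat :: nat \<Rightarrow> complex"] by (simp add: add_ac)
  have d_eq: "d = top - of_nat (Suc j) * \<gamma>"
    unfolding d_def e1 top_def e2 by (simp add: algebra_simps)
  have c_eq: "c = cc (Suc j + k) - of_nat (Suc j) * \<gamma>"
    unfolding c_def cc_def e2 by (simp add: algebra_simps)
  have i1: "?L (\<lambda>l. X j (Suc k) B l - Lam j (Suc j + k) * X 0 (Suc j + k) B l)"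
    using Suc.IH[of "Suc k" B] Suc.prems by simp
  have i2: "?L (X j k (add_mset s B))" if "s \<in> {2..q}" for s
  proof -
    have "?L (\<lambda>l. X j k (add_mset s B) l - Lam j (j + k) * X 0 (j + k) (add_mset s B) l)"
      by (rule in_lc_mono[OF _ _ Suc.IH]) (use Suc.prems that in auto)
    moreover have "?L (X 0 (j + k) (add_mset s B))"
      using Suc.prems that by (intro base_in_lc) auto
    ultimately have "?L (\<lambda>l. (X j k (add_mset s B) l - Lam j (j + k) * X 0 (j + k) (add_mset s B) l) + Lam j (j + k) * X 0 (j + k) (add_mset s B) l)"
      by (intro in_lc_add in_lc_cmult)
    then show ?thesis by simp
  qed
  have "?L (\<lambda>l. c / d * (X j (Suc k) B l - Lam j (Suc j + k) * X 0 (Suc j + k) B l)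
     + (1 / d) * ((\<Sum>s=2..q. \<alpha> s * X j k (add_mset s B) l) + \<gamma> * (\<Sum>s\<in>#B. X j k (add_mset s B) l)))"
    using i1 i2 Suc.prems(2) by (intro in_lc_add in_lc_cmult in_lc_sum in_lc_sum_mset) auto
  moreover have "X (Suc j) k B l - Lam (Suc j) (Suc j + k) * X 0 (Suc j + k) B l
     = c / d * (X j (Suc k) B l - Lam j (Suc j + k) * X 0 (Suc j + k) B l)
     + (1 / d) * ((\<Sum>s=2..q. \<alpha> s * X j k (add_mset s B) l) + \<gamma> * (\<Sum>s\<in>#B. X j k (add_mset s B) l))" for l
  proof -
    have "Lam (Suc j) (Suc j + k) = Lam j (Suc j + k) * (c / d)" unfolding Lam_Suc d_eq c_eq ..
    moreover have "X (Suc j) k B l = (c * X j (Suc k) B l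
       + (\<Sum>s=2..q. \<alpha> s * X j k (add_mset s B) l) + \<gamma> * (\<Sum>s\<in>#B. X j k (add_mset s B) l)) / d"
      using X_rec[OF Suc.prems, of l] dnz unfolding d_def[symmetric] c_def[symmetric]
      by (metis nonzero_mult_div_cancel_left)
    ultimately show ?thesis using dnz by (simp add: field_simps)
  qed
  ultimately show ?case by simp
qed

text \<open>By \<open>HG\<close> one \<open>LH 1\<close> becomes \<open>LG 1\<close> minus
  \<open>LT\<close>. The total \<open>i + j + k\<close> does not change, so the leading coefficients
  combine as in \<open>Th_Suc\<close>.\<close>

lemma Y_in_lc:
  assumes "i + j + k + size B = n" "set_mset B \<subseteq> {2..q}"
  shows "in_lc (\<lambda>m. V (bw (LG 1) m)) {m \<in> Zset n q. m 1 < i + j + k}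
    (\<lambda>l. V (replicate_mset i (LH 1) + (replicate_mset j LT + replicate_mset k (LG 1) + image_mset LU B)) l
       - Th i j (i + j + k) * X 0 (i + j + k) B l)"
  using assms
proof (induction i arbitrary: j k)
  case 0
  then show ?case using X_in_lc[of j k B] by (simp add: Th_def X_def)
next
  case (Suc i)
  let ?W = "\<lambda>i j k. replicate_mset i (LH 1) + (replicate_mset j LT + replicate_mset k (LG 1) + image_mset LU B)"
  let ?\<kappa> = "Suc i + j + k"
  have N: "size (?W i j k) + 1 = n" using Suc.prems by simp
  have N2: "set_mset (?W i j k) \<subseteq> letters q" using Suc.prems q1 by (force simp: letters_def split: if_splits)
  have eq: "V (?W (Suc i) j k) l = V (?W i j (Suc k)) l - V (?W i (Suc j) k) l" for l
    using HG[OF N N2, of l] by simp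
  have "i + j < 2 * n - 1" using Suc.prems by simp
  then have Th: "Th (Suc i) j ?\<kappa> = Th i j ?\<kappa> - Th i (Suc j) ?\<kappa>" by (rule Th_Suc)
  have "in_lc (\<lambda>m. V (bw (LG 1) m)) {m \<in> Zset n q. m 1 < ?\<kappa>}
    (\<lambda>l. (V (?W i j (Suc k)) l - Th i j ?\<kappa> * X 0 ?\<kappa> B l) - (V (?W i (Suc j) k) l - Th i (Suc j) ?\<kappa> * X 0 ?\<kappa> B l))"
  proof -
    have e: "i + j + Suc k = ?\<kappa>" "i + Suc j + k = ?\<kappa>" by auto
    have p: "i + j + Suc k + size B = n" "i + Suc j + k + size B = n" using Suc.prems by auto
    show ?thesis
      using in_lc_diff[OF Suc.IH[OF p(1) Suc.prems(2), unfolded e(1)] Suc.IH[OF p(2) Suc.prems(2), unfolded e(2)]] .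
  qed
  then show ?case unfolding eq Th by (simp add: algebra_simps)
qed

theorem det_shift:
  "det_on (Zset n q) (\<lambda>l m. V (image_mset LH (Abs_multiset m)) (f l))
   = (\<Prod>m\<in>Zset n q. \<Prod>s<m 1. (a + of_nat s * \<gamma>) / (A + (2 * of_nat n - 2 - of_nat s) * \<gamma>))
     * det_on (Zset n q) (\<lambda>l m. V (image_mset LG (Abs_multiset m)) (f l))"
proof -
  have "det_on (Zset n q) (\<lambda>l m. V (bw (LH 1) m) (f l))
    = (\<Prod>m\<in>Zset n q. Th (m 1) 0 (m 1)) * det_on (Zset n q) (\<lambda>l m. V (bw (LG 1) m) (f l))"
  proof (rule det_on_in_lc[where key="\<lambda>m. m 1" and v="\<lambda>m l. V (bw (LG 1) m) (f l)" and v'="\<lambda>m l. V (bw (LH 1) m) (f l)"])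
    fix m assume m: "m \<in> Zset n q"
    note d = drop_first[OF m]
    have p: "m 1 + 0 + 0 + size (Abs_multiset (m(1:=0))) = n"
      unfolding size_Abs_Zset[OF d(1)] using d(3) by simp
    have "in_lc (\<lambda>m. V (bw (LG 1) m)) {m' \<in> Zset n q. m' 1 < m 1}
       (\<lambda>l. V (bw (LH 1) m) l - Th (m 1) 0 (m 1) * V (bw (LG 1) m) l)"
      using Y_in_lc[OF p set_mset_drop_first[OF m]]
      unfolding X_def bw_def[of "LH 1" m] bw_def[of "LG 1" m] replicate_mset_0 add_0_right add_0_left .
    then show "in_lc (\<lambda>m l. V (bw (LG 1) m) (f l)) {m' \<in> Zset n q. m' 1 < m 1}
       (\<lambda>l. V (bw (LH 1) m) (f l) - Th (m 1) 0 (m 1) * V (bw (LG 1) m) (f l))"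
      by (rule in_lc_comp)
  qed simp
  moreover have "Th (m 1) 0 (m 1) = (\<Prod>s<m 1. (a + of_nat s * \<gamma>) / (A + (2 * of_nat n - 2 - of_nat s) * \<gamma>))"
    for m :: "nat \<Rightarrow> nat"
  proof -
    \<comment> \<open>Since \<open>top - cc (m 1)\<close> equals
      \<open>a + (m 1 - 1) * \<gamma>\<close>, these are the numerators of the statement in reverse
      order.\<close>
    have "(\<Prod>s<m 1. top - cc (m 1) - of_nat s * \<gamma>) = (\<Prod>s<m 1. a + of_nat (m 1 - Suc s) * \<gamma>)"
      unfolding top_def cc_def unfolding A by (intro prod.cong refl) (auto simp: of_nat_diff algebra_simps)
    also have "\<dots> = (\<Prod>s<m 1. a + of_nat s * \<gamma>)" by (rule prod.nat_diff_reindex)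
    finally have 1: "(\<Prod>s<m 1. top - cc (m 1) - of_nat s * \<gamma>) = (\<Prod>s<m 1. a + of_nat s * \<gamma>)" .
    have 2: "top - of_nat (Suc 0 + s) * \<gamma> = A + (2 * of_nat n - 2 - of_nat s) * \<gamma>" for s
      by (simp add: top_def algebra_simps)
    show ?thesis unfolding Th_def prod_dividef 1 2 by (simp add: Lam_def)
  qed
  moreover have "det_on (Zset n q) (\<lambda>l m. V (bw (LH 1) m) (f l)) = det_on (Zset n q) (\<lambda>l m. V (image_mset LH (Abs_multiset m)) (f l))"
    by (rule det_word_unitriangular) (auto simp: UH letters_def)
  moreover have "det_on (Zset n q) (\<lambda>l m. V (bw (LG 1) m) (f l)) = det_on (Zset n q) (\<lambda>l m. V (image_mset LG (Abs_multiset m)) (f l))"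
    by (rule det_word_unitriangular) (auto simp: UG letters_def)
  ultimately show ?thesis by (simp only:)
qed

end

section \<open>Affine substitutions in product Lebesgue measure, and calculus of powers\<close>

interpretation lb: product_sigma_finite "\<lambda>_::nat. lborel :: real measure" by standard

text \<open>Scaling, translation and renumbering of coordinates are combined in one map; this covers
  the rescaling by \<open>K\<close>, the reflection of Selberg's integral and the shifts of index
  blocks. The preimage of a box is a box, so the one-dimensional rule suffices.\<close>

lemma PiM_lborel_affine:
  fixes I J :: "nat set" and c d :: "nat \<Rightarrow> real"
  assumes f: "bij_betw f J I" and J: "finite J" and c: "\<And>j. j \<in> J \<Longrightarrow> c j \<noteq> 0"
  shows "density (distr (PiM I (\<lambda>_. lborel)) (PiM J (\<lambda>_. lborel)) (\<lambda>y. \<lambda>j\<in>J. d j + c j * y (f j)))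
           (\<lambda>_. \<Prod>j\<in>J. ennreal \<bar>c j\<bar>) = PiM J (\<lambda>_. lborel)" (is "density (distr ?P ?Q ?T) _ = _")
proof (rule lb.PiM_eqI[OF J])
  have I: "finite I" using f J bij_betw_finite by blast
  have fI: "f j \<in> I" if "j \<in> J" for j using f that by (auto simp: bij_betw_def)
  have T: "?T \<in> measurable ?P ?Q"
    by (rule measurable_restrict) (use fI in \<open>auto intro!: borel_measurable_add borel_measurable_times measurable_component_singleton\<close>)
  show "sets (density (distr ?P ?Q ?T) (\<lambda>_. \<Prod>j\<in>J. ennreal \<bar>c j\<bar>)) = sets ?Q" by simp
  fix A :: "nat \<Rightarrow> real set" assume A: "\<And>i. i \<in> J \<Longrightarrow> A i \<in> sets lborel"
  let ?B = "\<lambda>i. (\<lambda>x. d (inv_into J f i) + c (inv_into J f i) * x) -` A (inv_into J f i)"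
  have inv: "inv_into J f (f j) = j" if "j \<in> J" for j using f that by (simp add: bij_betw_def inv_into_f_f)
  have inv': "inv_into J f i \<in> J" "f (inv_into J f i) = i" if "i \<in> I" for i
    using f that by (auto simp: bij_betw_def inv_into_into f_inv_into_f)
  have PA: "Pi\<^sub>E J A \<in> sets ?Q" using A J by (intro sets_PiM_I_finite) auto
  have pre: "?T -` Pi\<^sub>E J A \<inter> space ?P = Pi\<^sub>E I ?B"
  proof (intro set_eqI iffI)
    fix y assume "y \<in> ?T -` Pi\<^sub>E J A \<inter> space ?P"
    then have y: "?T y \<in> Pi\<^sub>E J A" "y \<in> extensional I" by (auto simp: space_PiM PiE_def)
    have "y i \<in> ?B i" if "i \<in> I" for i
      using PiE_mem[OF y(1) inv'(1)[OF that]] inv'[OF that] by simp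
    then show "y \<in> Pi\<^sub>E I ?B" using y(2) by (auto simp: PiE_def)
  next
    fix y assume y: "y \<in> Pi\<^sub>E I ?B"
    have "d j + c j * y (f j) \<in> A j" if "j \<in> J" for j
      using PiE_mem[OF y fI[OF that]] inv[OF that] by simp
    then show "y \<in> ?T -` Pi\<^sub>E J A \<inter> space ?P" using y by (auto simp: space_PiM PiE_def)
  qed
  have one: "ennreal \<bar>c j\<bar> * emeasure lborel ((\<lambda>x. d j + c j * x) -` A j) = emeasure lborel (A j)" if j: "j \<in> J" for j
  proof -
    have "emeasure lborel (A j) = emeasure (density (distr lborel borel (\<lambda>x. d j + c j * x)) (\<lambda>_. \<bar>c j\<bar>)) (A j)"
      using lborel_real_affine[OF c[OF j], of "d j"] by simp
    also have "\<dots> = ennreal \<bar>c j\<bar> * emeasure (distr lborel borel (\<lambda>x. d j + c j * x)) (A j)"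
      using A[OF j] by (subst emeasure_density_const) auto
    also have "emeasure (distr lborel borel (\<lambda>x. d j + c j * x)) (A j) = emeasure lborel ((\<lambda>x. d j + c j * x) -` A j)"
      using A[OF j] by (subst emeasure_distr) auto
    finally show ?thesis by simp
  qed
  have "emeasure (density (distr ?P ?Q ?T) (\<lambda>_. \<Prod>j\<in>J. ennreal \<bar>c j\<bar>)) (Pi\<^sub>E J A)
     = (\<Prod>j\<in>J. ennreal \<bar>c j\<bar>) * emeasure ?P (Pi\<^sub>E I ?B)"
    using PA T by (simp add: emeasure_density_const emeasure_distr pre)
  also have "emeasure ?P (Pi\<^sub>E I ?B) = (\<Prod>i\<in>I. emeasure lborel (?B i))"
  proof (rule lb.emeasure_PiM[OF I])
    fix i assume "i \<in> I"
    have "(\<lambda>x. d (inv_into J f i) + c (inv_into J f i) * x) \<in> borel_measurable borel" by measurable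
    from measurable_sets[OF this, of "A (inv_into J f i)"] A[OF inv'(1)[OF \<open>i \<in> I\<close>]]
    show "?B i \<in> sets lborel" by simp
  qed
  also have "\<dots> = (\<Prod>j\<in>J. emeasure lborel ((\<lambda>x. d j + c j * x) -` A j))"
    using prod.reindex_bij_betw[OF f, of "\<lambda>i. emeasure lborel (?B i)"] inv by simp
  also have "(\<Prod>j\<in>J. ennreal \<bar>c j\<bar>) * (\<Prod>j\<in>J. emeasure lborel ((\<lambda>x. d j + c j * x) -` A j)) = (\<Prod>j\<in>J. emeasure lborel (A j))"
    unfolding prod.distrib[symmetric] by (intro prod.cong refl one)
  finally show "emeasure (density (distr ?P ?Q ?T) (\<lambda>_. \<Prod>j\<in>J. ennreal \<bar>c j\<bar>)) (Pi\<^sub>E J A) = (\<Prod>j\<in>J. emeasure lborel (A j))" .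
qed

lemma integral_PiM_affine:
  fixes g :: "(nat \<Rightarrow> real) \<Rightarrow> complex" and c d :: "nat \<Rightarrow> real" and I J :: "nat set"
  assumes f: "bij_betw f J I" and J: "finite J" and c: "\<And>j. j \<in> J \<Longrightarrow> c j \<noteq> 0"
    and g: "g \<in> borel_measurable (PiM J (\<lambda>_. lborel))"
  shows "(\<integral>x. g x \<partial>PiM J (\<lambda>_. lborel))
    = of_real (\<Prod>j\<in>J. \<bar>c j\<bar>) * (\<integral>y. g (\<lambda>j\<in>J. d j + c j * y (f j)) \<partial>PiM I (\<lambda>_. lborel))"
proof -
  let ?P = "PiM I (\<lambda>_. lborel :: real measure)" and ?Q = "PiM J (\<lambda>_. lborel :: real measure)" and ?T = "\<lambda>y. \<lambda>j\<in>J. d j + c j * y (f j)"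
  have fI: "f j \<in> I" if "j \<in> J" for j using f that by (auto simp: bij_betw_def)
  have T: "?T \<in> measurable ?P ?Q"
    by (rule measurable_restrict) (use fI in \<open>auto intro!: borel_measurable_add borel_measurable_times measurable_component_singleton\<close>)
  have "(\<Prod>j\<in>J. ennreal \<bar>c j\<bar>) = ennreal (\<Prod>j\<in>J. \<bar>c j\<bar>)" by (rule prod_ennreal) auto
  then have "(\<integral>x. g x \<partial>?Q) = (\<integral>x. g x \<partial>density (distr ?P ?Q ?T) (\<lambda>_. ennreal (\<Prod>j\<in>J. \<bar>c j\<bar>)))"
    using PiM_lborel_affine[OF f J, of c d] c by simp
  also have "\<dots> = (\<integral>x. (\<Prod>j\<in>J. \<bar>c j\<bar>) *\<^sub>R g x \<partial>distr ?P ?Q ?T)"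
    using g by (subst integral_density) (auto intro!: prod_nonneg)
  also have "\<dots> = of_real (\<Prod>j\<in>J. \<bar>c j\<bar>) * (\<integral>x. g x \<partial>distr ?P ?Q ?T)"
    by (simp add: scaleR_conv_of_real)
  also have "(\<integral>x. g x \<partial>distr ?P ?Q ?T) = (\<integral>y. g (?T y) \<partial>?P)"
    using g T by (intro integral_distr) auto
  finally show ?thesis .
qed

text \<open>The power of the absolute value, set to 0 at \<open>x = 0\<close> like \<open>br_pow\<close>; the phases of \<open>br_pow\<close> are split off.\<close>

definition cpw :: "real \<Rightarrow> complex \<Rightarrow> complex" where
  "cpw x a = (if x = 0 then 0 else exp (a * of_real (ln \<bar>x\<bar>)))"

lemma cpw_0 [simp]: "cpw 0 a = 0"
  by (simp add: cpw_def)

lemma cpw_eq_0_iff [simp]: "cpw x a = 0 \<longleftrightarrow> x = 0"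
  by (simp add: cpw_def)

lemma cpw_1 [simp]: "cpw 1 a = 1"
  by (simp add: cpw_def)

lemma norm_cpw: "norm (cpw x a) = \<bar>x\<bar> powr Re a"
  by (simp add: cpw_def powr_def)

lemma cpw_minus [simp]: "cpw (- x) a = cpw x a"
  by (simp add: cpw_def)

lemma cpw_commute: "cpw (x - y) a = cpw (y - x) a"
  using cpw_minus[of "x - y" a] by simp

lemma cpw_mult: "cpw (x * y) a = cpw x a * cpw y a"
  by (simp add: cpw_def abs_mult ln_mult distrib_left exp_add)

lemma cpw_divide: "cpw (x / y) a = cpw x a / cpw y a"
  by (simp add: cpw_def ln_div right_diff_distrib exp_diff)

lemma cpw_add: "cpw x (a + b) = cpw x a * cpw x b"
  by (simp add: cpw_def distrib_right exp_add)

lemma cpw_exponent_0: "x \<noteq> 0 \<Longrightarrow> cpw x 0 = 1"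
  by (simp add: cpw_def)

lemma cpw_sum: "x \<noteq> 0 \<Longrightarrow> cpw x (\<Sum>i\<in>S. f i) = (\<Prod>i\<in>S. cpw x (f i))"
  by (induction S rule: infinite_finite_induct) (auto simp: cpw_add cpw_exponent_0)

lemma cpw_power: "x \<noteq> 0 \<Longrightarrow> cpw x a ^ k = cpw x (of_nat k * a)"
  by (simp add: cpw_def exp_of_nat_mult[symmetric] mult_ac)

lemma cpw_add_of_nat: "cpw x (a + of_nat k) = cpw x a * of_real (\<bar>x\<bar> ^ k)"
proof (cases "x = 0")
  case False
  have "exp (of_nat k * of_real (ln \<bar>x\<bar>)) = (exp (of_real (ln \<bar>x\<bar>)) :: complex) ^ k"
    by (rule exp_of_nat_mult)
  also have "exp (of_real (ln \<bar>x\<bar>)) = (of_real \<bar>x\<bar> :: complex)" using False by (simp add: exp_of_real)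
  finally have "exp (of_nat k * of_real (ln \<bar>x\<bar>)) = (of_real (\<bar>x\<bar> ^ k) :: complex)" by simp
  then show ?thesis using False by (simp add: cpw_def distrib_right exp_add)
qed simp

lemma measurable_cpw [measurable]: "(\<lambda>x. cpw x a) \<in> borel_measurable borel"
  unfolding cpw_def by measurable

lemma isCont_cpw: "x \<noteq> 0 \<Longrightarrow> isCont (\<lambda>x. cpw x a) x"
proof -
  assume x: "x \<noteq> 0"
  have "isCont (\<lambda>x. exp (a * of_real (ln \<bar>x\<bar>))) x" using x by (intro continuous_intros) auto
  moreover have "\<forall>\<^sub>F y in nhds x. exp (a * of_real (ln \<bar>y\<bar>)) = cpw y a"
    using t1_space_nhds[OF x] by eventually_elim (simp add: cpw_def)
  ultimately show ?thesis by (subst isCont_cong[symmetric])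
qed

text \<open>A positive real part of the exponent makes 0 the continuous value at the origin.\<close>

lemma continuous_on_cpw: "Re a > 0 \<Longrightarrow> continuous_on S (\<lambda>x. cpw x a)"
proof (rule continuous_at_imp_continuous_on, rule ballI)
  fix x assume a: "Re a > 0"
  show "isCont (\<lambda>x. cpw x a) x"
  proof (cases "x = 0")
    case True
    have "((\<lambda>x::real. \<bar>x\<bar> powr Re a) \<longlongrightarrow> 0 powr Re a) (at 0)"
      using a by (intro tendsto_powr2) (auto intro!: tendsto_eq_intros)
    then have "((\<lambda>x. norm (cpw x a)) \<longlongrightarrow> 0) (at 0)" by (simp add: norm_cpw)
    then have "((\<lambda>x. cpw x a) \<longlongrightarrow> 0) (at 0)" by (rule tendsto_norm_zero_cancel)
    then show ?thesis using True by (simp add: isCont_def)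
  qed (rule isCont_cpw)
qed

lemma cpw_has_vector_derivative:
  assumes "x \<noteq> c"
  shows "((\<lambda>x. cpw (x - c) a) has_vector_derivative a / of_real (x - c) * cpw (x - c) a) (at x)"
proof -
  have ln: "((\<lambda>x. ln \<bar>x - c\<bar>) has_real_derivative 1 / (x - c)) (at x)"
  proof (cases "x > c")
    case True
    have "((\<lambda>x. ln (x - c)) has_real_derivative 1 / (x - c)) (at x)"
      using True by (auto intro!: derivative_eq_intros)
    moreover have "\<forall>\<^sub>F y in nhds x. ln (y - c) = ln \<bar>y - c\<bar>"
      using eventually_nhds_in_open[of "{c<..}" x] True by (auto elim!: eventually_mono)
    ultimately show ?thesis by (simp add: DERIV_cong_ev)
  next
    case False
    have "((\<lambda>x. ln (c - x)) has_real_derivative 1 / (x - c)) (at x)"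
      using False assms by (auto intro!: derivative_eq_intros simp: field_simps)
    moreover have "\<forall>\<^sub>F y in nhds x. ln (c - y) = ln \<bar>y - c\<bar>"
      using eventually_nhds_in_open[of "{..<c}" x] False assms by (auto elim!: eventually_mono)
    ultimately show ?thesis by (simp add: DERIV_cong_ev)
  qed
  have 1: "((\<lambda>x. a * of_real (ln \<bar>x - c\<bar>)) has_vector_derivative a * of_real (1 / (x - c))) (at x)"
    using ln by (intro has_vector_derivative_mult_right has_vector_derivative_of_real)
       (simp add: has_real_derivative_iff_has_vector_derivative)
  have 2: "((\<lambda>x. exp (a * of_real (ln \<bar>x - c\<bar>))) has_vector_derivative a * of_real (1 / (x - c)) * exp (a * of_real (ln \<bar>x - c\<bar>))) (at x)"
    using field_vector_diff_chain_at[OF 1 DERIV_exp] by (simp add: o_def)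
  have "a / of_real (x - c) * cpw (x - c) a = a * of_real (1 / (x - c)) * exp (a * of_real (ln \<bar>x - c\<bar>))"
    using assms by (simp add: cpw_def)
  moreover have "((\<lambda>x. cpw (x - c) a) has_vector_derivative a * of_real (1 / (x - c)) * exp (a * of_real (ln \<bar>x - c\<bar>))) (at x)"
    using assms by (intro has_vector_derivative_transform_within_open[OF 2, of "- {c}"]) (auto simp: cpw_def)
  ultimately show ?thesis by (simp only:)
qed

lemma has_vector_derivative_prod_log:
  fixes f :: "'k \<Rightarrow> real \<Rightarrow> complex"
  assumes "finite S" "\<And>k. k \<in> S \<Longrightarrow> (f k has_vector_derivative g k * f k x) (at x)"
  shows "((\<lambda>x. \<Prod>k\<in>S. f k x) has_vector_derivative ((\<Prod>k\<in>S. f k x) * (\<Sum>k\<in>S. g k))) (at x)"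
  using assms
proof (induction S rule: finite_induct)
  case (insert k S)
  have "((\<lambda>x. f k x * (\<Prod>k\<in>S. f k x)) has_vector_derivative f k x * ((\<Prod>k\<in>S. f k x) * (\<Sum>k\<in>S. g k)) + g k * f k x * (\<Prod>k\<in>S. f k x)) (at x)"
    using insert by (intro has_vector_derivative_mult) auto
  then show ?case using insert.hyps by (simp add: algebra_simps)
qed simp

text \<open>The integrand is the derivative of the product of powers, and each end of the interval
  is one of the points \<open>c k\<close>, where a factor vanishes. A section of at most one point
  is a null set, and in the non-integrable case the Bochner integral is 0 by convention.\<close>

lemma integral_log_derivative_zero:
  fixes c :: "'k \<Rightarrow> real" and \<beta> :: "'k \<Rightarrow> complex"
  assumes fin: "finite L" "finite R" "L \<noteq> {}" "R \<noteq> {}" and \<beta>: "\<And>k. k \<in> L \<union> R \<Longrightarrow> Re (\<beta> k) > 0"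
  shows "(\<integral>y. indicator {y. (\<forall>k\<in>L. c k \<le> y) \<and> (\<forall>k\<in>R. y \<le> c k)} y *\<^sub>R
      ((\<Prod>k\<in>L\<union>R. cpw (y - c k) (\<beta> k)) * (\<Sum>k\<in>L\<union>R. \<beta> k / of_real (y - c k))) \<partial>lborel) = 0"
    (is "(\<integral>y. indicator ?S y *\<^sub>R ?f y \<partial>lborel) = 0")
proof -
  define lo where "lo = Max (c ` L)"
  define hi where "hi = Min (c ` R)"
  have "lo \<le> y \<longleftrightarrow> (\<forall>k\<in>L. c k \<le> y)" for y unfolding lo_def using fin by (subst Max_le_iff) auto
  moreover have "y \<le> hi \<longleftrightarrow> (\<forall>k\<in>R. y \<le> c k)" for y unfolding hi_def using fin by (subst Min_ge_iff) auto
  ultimately have S: "?S = {lo..hi}" unfolding set_eq_iff mem_Collect_eq atLeastAtMost_iff by metis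
  define F where "F y = (\<Prod>k\<in>L\<union>R. cpw (y - c k) (\<beta> k))" for y
  show ?thesis
  proof (cases "integrable lborel (\<lambda>y. indicator ?S y *\<^sub>R ?f y)")
    case False
    then show ?thesis by (rule not_integrable_integral_eq)
  next
    case int: True
    show ?thesis
    proof (cases "lo < hi")
      case False
      then have "?S \<subseteq> {lo}" unfolding S by auto
      then have "AE y in lborel. indicator ?S y *\<^sub>R ?f y = 0"
        using AE_lborel_singleton[of lo] by (auto elim!: eventually_mono simp: indicator_def)
      then have "(\<integral>y. indicator ?S y *\<^sub>R ?f y \<partial>lborel) = (\<integral>y. 0 \<partial>(lborel :: real measure))"
        using int by (intro integral_cong_AE) auto
      then show ?thesis by simp
    next
      case True
      have "(?f has_integral (F hi - F lo)) {lo..hi}"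
      proof (rule fundamental_theorem_of_calculus_interior)
        show "continuous_on {lo..hi} F" unfolding F_def
          using \<beta> by (intro continuous_on_prod continuous_on_compose2[OF continuous_on_cpw[of _ UNIV]] continuous_intros) auto
        fix x assume x: "x \<in> {lo<..<hi}"
        have "x \<noteq> c k" if "k \<in> L \<union> R" for k
        proof -
          have "c k \<le> lo \<or> hi \<le> c k" using that fin by (auto simp: lo_def hi_def)
          then show ?thesis using x by auto
        qed
        then show "(F has_vector_derivative ?f x) (at x)" unfolding F_def
          using fin by (intro has_vector_derivative_prod_log cpw_has_vector_derivative) auto
      qed (use True in auto)
      moreover have "F lo = 0"
      proof -
        have "lo \<in> c ` L" unfolding lo_def using fin by (intro Max_in) auto
        then show ?thesis unfolding F_def using fin by (intro prod_zero) auto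
      qed
      moreover have "F hi = 0"
      proof -
        have "hi \<in> c ` R" unfolding hi_def using fin by (intro Min_in) auto
        then show ?thesis unfolding F_def using fin by (intro prod_zero) auto
      qed
      ultimately have "integral {lo..hi} ?f = 0" by (simp add: integral_unique)
      moreover have "(LINT y:{lo..hi}|lborel. ?f y) = integral {lo..hi} ?f"
        using int unfolding S by (intro set_borel_integral_eq_integral) (simp add: set_integrable_def)
      ultimately show ?thesis unfolding S by (simp add: set_lebesgue_integral_def)
    qed
  qed
qed

section \<open>One-variable bounds for powers and Gamma densities\<close>

lemma nn_integral_powr_interval:
  assumes "a > 0" "L \<ge> 0"
  shows "(\<integral>\<^sup>+t. ennreal (indicator {-L..L} t * \<bar>t\<bar> powr (a - 1)) \<partial>lborel) \<le> ennreal (2 * (L powr a / a))"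
proof -
  let ?g = "\<lambda>t. indicator {0..L} t * t powr (a - 1)"
  have hi: "(?g has_integral (L powr a / a)) UNIV"
  proof -
    have "((\<lambda>t. if t \<in> {0..L} then t powr (a - 1) else 0) has_integral (L powr a / a)) UNIV"
      unfolding has_integral_restrict_UNIV using has_integral_powr_from_0[of "a - 1" L] assms by simp
    then show ?thesis by (rule has_integral_eq[rotated]) (auto simp: indicator_def)
  qed
  have g: "(\<integral>\<^sup>+t. ennreal (?g t) \<partial>lborel) = ennreal (L powr a / a)"
    using hi by (intro nn_integral_has_integral_lborel) auto
  have g': "(\<integral>\<^sup>+t. ennreal (?g (- t)) \<partial>lborel) = ennreal (L powr a / a)"
    using nn_integral_real_affine[of "\<lambda>t. ennreal (?g t)" "-1" 0] g by simp
  have "(\<integral>\<^sup>+t. ennreal (indicator {-L..L} t * \<bar>t\<bar> powr (a - 1)) \<partial>lborel) \<le> (\<integral>\<^sup>+t. ennreal (?g t) + ennreal (?g (- t)) \<partial>lborel)"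
    by (rule nn_integral_mono) (auto simp: indicator_def abs_real_def)
  also have "\<dots> = ennreal (L powr a / a) + ennreal (L powr a / a)"
    by (subst nn_integral_add) (auto simp: g g')
  also have "\<dots> = ennreal (2 * (L powr a / a))" using assms by (simp flip: ennreal_plus)
  finally show ?thesis .
qed

text \<open>The bound does not depend on the position \<open>c\<close> of the singularity. In
  \<open>integrable_Psi_pole\<close> another variable of integration takes the place of
  \<open>c\<close>.\<close>

lemma nn_integral_powr_shift:
  assumes "a > 0" "c \<in> {A..B}"
  shows "(\<integral>\<^sup>+t. ennreal (indicator {A..B} t * \<bar>t - c\<bar> powr (a - 1)) \<partial>lborel) \<le> ennreal (2 * ((B - A) powr a / a))"
proof -
  let ?g = "\<lambda>t. indicator {-(B - A)..B - A} t * \<bar>t\<bar> powr (a - 1)"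
  have "(\<integral>\<^sup>+t. ennreal (indicator {A..B} t * \<bar>t - c\<bar> powr (a - 1)) \<partial>lborel) \<le> (\<integral>\<^sup>+t. ennreal (?g (t - c)) \<partial>lborel)"
    using assms by (intro nn_integral_mono) (auto simp: indicator_def)
  also have "\<dots> = (\<integral>\<^sup>+t. ennreal (?g t) \<partial>lborel)"
    using nn_integral_real_affine[of "\<lambda>t. ennreal (?g t)" 1 "- c"] by simp
  also have "\<dots> \<le> ennreal (2 * ((B - A) powr a / a))" using assms by (intro nn_integral_powr_interval) auto
  finally show ?thesis .
qed

lemma integrable_powr_shift:
  assumes "a > 0" "c \<in> {A..B}"
  shows "integrable lborel (\<lambda>t. indicator {A..B} t * \<bar>t - c\<bar> powr (a - 1) :: real)"
proof (rule integrableI_bounded)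
  have "(\<integral>\<^sup>+t. ennreal (norm (indicator {A..B} t * \<bar>t - c\<bar> powr (a - 1))) \<partial>lborel)
     = (\<integral>\<^sup>+t. ennreal (indicator {A..B} t * \<bar>t - c\<bar> powr (a - 1)) \<partial>lborel)" by simp
  also have "\<dots> < \<infinity>" using nn_integral_powr_shift[OF assms] by (simp add: order_le_less_trans)
  finally show "(\<integral>\<^sup>+t. ennreal (norm (indicator {A..B} t * \<bar>t - c\<bar> powr (a - 1))) \<partial>lborel) < \<infinity>" .
qed simp

lemma integrable_Gamma_density:
  assumes "a > 0"
  shows "integrable lborel (\<lambda>t. indicator {0..} t * (t powr (a - 1) * exp (- t)) :: real)"
proof -
  have "((\<lambda>t. if t \<in> {0..} then t powr (a - 1) / exp t else 0) has_integral Gamma a) UNIV"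
    unfolding has_integral_restrict_UNIV by (rule Gamma_integral_real[OF assms])
  then have "((\<lambda>t. indicator {0..} t * (t powr (a - 1) * exp (- t))) has_integral Gamma a) UNIV"
    by (rule has_integral_eq[rotated]) (auto simp: indicator_def exp_minus field_simps)
  then have "(\<integral>\<^sup>+t. ennreal (indicator {0..} t * (t powr (a - 1) * exp (- t))) \<partial>lborel) = ennreal (Gamma a)"
    by (intro nn_integral_has_integral_lborel) auto
  then show ?thesis by (intro integrableI_bounded) auto
qed

text \<open>By (1 + t)^Q \<le> 2^Q (1 + t^Q) for t \<ge> 0, two Gamma densities with parameters
  \<open>a\<close> and \<open>a + Q\<close> dominate. The factor (1 + t)^Q will absorb the
  interaction between the variables.\<close>

lemma integrable_Gamma_density_poly:
  assumes "a > 0" "Q \<ge> 0"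
  shows "integrable lborel (\<lambda>t. indicator {0..} t * (t powr (a - 1) * (1 + t) powr Q * exp (- t)) :: real)"
proof (rule Bochner_Integration.integrable_bound)
  show "integrable lborel (\<lambda>t. 2 powr Q * (indicator {0..} t * (t powr (a - 1) * exp (- t)) + indicator {0..} t * (t powr (a + Q - 1) * exp (- t))))"
    using assms by (intro integrable_mult_right Bochner_Integration.integrable_add integrable_Gamma_density) auto
  show "AE t in lborel. norm (indicator {0..} t * (t powr (a - 1) * (1 + t) powr Q * exp (- t)))
     \<le> norm (2 powr Q * (indicator {0..} t * (t powr (a - 1) * exp (- t)) + indicator {0..} t * (t powr (a + Q - 1) * exp (- t))))"
  proof (rule AE_I2)
    fix t :: real
    show "norm (indicator {0..} t * (t powr (a - 1) * (1 + t) powr Q * exp (- t)))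
     \<le> norm (2 powr Q * (indicator {0..} t * (t powr (a - 1) * exp (- t)) + indicator {0..} t * (t powr (a + Q - 1) * exp (- t))))"
    proof (cases "t \<ge> 0")
      case True
      have "(1 + t) powr Q \<le> 2 powr Q * (1 + t powr Q)"
      proof (cases "t \<le> 1")
        case True
        have "(1 + t) powr Q \<le> 2 powr Q" using assms \<open>t \<ge> 0\<close> True by (intro powr_mono2) auto
        then show ?thesis by (simp add: distrib_left add_increasing2)
      next
        case False
        have "(1 + t) powr Q \<le> (2 * t) powr Q" using assms False by (intro powr_mono2) auto
        also have "\<dots> = 2 powr Q * t powr Q" using False by (simp add: powr_mult)
        also have "\<dots> \<le> 2 powr Q * (1 + t powr Q)" by (intro mult_left_mono) auto
        finally show ?thesis .
      qed
      then have "t powr (a - 1) * (1 + t) powr Q * exp (- t) \<le> t powr (a - 1) * (2 powr Q * (1 + t powr Q)) * exp (- t)"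
        by (intro mult_right_mono mult_left_mono) auto
      also have "\<dots> = 2 powr Q * (t powr (a - 1) * exp (- t) + t powr (a + Q - 1) * exp (- t))"
      proof -
        have "t powr (a - 1) * t powr Q = t powr (a + Q - 1)" by (simp add: powr_add[symmetric] algebra_simps)
        then show ?thesis by (simp add: algebra_simps)
      qed
      finally show ?thesis using True by simp
    qed (simp add: indicator_def)
  qed
qed simp

section \<open>The weight and its integrability\<close>

definition vdm :: "nat \<Rightarrow> complex \<Rightarrow> (nat \<Rightarrow> real) \<Rightarrow> complex" where
  "vdm n \<gamma> t = (\<Prod>i=1..n. \<Prod>j\<in>{i<..n}. cpw (t j - t i) (2 * \<gamma>))"

definition Psi :: "nat \<Rightarrow> nat \<Rightarrow> (nat \<Rightarrow> real) \<Rightarrow> (nat \<Rightarrow> complex) \<Rightarrow> complex \<Rightarrow> (nat \<Rightarrow> real) \<Rightarrow> complex" where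
  "Psi n p z \<alpha> \<gamma> t = (\<Prod>i=1..n. \<Prod>s=1..p. cpw (t i - z s) (\<alpha> s)) * vdm n \<gamma> t"

definition off_pairs :: "nat \<Rightarrow> nat \<Rightarrow> (nat \<times> nat) set" where
  "off_pairs n i = {(a, b). a \<in> {1..n} \<and> b \<in> {a<..n} \<and> a \<noteq> i \<and> b \<noteq> i}"

text \<open>Isolates the dependence on t_i. As \<open>cpw\<close> is even in its base, the pairs
  with larger and with smaller partner can be treated alike.\<close>

lemma vdm_split:
  assumes i: "i \<in> {1..n}"
  shows "vdm n \<gamma> t = (\<Prod>j\<in>{1..n}-{i}. cpw (t i - t j) (2 * \<gamma>)) * (\<Prod>(a, b)\<in>off_pairs n i. cpw (t b - t a) (2 * \<gamma>))"
proof -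
  define P where "P = (SIGMA a:{1..n}. {a<..n})"
  define Pi where "Pi = {x\<in>P. fst x = i \<or> snd x = i}"
  have fin: "finite P" by (simp add: P_def)
  have "vdm n \<gamma> t = (\<Prod>(a, b)\<in>P. cpw (t b - t a) (2 * \<gamma>))"
    unfolding vdm_def P_def by (rule prod.Sigma) auto
  also have "P = Pi \<union> off_pairs n i" by (auto simp: Pi_def P_def off_pairs_def)
  also have "(\<Prod>(a, b)\<in>Pi \<union> off_pairs n i. cpw (t b - t a) (2 * \<gamma>))
      = (\<Prod>(a, b)\<in>Pi. cpw (t b - t a) (2 * \<gamma>)) * (\<Prod>(a, b)\<in>off_pairs n i. cpw (t b - t a) (2 * \<gamma>))"
    by (rule prod.union_disjoint) (use fin in \<open>auto simp: Pi_def off_pairs_def P_def intro: finite_subset[of _ P]\<close>)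
  also have "(\<Prod>(a, b)\<in>Pi. cpw (t b - t a) (2 * \<gamma>)) = (\<Prod>j\<in>{1..n}-{i}. cpw (t i - t j) (2 * \<gamma>))"
    by (rule prod.reindex_bij_witness[where i="\<lambda>j. (min i j, max i j)" and j="\<lambda>(a, b). if a = i then b else a"])
       (use i in \<open>auto simp: Pi_def P_def min_def max_def cpw_commute split: if_splits\<close>)
  finally show ?thesis .
qed

text \<open>The condition on \<open>\<alpha> p\<close> is weaker than in the theorem because Selberg's integral \<open>Sel n a b\<close> is the case \<open>\<alpha> 2 = b - 1\<close>.\<close>

locale conf =
  fixes n p :: nat and z :: "nat \<Rightarrow> real" and \<alpha> :: "nat \<Rightarrow> complex" and \<gamma> :: complex
  assumes p2: "p \<ge> 2"
    and zinc: "\<And>s. s \<in> {1..<p} \<Longrightarrow> z s < z (s + 1)"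
    and Apos: "\<And>s. s \<in> {1..<p} \<Longrightarrow> Re (\<alpha> s) > 0"
    and Ap: "Re (\<alpha> p) > - 1"
    and Gpos: "Re \<gamma> > 0"
begin

lemma z_less: "1 \<le> i \<Longrightarrow> i < j \<Longrightarrow> j \<le> p \<Longrightarrow> z i < z j"
proof (induction j)
  case (Suc j)
  show ?case
  proof (cases "i = j")
    case True
    then show ?thesis using zinc[of j] Suc.prems by simp
  next
    case False
    then show ?thesis using zinc[of j] Suc by force
  qed
qed simp

lemma z_le: "1 \<le> i \<Longrightarrow> i \<le> j \<Longrightarrow> j \<le> p \<Longrightarrow> z i \<le> z j"
  using z_less[of i j] by (cases "i = j") auto

lemma z_neq: "i \<in> {1..p} \<Longrightarrow> j \<in> {1..p} \<Longrightarrow> i \<noteq> j \<Longrightarrow> z i \<noteq> z j"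
  using z_less[of i j] z_less[of j i] by (cases "i < j") auto

lemma z1p: "z 1 < z p" using z_less[of 1 p] p2 by auto

text \<open>The order is imposed on all pairs of indices, not on neighbours within a block: across
  blocks it is automatic since the intervals are consecutive. In this form the section in one
  variable is visibly an interval.\<close>

definition inU :: "(nat \<Rightarrow> nat) \<Rightarrow> (nat \<Rightarrow> real) \<Rightarrow> bool" where
  "inU l t \<longleftrightarrow> (\<forall>i\<in>{1..n}. z (site l i) \<le> t i \<and> t i \<le> z (site l i + 1)) \<and> (\<forall>i\<in>{1..n}. \<forall>j\<in>{1..n}. i < j \<longrightarrow> t i \<le> t j)"

lemma Uset_iff:
  assumes l: "l \<in> Zset n (p - 1)"
  shows "t \<in> Uset n p z l \<longleftrightarrow> inU l t"
proof
  assume t: "t \<in> Uset n p z l"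
  have b: "z (site l i) \<le> t i \<and> t i \<le> z (site l i + 1)" if i: "i \<in> {1..n}" for i
    using t site_range[OF l i] Gam_eq_site[OF l site_range[OF l i]] i unfolding Uset_def by auto
  have c: "t i \<le> t j" if "s \<in> {1..p-1}" "i \<in> Gam l s" "i \<le> j" "j \<in> Gam l s" for s i j
    using that(3,4)
  proof (induction j rule: dec_induct)
    case (step m)
    have "m \<in> {psum l (s - 1) + 1..<psum l s}" using step that(2) by (auto simp: Gam_def)
    then have "t m \<le> t (m + 1)" using t that(1) unfolding Uset_def by blast
    moreover have "m \<in> Gam l s" using step that(2) by (auto simp: Gam_def)
    ultimately show ?case using step.IH by simp
  qed simp
  have "t i \<le> t j" if ij: "i \<in> {1..n}" "j \<in> {1..n}" "i < j" for i j
  proof (cases "site l i = site l j")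
    case True
    show ?thesis
      by (rule c[of "site l i"]) (use site_range[OF l ij(1)] Gam_eq_site[OF l site_range[OF l ij(1)]] True ij in auto)
  next
    case False
    then have "site l i < site l j" using site_mono[OF l, of i j] ij by simp
    then have "z (site l i + 1) \<le> z (site l j)" using site_range[OF l ij(2)] by (intro z_le) auto
    then show ?thesis using b[OF ij(1)] b[OF ij(2)] by linarith
  qed
  then show "inU l t" using b by (auto simp: inU_def)
next
  assume t: "inU l t"
  show "t \<in> Uset n p z l" unfolding Uset_def
  proof (intro CollectI ballI conjI)
    fix s j assume s: "s \<in> {1..p - 1}" and "j \<in> Gam l s"
    then have "j \<in> {1..n}" "site l j = s" using Gam_eq_site[OF l s] by auto
    then show "z s \<le> t j" "t j \<le> z (s + 1)" using t by (auto simp: inU_def)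
  next
    fix s j assume s: "s \<in> {1..p - 1}" and j: "j \<in> {psum l (s - 1) + 1..<psum l s}"
    then have "j \<in> Gam l s" "j + 1 \<in> Gam l s" by (auto simp: Gam_def)
    then have "j \<in> {1..n}" "j + 1 \<in> {1..n}" using Gam_eq_site[OF l s] by auto
    then show "t j \<le> t (j + 1)" using t by (auto simp: inU_def)
  qed
qed

lemma inU_range:
  assumes l: "l \<in> Zset n (p - 1)" and t: "inU l t" and i: "i \<in> {1..n}"
  shows "z 1 \<le> t i" "t i \<le> z p"
proof -
  have "site l i \<in> {1..p-1}" by (rule site_range[OF l i])
  then have "z 1 \<le> z (site l i)" "z (site l i + 1) \<le> z p" using p2 by (auto intro!: z_le)
  then show "z 1 \<le> t i" "t i \<le> z p" using t i by (auto simp: inU_def intro: order_trans)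
qed

lemma measurable_inU [measurable]: "Measurable.pred (Rn n) (inU l)"
proof -
  have c: "(\<lambda>t. t i) \<in> borel_measurable (Rn n)" if "i \<in> {1..n}" for i
    using measurable_component_singleton[OF that, of "\<lambda>_. lborel :: real measure"] by simp
  have a: "Measurable.pred (Rn n) (\<lambda>t. z (site l i) \<le> t i \<and> t i \<le> z (site l i + 1))" if "i \<in> {1..n}" for i
  proof -
    note [measurable] = c[OF that]
    show ?thesis by measurable
  qed
  have b: "Measurable.pred (Rn n) (\<lambda>t. i < j \<longrightarrow> t i \<le> t j)" if "i \<in> {1..n}" "j \<in> {1..n}" for i j
  proof -
    have "Measurable.pred (Rn n) (\<lambda>t. t i \<le> t j)"
      unfolding pred_def by (rule borel_measurable_le[OF c[OF that(1)] c[OF that(2)]])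
    then show ?thesis by (cases "i < j") simp_all
  qed
  show ?thesis unfolding inU_def
    by (rule pred_intros_logic(3)[OF pred_intros_finite(3)[OF _ a] pred_intros_finite(3)[OF _ pred_intros_finite(3)[OF _ b]]]) simp_all
qed

definition indU :: "(nat \<Rightarrow> nat) \<Rightarrow> (nat \<Rightarrow> real) \<Rightarrow> real" where
  "indU l t = (if inU l t then 1 else 0)"

lemma measurable_indU [measurable]: "indU l \<in> borel_measurable (Rn n)"
  unfolding indU_def by measurable

lemma measurable_vdm [measurable]: "vdm n \<gamma> \<in> borel_measurable (Rn n)"
  unfolding vdm_def by measurable

lemma measurable_Psi [measurable]: "Psi n p z \<alpha> \<gamma> \<in> borel_measurable (Rn n)"
  unfolding Psi_def by measurable

text \<open>The sum stops before \<open>p\<close>: at z_p the exponent may have real part just above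
  -1, which leaves no room for another pole.\<close>

definition pole :: "real \<Rightarrow> real" where
  "pole t = 1 + (\<Sum>s=1..<p. 1 / \<bar>t - z s\<bar>)"

definition wt :: "real \<Rightarrow> real" where
  "wt t = indicator {z 1..z p} t * ((\<Prod>s=1..p. \<bar>t - z s\<bar> powr Re (\<alpha> s)) * pole t)"

lemma pole_ge_1: "pole t \<ge> 1"
  unfolding pole_def by (simp add: sum_nonneg)

lemma wt_nonneg: "wt t \<ge> 0"
  unfolding wt_def using pole_ge_1[of t] by (auto intro!: mult_nonneg_nonneg prod_nonneg)

lemma measurable_wt [measurable]: "wt \<in> borel_measurable borel"
  unfolding wt_def pole_def by measurable

lemma powr_le_const: "0 \<le> x \<Longrightarrow> x \<le> L \<Longrightarrow> 0 \<le> e \<Longrightarrow> x powr e \<le> (L::real) powr e"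
  by (intro powr_mono2) auto

lemma powr_between: "0 < d \<Longrightarrow> d \<le> x \<Longrightarrow> x \<le> L \<Longrightarrow> x powr e \<le> d powr e + (L::real) powr e"
proof (cases "e \<ge> 0")
  case True
  assume "0 < d" "d \<le> x" "x \<le> L"
  then have "x powr e \<le> L powr e" using True by (intro powr_mono2) auto
  then show ?thesis by (simp add: add_increasing)
next
  case False
  assume "0 < d" "d \<le> x" "x \<le> L"
  then have "x powr e \<le> d powr e" using False by (intro powr_mono2') auto
  then show ?thesis by (simp add: add_increasing2)
qed

text \<open>Each pole is treated separately. With \<open>d\<close> half the distance from z_s to
  z_p, every t is at distance at least \<open>d\<close> from one of the two points, so only one of
  the exponents \<open>Re (\<alpha> s) - 1\<close> and \<open>Re (\<alpha> p)\<close> can be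
  singular at a time, and both exceed -1. The other powers are bounded by \<open>K\<close>.\<close>

lemma integrable_wt: "integrable lborel wt"
proof -
  define L where "L = z p - z 1"
  have L: "L > 0" using z1p by (simp add: L_def)
  have dist: "\<bar>t - z s\<bar> \<le> L" if "t \<in> {z 1..z p}" "s \<in> {1..p}" for t s
  proof -
    have "z 1 \<le> z s" "z s \<le> z p" using that by (auto intro!: z_le)
    then show ?thesis using that by (auto simp: L_def)
  qed
  define f where "f s t = (\<Prod>r=1..p. \<bar>t - z r\<bar> powr Re (\<alpha> r)) * (1 / \<bar>t - z s\<bar>)" for s t
  have f_int: "integrable lborel (\<lambda>t. indicator {z 1..z p} t * f s t)" if s: "s \<in> {1..<p}" for s
  proof -
    define d where "d = (z p - z s) / 2"
    have d: "d > 0" using z_less[of s p] s by (simp add: d_def)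
    define A where "A = Re (\<alpha> s) - 1"
    define B where "B = Re (\<alpha> p)"
    define K where "K = (\<Prod>r\<in>{1..p}-{s,p}. L powr Re (\<alpha> r))"
    have K: "K \<ge> 0" unfolding K_def by (intro prod_nonneg) auto
    define g where "g t = K * ((d powr A + L powr A) * (indicator {z 1..z p} t * \<bar>t - z p\<bar> powr (B + 1 - 1))
       + (d powr B + L powr B) * (indicator {z 1..z p} t * \<bar>t - z s\<bar> powr (A + 1 - 1)))" for t
    have "integrable lborel g" unfolding g_def
    proof (intro integrable_mult_right Bochner_Integration.integrable_add integrable_powr_shift)
      show "0 < B + 1" using Ap by (simp add: B_def)
      show "z p \<in> {z 1..z p}" using z1p by simp
      show "0 < A + 1" using Apos[OF s] by (simp add: A_def)
      show "z s \<in> {z 1..z p}" using s by (auto intro!: z_le)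
    qed
    then show ?thesis
    proof (rule Bochner_Integration.integrable_bound)
      show "(\<lambda>t. indicator {z 1..z p} t * f s t) \<in> borel_measurable lborel" unfolding f_def by measurable
      show "AE t in lborel. norm (indicator {z 1..z p} t * f s t) \<le> norm (g t)"
      proof (rule AE_I2)
        fix t
        show "norm (indicator {z 1..z p} t * f s t) \<le> norm (g t)"
        proof (cases "t \<in> {z 1..z p} \<and> t \<noteq> z s")
          case False
          have "f s (z s) = 0" using s by (simp add: f_def)
          then show ?thesis using False by (auto simp: indicator_def)
        next
          case True
          then have t: "t \<in> {z 1..z p}" and ts: "t \<noteq> z s" by auto
          have e: "{1..p} - {s} - {p} = {1..p} - {s, p}" by auto
          have "(\<Prod>r=1..p. \<bar>t - z r\<bar> powr Re (\<alpha> r))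
             = \<bar>t - z s\<bar> powr Re (\<alpha> s) * (\<Prod>r\<in>{1..p} - {s}. \<bar>t - z r\<bar> powr Re (\<alpha> r))"
            using s by (intro prod.remove) auto
          also have "(\<Prod>r\<in>{1..p} - {s}. \<bar>t - z r\<bar> powr Re (\<alpha> r))
             = \<bar>t - z p\<bar> powr B * (\<Prod>r\<in>{1..p}-{s,p}. \<bar>t - z r\<bar> powr Re (\<alpha> r))"
            unfolding B_def e[symmetric] using s by (intro prod.remove) auto
          finally have X: "(\<Prod>r=1..p. \<bar>t - z r\<bar> powr Re (\<alpha> r))
             = \<bar>t - z s\<bar> powr Re (\<alpha> s) * (\<bar>t - z p\<bar> powr B * (\<Prod>r\<in>{1..p}-{s,p}. \<bar>t - z r\<bar> powr Re (\<alpha> r)))" .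
          have Y: "\<bar>t - z s\<bar> powr Re (\<alpha> s) * (1 / \<bar>t - z s\<bar>) = \<bar>t - z s\<bar> powr A"
            using ts by (simp add: A_def powr_diff)
          have fe: "f s t = (\<Prod>r\<in>{1..p}-{s,p}. \<bar>t - z r\<bar> powr Re (\<alpha> r)) * (\<bar>t - z s\<bar> powr A * \<bar>t - z p\<bar> powr B)"
            unfolding f_def X Y[symmetric] by (simp only: mult_ac)
          have K1: "(\<Prod>r\<in>{1..p}-{s,p}. \<bar>t - z r\<bar> powr Re (\<alpha> r)) \<le> K" unfolding K_def
            by (intro prod_mono conjI powr_ge_zero powr_le_const) (use dist[OF t] Apos in \<open>force intro: less_imp_le\<close>)+
          have "\<bar>t - z s\<bar> powr A * \<bar>t - z p\<bar> powr B \<le> (d powr A + L powr A) * \<bar>t - z p\<bar> powr B + (d powr B + L powr B) * \<bar>t - z s\<bar> powr A"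
          proof (cases "d \<le> \<bar>t - z s\<bar>")
            case True
            then have "\<bar>t - z s\<bar> powr A \<le> d powr A + L powr A" using d dist[OF t] s by (intro powr_between) auto
            then have "\<bar>t - z s\<bar> powr A * \<bar>t - z p\<bar> powr B \<le> (d powr A + L powr A) * \<bar>t - z p\<bar> powr B"
              by (intro mult_right_mono) auto
            then show ?thesis by (smt (verit, best) powr_ge_zero mult_nonneg_nonneg)
          next
            case False
            then have "t - z s < d" by simp
            then have "d \<le> z p - t" unfolding d_def by (simp add: field_simps)
            then have "d \<le> \<bar>t - z p\<bar>" by simp
            then have "\<bar>t - z p\<bar> powr B \<le> d powr B + L powr B" using d dist[OF t, of p] p2 by (intro powr_between) auto
            then have "\<bar>t - z p\<bar> powr B * \<bar>t - z s\<bar> powr A \<le> (d powr B + L powr B) * \<bar>t - z s\<bar> powr A"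
              by (intro mult_right_mono) auto
            then show ?thesis by (smt (verit, best) powr_ge_zero mult_nonneg_nonneg mult.commute)
          qed
          then have "f s t \<le> K * ((d powr A + L powr A) * \<bar>t - z p\<bar> powr B + (d powr B + L powr B) * \<bar>t - z s\<bar> powr A)"
            unfolding fe using K1 by (intro mult_mono) (auto intro: K)
          moreover have "f s t \<ge> 0" unfolding f_def by (intro mult_nonneg_nonneg prod_nonneg) auto
          ultimately show ?thesis using t by (simp add: g_def)
        qed
      qed
    qed
  qed
  have s1: "1 \<in> {1..<p}" using p2 by simp
  have "integrable lborel (\<lambda>t. L * (indicator {z 1..z p} t * f 1 t) + (\<Sum>s=1..<p. indicator {z 1..z p} t * f s t))"
    using f_int s1 by (intro Bochner_Integration.integrable_add integrable_mult_right Bochner_Integration.integrable_sum) auto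
  then show ?thesis
  proof (rule Bochner_Integration.integrable_bound)
    show "wt \<in> borel_measurable lborel" by simp
    show "AE t in lborel. norm (wt t) \<le> norm (L * (indicator {z 1..z p} t * f 1 t) + (\<Sum>s=1..<p. indicator {z 1..z p} t * f s t))"
    proof (rule AE_I2)
      fix t
      have "wt t \<le> L * (indicator {z 1..z p} t * f 1 t) + (\<Sum>s=1..<p. indicator {z 1..z p} t * f s t)"
      proof (cases "t \<in> {z 1..z p}")
        case t: True
        let ?Q = "\<Prod>r=1..p. \<bar>t - z r\<bar> powr Re (\<alpha> r)"
        \<comment> \<open>The summand 1 of \<open>pole\<close> is absorbed by its first pole,
          because the distance from z_1 is at most \<open>L\<close>.\<close>
        have "?Q \<le> L * f 1 t"
        proof (cases "t = z 1")
          case True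
          then have "?Q = 0" using p2 by (intro prod_zero) auto
          then show ?thesis unfolding f_def by (simp only: mult_zero_left mult_zero_right order_refl)
        next
          case False
          have "?Q * 1 \<le> ?Q * (L / \<bar>t - z 1\<bar>)"
            using dist[OF t, of 1] p2 False by (intro mult_left_mono prod_nonneg) auto
          then show ?thesis by (simp add: f_def mult_ac)
        qed
        moreover have "wt t = ?Q + (\<Sum>s=1..<p. f s t)" using t by (simp add: wt_def pole_def f_def distrib_left sum_distrib_left)
        ultimately show ?thesis using t by simp
      qed (simp add: wt_def)
      then show "norm (wt t) \<le> norm (L * (indicator {z 1..z p} t * f 1 t) + (\<Sum>s=1..<p. indicator {z 1..z p} t * f s t))"
        using wt_nonneg[of t] by simp
    qed
  qed
qed

text \<open>The growth that one variable may carry so that \<open>wt\<close>, up to a constant,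
  still dominates its share of the integrand.\<close>

definition admissible :: "(real \<Rightarrow> complex) \<Rightarrow> bool" where
  "admissible h \<longleftrightarrow> h \<in> borel_measurable borel \<and> (\<exists>C\<ge>0. \<forall>t\<in>{z 1..z p}. norm (h t) \<le> C * pole t)"

end

lemma Rn_component: "i \<in> {1..n} \<Longrightarrow> (\<lambda>t. t i) \<in> borel_measurable (Rn n)"
  using measurable_component_singleton[of i "{1..n}" "\<lambda>_. lborel :: real measure"] by simp

context conf
begin

lemma admissibleD:
  assumes "admissible h"
  obtains C where "C \<ge> 0" "\<And>t. t \<in> {z 1..z p} \<Longrightarrow> norm (h t) \<le> C * pole t"
  using assms by (auto simp: admissible_def)

lemma admissible_measurable: "admissible h \<Longrightarrow> h \<in> borel_measurable borel"
  by (simp add: admissible_def)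

lemma admissible_const: "admissible (\<lambda>t. c)"
proof -
  have "norm c \<le> norm c * pole t" for t using mult_left_mono[OF pole_ge_1[of t], of "norm c"] by simp
  then show ?thesis unfolding admissible_def by (auto intro!: exI[of _ "norm c"])
qed

lemma admissible_add: "admissible f \<Longrightarrow> admissible g \<Longrightarrow> admissible (\<lambda>t. f t + g t)"
proof -
  assume f: "admissible f" and g: "admissible g"
  obtain C where C: "C \<ge> 0" "\<And>t. t \<in> {z 1..z p} \<Longrightarrow> norm (f t) \<le> C * pole t" using admissibleD[OF f] by blast
  obtain D where D: "D \<ge> 0" "\<And>t. t \<in> {z 1..z p} \<Longrightarrow> norm (g t) \<le> D * pole t" using admissibleD[OF g] by blast
  have "norm (f t + g t) \<le> (C + D) * pole t" if "t \<in> {z 1..z p}" for t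
    using norm_triangle_ineq[of "f t" "g t"] C(2)[OF that] D(2)[OF that] by (simp add: distrib_right)
  then show ?thesis using f g C(1) D(1) unfolding admissible_def by (auto intro!: exI[of _ "C + D"])
qed

lemma admissible_mult:
  assumes f: "admissible f" and g: "g \<in> borel_measurable borel" "\<And>t. t \<in> {z 1..z p} \<Longrightarrow> norm (g t) \<le> B"
  shows "admissible (\<lambda>t. f t * g t)"
proof -
  obtain C where C: "C \<ge> 0" "\<And>t. t \<in> {z 1..z p} \<Longrightarrow> norm (f t) \<le> C * pole t" using admissibleD[OF f] by blast
  have "norm (f t * g t) \<le> (C * \<bar>B\<bar>) * pole t" if "t \<in> {z 1..z p}" for t
  proof -
    have "norm (f t * g t) \<le> (C * pole t) * \<bar>B\<bar>"
      unfolding norm_mult using C(1) C(2)[OF that] g(2)[OF that] pole_ge_1[of t] by (intro mult_mono) auto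
    then show ?thesis by (simp add: mult_ac)
  qed
  then show ?thesis using f g(1) C(1) unfolding admissible_def by (auto intro!: exI[of _ "C * \<bar>B\<bar>"])
qed

lemma admissible_cmult: "admissible f \<Longrightarrow> admissible (\<lambda>t. c * f t)"
  using admissible_mult[of f "\<lambda>_. c" "norm c"] by (simp add: mult.commute)

lemma admissible_sum: "(\<And>i. i \<in> I \<Longrightarrow> admissible (f i)) \<Longrightarrow> admissible (\<lambda>t. \<Sum>i\<in>I. f i t)"
  by (induction I rule: infinite_finite_induct) (auto intro: admissible_add admissible_const)

lemma admissible_inverse: "s \<in> {1..<p} \<Longrightarrow> admissible (\<lambda>t. 1 / of_real (t - z s))"
proof -
  assume s: "s \<in> {1..<p}"
  have "norm (1 / of_real (t - z s) :: complex) \<le> 1 * pole t" for t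
  proof -
    have "1 / \<bar>t - z s\<bar> \<le> (\<Sum>s=1..<p. 1 / \<bar>t - z s\<bar>)" using s by (intro member_le_sum) auto
    then show ?thesis by (simp add: pole_def norm_divide del: of_real_diff)
  qed
  then show ?thesis unfolding admissible_def by (auto intro!: exI[of _ 1])
qed

text \<open>Away from the points z_s, the derivative of (t - z_p) times the one-variable weight
  \<open>pt\<close> is \<open>pt\<close> times \<open>kap\<close>.\<close>

definition kap :: "real \<Rightarrow> complex" where
  "kap t = 1 + (\<Sum>s=1..p. \<alpha> s * of_real (t - z p) / of_real (t - z s))"

lemma admissible_kap: "admissible kap"
proof -
  have "admissible (\<lambda>t. \<alpha> s * of_real (t - z p) / of_real (t - z s))" if s: "s \<in> {1..p}" for s
  proof (cases "s = p")
    case True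
    have "norm (\<alpha> p * of_real (t - z p) / of_real (t - z p)) \<le> norm (\<alpha> p) * pole t" for t
      using mult_left_mono[OF pole_ge_1[of t], of "norm (\<alpha> p)"] pole_ge_1[of t]
      by (cases "t = z p") (simp_all add: norm_divide norm_mult del: of_real_diff)
    then show ?thesis unfolding admissible_def True by (intro conjI exI[of _ "norm (\<alpha> p)"] ballI norm_ge_zero) measurable
  next
    case False
    have "norm (\<alpha> s * of_real (t - z p) :: complex) \<le> norm (\<alpha> s) * (z p - z 1)" if "t \<in> {z 1..z p}" for t
      unfolding norm_mult norm_of_real using that by (intro mult_left_mono) auto
    from admissible_mult[OF admissible_inverse _ this, of s] show ?thesis using s False by (simp add: mult.commute)
  qed
  then show ?thesis unfolding kap_def by (intro admissible_add admissible_const admissible_sum)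
qed

definition pt :: "real \<Rightarrow> complex" where "pt t = (\<Prod>s=1..p. cpw (t - z s) (\<alpha> s))"

lemma norm_pt: "norm (pt t) = (\<Prod>s=1..p. \<bar>t - z s\<bar> powr Re (\<alpha> s))"
  by (simp add: pt_def prod_norm[symmetric] norm_cpw)

lemma norm_cpw_bound: "x \<in> {z 1..z p} \<Longrightarrow> y \<in> {z 1..z p} \<Longrightarrow> norm (cpw (x - y) (2 * \<gamma>)) \<le> (z p - z 1) powr (2 * Re \<gamma>)"
proof -
  assume "x \<in> {z 1..z p}" "y \<in> {z 1..z p}"
  then have "\<bar>x - y\<bar> \<le> z p - z 1" by auto
  then have "\<bar>x - y\<bar> powr (2 * Re \<gamma>) \<le> (z p - z 1) powr (2 * Re \<gamma>)" using Gpos by (intro powr_mono2) auto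
  then show ?thesis by (simp add: norm_cpw)
qed

lemma vdm_bound:
  assumes "\<And>i. i \<in> {1..n} \<Longrightarrow> t i \<in> {z 1..z p}"
  shows "norm (vdm n \<gamma> t) \<le> (\<Prod>i=1..n. \<Prod>j\<in>{i<..n}. (z p - z 1) powr (2 * Re \<gamma>))"
  unfolding vdm_def prod_norm[symmetric]
  by (intro prod_mono conjI norm_cpw_bound prod_nonneg norm_ge_zero assms) auto

text \<open>On the bounded domain the interaction \<open>vdm\<close> is bounded, and what remains is
  a product of one-variable functions dominated by multiples of \<open>wt\<close>.\<close>

lemma integrable_Psi:
  assumes l: "l \<in> Zset n (p - 1)" and h: "\<And>i. i \<in> {1..n} \<Longrightarrow> admissible (h i)"
  shows "integrable (Rn n) (\<lambda>t. indU l t *\<^sub>R (Psi n p z \<alpha> \<gamma> t * (\<Prod>i=1..n. h i (t i))))"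
proof -
  have "\<forall>i\<in>{1..n}. \<exists>C. C \<ge> 0 \<and> (\<forall>t\<in>{z 1..z p}. norm (h i t) \<le> C * pole t)"
    using h unfolding admissible_def by blast
  from bchoice[OF this] obtain C where C0: "\<forall>i\<in>{1..n}. C i \<ge> 0 \<and> (\<forall>t\<in>{z 1..z p}. norm (h i t) \<le> C i * pole t)" ..
  then have C: "\<And>i. i \<in> {1..n} \<Longrightarrow> C i \<ge> 0" "\<And>i t. i \<in> {1..n} \<Longrightarrow> t \<in> {z 1..z p} \<Longrightarrow> norm (h i t) \<le> C i * pole t"
    by simp_all
  define B where "B = (\<Prod>i=1..n. \<Prod>j\<in>{i<..n}. (z p - z 1) powr (2 * Re \<gamma>))"
  have hm: "(\<lambda>t. h i (t i)) \<in> borel_measurable (Rn n)" if "i \<in> {1..n}" for i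
    by (rule measurable_compose[OF Rn_component[OF that] admissible_measurable[OF h[OF that]]])
  have "integrable (Rn n) (\<lambda>t. B * (\<Prod>i=1..n. C i * wt (t i)))"
    by (intro integrable_mult_right lb.product_integrable_prod integrable_wt) auto
  then show ?thesis
  proof (rule Bochner_Integration.integrable_bound)
    have "(\<lambda>t. \<Prod>i=1..n. h i (t i)) \<in> borel_measurable (Rn n)" by (intro borel_measurable_prod hm)
    then show "(\<lambda>t. indU l t *\<^sub>R (Psi n p z \<alpha> \<gamma> t * (\<Prod>i=1..n. h i (t i)))) \<in> borel_measurable (Rn n)" by measurable
    show "AE t in Rn n. norm (indU l t *\<^sub>R (Psi n p z \<alpha> \<gamma> t * (\<Prod>i=1..n. h i (t i)))) \<le> norm (B * (\<Prod>i=1..n. C i * wt (t i)))"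
    proof (rule AE_I2)
      fix t
      have nn: "0 \<le> B * (\<Prod>i=1..n. C i * wt (t i))"
        unfolding B_def by (intro mult_nonneg_nonneg prod_nonneg) (auto simp: C(1) wt_nonneg intro!: mult_nonneg_nonneg prod_nonneg)
      have "norm (indU l t *\<^sub>R (Psi n p z \<alpha> \<gamma> t * (\<Prod>i=1..n. h i (t i)))) \<le> B * (\<Prod>i=1..n. C i * wt (t i))"
      proof (cases "inU l t")
        case True
        then have r: "t i \<in> {z 1..z p}" if "i \<in> {1..n}" for i using inU_range[OF l] that by auto
        have "norm (Psi n p z \<alpha> \<gamma> t * (\<Prod>i=1..n. h i (t i))) = norm (vdm n \<gamma> t) * (\<Prod>i=1..n. norm (pt (t i)) * norm (h i (t i)))"
          unfolding Psi_def pt_def by (simp add: norm_mult prod_norm prod.distrib)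
        also have "\<dots> \<le> B * (\<Prod>i=1..n. C i * wt (t i))"
        proof (rule mult_mono)
          show "norm (vdm n \<gamma> t) \<le> B" unfolding B_def using r by (rule vdm_bound)
          show "(\<Prod>i=1..n. norm (pt (t i)) * norm (h i (t i))) \<le> (\<Prod>i=1..n. C i * wt (t i))"
          proof (rule prod_mono)
            fix i assume i: "i \<in> {1..n}"
            have "norm (pt (t i)) * norm (h i (t i)) \<le> norm (pt (t i)) * (C i * pole (t i))"
              using C(2)[OF i r[OF i]] by (intro mult_left_mono) auto
            also have "\<dots> = C i * wt (t i)" using r[OF i] by (simp add: wt_def norm_pt)
            finally show "0 \<le> norm (pt (t i)) * norm (h i (t i)) \<and> norm (pt (t i)) * norm (h i (t i)) \<le> C i * wt (t i)" by simp
          qed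
        qed (auto intro!: prod_nonneg simp: B_def)
        finally show ?thesis using True by (simp add: indU_def)
      qed (use nn in \<open>simp add: indU_def\<close>)
      then show "norm (indU l t *\<^sub>R (Psi n p z \<alpha> \<gamma> t * (\<Prod>i=1..n. h i (t i)))) \<le> norm (B * (\<Prod>i=1..n. C i * wt (t i)))"
        using nn by simp
    qed
  qed
qed

text \<open>The extra factor lifts the exponent at z_p to \<alpha>_p + 1, whose real part is
  positive, so all powers are bounded.\<close>

lemma pt_times_bound:
  "\<exists>B\<ge>0. \<forall>t\<in>{z 1..z p}. norm (pt t * of_real (t - z p)) \<le> B"
proof -
  define L where "L = z p - z 1"
  let ?B = "L powr (Re (\<alpha> p) + 1) * (\<Prod>s=1..<p. L powr Re (\<alpha> s))"
  have "norm (pt t * of_real (t - z p)) \<le> ?B" if t: "t \<in> {z 1..z p}" for t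
  proof -
    have "{1..p} = insert p {1..<p}" using p2 by auto
    then have "norm (pt t * of_real (t - z p)) = (\<bar>t - z p\<bar> powr Re (\<alpha> p) * \<bar>t - z p\<bar>) * (\<Prod>s=1..<p. \<bar>t - z s\<bar> powr Re (\<alpha> s))"
      unfolding norm_mult norm_pt norm_of_real by (simp add: mult_ac)
    also have "\<bar>t - z p\<bar> powr Re (\<alpha> p) * \<bar>t - z p\<bar> = \<bar>t - z p\<bar> powr (Re (\<alpha> p) + 1)" by (simp add: powr_add)
    also have "\<bar>t - z p\<bar> powr (Re (\<alpha> p) + 1) * (\<Prod>s=1..<p. \<bar>t - z s\<bar> powr Re (\<alpha> s)) \<le> ?B"
    proof (intro mult_mono prod_mono conjI powr_le_const)
      fix s assume s: "s \<in> {1..<p}"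
      have "z 1 \<le> z s" "z s \<le> z p" using s by (auto intro!: z_le)
      then show "\<bar>t - z s\<bar> \<le> L" using t by (auto simp: L_def)
      show "0 \<le> Re (\<alpha> s)" using Apos[OF s] by simp
    qed (use t Ap in \<open>auto simp: L_def intro!: prod_nonneg\<close>)
    finally show ?thesis .
  qed
  moreover have "?B \<ge> 0" by (intro mult_nonneg_nonneg prod_nonneg) auto
  ultimately show ?thesis by blast
qed

text \<open>The factor |t_i - t_j|^(2 Re \<gamma> - 1) prevents a product majorant. Variable
  \<open>i\<close> carries no letter and its weight is bounded thanks to (t_i - z_p), so t_i is
  integrated first: the inner integral is at most \<open>S\<close>, uniformly in t_j, and the outer
  one has a product majorant again.\<close>

lemma integrable_Psi_pole:
  assumes l: "l \<in> Zset n (p - 1)" and i: "i \<in> {1..n}" and j: "j \<in> {1..n} - {i}"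
    and h: "\<And>k. k \<in> {1..n} - {i} \<Longrightarrow> admissible (h k)"
  shows "integrable (Rn n) (\<lambda>t. indU l t *\<^sub>R (Psi n p z \<alpha> \<gamma> t * (\<Prod>k\<in>{1..n}-{i}. h k (t k))
      * (of_real (t i - z p) / of_real (t i - t j))))" (is "integrable _ ?f")
proof (rule integrableI_bounded)
  let ?I = "{1..n} - {i}"
  have ins: "insert i ?I = {1..n}" using i by auto
  have "\<forall>k\<in>?I. \<exists>C. C \<ge> 0 \<and> (\<forall>t\<in>{z 1..z p}. norm (h k t) \<le> C * pole t)"
    using h unfolding admissible_def by blast
  from bchoice[OF this] obtain C where C0: "\<forall>k\<in>?I. C k \<ge> 0 \<and> (\<forall>t\<in>{z 1..z p}. norm (h k t) \<le> C k * pole t)" ..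
  then have C: "\<And>k. k \<in> ?I \<Longrightarrow> C k \<ge> 0" "\<And>k t. k \<in> ?I \<Longrightarrow> t \<in> {z 1..z p} \<Longrightarrow> norm (h k t) \<le> C k * pole t"
    by simp_all
  obtain B where B: "B \<ge> 0" "\<And>t. t \<in> {z 1..z p} \<Longrightarrow> norm (pt t * of_real (t - z p)) \<le> B"
    using pt_times_bound by blast
  define L where "L = (z p - z 1) powr (2 * Re \<gamma>)"
  have L: "L \<ge> 0" by (simp add: L_def)
  define D where "D = B * (\<Prod>k\<in>?I-{j}. L) * (\<Prod>(a::nat, b::nat)\<in>off_pairs n i. L)"
  have D: "D \<ge> 0" unfolding D_def using B(1) L by (intro mult_nonneg_nonneg prod_nonneg) auto
  define g where "g t = D * (\<Prod>k\<in>?I. C k * wt (t k))" for t :: "nat \<Rightarrow> real"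
  define e where "e y c = indicator {z 1..z p} y * \<bar>y - c\<bar> powr (2 * Re \<gamma> - 1)" for y c :: real
  have gn: "g t \<ge> 0" for t unfolding g_def using C(1) wt_nonneg D by (intro mult_nonneg_nonneg prod_nonneg) auto
  have hm: "(\<lambda>t. h k (t k)) \<in> borel_measurable (Rn n)" if k: "k \<in> ?I" for k
  proof -
    have "k \<in> {1..n}" using k by auto
    then show ?thesis
      by (rule measurable_compose[OF Rn_component admissible_measurable[OF h[OF k]]])
  qed
  have "(\<lambda>t. \<Prod>k\<in>?I. h k (t k)) \<in> borel_measurable (Rn n)" by (intro borel_measurable_prod hm)
  moreover have "(\<lambda>t. t i) \<in> borel_measurable (Rn n)" "(\<lambda>t. t j) \<in> borel_measurable (Rn n)"
    using i j by (auto intro: Rn_component)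
  ultimately show fm [measurable]: "?f \<in> borel_measurable (Rn n)" by measurable
  have bound: "norm (?f t) \<le> g t * e (t i) (t j)" for t
  proof (cases "inU l t")
    case True
    then have r: "t k \<in> {z 1..z p}" if "k \<in> {1..n}" for k using inU_range[OF l] that by auto
    have en: "0 \<le> e (t i) (t j)" by (simp add: e_def)
    have P: "Psi n p z \<alpha> \<gamma> t = pt (t i) * (\<Prod>k\<in>?I. pt (t k)) * vdm n \<gamma> t"
      unfolding Psi_def pt_def[symmetric] using i by (simp add: prod.remove)
    have V: "vdm n \<gamma> t = cpw (t i - t j) (2 * \<gamma>) * (\<Prod>k\<in>?I-{j}. cpw (t i - t k) (2 * \<gamma>)) * (\<Prod>(a, b)\<in>off_pairs n i. cpw (t b - t a) (2 * \<gamma>))"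
      unfolding vdm_split[OF i] using j by (simp add: prod.remove)
    have "norm (?f t) = norm (pt (t i) * of_real (t i - z p)) * (\<Prod>k\<in>?I. norm (pt (t k)) * norm (h k (t k)))
       * (norm (cpw (t i - t j) (2 * \<gamma>)) / \<bar>t i - t j\<bar>) * (\<Prod>k\<in>?I-{j}. norm (cpw (t i - t k) (2 * \<gamma>)))
       * (\<Prod>(a, b)\<in>off_pairs n i. norm (cpw (t b - t a) (2 * \<gamma>)))"
      using True unfolding P V indU_def
      by (simp add: norm_mult norm_divide prod_norm[symmetric] prod.distrib case_prod_beta mult_ac del: of_real_diff)
    also have "norm (cpw (t i - t j) (2 * \<gamma>)) / \<bar>t i - t j\<bar> = e (t i) (t j)"
      using r[OF i] by (cases "t i = t j") (auto simp: e_def norm_cpw powr_diff)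
    also have "norm (pt (t i) * of_real (t i - z p)) * (\<Prod>k\<in>?I. norm (pt (t k)) * norm (h k (t k)))
       * e (t i) (t j) * (\<Prod>k\<in>?I-{j}. norm (cpw (t i - t k) (2 * \<gamma>))) * (\<Prod>(a, b)\<in>off_pairs n i. norm (cpw (t b - t a) (2 * \<gamma>)))
       \<le> B * (\<Prod>k\<in>?I. C k * wt (t k)) * e (t i) (t j) * (\<Prod>k\<in>?I-{j}. L) * (\<Prod>(a, b)\<in>off_pairs n i. L)"
    proof -
      have p1: "norm (pt (t i) * of_real (t i - z p)) \<le> B" using B(2)[OF r[OF i]] .
      have p2: "(\<Prod>k\<in>?I. norm (pt (t k)) * norm (h k (t k))) \<le> (\<Prod>k\<in>?I. C k * wt (t k))"
      proof (rule prod_mono)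
        fix k assume k: "k \<in> ?I"
        then have rk: "t k \<in> {z 1..z p}" using r by auto
        have "norm (pt (t k)) * norm (h k (t k)) \<le> norm (pt (t k)) * (C k * pole (t k))"
          using C(2)[OF k rk] by (intro mult_left_mono) auto
        also have "\<dots> = C k * wt (t k)" using rk by (simp add: wt_def norm_pt)
        finally show "0 \<le> norm (pt (t k)) * norm (h k (t k)) \<and> norm (pt (t k)) * norm (h k (t k)) \<le> C k * wt (t k)" by simp
      qed
      have p3: "(\<Prod>k\<in>?I-{j}. norm (cpw (t i - t k) (2 * \<gamma>))) \<le> (\<Prod>k\<in>?I-{j}. L)"
        unfolding L_def using r i by (intro prod_mono conjI norm_cpw_bound) auto
      have p4: "(\<Prod>(a, b)\<in>off_pairs n i. norm (cpw (t b - t a) (2 * \<gamma>))) \<le> (\<Prod>(a, b)\<in>off_pairs n i. L)"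
      proof (rule prod_mono)
        fix x assume "x \<in> off_pairs n i"
        then have "fst x \<in> {1..n}" "snd x \<in> {1..n}" by (auto simp: off_pairs_def)
        then show "0 \<le> (case x of (a, b) \<Rightarrow> norm (cpw (t b - t a) (2 * \<gamma>))) \<and>
            (case x of (a, b) \<Rightarrow> norm (cpw (t b - t a) (2 * \<gamma>))) \<le> (case x of (a, b) \<Rightarrow> L)"
          unfolding L_def case_prod_beta using r by (intro conjI norm_cpw_bound) auto
      qed
      have q: "0 \<le> (\<Prod>k\<in>?I. C k * wt (t k))" using C(1) wt_nonneg by (intro prod_nonneg ballI mult_nonneg_nonneg) auto
      have q': "0 \<le> (\<Prod>k\<in>?I-{j}. L)" using L by (intro prod_nonneg) auto
      have q'': "0 \<le> (\<Prod>(a, b)\<in>off_pairs n i. norm (cpw (t b - t a) (2 * \<gamma>)))" by (intro prod_nonneg) auto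
      show ?thesis
        by (intro mult_mono p1 p2 p3 p4 order_refl mult_nonneg_nonneg q q' q'' en B(1) prod_nonneg norm_ge_zero) auto
    qed
    also have "\<dots> = g t * e (t i) (t j)" by (simp add: g_def D_def mult_ac)
    finally show ?thesis .
  qed (use gn in \<open>auto simp: indU_def e_def intro!: mult_nonneg_nonneg\<close>)
  define S where "S = 2 * ((z p - z 1) powr (2 * Re \<gamma>) / (2 * Re \<gamma>))"
  have "(\<integral>\<^sup>+t. ennreal (norm (?f t)) \<partial>Rn n) = (\<integral>\<^sup>+x. \<integral>\<^sup>+y. ennreal (norm (?f (x(i := y)))) \<partial>lborel \<partial>PiM ?I (\<lambda>_. lborel))"
  proof (rule lb.product_nn_integral_insert[of ?I i "\<lambda>t. ennreal (norm (?f t))", unfolded ins])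
    show "(\<lambda>t. ennreal (norm (?f t))) \<in> borel_measurable (Rn n)"
      by (rule measurable_compose[OF measurable_compose[OF fm borel_measurable_norm] measurable_ennreal])
  qed auto
  also have "\<dots> \<le> (\<integral>\<^sup>+x. ennreal (g x) * ennreal S \<partial>PiM ?I (\<lambda>_. lborel))"
  proof (rule nn_integral_mono)
    fix x
    have gx: "g (x(i := y)) = g x" for y unfolding g_def by (intro arg_cong2[of _ _ _ _ "(*)"] refl prod.cong) auto
    have "(\<integral>\<^sup>+y. ennreal (norm (?f (x(i := y)))) \<partial>lborel) \<le> (\<integral>\<^sup>+y. ennreal (g x) * ennreal (e y (x j)) \<partial>lborel)"
      using bound[of "x(i := _)"] j gn[of x] by (intro nn_integral_mono) (auto simp: gx e_def simp flip: ennreal_mult intro!: ennreal_leI)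
    also have "\<dots> = ennreal (g x) * (\<integral>\<^sup>+y. ennreal (e y (x j)) \<partial>lborel)" unfolding e_def by (intro nn_integral_cmult) simp
    also have "\<dots> \<le> ennreal (g x) * ennreal S"
    proof (cases "x j \<in> {z 1..z p}")
      case True
      then show ?thesis unfolding S_def e_def using nn_integral_powr_shift[of "2 * Re \<gamma>" "x j" "z 1" "z p"] Gpos
        by (intro mult_left_mono) auto
    next
      case False
      then have "(\<Prod>k\<in>?I. C k * wt (x k)) = 0" using j by (intro prod_zero) (auto simp: wt_def intro!: bexI[of _ j])
      then have "g x = 0" unfolding g_def by (simp only: mult_zero_right)
      then show ?thesis by simp
    qed
    finally show "(\<integral>\<^sup>+y. ennreal (norm (?f (x(i := y)))) \<partial>lborel) \<le> ennreal (g x) * ennreal S" .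
  qed
  also have "\<dots> < \<infinity>"
  proof -
    have "integrable (PiM ?I (\<lambda>_. lborel)) g" unfolding g_def
      by (intro integrable_mult_right lb.product_integrable_prod integrable_wt) auto
    then have "integrable (PiM ?I (\<lambda>_. lborel)) (\<lambda>x. g x * S)" by (rule integrable_mult_left)
    then have "(\<integral>\<^sup>+x. ennreal (norm (g x * S)) \<partial>PiM ?I (\<lambda>_. lborel)) < \<infinity>"
      unfolding integrable_iff_bounded by (rule conjunct2)
    moreover have "S \<ge> 0" using Gpos by (simp add: S_def)
    ultimately show ?thesis using gn by (simp add: ennreal_mult)
  qed
  finally show "(\<integral>\<^sup>+t. ennreal (norm (?f t)) \<partial>Rn n) < \<infinity>" .
qed

lemma inU_bounds: "inU l t \<Longrightarrow> i \<in> {1..n} \<Longrightarrow> z (site l i) \<le> t i \<and> t i \<le> z (site l i + 1)"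
  by (simp only: inU_def)

lemma inU_sorted: "inU l t \<Longrightarrow> i \<in> {1..n} \<Longrightarrow> j \<in> {1..n} \<Longrightarrow> i < j \<Longrightarrow> t i \<le> t j"
  by (simp only: inU_def)

section \<open>Integration by parts\<close>

text \<open>With all other variables fixed, t_i ranges over an interval whose ends are among the z_s
  and the other t_j. The bracket is the logarithmic derivative of (t_i - z_p) \<open>Psi\<close>
  times (t_i - z_p), so the section is a total derivative of a function that vanishes at both ends.
  The two integrability lemmas justify Fubini.\<close>

lemma ibp:
  assumes l: "l \<in> Zset n (p - 1)" and i: "i \<in> {1..n}"
    and h: "\<And>k. k \<in> {1..n} - {i} \<Longrightarrow> admissible (h k)"
  shows "(\<integral>t. indU l t *\<^sub>R (Psi n p z \<alpha> \<gamma> t * (\<Prod>k\<in>{1..n}-{i}. h k (t k))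
      * (kap (t i) + 2 * \<gamma> * (\<Sum>j\<in>{1..n}-{i}. of_real (t i - z p) / of_real (t i - t j)))) \<partial>Rn n) = 0"
    (is "(\<integral>t. ?f t \<partial>Rn n) = 0")
proof -
  let ?I = "{1..n} - {i}"
  have ins: "insert i ?I = {1..n}" using i by auto
  have "integrable (Rn n) (\<lambda>t. indU l t *\<^sub>R (Psi n p z \<alpha> \<gamma> t * (\<Prod>k=1..n. (h(i := kap)) k (t k)))
     + (\<Sum>j\<in>?I. (2 * \<gamma>) * indU l t *\<^sub>R (Psi n p z \<alpha> \<gamma> t * (\<Prod>k\<in>{1..n}-{i}. h k (t k)) * (of_real (t i - z p) / of_real (t i - t j)))))"
    by (intro Bochner_Integration.integrable_add Bochner_Integration.integrable_sum integrable_mult_right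
        integrable_Psi[OF l] integrable_Psi_pole[OF l i]) (auto simp: admissible_kap h)
  moreover have "(\<Prod>k=1..n. (h(i := kap)) k (t k)) = kap (t i) * (\<Prod>k\<in>?I. h k (t k))" for t
  proof -
    have "(\<Prod>k=1..n. (h(i := kap)) k (t k)) = (h(i := kap)) i (t i) * (\<Prod>k\<in>?I. (h(i := kap)) k (t k))"
      using i by (intro prod.remove) auto
    also have "(\<Prod>k\<in>?I. (h(i := kap)) k (t k)) = (\<Prod>k\<in>?I. h k (t k))" by (intro prod.cong refl) auto
    finally show ?thesis by simp
  qed
  ultimately have fint: "integrable (Rn n) ?f"
    by (simp add: algebra_simps sum_distrib_left scaleR_sum_right del: of_real_diff)
  have "(\<integral>t. ?f t \<partial>Rn n) = (\<integral>x. (\<integral>y. ?f (x(i := y)) \<partial>lborel) \<partial>PiM ?I (\<lambda>_. lborel))"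
    by (rule lb.product_integral_insert[of ?I i ?f, unfolded ins]) (use fint in auto)
  also have "\<dots> = (\<integral>x. 0 \<partial>PiM ?I (\<lambda>_. lborel :: real measure))"
  proof (rule Bochner_Integration.integral_cong[OF refl])
    fix x :: "nat \<Rightarrow> real"
    show "(\<integral>y. ?f (x(i := y)) \<partial>lborel) = 0"
    proof (cases "\<exists>y. inU l (x(i := y))")
      case False
      then show ?thesis by (simp add: indU_def)
    next
      case True
      \<comment> \<open>\<open>y0\<close> supplies those inequalities of the domain that do not
        involve variable \<open>i\<close>.\<close>
      then obtain y0 where y0: "inU l (x(i := y0))" by blast
      \<comment> \<open>Both kinds of endpoints go on one list: \<open>Inl s\<close> for z_s and
        \<open>Inr j\<close> for another variable. The exponent at \<open>p\<close> is raised by 1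
        for the factor (t_i - z_p). Below, \<open>L\<close> and \<open>R\<close> collect the points
        to the left and to the right of t_i.\<close>
      define c :: "nat + nat \<Rightarrow> real" where "c = case_sum z x"
      define \<beta> :: "nat + nat \<Rightarrow> complex" where "\<beta> = case_sum (\<lambda>s. if s = p then \<alpha> p + 1 else \<alpha> s) (\<lambda>_. 2 * \<gamma>)"
      let ?s = "site l i"
      define L :: "(nat + nat) set" where "L = Inl ` {1..?s} \<union> Inr ` {j\<in>?I. j < i}"
      define R :: "(nat + nat) set" where "R = Inl ` {?s+1..p} \<union> Inr ` {j\<in>?I. i < j}"
      have s: "?s \<in> {1..p-1}" by (rule site_range[OF l i])
      have LR1: "{1..?s} \<union> {?s+1..p} = {1..p}" using s by auto
      have LR2: "{j\<in>?I. j < i} \<union> {j\<in>?I. i < j} = ?I" by auto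
      have "L \<union> R = Inl ` ({1..?s} \<union> {?s+1..p}) \<union> Inr ` ({j\<in>?I. j < i} \<union> {j\<in>?I. i < j})"
        unfolding L_def R_def image_Un by (simp only: Un_ac)
      then have LR: "L \<union> R = Inl ` {1..p} \<union> Inr ` ?I" unfolding LR1 LR2 .
      have sect: "inU l (x(i := y)) \<longleftrightarrow> (\<forall>k\<in>L. c k \<le> y) \<and> (\<forall>k\<in>R. y \<le> c k)" for y
      proof
        assume u: "inU l (x(i := y))"
        have z1: "z ?s \<le> y" "y \<le> z (?s + 1)" using inU_bounds[OF u i] by auto
        have "z r \<le> y" if "r \<in> {1..?s}" for r
          using z_le[of r ?s] that s z1 by (intro order_trans[OF _ z1(1)] z_le) auto
        moreover have "y \<le> z r" if "r \<in> {?s+1..p}" for r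
          using that s by (intro order_trans[OF z1(2)] z_le) auto
        moreover have "x j \<le> y" if "j \<in> ?I" "j < i" for j using inU_sorted[OF u _ i that(2)] that by auto
        moreover have "y \<le> x j" if "j \<in> ?I" "i < j" for j using inU_sorted[OF u i _ that(2)] that by auto
        ultimately show "(\<forall>k\<in>L. c k \<le> y) \<and> (\<forall>k\<in>R. y \<le> c k)" by (auto simp: L_def R_def c_def)
      next
        assume a: "(\<forall>k\<in>L. c k \<le> y) \<and> (\<forall>k\<in>R. y \<le> c k)"
        have z1: "z ?s \<le> y" "y \<le> z (?s + 1)"
        proof -
          have "Inl ?s \<in> L" "Inl (?s + 1) \<in> R" using s by (auto simp: L_def R_def)
          then have "c (Inl ?s) \<le> y" "y \<le> c (Inl (?s + 1))" using a by auto
          then show "z ?s \<le> y" "y \<le> z (?s + 1)" by (simp_all add: c_def)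
        qed
        have x1: "x j \<le> y" if "j \<in> ?I" "j < i" for j
        proof -
          have "Inr j \<in> L" unfolding L_def using that by (intro UnI2 imageI) simp
          then have "c (Inr j) \<le> y" using a by simp
          then show ?thesis by (simp add: c_def)
        qed
        have x2: "y \<le> x j" if "j \<in> ?I" "i < j" for j
        proof -
          have "Inr j \<in> R" unfolding R_def using that by (intro UnI2 imageI) simp
          then have "y \<le> c (Inr j)" using a by simp
          then show ?thesis by (simp add: c_def)
        qed
        show "inU l (x(i := y))" unfolding inU_def
        proof (intro conjI ballI impI)
          fix k assume k: "k \<in> {1..n}"
          show "z (site l k) \<le> (x(i := y)) k" "(x(i := y)) k \<le> z (site l k + 1)"
            using inU_bounds[OF y0 k] z1 by (cases "k = i"; simp)+
        next
          fix k j assume kj: "k \<in> {1..n}" "j \<in> {1..n}" "k < j"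
          have "(x(i := y0)) k \<le> (x(i := y0)) j" using inU_sorted[OF y0 kj] .
          then show "(x(i := y)) k \<le> (x(i := y)) j" using kj x1[of k] x2[of j] by (cases "k = i"; cases "j = i") auto
        qed
      qed
      define Q where "Q = (\<Prod>k\<in>?I. pt (x k) * h k (x k)) * (\<Prod>(a, b)\<in>off_pairs n i. cpw (x b - x a) (2 * \<gamma>))"
      define F where "F y = (\<Prod>k\<in>L\<union>R. cpw (y - c k) (\<beta> k)) * (\<Sum>k\<in>L\<union>R. \<beta> k / of_real (y - c k))" for y
      define Sec where "Sec = {y. (\<forall>k\<in>L. c k \<le> y) \<and> (\<forall>k\<in>R. y \<le> c k)}"
      have sec: "y \<in> Sec \<longleftrightarrow> inU l (x(i := y))" for y unfolding Sec_def mem_Collect_eq by (rule sect[symmetric])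
      have fe: "?f (x(i := y)) = - Q * (indicator Sec y *\<^sub>R F y)" for y
      proof (cases "inU l (x(i := y))")
        case False
        then have "indU l (x(i := y)) = 0" "indicator Sec y = (0::real)" using sec[of y] by (simp_all add: indU_def)
        then show ?thesis by (simp only: scaleR_zero_left mult_zero_right)
      next
        case True
        have yp: "y \<le> z p" using inU_range(2)[OF l True i] by simp
        let ?t = "x(i := y)"
        have e1: "(\<Prod>k\<in>?I. g k (?t k)) = (\<Prod>k\<in>?I. g k (x k))" for g :: "nat \<Rightarrow> real \<Rightarrow> complex" by (intro prod.cong refl) auto
        have e2: "(\<Prod>(a, b)\<in>off_pairs n i. cpw (?t b - ?t a) (2 * \<gamma>)) = (\<Prod>(a, b)\<in>off_pairs n i. cpw (x b - x a) (2 * \<gamma>))"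
          by (intro prod.cong refl) (auto simp: off_pairs_def)
        have e3: "(\<Prod>j\<in>?I. cpw (?t i - ?t j) (2 * \<gamma>)) = (\<Prod>j\<in>?I. cpw (y - x j) (2 * \<gamma>))" by (intro prod.cong refl) auto
        have Psi: "Psi n p z \<alpha> \<gamma> ?t * (\<Prod>k\<in>?I. h k (?t k)) = pt y * (\<Prod>j\<in>?I. cpw (y - x j) (2 * \<gamma>)) * Q"
        proof -
          have "(\<Prod>k=1..n. pt (?t k)) = pt y * (\<Prod>k\<in>?I. pt (x k))"
          proof -
            have "(\<Prod>k=1..n. pt (?t k)) = pt (?t i) * (\<Prod>k\<in>?I. pt (?t k))" using i by (intro prod.remove) auto
            then show ?thesis unfolding e1[of "\<lambda>_. pt"] by simp
          qed
          then show ?thesis unfolding Psi_def pt_def[symmetric] vdm_split[OF i] e1[of h] e2 e3 Q_def prod.distrib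
            by (simp add: mult_ac)
        qed
        have disj: "Inl ` {1..p} \<inter> Inr ` ?I = {}" by auto
        have prodLR: "(\<Prod>k\<in>L\<union>R. cpw (y - c k) (\<beta> k)) = pt y * of_real (z p - y) * (\<Prod>j\<in>?I. cpw (y - x j) (2 * \<gamma>))"
        proof -
          have "(\<Prod>k\<in>L\<union>R. cpw (y - c k) (\<beta> k)) = (\<Prod>k\<in>Inl ` {1..p}. cpw (y - c k) (\<beta> k)) * (\<Prod>k\<in>Inr ` ?I. cpw (y - c k) (\<beta> k))"
            unfolding LR by (rule prod.union_disjoint) auto
          also have "(\<Prod>k\<in>Inl ` {1..p}. cpw (y - c k) (\<beta> k)) = (\<Prod>s=1..p. cpw (y - z s) (if s = p then \<alpha> p + 1 else \<alpha> s))"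
            by (subst prod.reindex) (auto simp: c_def \<beta>_def)
          also have "\<dots> = cpw (y - z p) (\<alpha> p + 1) * (\<Prod>s\<in>{1..p}-{p}. cpw (y - z s) (\<alpha> s))"
          proof -
            have "(\<Prod>s=1..p. cpw (y - z s) (if s = p then \<alpha> p + 1 else \<alpha> s))
               = cpw (y - z p) (if p = p then \<alpha> p + 1 else \<alpha> p) * (\<Prod>s\<in>{1..p}-{p}. cpw (y - z s) (if s = p then \<alpha> p + 1 else \<alpha> s))"
              using p2 by (intro prod.remove) auto
            also have "(\<Prod>s\<in>{1..p}-{p}. cpw (y - z s) (if s = p then \<alpha> p + 1 else \<alpha> s)) = (\<Prod>s\<in>{1..p}-{p}. cpw (y - z s) (\<alpha> s))"
              by (intro prod.cong refl) auto
            finally show ?thesis by simp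
          qed
          also have "cpw (y - z p) (\<alpha> p + 1) = cpw (y - z p) (\<alpha> p) * of_real (z p - y)"
            using cpw_add_of_nat[of "y - z p" "\<alpha> p" 1] yp by (simp add: abs_if)
          also have "cpw (y - z p) (\<alpha> p) * of_real (z p - y) * (\<Prod>s\<in>{1..p}-{p}. cpw (y - z s) (\<alpha> s)) = pt y * of_real (z p - y)"
          proof -
            have "pt y = cpw (y - z p) (\<alpha> p) * (\<Prod>s\<in>{1..p}-{p}. cpw (y - z s) (\<alpha> s))"
              unfolding pt_def using p2 by (intro prod.remove) auto
            then show ?thesis by (simp only: mult_ac)
          qed
          also have "(\<Prod>k\<in>Inr ` ?I. cpw (y - c k) (\<beta> k)) = (\<Prod>j\<in>?I. cpw (y - x j) (2 * \<gamma>))"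
            by (subst prod.reindex) (auto simp: c_def \<beta>_def)
          finally show ?thesis .
        qed
        have sumLR: "(\<Sum>k\<in>L\<union>R. \<beta> k / of_real (y - c k)) = 1 / of_real (y - z p) + (\<Sum>s=1..p. \<alpha> s / of_real (y - z s)) + (\<Sum>j\<in>?I. 2 * \<gamma> / of_real (y - x j))"
        proof -
          have "(\<Sum>k\<in>L\<union>R. \<beta> k / of_real (y - c k)) = (\<Sum>k\<in>Inl ` {1..p}. \<beta> k / of_real (y - c k)) + (\<Sum>k\<in>Inr ` ?I. \<beta> k / of_real (y - c k))"
            unfolding LR by (rule sum.union_disjoint) auto
          also have "(\<Sum>k\<in>Inl ` {1..p}. \<beta> k / of_real (y - c k)) = (\<Sum>s=1..p. (if s = p then \<alpha> p + 1 else \<alpha> s) / of_real (y - z s))"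
            by (subst sum.reindex) (auto simp: c_def \<beta>_def)
          also have "\<dots> = (\<Sum>s=1..p. \<alpha> s / of_real (y - z s) + (if s = p then 1 / of_real (y - z p) else 0))"
            by (intro sum.cong refl) (auto simp: add_divide_distrib)
          also have "\<dots> = (\<Sum>s=1..p. \<alpha> s / of_real (y - z s)) + 1 / of_real (y - z p)"
            using p2 by (simp add: sum.distrib)
          also have "(\<Sum>k\<in>Inr ` ?I. \<beta> k / of_real (y - c k)) = (\<Sum>j\<in>?I. 2 * \<gamma> / of_real (y - x j))"
            by (subst sum.reindex) (auto simp: c_def \<beta>_def)
          finally show ?thesis by simp
        qed
        \<comment> \<open>The sign arises because the raised power contributes |y - z_p| = z_p - y.
          At y = z_p the divisions by zero are harmless since \<open>pt y\<close> is 0.\<close>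
        have key: "pt y * (kap y + 2 * \<gamma> * (\<Sum>j\<in>?I. of_real (y - z p) / of_real (y - x j)))
           = - (pt y * of_real (z p - y) * (1 / of_real (y - z p) + (\<Sum>s=1..p. \<alpha> s / of_real (y - z s)) + (\<Sum>j\<in>?I. 2 * \<gamma> / of_real (y - x j))))"
        proof (cases "y = z p")
          case True
          then have "pt y = 0" unfolding pt_def using p2 by (intro prod_zero) auto
          then show ?thesis by simp
        next
          case False
          define w :: complex where "w = of_real (y - z p)"
          have w: "w \<noteq> 0" using False by (simp add: w_def)
          have w': "of_real (z p - y) = - w" by (simp add: w_def)
          have "kap y = w * (1 / w + (\<Sum>s=1..p. \<alpha> s / of_real (y - z s)))"
            unfolding kap_def w_def[symmetric] using w by (simp add: distrib_left sum_distrib_left mult_ac del: of_real_diff)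
          moreover have "2 * \<gamma> * (\<Sum>j\<in>?I. w / of_real (y - x j)) = w * (\<Sum>j\<in>?I. 2 * \<gamma> / of_real (y - x j))"
            by (simp add: sum_distrib_left mult_ac del: of_real_diff)
          ultimately show ?thesis unfolding w' w_def[symmetric] by (simp add: algebra_simps)
        qed
        have e4: "(\<Sum>j\<in>?I. of_real (?t i - z p) / of_real (?t i - ?t j)) = (\<Sum>j\<in>?I. of_real (y - z p) / (of_real (y - x j) :: complex))"
          by (intro sum.cong refl) auto
        have gen: "- (a * b * c') * d * q = - q * (a * b * d * c')" for a b c' d q :: complex by simp
        have "?f ?t = pt y * (kap y + 2 * \<gamma> * (\<Sum>j\<in>?I. of_real (y - z p) / of_real (y - x j))) * (\<Prod>j\<in>?I. cpw (y - x j) (2 * \<gamma>)) * Q"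
          using True unfolding Psi e4 indU_def by (simp add: mult_ac del: of_real_diff)
        also have "\<dots> = - Q * F y" unfolding key F_def prodLR sumLR by (rule gen)
        also have "F y = indicator Sec y *\<^sub>R F y" using True sec[of y] by simp
        finally show ?thesis .
      qed
      have "(\<integral>y. ?f (x(i := y)) \<partial>lborel) = - Q * (\<integral>y. indicator Sec y *\<^sub>R F y \<partial>lborel)"
        unfolding fe by (rule integral_mult_right_zero)
      also have "(\<integral>y. indicator Sec y *\<^sub>R F y \<partial>lborel) = 0"
        unfolding F_def Sec_def
      proof (rule integral_log_derivative_zero)
        show "finite L" "finite R" by (auto simp: L_def R_def)
        show "L \<noteq> {}" "R \<noteq> {}" using s p2 by (auto simp: L_def R_def)
        fix k assume "k \<in> L \<union> R"
        then show "Re (\<beta> k) > 0" unfolding LR \<beta>_def using Apos Ap Gpos by (auto simp: order_le_less)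
      qed
      finally show ?thesis by (simp only: mult_zero_right)
    qed
  qed
  finally show ?thesis by simp
qed

end

section \<open>Symmetrised products and the letters as functions\<close>

definition Symf :: "nat \<Rightarrow> (nat \<Rightarrow> real \<Rightarrow> complex) \<Rightarrow> (nat \<Rightarrow> real) \<Rightarrow> complex" where
  "Symf n h t = (\<Sum>\<sigma> | \<sigma> permutes {1..n}. \<Prod>j=1..n. h j (t (\<sigma> j)))"

text \<open>The symmetrised product depends only on the multiset of its factors, which is why words
  may be treated as multisets.\<close>

lemma Symf_permute:
  assumes \<pi>: "\<pi> permutes {1..n}" and eq: "\<And>j. j \<in> {1..n} \<Longrightarrow> h j = h' (\<pi> j)"
  shows "Symf n h t = Symf n h' t"
proof -
  have "Symf n h' t = (\<Sum>\<sigma> | \<sigma> permutes {1..n}. \<Prod>j=1..n. h' j (t ((\<sigma> \<circ> inv \<pi>) j)))"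
    unfolding Symf_def by (rule sum_permutations_compose_right[OF permutes_inv[OF \<pi>]])
  also have "\<dots> = (\<Sum>\<sigma> | \<sigma> permutes {1..n}. \<Prod>j=1..n. h j (t (\<sigma> j)))"
  proof (rule sum.cong[OF refl])
    fix \<sigma>
    have "(\<Prod>j=1..n. h' j (t ((\<sigma> \<circ> inv \<pi>) j))) = (\<Prod>j=1..n. h' (\<pi> j) (t ((\<sigma> \<circ> inv \<pi>) (\<pi> j))))"
      using prod.permute[OF \<pi>, of "\<lambda>j. h' j (t ((\<sigma> \<circ> inv \<pi>) j))"] by (simp add: o_def)
    also have "\<dots> = (\<Prod>j=1..n. h j (t (\<sigma> j)))"
      using permutes_inverses[OF \<pi>] by (intro prod.cong refl) (simp add: eq)
    finally show "(\<Prod>j=1..n. h' j (t ((\<sigma> \<circ> inv \<pi>) j))) = (\<Prod>j=1..n. h j (t (\<sigma> j)))" .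
  qed
  finally show ?thesis by (simp add: Symf_def)
qed

lemma ex_word:
  assumes "finite A" "card A = size N"
  shows "\<exists>w. image_mset w (mset_set A) = N"
  using assms
proof (induction A arbitrary: N rule: finite_induct)
  case (insert a A)
  then obtain b N' where N: "N = add_mset b N'" by (cases N) auto
  then obtain w where w: "image_mset w (mset_set A) = N'" using insert by auto
  have "image_mset (w(a := b)) (mset_set A) = N'"
    unfolding w[symmetric] using insert.hyps by (intro image_mset_cong) auto
  then show ?case
    by (intro exI[of _ "w(a := b)"]) (simp only: mset_set.insert[OF insert.hyps] image_mset_add_mset N fun_upd_same)
qed auto

lemma image_mset_upd_first:
  fixes n :: nat
  assumes "image_mset w (mset_set {2..n}) = N" "n \<ge> 1"
  shows "image_mset (w(1 := a)) (mset_set {1..n}) = add_mset a N"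
proof -
  have "{1..n} = insert 1 {2..n}" using assms(2) by auto
  moreover have "image_mset (w(1 := a)) (mset_set {2..n}) = N"
    unfolding assms(1)[symmetric] by (intro image_mset_cong) auto
  ultimately show ?thesis by (simp del: fun_upd_apply) simp
qed

lemma image_mset_upd_two:
  fixes n :: nat
  assumes w: "image_mset w (mset_set {2..n}) = N" and r: "r \<in> {2..n}"
  shows "image_mset (w(1 := a, r := b)) (mset_set {1..n}) = add_mset a (add_mset b (N - {#w r#}))"
proof -
  have "{2..n} = insert r ({2..n} - {r})" using r by auto
  then have m: "mset_set {2..n} = add_mset r (mset_set ({2..n} - {r}))"
    by (metis finite_Diff finite_atLeastAtMost insert_Diff_single mset_set.insert Diff_iff singletonI)
  have "image_mset w (mset_set ({2..n} - {r})) = N - {#w r#}" using w unfolding m by auto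
  then have "image_mset (w(r := b)) (mset_set {2..n}) = add_mset b (N - {#w r#})"
    unfolding m by (simp, metis (no_types, lifting) Diff_iff elem_mset_set finite_Diff finite_atLeastAtMost fun_upd_apply image_mset_cong singletonI)
  from image_mset_upd_first[OF this, of a] show ?thesis
    using r by (subst fun_upd_twist) auto
qed

context conf
begin

primrec ev :: "letter \<Rightarrow> real \<Rightarrow> complex" where
  "ev LT = (\<lambda>t. 1)"
| "ev (LF s) = (\<lambda>t. 1 / of_real (t - z s))"
| "ev (LG s) = (\<lambda>t. of_real (z p - z s) / of_real (t - z s))"
| "ev (LH s) = (\<lambda>t. of_real (z p - t) / of_real (t - z s))"
| "ev (LU s) = (\<lambda>t. of_real (z p - z s) / of_real (t - z s) - of_real (z p - z 1) / of_real (t - z 1))"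

lemma admissible_ev: "w \<in> letters (p - 1) \<Longrightarrow> admissible (ev w)"
proof -
  have G: "admissible (\<lambda>t. of_real (z p - z s) / of_real (t - z s))" if "s \<in> {1..<p}" for s
    using admissible_cmult[OF admissible_inverse[OF that], of "of_real (z p - z s)"] by simp
  have H: "admissible (\<lambda>t. of_real (z p - t) / of_real (t - z s))" if "s \<in> {1..<p}" for s
  proof -
    have "norm (of_real (z p - t) :: complex) \<le> z p - z 1" if "t \<in> {z 1..z p}" for t
      unfolding norm_of_real using that by auto
    from admissible_mult[OF admissible_inverse[OF that] _ this] show ?thesis by simp
  qed
  have U: "admissible (\<lambda>t. of_real (z p - z s) / of_real (t - z s) - of_real (z p - z 1) / of_real (t - z 1))" if "s \<in> {1..<p}" for s
  proof -
    have "1 \<in> {1..<p}" using p2 by simp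
    from admissible_add[OF G[OF that] admissible_cmult[OF G[OF this], of "-1"]] show ?thesis
      by (simp only: mult_minus1 add_uminus_conv_diff)
  qed
  assume "w \<in> letters (p - 1)"
  then show ?thesis
    unfolding letters_def using G H U admissible_inverse admissible_const[of 1] p2 by auto
qed

definition Vint :: "(nat \<Rightarrow> nat) \<Rightarrow> (nat \<Rightarrow> real \<Rightarrow> complex) \<Rightarrow> complex" where
  "Vint l h = (\<integral>t. indU l t *\<^sub>R (Psi n p z \<alpha> \<gamma> t * Symf n h t) \<partial>Rn n)"

text \<open>Some spelling of the multiset as a word is chosen; by \<open>Vm_word\<close> the choice
  does not matter. The value 0 off \<open>Zset\<close> makes the relations of \<open>sym_rec\<close>
  hold for every row index.\<close>

definition Vm :: "letter multiset \<Rightarrow> (nat \<Rightarrow> nat) \<Rightarrow> complex" where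
  "Vm M l = (if l \<in> Zset n (p - 1) then Vint l (\<lambda>j. ev ((SOME w. image_mset w (mset_set {1..n}) = M) j)) else 0)"

lemma Vm_word:
  assumes "l \<in> Zset n (p - 1)"
  shows "Vm (image_mset w (mset_set {1..n})) l = Vint l (\<lambda>j. ev (w j))"
proof -
  define w' where "w' = (SOME w'. image_mset w' (mset_set {1..n}) = image_mset w (mset_set {1..n}))"
  have "image_mset w' (mset_set {1..n}) = image_mset w (mset_set {1..n})"
    unfolding w'_def by (rule someI[of _ w]) simp
  then obtain \<pi> where \<pi>: "\<pi> permutes {1..n}" "\<forall>j\<in>{1..n}. w' j = w (\<pi> j)"
    using image_mset_eq_implies_permutes[of "{1..n}" w' w] by auto
  have "Symf n (\<lambda>j. ev (w' j)) t = Symf n (\<lambda>j. ev (w j)) t" for t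
    using \<pi> by (intro Symf_permute[OF \<pi>(1)]) auto
  then show ?thesis unfolding Vm_def w'_def[symmetric] if_P[OF assms] Vint_def by (simp only:)
qed

lemma prod_perm_reindex:
  assumes "\<sigma> permutes {1..n}"
  shows "(\<Prod>j=1..n. h j (t (\<sigma> j))) = (\<Prod>i=1..n. h (inv \<sigma> i) (t i))"
  using prod.permute[OF assms, of "\<lambda>i. h (inv \<sigma> i) (t i)"] permutes_inverses[OF assms] by (simp add: o_def)

lemma integrable_term:
  assumes l: "l \<in> Zset n (p - 1)" and h: "\<And>j. j \<in> {1..n} \<Longrightarrow> admissible (h j)" and \<sigma>: "\<sigma> permutes {1..n}"
  shows "integrable (Rn n) (\<lambda>t. indU l t *\<^sub>R (Psi n p z \<alpha> \<gamma> t * (\<Prod>j=1..n. h j (t (\<sigma> j)))))"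
  unfolding prod_perm_reindex[OF \<sigma>]
  using permutes_in_image[OF permutes_inv[OF \<sigma>]] by (intro integrable_Psi[OF l] h) auto

lemma integrable_Vint:
  assumes l: "l \<in> Zset n (p - 1)" and h: "\<And>j. j \<in> {1..n} \<Longrightarrow> admissible (h j)"
  shows "integrable (Rn n) (\<lambda>t. indU l t *\<^sub>R (Psi n p z \<alpha> \<gamma> t * Symf n h t))"
  unfolding Symf_def sum_distrib_left scaleR_sum_right
  using integrable_term[OF l h] by (intro Bochner_Integration.integrable_sum) auto

lemma Psi_nz:
  assumes "Psi n p z \<alpha> \<gamma> t \<noteq> 0"
  shows "i \<in> {1..n} \<Longrightarrow> s \<in> {1..p} \<Longrightarrow> t i \<noteq> z s" "i \<in> {1..n} \<Longrightarrow> j \<in> {1..n} \<Longrightarrow> i \<noteq> j \<Longrightarrow> t i \<noteq> t j"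
proof -
  assume i: "i \<in> {1..n}" and s: "s \<in> {1..p}"
  then show "t i \<noteq> z s" using assms unfolding Psi_def by auto
next
  assume i: "i \<in> {1..n}" and j: "j \<in> {1..n}" "i \<noteq> j"
  have "cpw (t i - t j) (2 * \<gamma>) \<noteq> 0" using assms j unfolding Psi_def vdm_split[OF i] by auto
  then show "t i \<noteq> t j" by auto
qed

lemma prod_first:
  fixes h :: "nat \<Rightarrow> real \<Rightarrow> complex"
  assumes "n \<ge> 1"
  shows "(\<Prod>j=1..n. (h(1 := f)) j (t (\<sigma> j))) = f (t (\<sigma> 1)) * (\<Prod>j=2..n. h j (t (\<sigma> j)))"
proof -
  have "{1..n} = insert 1 {2..n}" using assms by auto
  then have "(\<Prod>j=1..n. (h(1 := f)) j (t (\<sigma> j))) = f (t (\<sigma> 1)) * (\<Prod>j=2..n. (h(1 := f)) j (t (\<sigma> j)))" by simp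
  also have "(\<Prod>j=2..n. (h(1 := f)) j (t (\<sigma> j))) = (\<Prod>j=2..n. h j (t (\<sigma> j)))" by (intro prod.cong refl) auto
  finally show ?thesis .
qed

text \<open>It is enough to know the relation away from the points z_s, because \<open>Psi\<close>
  vanishes when a variable hits one of them. After symmetrisation slot 1 stands for an arbitrary
  letter of the word.\<close>

lemma Vint_comb:
  assumes l: "l \<in> Zset n (p - 1)" and n: "n \<ge> 1" and h: "\<And>j. j \<in> {2..n} \<Longrightarrow> admissible (h j)"
    and g: "\<And>i. i \<in> I \<Longrightarrow> admissible (g i)"
    and eq: "\<And>t. (\<forall>s\<in>{1..p}. t \<noteq> z s) \<Longrightarrow> f t = (\<Sum>i\<in>I. c i * g i t)"
  shows "Vint l (h(1 := f)) = (\<Sum>i\<in>I. c i * Vint l (h(1 := g i)))"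
proof -
  have "Psi n p z \<alpha> \<gamma> t * Symf n (h(1 := f)) t = (\<Sum>i\<in>I. c i * (Psi n p z \<alpha> \<gamma> t * Symf n (h(1 := g i)) t))" for t
  proof (cases "Psi n p z \<alpha> \<gamma> t = 0")
    case False
    have "Symf n (h(1 := f)) t = (\<Sum>\<sigma> | \<sigma> permutes {1..n}. \<Sum>i\<in>I. c i * (g i (t (\<sigma> 1)) * (\<Prod>j=2..n. h j (t (\<sigma> j)))))"
      unfolding Symf_def prod_first[OF n]
    proof (rule sum.cong[OF refl])
      fix \<sigma> assume "\<sigma> \<in> {\<sigma>. \<sigma> permutes {1..n}}"
      then have "\<sigma> 1 \<in> {1..n}" using n permutes_in_image[of \<sigma> "{1..n}" 1] by auto
      then have "f (t (\<sigma> 1)) = (\<Sum>i\<in>I. c i * g i (t (\<sigma> 1)))" using Psi_nz(1)[OF False] by (intro eq) auto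
      then show "f (t (\<sigma> 1)) * (\<Prod>j=2..n. h j (t (\<sigma> j))) = (\<Sum>i\<in>I. c i * (g i (t (\<sigma> 1)) * (\<Prod>j=2..n. h j (t (\<sigma> j)))))"
        by (simp add: sum_distrib_right mult.assoc)
    qed
    also have "\<dots> = (\<Sum>i\<in>I. c i * Symf n (h(1 := g i)) t)"
      unfolding Symf_def prod_first[OF n] by (subst sum.swap) (simp add: sum_distrib_left)
    finally show ?thesis by (simp add: sum_distrib_left mult_ac)
  qed simp
  then have "Vint l (h(1 := f)) = (\<integral>t. (\<Sum>i\<in>I. c i * (indU l t *\<^sub>R (Psi n p z \<alpha> \<gamma> t * Symf n (h(1 := g i)) t))) \<partial>Rn n)"
    unfolding Vint_def by (simp add: scaleR_sum_right)
  also have "\<dots> = (\<Sum>i\<in>I. \<integral>t. c i * (indU l t *\<^sub>R (Psi n p z \<alpha> \<gamma> t * Symf n (h(1 := g i)) t)) \<partial>Rn n)"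
    by (intro Bochner_Integration.integral_sum integrable_mult_right integrable_Vint[OF l]) (auto simp: g h)
  finally show ?thesis unfolding Vint_def by (simp only: integral_mult_right_zero)
qed

end

text \<open>Bilinear expansion of the quotient in \<open>pair_identity\<close>: a triple
  \<open>(a, a', c)\<close> stands for c times \<open>a\<close> at u times \<open>a'\<close> at u'.
  Forgetting the order of the two letters gives \<open>pair_term\<close>.\<close>

primrec pair_expansion :: "letter \<Rightarrow> (letter \<times> letter \<times> complex) list" where
  "pair_expansion LT = [(LT, LT, 1)]"
| "pair_expansion (LG s) = [(LT, LG s, 1), (LG s, LT, 1), (LG s, LG s, -1)]"
| "pair_expansion (LU s) = [(LT, LU s, 1), (LU s, LT, 1), (LU s, LU s, -1), (LU s, LG 1, -1), (LG 1, LU s, -1)]"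
| "pair_expansion (LF s) = []"
| "pair_expansion (LH s) = []"

lemma pair_term_expansion:
  "pair_term V N l b = (\<Sum>(a, a', c)\<leftarrow>pair_expansion b. c * V (add_mset a (add_mset a' N)) l)"
  if "b \<in> {LT} \<union> LG ` {1..q} \<union> LU ` {1..q}"
proof -
  have c: "V (add_mset a (add_mset a' N)) l = V (add_mset a' (add_mset a N)) l" for a a'
    by (simp add: add_mset_commute)
  show ?thesis using that
    by (auto simp: c[of "LG _" LT] c[of "LU _" LT] c[of "LU _" "LG _"])
qed

context conf
begin

lemma pair_expansion_letters:
  assumes "b \<in> {LT} \<union> LG ` {1..p-1} \<union> LU ` {1..p-1}" "(a, a', c) \<in> set (pair_expansion b)"
  shows "a \<in> letters (p - 1)" "a' \<in> letters (p - 1)"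
  using assms p2 by (auto simp: letters_def)

lemma pair_identity_G:
  fixes u u' zs zp :: complex
  assumes "u \<noteq> u'" "u \<noteq> zs" "u' \<noteq> zs"
  shows "((u - zp) * ((zp - zs) / (u' - zs)) - (u' - zp) * ((zp - zs) / (u - zs))) / (u - u')
    = (zp - zs) / (u' - zs) + (zp - zs) / (u - zs) - (zp - zs) / (u - zs) * ((zp - zs) / (u' - zs))"
proof -
  have "u - u' \<noteq> 0" "u - zs \<noteq> 0" "u' - zs \<noteq> 0" using assms by auto
  then show ?thesis by (simp add: divide_simps) (simp add: algebra_simps)
qed

text \<open>The numerator is antisymmetric in u and u', so the pole on the diagonal cancels. The
  case \<open>LG\<close> is a direct computation; \<open>LU s\<close> is the difference of the cases
  \<open>s\<close> and 1, with g_s(u) g_s(u') rewritten through g_s = u_s + g_1.\<close>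

lemma pair_identity:
  assumes b: "b \<in> {LT} \<union> LG ` {1..p-1} \<union> LU ` {1..p-1}" and u: "u \<noteq> u'"
    and off: "\<And>s. s \<in> {1..p} \<Longrightarrow> u \<noteq> z s \<and> u' \<noteq> z s"
  shows "(of_real (u - z p) * ev b u' - of_real (u' - z p) * ev b u) / of_real (u - u')
     = (\<Sum>(a, a', c)\<leftarrow>pair_expansion b. c * (ev a u * ev a' u'))"
proof -
  let ?c = "of_real :: real \<Rightarrow> complex"
  have uc: "?c u \<noteq> ?c u'" using u by simp
  have G: "(?c (u - z p) * ev (LG s) u' - ?c (u' - z p) * ev (LG s) u) / ?c (u - u')
      = ev (LG s) u' + ev (LG s) u - ev (LG s) u * ev (LG s) u'" if s: "s \<in> {1..p-1}" for s
  proof -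
    have "s \<in> {1..p}" using s by auto
    then show ?thesis using off[of s] pair_identity_G[OF uc, of "?c (z s)" "?c (z p)"] by simp
  qed
  consider "b = LT" | s where "b = LG s" "s \<in> {1..p-1}" | s where "b = LU s" "s \<in> {1..p-1}" using b by auto
  then show ?thesis
  proof cases
    case 1
    then show ?thesis using u by (simp add: divide_simps)
  next
    case (2 s)
    then show ?thesis using G[of s] by (simp del: ev.simps(3) add: algebra_simps)
  next
    case (3 s)
    have U: "ev (LU s) v = ev (LG s) v - ev (LG 1) v" for v by simp
    have 1: "1 \<in> {1..p-1}" using p2 by auto
    have "(?c (u - z p) * ev (LU s) u' - ?c (u' - z p) * ev (LU s) u) / ?c (u - u')
       = (?c (u - z p) * ev (LG s) u' - ?c (u' - z p) * ev (LG s) u) / ?c (u - u')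
       - (?c (u - z p) * ev (LG 1) u' - ?c (u' - z p) * ev (LG 1) u) / ?c (u - u')"
      unfolding U diff_divide_distrib[symmetric] by (simp only: algebra_simps)
    also have "\<dots> = (ev (LG s) u' + ev (LG s) u - ev (LG s) u * ev (LG s) u') - (ev (LG 1) u' + ev (LG 1) u - ev (LG 1) u * ev (LG 1) u')"
      unfolding G[OF 3(2)] G[OF 1] ..
    also have "\<dots> = (\<Sum>(a, a', c)\<leftarrow>pair_expansion (LU s). c * (ev a u * ev a' u'))"
      by (simp del: ev.simps add: U ev.simps(1) algebra_simps)
    finally show ?thesis unfolding 3 .
  qed
qed

lemma prod_two:
  fixes h :: "nat \<Rightarrow> real \<Rightarrow> complex"
  assumes r: "r \<in> {2..n}"
  shows "(\<Prod>j=1..n. (h(1 := f, r := g)) j (t (\<sigma> j))) = f (t (\<sigma> 1)) * g (t (\<sigma> r)) * (\<Prod>j\<in>{2..n}-{r}. h j (t (\<sigma> j)))"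
proof -
  have tw: "h(1 := f, r := g) = (h(r := g))(1 := f)" using r by (auto simp: fun_eq_iff)
  have "(\<Prod>j=2..n. (h(r := g)) j (t (\<sigma> j))) = (h(r := g)) r (t (\<sigma> r)) * (\<Prod>j\<in>{2..n}-{r}. (h(r := g)) j (t (\<sigma> j)))"
    using r by (intro prod.remove) auto
  also have "(\<Prod>j\<in>{2..n}-{r}. (h(r := g)) j (t (\<sigma> j))) = (\<Prod>j\<in>{2..n}-{r}. h j (t (\<sigma> j)))" by (intro prod.cong refl) auto
  finally show ?thesis unfolding tw using r by (subst prod_first) auto
qed

text \<open>The factor 2 pays for adding to each permutation its composite with the transposition of
  slots 1 and \<open>r\<close>; the two singular quotients then combine as in
  \<open>pair_identity\<close>. Wherever \<open>Psi\<close> is nonzero the variables are distinct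
  and avoid the z_s, as that identity requires.\<close>

lemma sym_pair:
  assumes l: "l \<in> Zset n (p - 1)" and N: "image_mset w (mset_set {2..n}) = N"
    and w: "\<And>j. j \<in> {2..n} \<Longrightarrow> w j \<in> {LT} \<union> LG ` {1..p-1} \<union> LU ` {1..p-1}" and r: "r \<in> {2..n}"
  shows "2 * (\<integral>t. (\<Sum>\<sigma> | \<sigma> permutes {1..n}. indU l t *\<^sub>R (Psi n p z \<alpha> \<gamma> t * (\<Prod>j=2..n. ev (w j) (t (\<sigma> j)))
      * (of_real (t (\<sigma> 1) - z p) / of_real (t (\<sigma> 1) - t (\<sigma> r))))) \<partial>Rn n) = pair_term Vm (N - {#w r#}) l (w r)"
proof -
  let ?h = "\<lambda>j. ev (w j)" and ?b = "w r"
  let ?S = "{\<sigma>. \<sigma> permutes {1..n}}"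
  have n: "n \<ge> 1" using r by auto
  have wl: "w j \<in> letters (p - 1)" if "j \<in> {2..n}" for j using w[OF that] by (auto simp: letters_def)
  define B where "B t \<sigma> = (\<Prod>j=2..n. ev (w j) (t (\<sigma> j))) * (of_real (t (\<sigma> 1) - z p) / of_real (t (\<sigma> 1) - t (\<sigma> r)))"
    for t :: "nat \<Rightarrow> real" and \<sigma> :: "nat \<Rightarrow> nat"
  have pw: "2 * (\<Sum>\<sigma>\<in>?S. indU l t *\<^sub>R (Psi n p z \<alpha> \<gamma> t * (\<Prod>j=2..n. ev (w j) (t (\<sigma> j)))
      * (of_real (t (\<sigma> 1) - z p) / of_real (t (\<sigma> 1) - t (\<sigma> r)))))
     = (\<Sum>(a, a', c)\<leftarrow>pair_expansion ?b. c * (indU l t *\<^sub>R (Psi n p z \<alpha> \<gamma> t * Symf n (?h(1 := ev a, r := ev a')) t)))" for t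
  proof (cases "Psi n p z \<alpha> \<gamma> t = 0")
    case True
    have "(\<Sum>(a, a', c)\<leftarrow>xs. 0) = (0::complex)" for xs :: "(letter \<times> letter \<times> complex) list" by (induction xs) auto
    then show ?thesis using True by simp
  next
    case nz: False
    let ?\<tau> = "Transposition.transpose 1 r"
    have \<tau>: "?\<tau> permutes {1..n}" using r by (intro permutes_swap_id) auto
    have "2 * (\<Sum>\<sigma>\<in>?S. B t \<sigma>) = (\<Sum>\<sigma>\<in>?S. B t \<sigma>) + (\<Sum>\<sigma>\<in>?S. B t (\<sigma> \<circ> ?\<tau>))"
      using sum_permutations_compose_right[OF \<tau>, of "B t"] by simp
    also have "\<dots> = (\<Sum>\<sigma>\<in>?S. B t \<sigma> + B t (\<sigma> \<circ> ?\<tau>))" by (simp add: sum.distrib)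
    also have "\<dots> = (\<Sum>\<sigma>\<in>?S. (\<Sum>(a, a', c)\<leftarrow>pair_expansion ?b. c * (ev a (t (\<sigma> 1)) * ev a' (t (\<sigma> r)))) * (\<Prod>j\<in>{2..n}-{r}. ?h j (t (\<sigma> j))))"
    proof (rule sum.cong[OF refl])
      fix \<sigma> assume "\<sigma> \<in> ?S"
      then have \<sigma>: "\<sigma> permutes {1..n}" by simp
      define u where "u = t (\<sigma> 1)"
      define u' where "u' = t (\<sigma> r)"
      define R where "R = (\<Prod>j\<in>{2..n}-{r}. ?h j (t (\<sigma> j)))"
      have s1: "\<sigma> 1 \<in> {1..n}" "\<sigma> r \<in> {1..n}" using permutes_in_image[OF \<sigma>] r n by auto
      have "\<sigma> 1 \<noteq> \<sigma> r" using r inj_eq[OF permutes_inj[OF \<sigma>], of 1 r] by simp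
      then have u: "u \<noteq> u'" unfolding u_def u'_def using Psi_nz(2)[OF nz s1] by simp
      have off: "u \<noteq> z s \<and> u' \<noteq> z s" if "s \<in> {1..p}" for s
        unfolding u_def u'_def using Psi_nz(1)[OF nz _ that] s1 by auto
      have e1: "(\<Prod>j=2..n. ?h j (t (\<sigma> j))) = ev ?b u' * R"
        unfolding R_def u'_def using r by (intro prod.remove) auto
      have "(\<Prod>j=2..n. ?h j (t ((\<sigma> \<circ> ?\<tau>) j))) = ?h r (t ((\<sigma> \<circ> ?\<tau>) r)) * (\<Prod>j\<in>{2..n}-{r}. ?h j (t ((\<sigma> \<circ> ?\<tau>) j)))"
        using r by (intro prod.remove) auto
      also have "(\<Prod>j\<in>{2..n}-{r}. ?h j (t ((\<sigma> \<circ> ?\<tau>) j))) = R"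
        unfolding R_def by (intro prod.cong refl) (auto simp: Transposition.transpose_def)
      finally have e2: "(\<Prod>j=2..n. ?h j (t ((\<sigma> \<circ> ?\<tau>) j))) = ev ?b u * R" by (simp add: u_def)
      have "B t \<sigma> + B t (\<sigma> \<circ> ?\<tau>) = ev ?b u' * R * (of_real (u - z p) / of_real (u - u')) + ev ?b u * R * (of_real (u' - z p) / of_real (u' - u))"
        unfolding B_def e1 e2 by (simp add: u_def u'_def del: of_real_diff)
      also have "\<dots> = (of_real (u - z p) * ev ?b u' - of_real (u' - z p) * ev ?b u) / of_real (u - u') * R"
      proof -
        define d :: complex where "d = of_real (u - u')"
        have d': "of_real (u' - u) = - d" by (simp add: d_def)
        show ?thesis unfolding d' d_def[symmetric] by (simp add: diff_divide_distrib algebra_simps del: of_real_diff)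
      qed
      also have "\<dots> = (\<Sum>(a, a', c)\<leftarrow>pair_expansion ?b. c * (ev a u * ev a' u')) * R"
        by (subst pair_identity[OF w[OF r] u]) (use off in auto)
      finally show "B t \<sigma> + B t (\<sigma> \<circ> ?\<tau>) = (\<Sum>(a, a', c)\<leftarrow>pair_expansion ?b. c * (ev a (t (\<sigma> 1)) * ev a' (t (\<sigma> r)))) * (\<Prod>j\<in>{2..n}-{r}. ?h j (t (\<sigma> j)))"
        unfolding R_def u_def u'_def .
    qed
    also have "\<dots> = (\<Sum>(a, a', c)\<leftarrow>pair_expansion ?b. c * Symf n (?h(1 := ev a, r := ev a')) t)"
    proof -
      have "(\<Sum>\<sigma>\<in>?S. (\<Sum>(a, a', c)\<leftarrow>xs. c * (ev a (t (\<sigma> 1)) * ev a' (t (\<sigma> r)))) * (\<Prod>j\<in>{2..n}-{r}. ?h j (t (\<sigma> j))))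
        = (\<Sum>(a, a', c)\<leftarrow>xs. c * Symf n (?h(1 := ev a, r := ev a')) t)" for xs
        unfolding Symf_def prod_two[OF r]
        by (induction xs) (auto simp: sum.distrib distrib_right sum_distrib_left mult.assoc)
      then show ?thesis .
    qed
    finally have e: "2 * (\<Sum>\<sigma>\<in>?S. B t \<sigma>) = (\<Sum>(a, a', c)\<leftarrow>pair_expansion ?b. c * Symf n (?h(1 := ev a, r := ev a')) t)" .
    have "2 * (\<Sum>\<sigma>\<in>?S. indU l t *\<^sub>R (Psi n p z \<alpha> \<gamma> t * (\<Prod>j=2..n. ev (w j) (t (\<sigma> j)))
      * (of_real (t (\<sigma> 1) - z p) / of_real (t (\<sigma> 1) - t (\<sigma> r))))) = of_real (indU l t) * Psi n p z \<alpha> \<gamma> t * (2 * (\<Sum>\<sigma>\<in>?S. B t \<sigma>))"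
      by (simp add: B_def sum_distrib_left scaleR_conv_of_real mult_ac del: of_real_diff)
    also have "\<dots> = (\<Sum>(a, a', c)\<leftarrow>pair_expansion ?b. c * (indU l t *\<^sub>R (Psi n p z \<alpha> \<gamma> t * Symf n (?h(1 := ev a, r := ev a')) t)))"
    proof -
      have "of_real (indU l t) * Psi n p z \<alpha> \<gamma> t * (\<Sum>(a, a', c)\<leftarrow>xs. c * Symf n (?h(1 := ev a, r := ev a')) t)
        = (\<Sum>(a, a', c)\<leftarrow>xs. c * (indU l t *\<^sub>R (Psi n p z \<alpha> \<gamma> t * Symf n (?h(1 := ev a, r := ev a')) t)))" for xs
        by (induction xs) (auto simp: scaleR_conv_of_real algebra_simps)
      then show ?thesis unfolding e .
    qed
    finally show ?thesis .
  qed
  have int: "integrable (Rn n) (\<lambda>t. indU l t *\<^sub>R (Psi n p z \<alpha> \<gamma> t * Symf n (?h(1 := ev a, r := ev a')) t))"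
    if "(a, a', c) \<in> set (pair_expansion ?b)" for a a' c
  proof (rule integrable_Vint[OF l])
    fix j assume "j \<in> {1..n}"
    then show "admissible ((?h(1 := ev a, r := ev a')) j)"
      using pair_expansion_letters[OF w[OF r] that] wl[of j] by (auto intro!: admissible_ev)
  qed
  have "2 * (\<integral>t. (\<Sum>\<sigma>\<in>?S. indU l t *\<^sub>R (Psi n p z \<alpha> \<gamma> t * (\<Prod>j=2..n. ev (w j) (t (\<sigma> j)))
      * (of_real (t (\<sigma> 1) - z p) / of_real (t (\<sigma> 1) - t (\<sigma> r))))) \<partial>Rn n)
    = (\<integral>t. (\<Sum>(a, a', c)\<leftarrow>pair_expansion ?b. c * (indU l t *\<^sub>R (Psi n p z \<alpha> \<gamma> t * Symf n (?h(1 := ev a, r := ev a')) t))) \<partial>Rn n)"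
    unfolding integral_mult_right_zero[symmetric] pw ..
  also have "\<dots> = (\<Sum>(a, a', c)\<leftarrow>pair_expansion ?b. c * Vint l (?h(1 := ev a, r := ev a')))"
  proof -
    have "integrable (Rn n) (\<lambda>t. (\<Sum>(a, a', c)\<leftarrow>xs. c * (indU l t *\<^sub>R (Psi n p z \<alpha> \<gamma> t * Symf n (?h(1 := ev a, r := ev a')) t))))
        \<and> (\<integral>t. (\<Sum>(a, a', c)\<leftarrow>xs. c * (indU l t *\<^sub>R (Psi n p z \<alpha> \<gamma> t * Symf n (?h(1 := ev a, r := ev a')) t))) \<partial>Rn n)
        = (\<Sum>(a, a', c)\<leftarrow>xs. c * Vint l (?h(1 := ev a, r := ev a')))" if "set xs \<subseteq> set (pair_expansion ?b)" for xs
      using that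
    proof (induction xs)
      case (Cons x xs)
      obtain a a' c where x: "x = (a, a', c)" by (cases x) auto
      have i: "integrable (Rn n) (\<lambda>t. c * (indU l t *\<^sub>R (Psi n p z \<alpha> \<gamma> t * Symf n (?h(1 := ev a, r := ev a')) t)))"
        using int[of a a' c] Cons.prems x by (intro integrable_mult_right) auto
      then show ?case using Cons unfolding x list.map sum_list.Cons prod.case Vint_def
        by (subst Bochner_Integration.integral_add) (auto simp only: integral_mult_right_zero set_simps insert_subset intro!: Bochner_Integration.integrable_add)
    qed simp
    from this[of "pair_expansion ?b"] show ?thesis by simp
  qed
  also have "\<dots> = (\<Sum>(a, a', c)\<leftarrow>pair_expansion ?b. c * Vm (add_mset a (add_mset a' (N - {#w r#}))) l)"
  proof -
    have "Vint l (?h(1 := ev a, r := ev a')) = Vm (add_mset a (add_mset a' (N - {#w r#}))) l" for a a'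
    proof -
      have "?h(1 := ev a, r := ev a') = (\<lambda>j. ev ((w(1 := a, r := a')) j))" by auto
      then show ?thesis unfolding image_mset_upd_two[OF N r, symmetric] Vm_word[OF l] by (rule arg_cong)
    qed
    then show ?thesis by simp
  qed
  also have "\<dots> = pair_term Vm (N - {#w r#}) l (w r)" by (rule pair_term_expansion[OF w[OF r], symmetric])
  finally show ?thesis .
qed

text \<open>Sums \<open>ibp\<close> over all permutations \<sigma>, with \<sigma> 1 as the variable
  of differentiation and the letter \<open>w j\<close> placed at variable \<sigma> j. Each r \<ge> 2
  then yields one symmetrised pair term.\<close>

lemma sym_ibp:
  assumes l: "l \<in> Zset n (p - 1)" and n: "n \<ge> 1" and N: "image_mset w (mset_set {2..n}) = N"
    and w: "\<And>j. j \<in> {2..n} \<Longrightarrow> w j \<in> {LT} \<union> LG ` {1..p-1} \<union> LU ` {1..p-1}"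
  shows "Vint l ((\<lambda>j. ev (w j))(1 := kap)) + \<gamma> * (\<Sum>r=2..n. pair_term Vm (N - {#w r#}) l (w r)) = 0"
proof -
  let ?h = "\<lambda>j. ev (w j)"
  let ?S = "{\<sigma>. \<sigma> permutes {1..n}}"
  have wl: "w j \<in> letters (p - 1)" if "j \<in> {2..n}" for j using w[OF that] by (auto simp: letters_def)
  define A where "A \<sigma> r t = indU l t *\<^sub>R (Psi n p z \<alpha> \<gamma> t * (\<Prod>j=2..n. ?h j (t (\<sigma> j)))
      * (of_real (t (\<sigma> 1) - z p) / of_real (t (\<sigma> 1) - t (\<sigma> r))))" for \<sigma> r and t :: "nat \<Rightarrow> real"
  have main: "(\<forall>r\<in>{2..n}. integrable (Rn n) (A \<sigma> r)) \<and>
     (\<integral>t. indU l t *\<^sub>R (Psi n p z \<alpha> \<gamma> t * (\<Prod>j=1..n. (?h(1 := kap)) j (t (\<sigma> j)))) \<partial>Rn n) + 2 * \<gamma> * (\<Sum>r=2..n. \<integral>t. A \<sigma> r t \<partial>Rn n) = 0"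
    if "\<sigma> \<in> ?S" for \<sigma>
  proof -
    define i where "i = \<sigma> 1"
    have \<sigma>: "\<sigma> permutes {1..n}" using that by simp
    have i: "i \<in> {1..n}" unfolding i_def using permutes_in_image[OF \<sigma>] n by auto
    have "bij_betw \<sigma> ({1..n} - {1}) ({1..n} - {\<sigma> 1})"
      using permutes_imp_bij[OF \<sigma>] n i by (intro bij_betw_DiffI) (auto simp: i_def)
    moreover have "{1..n} - {1} = {2..n}" by auto
    ultimately have bij: "bij_betw \<sigma> {2..n} ({1..n} - {i})" by (simp add: i_def)
    define h' where "h' k = ?h (inv \<sigma> k)" for k
    have inv: "inv \<sigma> (\<sigma> j) = j" for j using permutes_inverses[OF \<sigma>] by simp
    have h': "admissible (h' k)" if "k \<in> {1..n} - {i}" for k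
    proof -
      have "k \<in> \<sigma> ` {2..n}" using bij that unfolding bij_betw_def by simp
      then obtain j where "j \<in> {2..n}" "k = \<sigma> j" by (elim imageE)
      then show ?thesis unfolding h'_def using inv wl by (auto intro: admissible_ev)
    qed
    have P: "(\<Prod>k\<in>{1..n}-{i}. h' k (t k)) = (\<Prod>j=2..n. ?h j (t (\<sigma> j)))" for t
      using prod.reindex_bij_betw[OF bij, of "\<lambda>k. h' k (t k)"] by (simp add: h'_def inv)
    have S: "(\<Sum>j\<in>{1..n}-{i}. g j) = (\<Sum>r=2..n. g (\<sigma> r))" for g :: "nat \<Rightarrow> complex"
      using sum.reindex_bij_betw[OF bij, of g] by simp
    have int: "integrable (Rn n) (A \<sigma> r)" if "r \<in> {2..n}" for r
    proof -
      have "\<sigma> r \<in> {1..n} - {i}" using bij that unfolding bij_betw_def by blast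
      then have "integrable (Rn n) (\<lambda>t. indU l t *\<^sub>R (Psi n p z \<alpha> \<gamma> t * (\<Prod>k\<in>{1..n}-{i}. h' k (t k))
        * (of_real (t i - z p) / of_real (t i - t (\<sigma> r)))))"
        by (rule integrable_Psi_pole[OF l i]) (rule h')
      then show ?thesis unfolding P A_def unfolding i_def .
    qed

    have intk: "integrable (Rn n) (\<lambda>t. indU l t *\<^sub>R (Psi n p z \<alpha> \<gamma> t * (\<Prod>j=1..n. (?h(1 := kap)) j (t (\<sigma> j)))))"
      by (rule integrable_term[OF l _ \<sigma>]) (auto simp: admissible_kap intro!: admissible_ev wl)
    have "0 = (\<integral>t. indU l t *\<^sub>R (Psi n p z \<alpha> \<gamma> t * (\<Prod>k\<in>{1..n}-{i}. h' k (t k))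
      * (kap (t i) + 2 * \<gamma> * (\<Sum>j\<in>{1..n}-{i}. of_real (t i - z p) / of_real (t i - t j)))) \<partial>Rn n)"
      by (rule ibp[OF l i, symmetric]) (rule h')
    also have "\<dots> = (\<integral>t. indU l t *\<^sub>R (Psi n p z \<alpha> \<gamma> t * (\<Prod>j=1..n. (?h(1 := kap)) j (t (\<sigma> j)))) + 2 * \<gamma> * (\<Sum>r=2..n. A \<sigma> r t) \<partial>Rn n)"
      unfolding P S prod_first[OF n] A_def i_def[symmetric]
      by (intro Bochner_Integration.integral_cong refl)
         (simp add: algebra_simps sum_distrib_left scaleR_sum_right del: of_real_diff)
    also have "\<dots> = (\<integral>t. indU l t *\<^sub>R (Psi n p z \<alpha> \<gamma> t * (\<Prod>j=1..n. (?h(1 := kap)) j (t (\<sigma> j)))) \<partial>Rn n) + (\<integral>t. 2 * \<gamma> * (\<Sum>r=2..n. A \<sigma> r t) \<partial>Rn n)"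
      by (rule Bochner_Integration.integral_add[OF intk]) (intro integrable_mult_right Bochner_Integration.integrable_sum int)
    also have "(\<integral>t. 2 * \<gamma> * (\<Sum>r=2..n. A \<sigma> r t) \<partial>Rn n) = 2 * \<gamma> * (\<Sum>r=2..n. \<integral>t. A \<sigma> r t \<partial>Rn n)"
      unfolding integral_mult_right_zero by (subst Bochner_Integration.integral_sum, erule int, rule refl)
    finally show ?thesis using int by simp
  qed
  then have one: "integrable (Rn n) (A \<sigma> r)" if "\<sigma> \<in> ?S" "r \<in> {2..n}" for \<sigma> r using that by blast
  have two: "(\<integral>t. indU l t *\<^sub>R (Psi n p z \<alpha> \<gamma> t * (\<Prod>j=1..n. (?h(1 := kap)) j (t (\<sigma> j)))) \<partial>Rn n) + 2 * \<gamma> * (\<Sum>r=2..n. \<integral>t. A \<sigma> r t \<partial>Rn n) = 0"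
    if "\<sigma> \<in> ?S" for \<sigma> using main[OF that] by (rule conjunct2)
  have "0 = (\<Sum>\<sigma>\<in>?S. (\<integral>t. indU l t *\<^sub>R (Psi n p z \<alpha> \<gamma> t * (\<Prod>j=1..n. (?h(1 := kap)) j (t (\<sigma> j)))) \<partial>Rn n) + 2 * \<gamma> * (\<Sum>r=2..n. \<integral>t. A \<sigma> r t \<partial>Rn n))"
    using two by simp
  also have "\<dots> = (\<Sum>\<sigma>\<in>?S. \<integral>t. indU l t *\<^sub>R (Psi n p z \<alpha> \<gamma> t * (\<Prod>j=1..n. (?h(1 := kap)) j (t (\<sigma> j)))) \<partial>Rn n)
      + 2 * \<gamma> * (\<Sum>r=2..n. \<Sum>\<sigma>\<in>?S. \<integral>t. A \<sigma> r t \<partial>Rn n)"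
    unfolding sum.distrib sum_distrib_left[symmetric] by (subst sum.swap) (rule refl)
  also have "(\<Sum>\<sigma>\<in>?S. \<integral>t. indU l t *\<^sub>R (Psi n p z \<alpha> \<gamma> t * (\<Prod>j=1..n. (?h(1 := kap)) j (t (\<sigma> j)))) \<partial>Rn n) = Vint l (?h(1 := kap))"
    unfolding Vint_def Symf_def sum_distrib_left scaleR_sum_right
    by (rule Bochner_Integration.integral_sum[symmetric], rule integrable_term[OF l]) (auto simp: admissible_kap intro!: admissible_ev wl)
  also have "2 * \<gamma> * (\<Sum>r=2..n. \<Sum>\<sigma>\<in>?S. \<integral>t. A \<sigma> r t \<partial>Rn n) = \<gamma> * (\<Sum>r=2..n. pair_term Vm (N - {#w r#}) l (w r))"
  proof -
    have "2 * (\<Sum>\<sigma>\<in>?S. \<integral>t. A \<sigma> r t \<partial>Rn n) = pair_term Vm (N - {#w r#}) l (w r)" if r: "r \<in> {2..n}" for r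
    proof -
      have "(\<Sum>\<sigma>\<in>?S. \<integral>t. A \<sigma> r t \<partial>Rn n) = (\<integral>t. (\<Sum>\<sigma>\<in>?S. A \<sigma> r t) \<partial>Rn n)"
        using one r by (intro Bochner_Integration.integral_sum[symmetric]) auto
      moreover have "2 * (\<integral>t. (\<Sum>\<sigma>\<in>?S. A \<sigma> r t) \<partial>Rn n) = pair_term Vm (N - {#w r#}) l (w r)"
        unfolding A_def by (rule sym_pair[OF l N _ r]) (rule w)
      ultimately show ?thesis by simp
    qed
    then have "(\<Sum>r=2..n. pair_term Vm (N - {#w r#}) l (w r)) = (\<Sum>r=2..n. 2 * (\<Sum>\<sigma>\<in>?S. \<integral>t. A \<sigma> r t \<partial>Rn n))"
      by (intro sum.cong refl) simp
    then show ?thesis by (simp add: sum_distrib_left mult_ac)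
  qed
  finally show ?thesis by (rule sym)
qed

lemma word_rest:
  assumes "size N + 1 = n"
  obtains w where "image_mset w (mset_set {2..n}) = N"
  using ex_word[of "{2..n}" N] assms by auto

lemma word_rest_mem: "image_mset w (mset_set {2..n}) = N \<Longrightarrow> j \<in> {2..n} \<Longrightarrow> w j \<in># N"
  by auto

lemma Vm_add:
  assumes "image_mset w (mset_set {2..n}) = N" "l \<in> Zset n (p - 1)" "n \<ge> 1"
  shows "Vm (add_mset a N) l = Vint l ((\<lambda>j. ev (w j))(1 := ev a))"
proof -
  have "(\<lambda>j. ev (w j))(1 := ev a) = (\<lambda>j. ev ((w(1 := a)) j))" by auto
  then show ?thesis unfolding image_mset_upd_first[OF assms(1,3), symmetric] Vm_word[OF assms(2)] by (rule arg_cong[symmetric])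
qed

lemma Vm_lin:
  assumes N: "size N + 1 = n" "set_mset N \<subseteq> letters (p - 1)"
    and abc: "a \<in> letters (p - 1)" "b \<in> letters (p - 1)"
    and eq: "\<And>t. (\<forall>s\<in>{1..p}. t \<noteq> z s) \<Longrightarrow> ev c t = ev a t - ev b t"
  shows "Vm (add_mset c N) l = Vm (add_mset a N) l - Vm (add_mset b N) l"
proof (cases "l \<in> Zset n (p - 1)")
  case False
  then show ?thesis by (simp add: Vm_def)
next
  case l: True
  obtain w where w: "image_mset w (mset_set {2..n}) = N" using word_rest[OF N(1)] by blast
  have n: "n \<ge> 1" using N by auto
  have "Vint l ((\<lambda>j. ev (w j))(1 := ev c)) = (\<Sum>i\<in>{True, False}. (if i then 1 else -1) * Vint l ((\<lambda>j. ev (w j))(1 := (if i then ev a else ev b))))"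
  proof (rule Vint_comb[OF l n])
    show "admissible (ev (w j))" if "j \<in> {2..n}" for j
      using word_rest_mem[OF w that] N(2) by (intro admissible_ev) auto
    show "admissible (if i then ev a else ev b)" for i :: bool using abc by (auto intro: admissible_ev)
    show "ev c t = (\<Sum>i\<in>{True, False}. (if i then 1 else - 1) * (if i then ev a else ev b) t)" if "\<forall>s\<in>{1..p}. t \<noteq> z s" for t
      using eq[OF that] by simp
  qed
  then show ?thesis unfolding Vm_add[OF w l n] by simp
qed

text \<open>Because (t - z_p) / (t - z_s) = 1 - g_s and g_p = 0, the function \<open>kap\<close> is
  \<open>1 + (\<Sum>s=1..p. \<alpha> s)\<close> minus the sum of the \<alpha>_s g_s over s < p; this
  gives both terms of \<open>IBP\<close> outside the pair terms. The denominators have positive real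
  part since Re \<alpha>_p > -1.\<close>

lemma sym_rec_Vm: "sym_rec Vm n (p - 1) \<alpha> \<gamma> (1 + \<alpha> p) (1 + (\<Sum>s=1..p. \<alpha> s))"
proof
  show "1 \<le> p - 1" using p2 by simp
  have "{1..p} = insert p {1..p-1}" using p2 by auto
  moreover have "p \<notin> {1..p-1}" using p2 by simp
  ultimately show A: "1 + (\<Sum>s=1..p. \<alpha> s) = 1 + \<alpha> p + (\<Sum>s=1..p-1. \<alpha> s)" by simp
  have one: "1 \<in> {1..p-1}" using p2 by simp
  have lt: "LG s \<in> letters (p - 1)" "LH s \<in> letters (p - 1)" "LT \<in> letters (p - 1)" if "s \<in> {1..p-1}" for s
    using that by (auto simp: letters_def)
  have HG: "ev (LH s) t = ev (LG s) t - 1" if "t \<noteq> z s" for s t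
    using that by (simp add: field_simps)
  have off: "t \<noteq> z s" if "\<forall>s\<in>{1..p}. t \<noteq> z s" "s \<in> {1..p-1}" for s t using that by auto
  fix N :: "letter multiset" and l
  assume N: "size N + 1 = n"
  {
    assume N2: "set_mset N \<subseteq> letters (p - 1)"
    show "Vm (add_mset (LH 1) N) l = Vm (add_mset (LG 1) N) l - Vm (add_mset LT N) l"
      using HG[OF off[OF _ one]] by (intro Vm_lin[OF N N2 lt(1,3)[OF one]]) auto
    fix s assume s: "s \<in> {1..p-1}"
    show "Vm (add_mset (LU s) N) l = Vm (add_mset (LG s) N) l - Vm (add_mset (LG 1) N) l"
      by (rule Vm_lin[OF N N2 lt(1)[OF s] lt(1)[OF one]]) simp
    show "Vm (add_mset (LU s) N) l = Vm (add_mset (LH s) N) l - Vm (add_mset (LH 1) N) l"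
    proof (rule Vm_lin[OF N N2 lt(2)[OF s] lt(2)[OF one]])
      fix t assume t: "\<forall>s\<in>{1..p}. t \<noteq> z s"
      have "ev (LU s) t = ev (LG s) t - ev (LG 1) t" by simp
      then show "ev (LU s) t = ev (LH s) t - ev (LH 1) t"
        unfolding HG[OF off[OF t s]] HG[OF off[OF t one]] by (simp only: diff_diff_eq2 diff_add_cancel)
    qed
  }
  assume N2: "set_mset N \<subseteq> {LT} \<union> LG ` {1..p-1} \<union> LU ` {1..p-1}"
  show "(1 + (\<Sum>s=1..p. \<alpha> s)) * Vm (add_mset LT N) l - (\<Sum>s=1..p-1. \<alpha> s * Vm (add_mset (LG s) N) l)
      + \<gamma> * (\<Sum>b\<in>#N. pair_term Vm (N - {#b#}) l b) = 0"
  proof (cases "l \<in> Zset n (p - 1)")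
    case False
    have V0: "Vm M l = 0" for M using False by (simp add: Vm_def)
    have "pair_term Vm M l b = 0" for M b by (cases b) (simp_all add: V0)
    then show ?thesis by (simp add: V0)
  next
    case l: True
    obtain w where w: "image_mset w (mset_set {2..n}) = N" using word_rest[OF N] by blast
    have n: "n \<ge> 1" using N by auto
    define I where "I = insert LT (LG ` {1..p-1})"
    define c where "c b = (case b of LG s \<Rightarrow> - \<alpha> s | _ \<Rightarrow> 1 + (\<Sum>s=1..p. \<alpha> s))" for b
    have wN: "w j \<in> {LT} \<union> LG ` {1..p-1} \<union> LU ` {1..p-1}" if "j \<in> {2..n}" for j
      using word_rest_mem[OF w that] N2 by auto
    have sumI: "(\<Sum>b\<in>I. c b * f b) = (1 + (\<Sum>s=1..p. \<alpha> s)) * f LT - (\<Sum>s=1..p-1. \<alpha> s * f (LG s))" for f :: "letter \<Rightarrow> complex"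
    proof -
      have "(\<Sum>b\<in>LG ` {1..p-1}. c b * f b) = (\<Sum>s=1..p-1. - \<alpha> s * f (LG s))"
        by (subst sum.reindex) (auto simp: c_def inj_on_def)
      moreover have "(\<Sum>b\<in>I. c b * f b) = c LT * f LT + (\<Sum>b\<in>LG ` {1..p-1}. c b * f b)"
        unfolding I_def by (rule sum.insert) auto
      ultimately show ?thesis by (simp add: c_def sum_negf)
    qed
    have "Vint l ((\<lambda>j. ev (w j))(1 := kap)) = (\<Sum>b\<in>I. c b * Vint l ((\<lambda>j. ev (w j))(1 := ev b)))"
    proof (rule Vint_comb[OF l n])
      show "admissible (ev (w j))" if "j \<in> {2..n}" for j
        using wN[OF that] by (intro admissible_ev) (auto simp: letters_def)
      show "admissible (ev b)" if "b \<in> I" for b using that by (intro admissible_ev) (auto simp: letters_def I_def)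
      show "kap t = (\<Sum>b\<in>I. c b * ev b t)" if t: "\<forall>s\<in>{1..p}. t \<noteq> z s" for t
      proof -
        have "kap t = 1 + (\<Sum>s=1..p. \<alpha> s - \<alpha> s * ev (LG s) t)"
          unfolding kap_def
        proof (intro arg_cong2[of _ _ _ _ "(+)"] refl sum.cong)
          fix s assume "s \<in> {1..p}"
          then have "of_real (t - z s) \<noteq> (0::complex)" using t by auto
          then show "\<alpha> s * of_real (t - z p) / of_real (t - z s) = \<alpha> s - \<alpha> s * ev (LG s) t"
            by (simp add: field_simps)
        qed
        also have "\<dots> = 1 + (\<Sum>s=1..p. \<alpha> s) - (\<Sum>s=1..p. \<alpha> s * ev (LG s) t)" by (simp add: sum_subtractf del: ev.simps)
        also have "(\<Sum>s=1..p. \<alpha> s * ev (LG s) t) = (\<Sum>s=1..p-1. \<alpha> s * ev (LG s) t)"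
        proof (rule sum.mono_neutral_right)
          show "\<forall>s\<in>{1..p} - {1..p-1}. \<alpha> s * ev (LG s) t = 0"
          proof
            fix s assume "s \<in> {1..p} - {1..p-1}"
            then have "s = p" by auto
            then show "\<alpha> s * ev (LG s) t = 0" by simp
          qed
        qed auto
        finally show ?thesis unfolding sumI by simp
      qed
    qed
    also have "\<dots> = (\<Sum>b\<in>I. c b * Vm (add_mset b N) l)" unfolding Vm_add[OF w l n] ..
    finally have V: "Vint l ((\<lambda>j. ev (w j))(1 := kap)) = (\<Sum>b\<in>I. c b * Vm (add_mset b N) l)" .
    have P: "(\<Sum>b\<in>#N. pair_term Vm (N - {#b#}) l b) = (\<Sum>r=2..n. pair_term Vm (N - {#w r#}) l (w r))"
    proof -
      have "image_mset (\<lambda>b. pair_term Vm (N - {#b#}) l b) N = image_mset (\<lambda>r. pair_term Vm (N - {#w r#}) l (w r)) (mset_set {2..n})"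
        using w[symmetric] by (metis (no_types, lifting) comp_apply image_mset.comp image_mset_cong)
      then show ?thesis by (simp only: sum_unfold_sum_mset)
    qed
    have "Vint l ((\<lambda>j. ev (w j))(1 := kap)) + \<gamma> * (\<Sum>r=2..n. pair_term Vm (N - {#w r#}) l (w r)) = 0"
      by (rule sym_ibp[OF l n w]) (rule wN)
    then show ?thesis unfolding V sumI P .
  qed
next
  fix j :: nat
  have "Re (\<Sum>s=1..p. \<alpha> s) = (\<Sum>s=1..<p. Re (\<alpha> s)) + Re (\<alpha> p)"
  proof -
    have "{1..p} = insert p {1..<p}" using p2 by auto
    then show ?thesis by simp
  qed
  moreover have "(\<Sum>s=1..<p. Re (\<alpha> s)) \<ge> 0" using Apos by (intro sum_nonneg) (auto intro: less_imp_le)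
  ultimately have "Re (1 + (\<Sum>s=1..p. \<alpha> s) + of_nat j * \<gamma>) > 0" using Ap Gpos by simp (simp add: add_pos_nonneg)
  then show "1 + (\<Sum>s=1..p. \<alpha> s) + of_nat j * \<gamma> \<noteq> 0" by (metis less_irrefl zero_complex.sel(1))
qed

section \<open>Matrix entries and the shift of the last exponent\<close>

definition entry :: "(nat \<Rightarrow> nat) \<Rightarrow> (nat \<Rightarrow> nat) \<Rightarrow> complex" where
  "entry l m = (\<integral>t. indU l t *\<^sub>R (Psi n p z \<alpha> \<gamma> t * omega n p z m t) \<partial>Rn n)"

definition mfact :: "(nat \<Rightarrow> nat) \<Rightarrow> complex" where
  "mfact m = (\<Prod>s=1..p. 1 / of_nat (fact (m s)))"

lemma omega_Symf:
  assumes m: "m \<in> Zset n (p - 1)"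
  shows "omega n p z m t = mfact m * Symf n (\<lambda>j. ev (LF (site m j))) t"
proof -
  have mp: "m p = 0" using m p2 by (auto simp: Zset_def)
  have "(\<Prod>s=1..p. (1 / of_nat (fact (m s))) * (\<Prod>j\<in>Gam m s. 1 / complex_of_real (t (\<sigma> j) - z s)))
     = mfact m * (\<Prod>j=1..n. ev (LF (site m j)) (t (\<sigma> j)))" for \<sigma>
  proof -
    have "(\<Prod>s=1..p. \<Prod>j\<in>Gam m s. 1 / complex_of_real (t (\<sigma> j) - z s)) = (\<Prod>s=1..p-1. \<Prod>j\<in>Gam m s. 1 / complex_of_real (t (\<sigma> j) - z s))"
    proof (rule prod.mono_neutral_right)
      show "\<forall>s\<in>{1..p} - {1..p-1}. (\<Prod>j\<in>Gam m s. 1 / complex_of_real (t (\<sigma> j) - z s)) = 1"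
      proof
        fix s assume "s \<in> {1..p} - {1..p-1}"
        then have s: "s = p" by auto
        have "psum m p = psum m (p - 1)" using psum_Suc[of m "p - 1"] mp p2 by simp
        then have "Gam m s = {}" unfolding s by (simp add: Gam_def)
        then show "(\<Prod>j\<in>Gam m s. 1 / complex_of_real (t (\<sigma> j) - z s)) = 1" by simp
      qed
    qed auto
    also have "\<dots> = (\<Prod>s=1..p-1. \<Prod>j\<in>{j\<in>{1..n}. site m j = s}. ev (LF (site m j)) (t (\<sigma> j)))"
      by (intro prod.cong refl) (auto simp: Gam_eq_site[OF m])
    also have "\<dots> = (\<Prod>j=1..n. ev (LF (site m j)) (t (\<sigma> j)))"
      using site_range[OF m] by (intro prod.group) auto
    finally show ?thesis unfolding mfact_def prod.distrib by (simp only:)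
  qed
  then show ?thesis unfolding omega_def Symf_def by (simp only: sum_distrib_left)
qed

lemma word_site:
  assumes m: "m \<in> Zset n (p - 1)"
  shows "image_mset (site m) (mset_set {1..n}) = Abs_multiset m"
proof (rule multiset_eqI)
  fix s
  have "count (image_mset (site m) (mset_set {1..n})) s = card {i\<in>{1..n}. site m i = s}"
    by (simp add: count_image_mset vimage_def Int_def conj_commute)
  also have "\<dots> = m s"
  proof (cases "s \<in> {1..p-1}")
    case True
    then show ?thesis by (rule card_site_eq[OF m])
  next
    case False
    then have "{i\<in>{1..n}. site m i = s} = {}" using site_range[OF m] by auto
    moreover have "m s = 0" using m False unfolding Zset_def mem_Collect_eq by blast
    ultimately show ?thesis by simp
  qed
  finally show "count (image_mset (site m) (mset_set {1..n})) s = count (Abs_multiset m) s"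
    unfolding Abs_multiset_count_Zset[OF m] .
qed

lemma Vm_image:
  assumes "m \<in> Zset n (p - 1)" "l \<in> Zset n (p - 1)"
  shows "Vm (image_mset P (Abs_multiset m)) l = Vint l (\<lambda>j. ev (P (site m j)))"
  unfolding word_site[OF assms(1), symmetric] image_mset.compositionality Vm_word[OF assms(2)] o_def ..

lemma entry_eq:
  assumes "m \<in> Zset n (p - 1)" "l \<in> Zset n (p - 1)"
  shows "entry l m = mfact m * Vm (image_mset LF (Abs_multiset m)) l"
  unfolding entry_def omega_Symf[OF assms(1)] Vm_image[OF assms] Vint_def
  by (subst integral_mult_right_zero[symmetric]) (simp add: mult_ac scaleR_conv_of_real)

lemma Vm_G:
  assumes m: "m \<in> Zset n (p - 1)" and l: "l \<in> Zset n (p - 1)"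
  shows "Vm (image_mset LG (Abs_multiset m)) l = (\<Prod>s=1..p-1. of_real (z p - z s) ^ m s) * Vm (image_mset LF (Abs_multiset m)) l"
proof -
  have "Symf n (\<lambda>j. ev (LG (site m j))) t = (\<Prod>s=1..p-1. of_real (z p - z s) ^ m s) * Symf n (\<lambda>j. ev (LF (site m j))) t" for t
  proof -
    have "(\<Prod>j=1..n. ev (LG (site m j)) (t (\<sigma> j))) = (\<Prod>j=1..n. of_real (z p - z (site m j))) * (\<Prod>j=1..n. ev (LF (site m j)) (t (\<sigma> j)))" for \<sigma>
      unfolding prod.distrib[symmetric] by (intro prod.cong refl) simp
    then show ?thesis unfolding Symf_def prod_site[OF m, symmetric] by (simp only: sum_distrib_left)
  qed
  then show ?thesis unfolding Vm_image[OF m l] Vint_def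
    by (subst integral_mult_right_zero[symmetric]) (simp add: mult_ac scaleR_conv_of_real del: ev.simps)
qed

text \<open>On the domain the shift multiplies the integrand by the symmetric product of the z_p -
  t_i, one factor for each letter, so every f becomes an h. Conversely g differs from f by the
  constants z_p - z_s, a rescaling of columns. The factors \<open>mfact\<close> multiply both
  determinants alike.\<close>

theorem det_entry_shift:
  shows "det_on (Zset n (p - 1)) (conf.entry n p z (\<alpha>(p := \<alpha> p + 1)) \<gamma>)
    = (\<Prod>m\<in>Zset n (p - 1). \<Prod>s<m 1. (1 + \<alpha> p + of_nat s * \<gamma>) / (1 + (\<Sum>s=1..p. \<alpha> s) + (2 * of_nat n - 2 - of_nat s) * \<gamma>))
      * (\<Prod>m\<in>Zset n (p - 1). \<Prod>s=1..p-1. of_real (z p - z s) ^ m s) * det_on (Zset n (p - 1)) entry"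
proof -
  let ?Z = "Zset n (p - 1)"
  interpret sym_rec Vm n "p - 1" \<alpha> \<gamma> "1 + \<alpha> p" "1 + (\<Sum>s=1..p. \<alpha> s)" by (rule sym_rec_Vm)
  interpret c': conf n p z "\<alpha>(p := \<alpha> p + 1)" \<gamma>
    by standard (use p2 zinc Apos Ap Gpos in auto)
  have "c'.entry l m = mfact m * Vm (image_mset LH (Abs_multiset m)) l" if lm: "l \<in> ?Z" "m \<in> ?Z" for l m
  proof -
    have "indU l t *\<^sub>R (Psi n p z (\<alpha>(p := \<alpha> p + 1)) \<gamma> t * omega n p z m t)
       = mfact m * (indU l t *\<^sub>R (Psi n p z \<alpha> \<gamma> t * Symf n (\<lambda>j. ev (LH (site m j))) t))" for t
    proof (cases "inU l t")
      case True
      have tp: "t i \<le> z p" if "i \<in> {1..n}" for i using inU_range(2)[OF lm(1) True that] .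
      have "Psi n p z (\<alpha>(p := \<alpha> p + 1)) \<gamma> t = Psi n p z \<alpha> \<gamma> t * (\<Prod>i=1..n. of_real (z p - t i))"
      proof -
        have "(\<Prod>s=1..p. cpw (t i - z s) ((\<alpha>(p := \<alpha> p + 1)) s)) = (\<Prod>s=1..p. cpw (t i - z s) (\<alpha> s)) * of_real (z p - t i)" if "i \<in> {1..n}" for i
        proof -
          have "{1..p} = insert p {1..<p}" using p2 by auto
          moreover have "cpw (t i - z p) (\<alpha> p + 1) = cpw (t i - z p) (\<alpha> p) * of_real (z p - t i)"
            using cpw_add_of_nat[of "t i - z p" "\<alpha> p" 1] tp[OF that] by (simp add: abs_if)
          ultimately show ?thesis by simp
        qed
        then have "(\<Prod>i=1..n. \<Prod>s=1..p. cpw (t i - z s) ((\<alpha>(p := \<alpha> p + 1)) s)) = (\<Prod>i=1..n. (\<Prod>s=1..p. cpw (t i - z s) (\<alpha> s)) * of_real (z p - t i))"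
          by (intro prod.cong refl)
        then show ?thesis unfolding Psi_def prod.distrib by (simp only: mult_ac)
      qed
      moreover have "(\<Prod>i=1..n. of_real (z p - t i)) * Symf n (\<lambda>j. ev (LF (site m j))) t = Symf n (\<lambda>j. ev (LH (site m j))) t"
        unfolding Symf_def sum_distrib_left
      proof (rule sum.cong[OF refl])
        fix \<sigma> assume "\<sigma> \<in> {\<sigma>. \<sigma> permutes {1..n}}"
        then have "(\<Prod>i=1..n. of_real (z p - t i)) = (\<Prod>j=1..n. of_real (z p - t (\<sigma> j)) :: complex)"
          using prod.permute[of \<sigma> "{1..n}" "\<lambda>i. of_real (z p - t i) :: complex"] by (simp add: o_def)
        then show "(\<Prod>i=1..n. of_real (z p - t i)) * (\<Prod>j=1..n. ev (LF (site m j)) (t (\<sigma> j))) = (\<Prod>j=1..n. ev (LH (site m j)) (t (\<sigma> j)))"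
          by (simp add: prod.distrib[symmetric])
      qed
      ultimately show ?thesis unfolding omega_Symf[OF lm(2)] by (simp add: scaleR_conv_of_real mult_ac del: ev.simps)
    qed (simp add: indU_def)
    moreover have "c'.indU l t = indU l t" for t unfolding c'.indU_def indU_def c'.inU_def inU_def ..
    ultimately show ?thesis unfolding c'.entry_def Vm_image[OF lm(2,1)] Vint_def
      by (simp only: integral_mult_right_zero)
  qed
  then have "det_on ?Z c'.entry = det_on ?Z (\<lambda>l m. 1 * Vm (image_mset LH (Abs_multiset m)) l * mfact m)"
    by (intro det_on_cong) simp
  also have "\<dots> = (\<Prod>m\<in>?Z. mfact m) * det_on ?Z (\<lambda>l m. Vm (image_mset LH (Abs_multiset m)) l)"
    unfolding det_on_scale by simp
  also have "det_on ?Z (\<lambda>l m. Vm (image_mset LH (Abs_multiset m)) l) =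
     (\<Prod>m\<in>?Z. \<Prod>s<m 1. (1 + \<alpha> p + of_nat s * \<gamma>) / (1 + (\<Sum>s=1..p. \<alpha> s) + (2 * of_nat n - 2 - of_nat s) * \<gamma>))
     * det_on ?Z (\<lambda>l m. Vm (image_mset LG (Abs_multiset m)) l)" by (rule det_shift)
  also have "det_on ?Z (\<lambda>l m. Vm (image_mset LG (Abs_multiset m)) l)
     = det_on ?Z (\<lambda>l m. 1 * Vm (image_mset LF (Abs_multiset m)) l * (\<Prod>s=1..p-1. of_real (z p - z s) ^ m s))"
    by (intro det_on_cong) (simp add: Vm_G)
  also have "\<dots> = (\<Prod>m\<in>?Z. \<Prod>s=1..p-1. of_real (z p - z s) ^ m s) * det_on ?Z (\<lambda>l m. Vm (image_mset LF (Abs_multiset m)) l)"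
    unfolding det_on_scale by simp
  finally have 1: "det_on ?Z c'.entry = (\<Prod>m\<in>?Z. mfact m) *
     ((\<Prod>m\<in>?Z. \<Prod>s<m 1. (1 + \<alpha> p + of_nat s * \<gamma>) / (1 + (\<Sum>s=1..p. \<alpha> s) + (2 * of_nat n - 2 - of_nat s) * \<gamma>))
     * ((\<Prod>m\<in>?Z. \<Prod>s=1..p-1. of_real (z p - z s) ^ m s) * det_on ?Z (\<lambda>l m. Vm (image_mset LF (Abs_multiset m)) l)))" .
  have "det_on ?Z entry = det_on ?Z (\<lambda>l m. 1 * Vm (image_mset LF (Abs_multiset m)) l * mfact m)"
    by (intro det_on_cong) (simp add: entry_eq)
  also have "\<dots> = (\<Prod>m\<in>?Z. mfact m) * det_on ?Z (\<lambda>l m. Vm (image_mset LF (Abs_multiset m)) l)"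
    unfolding det_on_scale by simp
  finally show ?thesis unfolding 1 by (simp only: mult_ac)
qed

end

section \<open>Laguerre--Selberg integrals\<close>

text \<open>One-variable majorant: a Gamma density with room for the polynomial growth of the pair
  factors.\<close>

definition gdom :: "real \<Rightarrow> real \<Rightarrow> real \<Rightarrow> real" where
  "gdom a Q y = indicator {0..} y * (y powr (a - 1) * (1 + y) powr Q * exp (- y))"

lemma gdom_nonneg: "gdom a Q y \<ge> 0"
  by (simp add: gdom_def)

lemma integrable_gdom: "a > 0 \<Longrightarrow> Q \<ge> 0 \<Longrightarrow> integrable lborel (gdom a Q)"
  unfolding gdom_def by (rule integrable_Gamma_density_poly)

text \<open>Each pair is bounded by \<open>M\<close> times P^g with P \<ge> 1 the product of all 1 +
  y_k. There are at most \<open>n * n\<close> pairs, and powers of P split into one-variable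
  factors, so the interacting product gets a product majorant.\<close>

lemma prod_pairs_bound:
  fixes b :: "nat \<Rightarrow> nat \<Rightarrow> complex" and y :: "nat \<Rightarrow> real"
  assumes y: "\<And>i. i \<in> {1..n} \<Longrightarrow> y i \<ge> 0" and g: "g \<ge> 0" and M: "M \<ge> 0"
    and b: "\<And>i j. i \<in> {1..n} \<Longrightarrow> j \<in> {i<..n} \<Longrightarrow> norm (b i j) \<le> M * ((1 + y i) * (1 + y j)) powr g"
  shows "norm (\<Prod>i=1..n. \<Prod>j\<in>{i<..n}. b i j)
     \<le> (\<Prod>i=1..n. \<Prod>j\<in>{i<..n}. M) * (\<Prod>k=1..n. (1 + y k) powr (g * of_nat (n * n)))"
proof -
  define P where "P = (\<Prod>k=1..n. 1 + y k)"
  have P1: "P \<ge> 1" unfolding P_def by (rule prod_ge_1) (use y in auto)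
  have b': "norm (b i j) \<le> M * P powr g" if ij: "i \<in> {1..n}" "j \<in> {i<..n}" for i j
  proof -
    have "P = (1 + y i) * (\<Prod>k\<in>{1..n}-{i}. 1 + y k)" unfolding P_def using ij by (intro prod.remove) auto
    also have "(\<Prod>k\<in>{1..n}-{i}. 1 + y k) = (1 + y j) * (\<Prod>k\<in>{1..n}-{i}-{j}. 1 + y k)" using ij by (intro prod.remove) auto
    finally have P2: "P = (1 + y i) * (1 + y j) * (\<Prod>k\<in>{1..n}-{i}-{j}. 1 + y k)" by simp
    have "(\<Prod>k\<in>{1..n}-{i}-{j}. 1 + y k) \<ge> 1" by (rule prod_ge_1) (use y in auto)
    moreover have "0 \<le> (1 + y i) * (1 + y j)" using y[of i] y[of j] ij by auto
    ultimately have "(1 + y i) * (1 + y j) \<le> P" unfolding P2 using mult_left_mono by fastforce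
    then have "((1 + y i) * (1 + y j)) powr g \<le> P powr g" using y[of i] y[of j] ij g by (intro powr_mono2) auto
    then show ?thesis using b[OF ij] M by (meson mult_left_mono order_trans)
  qed
  have "norm (\<Prod>i=1..n. \<Prod>j\<in>{i<..n}. b i j) \<le> (\<Prod>i=1..n. \<Prod>j\<in>{i<..n}. M * P powr g)"
    unfolding prod_norm[symmetric] by (intro prod_mono conjI prod_nonneg b') auto
  also have "\<dots> = (\<Prod>i=1..n. \<Prod>j\<in>{i<..n}. M) * (\<Prod>i=1..n. \<Prod>j\<in>{i<..n}. P powr g)" by (simp only: prod.distrib)
  also have "(\<Prod>i=1..n. \<Prod>j\<in>{i<..n}. P powr g) \<le> (\<Prod>i=1..n. \<Prod>j=1..n. P powr g)"
  proof (intro prod_mono conjI prod_nonneg)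
    fix i assume "i \<in> {1..n}"
    have P1g: "P powr g \<ge> 1" using P1 g by (simp add: ge_one_powr_ge_zero)
    have "(\<Prod>j\<in>{i<..n}. P powr g) = (P powr g) ^ card {i<..n}" by simp
    also have "\<dots> \<le> (P powr g) ^ card {1..n}" using P1g by (intro power_increasing card_mono) auto
    finally show "(\<Prod>j\<in>{i<..n}. P powr g) \<le> (\<Prod>j=1..n. P powr g)" by simp
  qed auto
  also have "(\<Prod>i=1..n. \<Prod>j=1..n. P powr g) = P powr (g * of_nat (n * n))"
    using P1 by (simp add: power_mult[symmetric] powr_powr[symmetric] powr_realpow)
  also have "\<dots> = (\<Prod>k=1..n. (1 + y k) powr (g * of_nat (n * n)))" unfolding P_def
    by (rule prod_powr_distrib)
  finally show ?thesis using M by (simp add: mult_left_mono prod_nonneg)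
qed

lemma integrable_gdom_bound:
  assumes f: "f \<in> borel_measurable (Rn n)" and a: "\<And>i. i \<in> {1..n} \<Longrightarrow> a i > 0" and Q: "Q \<ge> 0"
    and b: "\<And>y. norm (f y :: complex) \<le> C * (\<Prod>i=1..n. gdom (a i) Q (y i))"
  shows "integrable (Rn n) f"
proof (rule Bochner_Integration.integrable_bound)
  show "integrable (Rn n) (\<lambda>y. C * (\<Prod>i=1..n. gdom (a i) Q (y i)))"
    using a Q by (intro integrable_mult_right lb.product_integrable_prod integrable_gdom) auto
  show "AE y in Rn n. norm (f y) \<le> norm (C * (\<Prod>i=1..n. gdom (a i) Q (y i)))"
    by (rule AE_I2) (rule order_trans[OF b], simp)
qed (rule f)

text \<open>The quotient \<open>cpw (y i) a / y i\<close> is y_i^(a - 1); it is left in this form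
  because it arises from a power of exponent \<open>a\<close> and a simple pole.\<close>

definition lagI :: "nat \<Rightarrow> complex \<Rightarrow> complex \<Rightarrow> (nat \<Rightarrow> real) \<Rightarrow> complex" where
  "lagI n a \<gamma> y = (if (\<forall>i\<in>{1..n}. 0 \<le> y i) \<and> (\<forall>i\<in>{1..n}. \<forall>j\<in>{1..n}. i < j \<longrightarrow> y i \<le> y j)
     then (\<Prod>i=1..n. cpw (y i) a / of_real (y i) * of_real (exp (- y i))) * vdm n \<gamma> y else 0)"

definition Lag :: "nat \<Rightarrow> complex \<Rightarrow> complex \<Rightarrow> complex" where
  "Lag n a \<gamma> = (\<integral>y. lagI n a \<gamma> y \<partial>Rn n)"

text \<open>The shape of the limiting integrand: variables with the same value of \<sigma> are
  ordered and interact, the others are independent.\<close>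

definition grpI :: "nat \<Rightarrow> (nat \<Rightarrow> nat) \<Rightarrow> (nat \<Rightarrow> complex) \<Rightarrow> complex \<Rightarrow> (nat \<Rightarrow> real) \<Rightarrow> complex" where
  "grpI n \<sigma> \<alpha> \<gamma> y = (if (\<forall>i\<in>{1..n}. 0 \<le> y i) \<and> (\<forall>i\<in>{1..n}. \<forall>j\<in>{1..n}. i < j \<and> \<sigma> i = \<sigma> j \<longrightarrow> y i \<le> y j)
     then (\<Prod>i=1..n. cpw (y i) (\<alpha> (\<sigma> i)) / of_real (y i) * of_real (exp (- y i)))
       * (\<Prod>i=1..n. \<Prod>j\<in>{i<..n}. if \<sigma> i = \<sigma> j then cpw (y j - y i) (2 * \<gamma>) else 1) else 0)"

lemma lagI_eq_grpI: "lagI n a \<gamma> y = grpI n (\<lambda>_. 0) (\<lambda>_. a) \<gamma> y"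
  unfolding lagI_def grpI_def vdm_def by (simp only: simp_thms if_True)

lemma pred_finite_pairs:
  assumes "\<And>i j. i \<in> {1..n} \<Longrightarrow> j \<in> {1..n} \<Longrightarrow> Q i j \<Longrightarrow> Measurable.pred (Rn n) (P i j)"
  shows "Measurable.pred (Rn n) (\<lambda>y. \<forall>i\<in>{1..n::nat}. \<forall>j\<in>{1..n::nat}. Q i j \<longrightarrow> P i j y)"
proof (rule pred_intros_finite(3)[OF _ pred_intros_finite(3)])
  fix i j assume "i \<in> {1..n}" "j \<in> {1..n}"
  then show "Measurable.pred (Rn n) (\<lambda>y. Q i j \<longrightarrow> P i j y)" using assms[of i j] by (cases "Q i j") auto
qed auto

lemma pred_le_components: "i \<in> {1..n} \<Longrightarrow> j \<in> {1..n} \<Longrightarrow> Measurable.pred (Rn n) (\<lambda>y. y i \<le> y j)"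
  unfolding pred_def by (rule borel_measurable_le[OF Rn_component Rn_component])

lemma measurable_grpI [measurable]: "grpI n \<sigma> \<alpha> \<gamma> \<in> borel_measurable (Rn n)"
proof -
  have c: "(\<lambda>y. y i) \<in> borel_measurable (Rn n)" if "i \<in> {1..n}" for i by (rule Rn_component[OF that])
  have p1: "Measurable.pred (Rn n) (\<lambda>y. \<forall>i\<in>{1..n}. 0 \<le> y i)"
  proof (rule pred_intros_finite(3))
    fix i assume "i \<in> {1..n}"
    then show "Measurable.pred (Rn n) (\<lambda>y. 0 \<le> y i)" unfolding pred_def by (intro borel_measurable_le c borel_measurable_const)
  qed simp
  have p2: "Measurable.pred (Rn n) (\<lambda>y. \<forall>i\<in>{1..n}. \<forall>j\<in>{1..n}. i < j \<and> \<sigma> i = \<sigma> j \<longrightarrow> y i \<le> y j)"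
    by (rule pred_finite_pairs) (rule pred_le_components)
  have f1: "(\<lambda>y. \<Prod>i=1..n. cpw (y i) (\<alpha> (\<sigma> i)) / of_real (y i) * of_real (exp (- y i))) \<in> borel_measurable (Rn n)"
  proof (rule borel_measurable_prod)
    fix i assume "i \<in> {1..n}"
    note [measurable] = c[OF this]
    show "(\<lambda>y. cpw (y i) (\<alpha> (\<sigma> i)) / of_real (y i) * of_real (exp (- y i))) \<in> borel_measurable (Rn n)" by measurable
  qed
  have f2: "(\<lambda>y. \<Prod>i=1..n. \<Prod>j\<in>{i<..n}. if \<sigma> i = \<sigma> j then cpw (y j - y i) (2 * \<gamma>) else 1) \<in> borel_measurable (Rn n)"
  proof (intro borel_measurable_prod)
    fix i j assume "i \<in> {1..n}" "j \<in> {i<..n}"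
    then have [measurable]: "(\<lambda>y. y i) \<in> borel_measurable (Rn n)" "(\<lambda>y. y j) \<in> borel_measurable (Rn n)" by (auto intro: c)
    show "(\<lambda>y. if \<sigma> i = \<sigma> j then cpw (y j - y i) (2 * \<gamma>) else 1) \<in> borel_measurable (Rn n)" by measurable
  qed
  show ?thesis unfolding grpI_def
    by (rule measurable_If[OF borel_measurable_times[OF f1 f2] borel_measurable_const pred_intros_logic(3)[OF p1 p2, unfolded pred_def]])
qed

lemma measurable_lagI [measurable]: "lagI n a \<gamma> \<in> borel_measurable (Rn n)"
proof -
  have "lagI n a \<gamma> = grpI n (\<lambda>_. 0) (\<lambda>_. a) \<gamma>" by (rule ext) (rule lagI_eq_grpI)
  then show ?thesis using measurable_grpI by metis
qed

lemma cpw_diff_bound: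
  assumes "x \<ge> 0" "y \<ge> 0" "Re \<gamma> > 0"
  shows "norm (cpw (y - x) (2 * \<gamma>)) \<le> ((1 + x) * (1 + y)) powr (2 * Re \<gamma>)"
proof -
  have "\<bar>y - x\<bar> \<le> (1 + x) * (1 + y)"
  proof -
    have "\<bar>y - x\<bar> \<le> x + y" using assms by auto
    also have "\<dots> \<le> (1 + x) * (1 + y)" using assms by (simp add: algebra_simps)
    finally show ?thesis .
  qed
  then show ?thesis unfolding norm_cpw using assms by (simp add: powr_mono2)
qed

lemma grpI_bound:
  assumes a: "\<And>i. i \<in> {1..n} \<Longrightarrow> Re (\<alpha> (\<sigma> i)) > 0" and g: "Re \<gamma> > 0"
  shows "norm (grpI n \<sigma> \<alpha> \<gamma> y) \<le> 1 * (\<Prod>i=1..n. gdom (Re (\<alpha> (\<sigma> i))) (2 * Re \<gamma> * of_nat (n * n)) (y i))"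
proof (cases "(\<forall>i\<in>{1..n}. 0 \<le> y i) \<and> (\<forall>i\<in>{1..n}. \<forall>j\<in>{1..n}. i < j \<and> \<sigma> i = \<sigma> j \<longrightarrow> y i \<le> y j)")
  case False
  then show ?thesis unfolding grpI_def if_not_P[OF False] by (simp add: prod_nonneg gdom_nonneg)
next
  case True
  then have y: "y i \<ge> 0" if "i \<in> {1..n}" for i using that by simp
  have "norm (\<Prod>i=1..n. \<Prod>j\<in>{i<..n}. if \<sigma> i = \<sigma> j then cpw (y j - y i) (2 * \<gamma>) else 1)
     \<le> (\<Prod>i=1..n. \<Prod>j\<in>{i<..n}. 1) * (\<Prod>k=1..n. (1 + y k) powr (2 * Re \<gamma> * of_nat (n * n)))"
  proof (rule prod_pairs_bound)
    fix i j assume ij: "i \<in> {1..n}" "j \<in> {i<..n}"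
    then have yij: "y i \<ge> 0" "y j \<ge> 0" using y by auto
    have "1 \<le> ((1 + y i) * (1 + y j)) powr (2 * Re \<gamma>)"
    proof (rule ge_one_powr_ge_zero)
      show "1 \<le> (1 + y i) * (1 + y j)" using yij by (simp add: algebra_simps)
    qed (use g in simp)
    then show "norm (if \<sigma> i = \<sigma> j then cpw (y j - y i) (2 * \<gamma>) else 1) \<le> 1 * ((1 + y i) * (1 + y j)) powr (2 * Re \<gamma>)"
      using cpw_diff_bound[OF yij g] by simp
  qed (use y g in auto)
  moreover have "norm (\<Prod>i=1..n. cpw (y i) (\<alpha> (\<sigma> i)) / of_real (y i) * of_real (exp (- y i))) = (\<Prod>i=1..n. y i powr (Re (\<alpha> (\<sigma> i)) - 1) * exp (- y i))"
    unfolding prod_norm[symmetric]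
  proof (rule prod.cong[OF refl])
    fix i assume "i \<in> {1..n}"
    then show "norm (cpw (y i) (\<alpha> (\<sigma> i)) / of_real (y i) * of_real (exp (- y i))) = y i powr (Re (\<alpha> (\<sigma> i)) - 1) * exp (- y i)"
      using y[of i] by (cases "y i = 0") (auto simp: norm_mult norm_divide norm_cpw powr_diff)
  qed
  ultimately have "norm (grpI n \<sigma> \<alpha> \<gamma> y) \<le> (\<Prod>i=1..n. y i powr (Re (\<alpha> (\<sigma> i)) - 1) * exp (- y i)) * (\<Prod>k=1..n. (1 + y k) powr (2 * Re \<gamma> * of_nat (n * n)))"
    unfolding grpI_def if_P[OF True] norm_mult by (intro mult_mono) (auto intro!: prod_nonneg)
  also have "\<dots> = (\<Prod>i=1..n. gdom (Re (\<alpha> (\<sigma> i))) (2 * Re \<gamma> * of_nat (n * n)) (y i))"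
    unfolding prod.distrib[symmetric] gdom_def using y by (intro prod.cong refl) (simp add: mult_ac)
  finally show ?thesis by simp
qed

lemma integrable_grpI:
  assumes a: "\<And>i. i \<in> {1..n} \<Longrightarrow> Re (\<alpha> (\<sigma> i)) > 0" and g: "Re \<gamma> > 0"
  shows "integrable (Rn n) (grpI n \<sigma> \<alpha> \<gamma>)"
proof (rule integrable_gdom_bound[where a="\<lambda>i. Re (\<alpha> (\<sigma> i))"])
  show "norm (grpI n \<sigma> \<alpha> \<gamma> y) \<le> 1 * (\<Prod>i=1..n. gdom (Re (\<alpha> (\<sigma> i))) (2 * Re \<gamma> * of_nat (n * n)) (y i))" for y
    by (rule grpI_bound) (use a g in auto)
  show "grpI n \<sigma> \<alpha> \<gamma> \<in> borel_measurable (Rn n)" by (rule measurable_grpI)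
qed (use a g in auto)

text \<open>Induction on the number of blocks: the last block is split off by Fubini. Pairs that
  meet both parts have different sites, so they impose no inequality and contribute the factor
  1.\<close>

lemma integral_grpI:
  assumes "l \<in> Zset n q" "\<And>s. s \<in> {1..q} \<Longrightarrow> Re (\<alpha> s) > 0" and g: "Re \<gamma> > 0"
  shows "(\<integral>y. grpI n (site l) \<alpha> \<gamma> y \<partial>Rn n) = (\<Prod>s=1..q. Lag (l s) (\<alpha> s) \<gamma>)"
  using assms(1,2)
proof (induction q arbitrary: l n)
  case 0
  then have "n = 0" by (auto simp: Zset_def)
  moreover have "grpI 0 (site l) \<alpha> \<gamma> = (\<lambda>x. \<Prod>i\<in>({}::nat set). 1)" by (simp add: grpI_def fun_eq_iff)
  moreover have "(\<integral>x. (\<Prod>i\<in>({}::nat set). 1) \<partial>PiM ({}::nat set) (\<lambda>_. lborel :: real measure)) = (1::complex)"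
    using lb.product_integral_prod[of "{}" "\<lambda>_ _. 1 :: complex"] by simp
  ultimately show ?case by simp
next
  case (Suc q)
  note l = Suc.prems(1)
  define k where "k = l (Suc q)"
  define n' where "n' = psum l q"
  define l' where "l' = l(Suc q := 0)"
  have nn: "n = n' + k" using psum_Zset[OF l] by (simp add: psum_Suc n'_def k_def)
  have ps: "psum l' s = psum l s" if "s \<le> q" for s
    unfolding psum_def l'_def using that by (intro sum.cong) auto
  have l': "l' \<in> Zset n' q"
  proof -
    have "l' i = 0" if "i \<notin> {1..q}" for i using l that unfolding Zset_def l'_def by (cases "i = Suc q") auto
    moreover have "(\<Sum>i=1..q. l' i) = n'" using ps[of q] by (simp add: n'_def psum_def)
    ultimately show ?thesis by (simp add: Zset_def)
  qed
  have site1: "site l i = site l' i" if "i \<in> {1..n'}" for i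
  proof -
    have "site l' i \<in> {1..q}" by (rule site_range[OF l' that])
    moreover from this have "i \<in> Gam l' (site l' i)" using Gam_eq_site[OF l'] that by auto
    ultimately have "i \<in> Gam l (site l' i)" using ps by (auto simp: Gam_def)
    then show ?thesis using site_iff[of i l "Suc q" "site l' i"] that \<open>site l' i \<in> {1..q}\<close> psum_Zset[OF l] nn by auto
  qed
  have site1': "site l i \<in> {1..q}" if "i \<in> {1..n'}" for i using site1[OF that] site_range[OF l' that] by simp
  have site2: "site l i = Suc q" if "i \<in> {n'+1..n}" for i
    using site_iff[of i l "Suc q" "Suc q"] that psum_Zset[OF l] by (auto simp: Gam_def n'_def)
  let ?I = "{1..n'}" and ?J = "{n'+1..n}"
  have U: "{1..n} = ?I \<union> ?J" and D: "?I \<inter> ?J = {}" using nn by auto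
  have a: "Re (\<alpha> (site l i)) > 0" if "i \<in> {1..n}" for i using Suc.prems(2) site_range[OF l that] by simp
  have split: "grpI n (site l) \<alpha> \<gamma> (merge ?I ?J (x, y)) = grpI n' (site l') \<alpha> \<gamma> x * lagI k (\<alpha> (Suc q)) \<gamma> (\<lambda>j. y (n' + j))" for x y
  proof -
    let ?m = "merge ?I ?J (x, y)"
    have m1: "?m i = x i" if "i \<in> ?I" for i using that by (simp add: merge_def)
    have m2: "?m i = y i" if "i \<in> ?J" for i using that by (auto simp: merge_def)
    have sh: "j \<in> {1..k} \<longleftrightarrow> n' + j \<in> ?J" for j using nn by auto
    have shift: "(\<forall>i\<in>?J. P i) \<longleftrightarrow> (\<forall>j\<in>{1..k}. P (n' + j))" for P
    proof
      assume *: "\<forall>j\<in>{1..k}. P (n' + j)"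
      show "\<forall>i\<in>?J. P i"
      proof
        fix i assume "i \<in> ?J"
        then have "i - n' \<in> {1..k}" "n' + (i - n') = i" using nn by auto
        then show "P i" using * by metis
      qed
    qed (use nn in auto)
    have pshift: "(\<Prod>i\<in>?J. f i) = (\<Prod>j=1..k. f (n' + j))" for f :: "nat \<Rightarrow> complex"
      by (rule prod.reindex_bij_witness[where i="\<lambda>j. n' + j" and j="\<lambda>i. i - n'"]) (use nn in auto)
    have c1: "(\<forall>i\<in>{1..n}. 0 \<le> ?m i) \<longleftrightarrow> (\<forall>i\<in>?I. 0 \<le> x i) \<and> (\<forall>j\<in>{1..k}. 0 \<le> y (n' + j))"
    proof -
      have "(\<forall>j\<in>{1..k}. 0 \<le> y (n' + j)) \<longleftrightarrow> (\<forall>i\<in>?J. 0 \<le> y i)" by (rule shift[symmetric])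
      then show ?thesis unfolding U ball_Un using m1 m2 by simp
    qed
    have c2: "(\<forall>i\<in>{1..n}. \<forall>j\<in>{1..n}. i < j \<and> site l i = site l j \<longrightarrow> ?m i \<le> ?m j)
       \<longleftrightarrow> (\<forall>i\<in>?I. \<forall>j\<in>?I. i < j \<and> site l' i = site l' j \<longrightarrow> x i \<le> x j) \<and> (\<forall>i\<in>{1..k}. \<forall>j\<in>{1..k}. i < j \<longrightarrow> y (n' + i) \<le> y (n' + j))"
    proof -
      have A: "(\<forall>i\<in>?I. \<forall>j\<in>?I. i < j \<and> site l i = site l j \<longrightarrow> ?m i \<le> ?m j) \<longleftrightarrow> (\<forall>i\<in>?I. \<forall>j\<in>?I. i < j \<and> site l' i = site l' j \<longrightarrow> x i \<le> x j)"
        by (intro ball_cong refl) (simp only: m1 site1)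
      have B: "\<forall>i\<in>?I. \<forall>j\<in>?J. i < j \<and> site l i = site l j \<longrightarrow> ?m i \<le> ?m j"
        using site1' site2 by fastforce
      have C: "\<forall>i\<in>?J. \<forall>j\<in>?I. i < j \<and> site l i = site l j \<longrightarrow> ?m i \<le> ?m j" by auto
      have *: "(\<forall>i\<in>?J. \<forall>j\<in>?J. i < j \<and> site l i = site l j \<longrightarrow> ?m i \<le> ?m j) \<longleftrightarrow> (\<forall>i\<in>?J. \<forall>j\<in>?J. i < j \<longrightarrow> y i \<le> y j)"
        by (intro ball_cong refl) (simp only: m2 site2, simp)
      have D: "(\<forall>i\<in>?J. \<forall>j\<in>?J. i < j \<and> site l i = site l j \<longrightarrow> ?m i \<le> ?m j) \<longleftrightarrow> (\<forall>i\<in>{1..k}. \<forall>j\<in>{1..k}. i < j \<longrightarrow> y (n' + i) \<le> y (n' + j))"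
      proof -
        have "(\<forall>i\<in>?J. \<forall>j\<in>?J. i < j \<longrightarrow> y i \<le> y j) \<longleftrightarrow> (\<forall>i\<in>{1..k}. \<forall>j\<in>?J. n' + i < j \<longrightarrow> y (n' + i) \<le> y j)" by (rule shift)
        moreover have "(\<forall>j\<in>?J. n' + i < j \<longrightarrow> y (n' + i) \<le> y j) \<longleftrightarrow> (\<forall>j\<in>{1..k}. n' + i < n' + j \<longrightarrow> y (n' + i) \<le> y (n' + j))" for i
          by (rule shift)
        ultimately show ?thesis using * by simp
      qed
      have gen: "X = X' \<Longrightarrow> B' \<Longrightarrow> C' \<Longrightarrow> Y = Y' \<Longrightarrow> ((X \<and> C') \<and> (B' \<and> Y)) = (X' \<and> Y')" for X X' B' C' Y Y' by simp
      show ?thesis unfolding U ball_Un ball_conj_distrib by (rule gen[OF A B C D])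
    qed
    have p1: "(\<Prod>i=1..n. cpw (?m i) (\<alpha> (site l i)) / of_real (?m i) * of_real (exp (- ?m i)))
       = (\<Prod>i\<in>?I. cpw (x i) (\<alpha> (site l' i)) / of_real (x i) * of_real (exp (- x i)))
        * (\<Prod>j=1..k. cpw (y (n' + j)) (\<alpha> (Suc q)) / of_real (y (n' + j)) * of_real (exp (- y (n' + j))))"
    proof -
      have "(\<Prod>i=1..n. cpw (?m i) (\<alpha> (site l i)) / of_real (?m i) * of_real (exp (- ?m i)))
       = (\<Prod>i\<in>?I. cpw (?m i) (\<alpha> (site l i)) / of_real (?m i) * of_real (exp (- ?m i))) * (\<Prod>i\<in>?J. cpw (?m i) (\<alpha> (site l i)) / of_real (?m i) * of_real (exp (- ?m i)))"
        unfolding U by (rule prod.union_disjoint) (use D in auto)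
      also have "(\<Prod>i\<in>?I. cpw (?m i) (\<alpha> (site l i)) / of_real (?m i) * of_real (exp (- ?m i))) = (\<Prod>i\<in>?I. cpw (x i) (\<alpha> (site l' i)) / of_real (x i) * of_real (exp (- x i)))"
        by (intro prod.cong refl) (simp only: m1 site1)
      also have "(\<Prod>i\<in>?J. cpw (?m i) (\<alpha> (site l i)) / of_real (?m i) * of_real (exp (- ?m i))) = (\<Prod>i\<in>?J. cpw (y i) (\<alpha> (Suc q)) / of_real (y i) * of_real (exp (- y i)))"
        by (intro prod.cong refl) (simp only: m2 site2)
      finally show ?thesis unfolding pshift .
    qed
    let ?B = "\<lambda>m s i j. if s i = s j then cpw (m j - m i) (2 * \<gamma>) else (1::complex)"
    have p2: "(\<Prod>i=1..n. \<Prod>j\<in>{i<..n}. ?B ?m (site l) i j)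
       = (\<Prod>i\<in>?I. \<Prod>j\<in>{i<..n'}. ?B x (site l') i j) * vdm k \<gamma> (\<lambda>j. y (n' + j))"
    proof -
      have "(\<Prod>i=1..n. \<Prod>j\<in>{i<..n}. ?B ?m (site l) i j) = (\<Prod>i\<in>?I. \<Prod>j\<in>{i<..n}. ?B ?m (site l) i j) * (\<Prod>i\<in>?J. \<Prod>j\<in>{i<..n}. ?B ?m (site l) i j)"
        unfolding U by (rule prod.union_disjoint) (use D in auto)
      also have "(\<Prod>i\<in>?I. \<Prod>j\<in>{i<..n}. ?B ?m (site l) i j) = (\<Prod>i\<in>?I. \<Prod>j\<in>{i<..n'}. ?B x (site l') i j)"
      proof (rule prod.cong[OF refl])
        fix i assume i: "i \<in> ?I"
        have "(\<Prod>j\<in>{i<..n}. ?B ?m (site l) i j) = (\<Prod>j\<in>{i<..n'}. ?B ?m (site l) i j)"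
        proof (rule prod.mono_neutral_right)
          show "\<forall>j\<in>{i<..n} - {i<..n'}. ?B ?m (site l) i j = 1"
          proof
            fix j assume "j \<in> {i<..n} - {i<..n'}"
            then have "j \<in> ?J" by auto
            then show "?B ?m (site l) i j = 1" using site1'[OF i] site2[of j] by auto
          qed
        qed (use nn in auto)
        also have "\<dots> = (\<Prod>j\<in>{i<..n'}. ?B x (site l') i j)"
        proof (rule prod.cong[OF refl])
          fix j assume "j \<in> {i<..n'}"
          then have "j \<in> ?I" using i by auto
          then show "?B ?m (site l) i j = ?B x (site l') i j" by (simp only: m1 site1 i)
        qed
        finally show "(\<Prod>j\<in>{i<..n}. ?B ?m (site l) i j) = (\<Prod>j\<in>{i<..n'}. ?B x (site l') i j)" .
      qed
      also have "(\<Prod>i\<in>?J. \<Prod>j\<in>{i<..n}. ?B ?m (site l) i j) = vdm k \<gamma> (\<lambda>j. y (n' + j))"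
        unfolding vdm_def pshift
      proof (rule prod.cong[OF refl])
        fix i assume i: "i \<in> {1..k}"
        then have iJ: "n' + i \<in> ?J" using sh by blast
        show "(\<Prod>j\<in>{n' + i<..n}. ?B ?m (site l) (n' + i) j) = (\<Prod>j\<in>{i<..k}. cpw (y (n' + j) - y (n' + i)) (2 * \<gamma>))"
        proof (rule prod.reindex_bij_witness[where i="\<lambda>j. n' + j" and j="\<lambda>i. i - n'"])
          fix j assume "j \<in> {n' + i<..n}"
          then have "j \<in> ?J" by auto
          then show "cpw (y (n' + (j - n')) - y (n' + i)) (2 * \<gamma>) = ?B ?m (site l) (n' + i) j"
            using m2[OF iJ] m2[of j] site2[OF iJ] site2[of j] by simp
        qed (use nn in auto)
      qed
      finally show ?thesis .
    qed
    have gen: "(if (P1 \<and> P2) \<and> (Q1 \<and> Q2) then (u * v) * (u' * v') else 0) = (if P1 \<and> Q1 then u * u' else 0) * (if P2 \<and> Q2 then v * v' else 0)"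
      for P1 P2 Q1 Q2 and u u' v v' :: complex by simp
    show ?thesis unfolding grpI_def[of n] c1 c2 p1 p2 grpI_def[of n'] lagI_def by (rule gen)
  qed
  have "(\<integral>y. grpI n (site l) \<alpha> \<gamma> y \<partial>Rn n) = (\<integral>y. grpI n (site l) \<alpha> \<gamma> y \<partial>PiM (?I \<union> ?J) (\<lambda>_. lborel))" unfolding U ..
  also have "\<dots> = (\<integral>x. (\<integral>y. grpI n (site l) \<alpha> \<gamma> (merge ?I ?J (x, y)) \<partial>PiM ?J (\<lambda>_. lborel)) \<partial>PiM ?I (\<lambda>_. lborel))"
  proof (rule lb.product_integral_fold[OF D])
    show "integrable (PiM (?I \<union> ?J) (\<lambda>_. lborel)) (grpI n (site l) \<alpha> \<gamma>)"
      unfolding U[symmetric] by (rule integrable_grpI[OF _ g]) (rule a)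
  qed auto
  also have "\<dots> = (\<integral>x. grpI n' (site l') \<alpha> \<gamma> x \<partial>Rn n') * (\<integral>y. lagI k (\<alpha> (Suc q)) \<gamma> (\<lambda>j. y (n' + j)) \<partial>PiM ?J (\<lambda>_. lborel))"
    unfolding split by simp
  also have "(\<integral>y. lagI k (\<alpha> (Suc q)) \<gamma> (\<lambda>j. y (n' + j)) \<partial>PiM ?J (\<lambda>_. lborel)) = Lag k (\<alpha> (Suc q)) \<gamma>"
  proof -
    have bij: "bij_betw (\<lambda>j. n' + j) {1..k} ?J"
      by (rule bij_betw_byWitness[where f'="\<lambda>i. i - n'"]) (use nn in auto)
    have lm: "lagI k (\<alpha> (Suc q)) \<gamma> \<in> borel_measurable (Rn k)" by (rule measurable_lagI)
    have "Lag k (\<alpha> (Suc q)) \<gamma> = of_real (\<Prod>j\<in>{1..k}. \<bar>1\<bar>) * (\<integral>y. lagI k (\<alpha> (Suc q)) \<gamma> (\<lambda>j\<in>{1..k}. 0 + 1 * y (n' + j)) \<partial>PiM ?J (\<lambda>_. lborel))"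
      unfolding Lag_def by (rule integral_PiM_affine[OF bij _ _ lm]) auto
    also have "(\<lambda>y. lagI k (\<alpha> (Suc q)) \<gamma> (\<lambda>j\<in>{1..k}. 0 + 1 * y (n' + j))) = (\<lambda>y. lagI k (\<alpha> (Suc q)) \<gamma> (\<lambda>j. y (n' + j)))"
      unfolding lagI_def vdm_def by (intro ext if_cong conj_cong ball_cong arg_cong2[of _ _ _ _ "(*)"] prod.cong refl) auto
    finally show ?thesis by simp
  qed
  also have "(\<integral>x. grpI n' (site l') \<alpha> \<gamma> x \<partial>Rn n') = (\<Prod>s=1..q. Lag (l' s) (\<alpha> s) \<gamma>)"
    using Suc.prems(2) by (intro Suc.IH[OF l']) auto
  also have "(\<Prod>s=1..q. Lag (l' s) (\<alpha> s) \<gamma>) = (\<Prod>s=1..q. Lag (l s) (\<alpha> s) \<gamma>)" by (intro prod.cong refl) (auto simp: l'_def)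
  finally show ?case by (simp add: k_def)
qed

lemma powr_times_power_tendsto_0:
  fixes a x :: real
  assumes "0 < x" "x < 1"
  shows "(\<lambda>k. real (Suc k) powr a * x ^ Suc k) \<longlonglongrightarrow> 0"
proof -
  define b where "b = - ln x"
  have b: "b > 0" using assms by (simp add: b_def)
  have "(\<lambda>k. real (Suc k) powr a * exp (- b * real (Suc k))) \<longlonglongrightarrow> 0" using b by real_asymp
  moreover have "exp (- b * real (Suc k)) = x ^ Suc k" for k
    using assms exp_of_nat_mult[of "Suc k" "ln x"] by (simp add: b_def mult.commute del: of_nat_Suc)
  ultimately show ?thesis by simp
qed

lemma power_le_exp: "0 \<le> y \<Longrightarrow> y \<le> real K \<Longrightarrow> K > 0 \<Longrightarrow> (1 - y / real K) ^ K \<le> exp (- y)"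
proof -
  assume y: "0 \<le> y" "y \<le> real K" "K > 0"
  have "(1 - y / real K) ^ K \<le> exp (- (y / real K)) ^ K"
    using y exp_ge_add_one_self[of "- (y / real K)"] by (intro power_mono) (auto simp: divide_le_eq_1)
  also have "\<dots> = exp (- y)" using y exp_of_nat_mult[of K "- (y / real K)"] by simp
  finally show ?thesis .
qed

context conf
begin

section \<open>Letting the last exponent tend to infinity\<close>

definition cs :: "nat \<Rightarrow> real" where "cs s = z p - z s"

lemma cs_pos: "s \<in> {1..p-1} \<Longrightarrow> cs s > 0"
  using z_less[of s p] by (auto simp: cs_def)

lemma gap_exists: "\<exists>d>0. \<forall>s\<in>{1..<p}. 2 * d \<le> z (s + 1) - z s"
proof -
  define d where "d = Min ((\<lambda>s. (z (s + 1) - z s) / 2) ` {1..<p})"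
  have ne: "(\<lambda>s. (z (s + 1) - z s) / 2) ` {1..<p} \<noteq> {}" using p2 by auto
  have "d \<in> (\<lambda>s. (z (s + 1) - z s) / 2) ` {1..<p}" unfolding d_def using ne by (intro Min_in) auto
  then have "d > 0" using zinc by auto
  moreover have "2 * d \<le> z (s + 1) - z s" if "s \<in> {1..<p}" for s
  proof -
    have "d \<le> (z (s + 1) - z s) / 2" unfolding d_def using that by (intro Min_le) auto
    then show ?thesis by simp
  qed
  ultimately show ?thesis by blast
qed

definition gap :: real where "gap = (SOME d. d > 0 \<and> (\<forall>s\<in>{1..<p}. 2 * d \<le> z (s + 1) - z s))"

lemma gap: "gap > 0" "s \<in> {1..<p} \<Longrightarrow> 2 * gap \<le> z (s + 1) - z s"
  using someI_ex[OF gap_exists[unfolded Bex_def]] unfolding gap_def by auto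

lemma gap_sep: "1 \<le> r \<Longrightarrow> r < s \<Longrightarrow> s \<le> p \<Longrightarrow> 2 * gap \<le> z s - z r"
  using gap(2)[of r] z_le[of "r + 1" s] by auto

text \<open>As \<open>cs s\<close> is at most \<open>z p - z 1\<close>, a variable within
  \<open>rel * cs s\<close> to the right of z_s is within \<open>gap\<close> of it, hence still at
  distance at least \<open>gap\<close> from all other z_r.\<close>

definition rel :: real where "rel = gap / (z p - z 1)"

lemma rel: "0 < rel" "rel \<le> 1 / 2" "s \<in> {1..p-1} \<Longrightarrow> rel * cs s \<le> gap"
proof -
  have L: "z p - z 1 > 0" using z1p by simp
  show "0 < rel" using gap(1) L by (simp add: rel_def)
  have "2 * gap \<le> z p - z 1" using gap_sep[of 1 p] p2 by simp
  then show "rel \<le> 1 / 2" using L by (simp add: rel_def field_simps)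
  assume s: "s \<in> {1..p-1}"
  have "cs s \<le> z p - z 1" using z_le[of 1 s] s by (auto simp: cs_def)
  then have "gap * cs s \<le> gap * (z p - z 1)" using gap(1) by (intro mult_left_mono) auto
  then show "rel * cs s \<le> gap" using L by (simp add: rel_def field_simps)
qed

lemma near_away:
  assumes s: "s \<in> {1..p-1}" and t: "z s \<le> t" "t \<le> z s + rel * cs s" and r: "r \<in> {1..p}" "r \<noteq> s"
  shows "gap \<le> \<bar>t - z r\<bar>" "\<bar>t - z r\<bar> \<le> z p - z 1"
proof -
  have t2: "t \<le> z s + gap" using t rel(3)[OF s] by linarith
  show "gap \<le> \<bar>t - z r\<bar>"
  proof (cases "r < s")
    case True
    then have "2 * gap \<le> z s - z r" using r s by (intro gap_sep) auto
    then show ?thesis using t gap(1) by linarith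
  next
    case False
    then have "2 * gap \<le> z r - z s" using r s by (intro gap_sep) auto
    then show ?thesis using t2 gap(1) by linarith
  qed
  have "z 1 \<le> z s" "z 1 \<le> z r" "z r \<le> z p" using s r by (auto intro!: z_le)
  moreover have "2 * gap \<le> z p - z s" using s p2 by (intro gap_sep) auto
  then have "t \<le> z p" using t2 gap(1) by linarith
  ultimately show "\<bar>t - z r\<bar> \<le> z p - z 1" using t by auto
qed

text \<open>The part of the domain on which the substitution \<open>t\<^sub>i = z\<^sub>s + c\<^sub>s y\<^sub>i / K\<close> is made; outside it the integral decays geometrically in \<open>K\<close>.\<close>

definition nearN :: "(nat \<Rightarrow> nat) \<Rightarrow> (nat \<Rightarrow> real) \<Rightarrow> bool" where
  "nearN l t \<longleftrightarrow> (\<forall>i\<in>{1..n}. t i \<le> z (site l i) + rel * cs (site l i))"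

lemma measurable_nearN [measurable]: "Measurable.pred (Rn n) (nearN l)"
  unfolding nearN_def
proof (rule pred_intros_finite(3))
  fix i assume "i \<in> {1..n}"
  then show "Measurable.pred (Rn n) (\<lambda>t. t i \<le> z (site l i) + rel * cs (site l i))"
    unfolding pred_def by (intro borel_measurable_le Rn_component borel_measurable_const)
qed simp

text \<open>The scaling weight of the integrand near the corner of the domain: a variable
  contributes the exponent at its own site, a pair in one block contributes 2 \<gamma>. The Jacobian
  K^(-n) is compensated by one pole per variable.\<close>

definition expo :: "(nat \<Rightarrow> nat) \<Rightarrow> complex" where
  "expo l = (\<Sum>i=1..n. \<alpha> (site l i)) + (\<Sum>i=1..n. \<Sum>j\<in>{i<..n}. if site l i = site l j then 2 * \<gamma> else 0)"

text \<open>The normalised integrand for last exponent \<alpha>_p + K, in which variable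
  \<open>i\<close> has its pole at the point number \<open>\<tau> i\<close>. Dividing by
  \<open>cs\<close> makes the quotient equal to 1 at the left end of the interval of t_i.\<close>

definition scaledI :: "(nat \<Rightarrow> nat) \<Rightarrow> (nat \<Rightarrow> nat) \<Rightarrow> nat \<Rightarrow> (nat \<Rightarrow> real) \<Rightarrow> complex" where
  "scaledI l \<tau> K t = cpw (real K) (expo l) * (Psi n p z \<alpha> \<gamma> t *
     (\<Prod>i=1..n. of_real (((z p - t i) / cs (site l i)) ^ K) * (1 / of_real (t i - z (\<tau> i)))))"

context
  fixes l \<tau> :: "nat \<Rightarrow> nat"
  assumes l: "l \<in> Zset n (p - 1)" and \<tau>: "\<And>i. i \<in> {1..n} \<Longrightarrow> \<tau> i \<in> {1..p-1}"
begin

lemma site_in: "i \<in> {1..n} \<Longrightarrow> site l i \<in> {1..p-1}"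
  by (rule site_range[OF l])

lemma frac_bounds:
  assumes "inU l t" "i \<in> {1..n}"
  shows "0 \<le> (z p - t i) / cs (site l i)" "(z p - t i) / cs (site l i) \<le> 1"
proof -
  have c: "cs (site l i) > 0" by (rule cs_pos[OF site_in[OF assms(2)]])
  show "0 \<le> (z p - t i) / cs (site l i)" using inU_range(2)[OF l assms] c by simp
  have "z (site l i) \<le> t i" using inU_bounds[OF assms] by simp
  then show "(z p - t i) / cs (site l i) \<le> 1" using c by (simp add: cs_def)
qed

lemma measurable_poles:
  "(\<lambda>t. \<Prod>i=1..n. of_real (((z p - t i) / cs (site l i)) ^ K) * (1 / of_real (t i - z (\<tau> i))) :: complex) \<in> borel_measurable (Rn n)"
proof (rule borel_measurable_prod)
  fix i assume "i \<in> {1..n}"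
  note [measurable] = Rn_component[OF this]
  show "(\<lambda>t. of_real (((z p - t i) / cs (site l i)) ^ K) * (1 / of_real (t i - z (\<tau> i))) :: complex) \<in> borel_measurable (Rn n)"
    by measurable
qed

lemma measurable_scaledI: "scaledI l \<tau> K \<in> borel_measurable (Rn n)"
  unfolding scaledI_def using measurable_poles by measurable

lemma scaledI_norm_le:
  assumes "inU l t"
  shows "norm (scaledI l \<tau> K t) \<le> norm (cpw (real K) (expo l)) * norm (Psi n p z \<alpha> \<gamma> t * (\<Prod>i=1..n. 1 / of_real (t i - z (\<tau> i))))"
proof -
  have "norm (\<Prod>i=1..n. of_real (((z p - t i) / cs (site l i)) ^ K) * (1 / of_real (t i - z (\<tau> i))) :: complex)
     \<le> (\<Prod>i=1..n. 1 * norm (1 / of_real (t i - z (\<tau> i)) :: complex))"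
    unfolding prod_norm[symmetric] norm_mult norm_of_real
  proof (intro prod_mono conjI mult_right_mono mult_nonneg_nonneg abs_ge_zero norm_ge_zero)
    fix i assume i: "i \<in> {1..n}"
    show "\<bar>((z p - t i) / cs (site l i)) ^ K\<bar> \<le> 1"
      unfolding abs_of_nonneg[OF zero_le_power[OF frac_bounds(1)[OF assms i]]] by (rule power_le_one[OF frac_bounds[OF assms i]])
  qed
  then show ?thesis unfolding scaledI_def norm_mult by (intro mult_left_mono) (auto simp: prod_norm[symmetric])
qed

text \<open>Some variable has (z_p - t_k) / c at most \<open>1 - rel\<close>, and the corresponding
  quotients of all others lie between 0 and 1.\<close>

lemma scaledI_far_le:
  assumes "inU l t" "\<not> nearN l t"
  shows "norm (scaledI l \<tau> K t) \<le> norm (cpw (real K) (expo l)) * (1 - rel) ^ K * norm (Psi n p z \<alpha> \<gamma> t * (\<Prod>i=1..n. 1 / of_real (t i - z (\<tau> i))))"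
proof -
  obtain k where k: "k \<in> {1..n}" "t k > z (site l k) + rel * cs (site l k)"
    using assms(2) by (auto simp: nearN_def not_le)
  have c: "cs (site l k) > 0" by (rule cs_pos[OF site_in[OF k(1)]])
  have fk: "(z p - t k) / cs (site l k) \<le> 1 - rel"
  proof -
    have "z p - t k \<le> cs (site l k) - rel * cs (site l k)" using k(2) by (simp add: cs_def)
    then show ?thesis using c by (simp add: field_simps)
  qed
  have f1: "((z p - t i) / cs (site l i)) ^ K \<le> 1" "0 \<le> ((z p - t i) / cs (site l i)) ^ K" if "i \<in> {1..n}" for i
    using power_le_one[OF frac_bounds[OF assms(1) that]] zero_le_power[OF frac_bounds(1)[OF assms(1) that]] by auto
  have "(\<Prod>i=1..n. ((z p - t i) / cs (site l i)) ^ K) = ((z p - t k) / cs (site l k)) ^ K * (\<Prod>i\<in>{1..n}-{k}. ((z p - t i) / cs (site l i)) ^ K)"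
    using k by (intro prod.remove) auto
  also have "\<dots> \<le> (1 - rel) ^ K * 1"
  proof (rule mult_mono)
    show "((z p - t k) / cs (site l k)) ^ K \<le> (1 - rel) ^ K" by (rule power_mono[OF fk frac_bounds(1)[OF assms(1) k(1)]])
    show "(\<Prod>i\<in>{1..n}-{k}. ((z p - t i) / cs (site l i)) ^ K) \<le> 1" by (rule prod_le_1) (use f1 in auto)
    show "0 \<le> (1 - rel) ^ K" using rel(2) by simp
    show "0 \<le> (\<Prod>i\<in>{1..n}-{k}. ((z p - t i) / cs (site l i)) ^ K)" by (rule prod_nonneg) (use f1 in auto)
  qed
  finally have P: "(\<Prod>i=1..n. ((z p - t i) / cs (site l i)) ^ K) \<le> (1 - rel) ^ K" by simp
  have "norm (\<Prod>i=1..n. of_real (((z p - t i) / cs (site l i)) ^ K) * (1 / of_real (t i - z (\<tau> i))) :: complex)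
     = (\<Prod>i=1..n. ((z p - t i) / cs (site l i)) ^ K) * norm (\<Prod>i=1..n. 1 / of_real (t i - z (\<tau> i)) :: complex)"
  proof -
    have "norm (\<Prod>i=1..n. of_real (((z p - t i) / cs (site l i)) ^ K) :: complex) = (\<Prod>i=1..n. ((z p - t i) / cs (site l i)) ^ K)"
      unfolding prod_norm[symmetric] norm_of_real by (intro prod.cong refl abs_of_nonneg f1(2))
    then show ?thesis unfolding prod.distrib norm_mult by simp
  qed
  also have "\<dots> \<le> (1 - rel) ^ K * norm (\<Prod>i=1..n. 1 / of_real (t i - z (\<tau> i)) :: complex)"
    using P by (rule mult_right_mono) simp
  finally have "norm (scaledI l \<tau> K t) \<le> norm (cpw (real K) (expo l)) * (norm (Psi n p z \<alpha> \<gamma> t) * ((1 - rel) ^ K * norm (\<Prod>i=1..n. 1 / of_real (t i - z (\<tau> i)) :: complex)))"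
    unfolding scaledI_def norm_mult by (intro mult_left_mono norm_ge_zero)
  then show ?thesis by (simp add: norm_mult mult_ac)
qed

lemma integrable_base: "integrable (Rn n) (\<lambda>t. indU l t *\<^sub>R (Psi n p z \<alpha> \<gamma> t * (\<Prod>i=1..n. 1 / of_real (t i - z (\<tau> i)))))"
proof (rule integrable_Psi[OF l])
  fix i assume "i \<in> {1..n}"
  then have "\<tau> i \<in> {1..<p}" using \<tau>[of i] p2 by auto
  then show "admissible (\<lambda>t. 1 / of_real (t - z (\<tau> i)))" by (rule admissible_inverse)
qed

text \<open>A power of K against a geometric factor; the integral that remains in the bound does not
  depend on K.\<close>

lemma far_tendsto_0:
  "(\<lambda>k. \<integral>t. (if inU l t \<and> \<not> nearN l t then scaledI l \<tau> (Suc k) t else 0) \<partial>Rn n) \<longlonglongrightarrow> 0"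
proof -
  let ?g = "\<lambda>t. norm (indU l t *\<^sub>R (Psi n p z \<alpha> \<gamma> t * (\<Prod>i=1..n. 1 / of_real (t i - z (\<tau> i)))))"
  define J where "J = (\<integral>t. ?g t \<partial>Rn n)"
  have gi: "integrable (Rn n) ?g" by (rule integrable_norm[OF integrable_base])
  define C where "C k = norm (cpw (real (Suc k)) (expo l)) * (1 - rel) ^ Suc k" for k
  have C0: "C k \<ge> 0" for k using rel(2) by (simp add: C_def)
  have b: "norm (if inU l t \<and> \<not> nearN l t then scaledI l \<tau> (Suc k) t else 0) \<le> C k * ?g t" for t k
  proof (cases "inU l t \<and> \<not> nearN l t")
    case True
    then show ?thesis using scaledI_far_le[of t "Suc k"] by (simp add: C_def indU_def)
  next
    case False
    show ?thesis unfolding if_not_P[OF False] using C0[of k] by (simp add: mult_nonneg_nonneg)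
  qed
  have bd: "norm (\<integral>t. (if inU l t \<and> \<not> nearN l t then scaledI l \<tau> (Suc k) t else 0) \<partial>Rn n) \<le> C k * J" for k
  proof -
    have "norm (\<integral>t. (if inU l t \<and> \<not> nearN l t then scaledI l \<tau> (Suc k) t else 0) \<partial>Rn n) \<le> (\<integral>t. C k * ?g t \<partial>Rn n)"
    proof (rule order_trans[OF integral_norm_bound integral_mono'])
      show "integrable (Rn n) (\<lambda>t. C k * ?g t)" by (rule integrable_mult_right[OF gi])
      show "norm (if inU l t \<and> \<not> nearN l t then scaledI l \<tau> (Suc k) t else 0) \<le> C k * ?g t" for t by (rule b)
      show "0 \<le> C k * ?g t" for t using C0 by (intro mult_nonneg_nonneg) auto
    qed
    then show ?thesis by (simp add: J_def)
  qed
  have lim: "(\<lambda>k. C k * J) \<longlonglongrightarrow> 0"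
  proof -
    have "C = (\<lambda>k. real (Suc k) powr Re (expo l) * (1 - rel) ^ Suc k)" by (simp add: C_def norm_cpw fun_eq_iff del: of_nat_Suc)
    moreover have "(\<lambda>k. real (Suc k) powr Re (expo l) * (1 - rel) ^ Suc k) \<longlonglongrightarrow> 0"
      using rel by (intro powr_times_power_tendsto_0) auto
    ultimately show ?thesis using tendsto_mult_left_zero[of C sequentially J] by simp
  qed
  show ?thesis by (rule Lim_null_comparison[OF _ lim]) (rule always_eventually, rule allI, rule bd)
qed

end

end

lemma powr_exp_lim: "(\<lambda>k. (1 - y / real (Suc k)) ^ Suc k) \<longlonglongrightarrow> exp (- y)"
  using LIMSEQ_Suc[OF tendsto_exp_limit_sequentially[of "- y"]] by simp

context conf
begin

text \<open>The constant that the substitution leaves in row \<open>l\<close>: powers of the c_s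
  from variables and pairs at their own site, powers of differences of the z_s from everything
  else.\<close>

definition Kst :: "(nat \<Rightarrow> nat) \<Rightarrow> complex" where
  "Kst l = (\<Prod>i=1..n. cpw (cs (site l i)) (\<alpha> (site l i)) * (\<Prod>r\<in>{1..p}-{site l i}. cpw (z (site l i) - z r) (\<alpha> r)))
    * (\<Prod>i=1..n. \<Prod>j\<in>{i<..n}. if site l i = site l j then cpw (cs (site l i)) (2 * \<gamma>) else cpw (z (site l j) - z (site l i)) (2 * \<gamma>))"

context
  fixes l \<tau> :: "nat \<Rightarrow> nat"
  assumes l: "l \<in> Zset n (p - 1)" and \<tau>: "\<And>i. i \<in> {1..n} \<Longrightarrow> \<tau> i \<in> {1..p-1}"
begin

definition tt :: "nat \<Rightarrow> nat \<Rightarrow> real \<Rightarrow> real" where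
  "tt K i y = z (site l i) + cs (site l i) / real K * y"

text \<open>All factors that belong to one variable, including its share \<open>cs / K\<close> of
  the Jacobian. The powers of K split off from \<open>cpw\<close> are cancelled by the factor with
  exponent \<open>expo\<close>.\<close>

definition aK :: "nat \<Rightarrow> nat \<Rightarrow> real \<Rightarrow> complex" where
  "aK K i y = of_real (cs (site l i)) * cpw (cs (site l i) * y) (\<alpha> (site l i))
     * (\<Prod>r\<in>{1..p}-{site l i}. cpw (tt K i y - z r) (\<alpha> r)) * of_real ((1 - y / real K) ^ K)
     * (1 / (of_real (real K) * of_real (tt K i y - z (\<tau> i))))"

definition bK :: "nat \<Rightarrow> (nat \<Rightarrow> real) \<Rightarrow> nat \<Rightarrow> nat \<Rightarrow> complex" where
  "bK K y i j = (if site l i = site l j then cpw (cs (site l i) * (y j - y i)) (2 * \<gamma>)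
     else cpw (tt K j (y j) - tt K i (y i)) (2 * \<gamma>))"

definition domK :: "nat \<Rightarrow> (nat \<Rightarrow> real) \<Rightarrow> bool" where
  "domK K y \<longleftrightarrow> (\<forall>i\<in>{1..n}. 0 \<le> y i \<and> y i \<le> rel * real K) \<and> (\<forall>i\<in>{1..n}. \<forall>j\<in>{1..n}. i < j \<and> site l i = site l j \<longrightarrow> y i \<le> y j)"

definition TT :: "nat \<Rightarrow> (nat \<Rightarrow> real) \<Rightarrow> nat \<Rightarrow> real" where
  "TT K y = (\<lambda>j\<in>{1..n}. z (site l j) + cs (site l j) / real K * y j)"

lemma TT_eq: "i \<in> {1..n} \<Longrightarrow> TT K y i = tt K i (y i)"
  by (simp add: TT_def tt_def)

lemma site_mem: "i \<in> {1..n} \<Longrightarrow> site l i \<in> {1..p-1}"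
  by (rule site_range[OF l])

lemma cs_site_pos: "i \<in> {1..n} \<Longrightarrow> cs (site l i) > 0"
  by (rule cs_pos[OF site_mem])

text \<open>Near the left ends a variable stays within \<open>gap\<close> of its point and cannot
  reach the next one, so upper bounds and the order across blocks hold automatically. Only the order
  within a block remains.\<close>

lemma dom_iff:
  assumes K: "K > 0"
  shows "inU l (TT K y) \<and> nearN l (TT K y) \<longleftrightarrow> domK K y"
proof -
  have b: "z (site l i) \<le> TT K y i \<longleftrightarrow> 0 \<le> y i" "TT K y i \<le> z (site l i) + rel * cs (site l i) \<longleftrightarrow> y i \<le> rel * real K"
    if i: "i \<in> {1..n}" for i
    unfolding TT_eq[OF i] tt_def using cs_site_pos[OF i] K by (auto simp: zero_le_mult_iff field_simps)
  have le: "TT K y i \<le> TT K y j \<longleftrightarrow> y i \<le> y j" if "i \<in> {1..n}" "j \<in> {1..n}" "site l i = site l j" for i j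
    unfolding TT_eq[OF that(1)] TT_eq[OF that(2)] tt_def that(3) using cs_site_pos[OF that(2)] K by (simp add: field_simps)
  show ?thesis
  proof
    assume a: "inU l (TT K y) \<and> nearN l (TT K y)"
    have "0 \<le> y i \<and> y i \<le> rel * real K" if i: "i \<in> {1..n}" for i
      using inU_bounds[OF conjunct1[OF a] i] a i b[OF i] by (auto simp: nearN_def)
    moreover have "y i \<le> y j" if "i \<in> {1..n}" "j \<in> {1..n}" "i < j" "site l i = site l j" for i j
      using inU_sorted[OF conjunct1[OF a] that(1-3)] le that by auto
    ultimately show "domK K y" unfolding domK_def by blast
  next
    assume d: "domK K y"
    have d1: "0 \<le> y i" "y i \<le> rel * real K" if "i \<in> {1..n}" for i using d that unfolding domK_def by auto
    have N: "TT K y i \<le> z (site l i) + rel * cs (site l i)" "z (site l i) \<le> TT K y i" if i: "i \<in> {1..n}" for i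
      using b[OF i] d1[OF i] by auto
    have G: "TT K y i \<le> z (site l i) + gap" if i: "i \<in> {1..n}" for i
      using N(1)[OF i] rel(3)[OF site_mem[OF i]] by linarith
    have up: "TT K y i \<le> z s" if i: "i \<in> {1..n}" and s: "site l i < s" "s \<le> p" for i s
    proof -
      have "2 * gap \<le> z s - z (site l i)" using site_mem[OF i] s by (intro gap_sep) auto
      then show ?thesis using G[OF i] gap(1) by linarith
    qed
    have "inU l (TT K y)" unfolding inU_def
    proof (intro conjI ballI impI)
      fix i assume i: "i \<in> {1..n}"
      show "z (site l i) \<le> TT K y i" by (rule N(2)[OF i])
      show "TT K y i \<le> z (site l i + 1)" using site_mem[OF i] by (intro up[OF i]) auto
    next
      fix i j assume ij: "i \<in> {1..n}" "j \<in> {1..n}" "i < j"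
      show "TT K y i \<le> TT K y j"
      proof (cases "site l i = site l j")
        case True
        then show ?thesis using le[OF ij(1,2)] d ij unfolding domK_def by blast
      next
        case False
        then have "site l i < site l j" using site_mono[OF l, of i j] ij by simp
        then have "TT K y i \<le> z (site l j)" using site_mem[OF ij(2)] by (intro up[OF ij(1)]) auto
        then show ?thesis using N(2)[OF ij(2)] by linarith
      qed
    qed
    then show "inU l (TT K y) \<and> nearN l (TT K y)" using N by (auto simp: nearN_def)
  qed
qed

definition gK :: "nat \<Rightarrow> (nat \<Rightarrow> real) \<Rightarrow> complex" where
  "gK K y = (if domK K y then (\<Prod>i=1..n. aK K i (y i)) * (\<Prod>i=1..n. \<Prod>j\<in>{i<..n}. bK K y i j) else 0)"

lemma subst_scaled:
  assumes K: "K > 0"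
  shows "of_real (\<Prod>i=1..n. \<bar>cs (site l i) / real K\<bar>) *
      (if inU l (TT K y) \<and> nearN l (TT K y) then scaledI l \<tau> K (TT K y) else 0) = gK K y"
proof (cases "domK K y")
  case False
  then show ?thesis unfolding dom_iff[OF K] gK_def by (simp only: if_False mult_zero_right)
next
  case True
  have K0: "real K \<noteq> 0" using K by simp
  let ?k = "cpw (real K)"
  have pt: "pt (TT K y i) = cpw (cs (site l i) * y i) (\<alpha> (site l i)) * (\<Prod>r\<in>{1..p}-{site l i}. cpw (tt K i (y i) - z r) (\<alpha> r)) / ?k (\<alpha> (site l i))"
    if i: "i \<in> {1..n}" for i
  proof -
    have s: "site l i \<in> {1..p}" using site_mem[OF i] by auto
    have "pt (TT K y i) = cpw (tt K i (y i) - z (site l i)) (\<alpha> (site l i)) * (\<Prod>r\<in>{1..p}-{site l i}. cpw (tt K i (y i) - z r) (\<alpha> r))"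
      unfolding pt_def TT_eq[OF i] using s by (intro prod.remove) auto
    also have "tt K i (y i) - z (site l i) = cs (site l i) * y i / real K" by (simp add: tt_def)
    finally show ?thesis by (simp add: cpw_divide)
  qed
  have frac: "(z p - TT K y i) / cs (site l i) = 1 - y i / real K" if i: "i \<in> {1..n}" for i
    unfolding TT_eq[OF i] tt_def using cs_site_pos[OF i] K by (simp add: cs_def field_simps)
  have pair: "cpw (TT K y j - TT K y i) (2 * \<gamma>) = bK K y i j / (if site l i = site l j then ?k (2 * \<gamma>) else 1)"
    if ij: "i \<in> {1..n}" "j \<in> {i<..n}" for i j
  proof -
    have j: "j \<in> {1..n}" using ij by auto
    show ?thesis
    proof (cases "site l i = site l j")
      case True
      have "TT K y j - TT K y i = cs (site l i) * (y j - y i) / real K"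
        unfolding TT_eq[OF ij(1)] TT_eq[OF j] tt_def True by (simp add: algebra_simps diff_divide_distrib)
      then show ?thesis using True by (simp add: bK_def cpw_divide)
    next
      case False
      then show ?thesis by (simp only: bK_def if_False TT_eq[OF ij(1)] TT_eq[OF j] div_by_1)
    qed
  qed
  have V: "vdm n \<gamma> (TT K y) = (\<Prod>i=1..n. \<Prod>j\<in>{i<..n}. bK K y i j) / (\<Prod>i=1..n. \<Prod>j\<in>{i<..n}. if site l i = site l j then ?k (2 * \<gamma>) else 1)"
    unfolding vdm_def prod_dividef[symmetric] by (intro prod.cong refl pair)
  have E: "?k (expo l) = (\<Prod>i=1..n. ?k (\<alpha> (site l i))) * (\<Prod>i=1..n. \<Prod>j\<in>{i<..n}. if site l i = site l j then ?k (2 * \<gamma>) else 1)"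
  proof -
    have "?k (expo l) = (\<Prod>i=1..n. ?k (\<alpha> (site l i))) * (\<Prod>i=1..n. \<Prod>j\<in>{i<..n}. ?k (if site l i = site l j then 2 * \<gamma> else 0))"
      unfolding expo_def cpw_add cpw_sum[OF K0] ..
    also have "(\<Prod>i=1..n. \<Prod>j\<in>{i<..n}. ?k (if site l i = site l j then 2 * \<gamma> else 0)) = (\<Prod>i=1..n. \<Prod>j\<in>{i<..n}. if site l i = site l j then ?k (2 * \<gamma>) else 1)"
      using cpw_exponent_0[OF K0] by (intro prod.cong refl) auto
    finally show ?thesis .
  qed
  define D where "D = (\<Prod>i=1..n. \<Prod>j\<in>{i<..n}. if site l i = site l j then ?k (2 * \<gamma>) else 1)"
  have D: "D \<noteq> 0" unfolding D_def using K0 by (auto simp: prod_zero_iff)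
  define B where "B = (\<Prod>i=1..n. \<Prod>j\<in>{i<..n}. bK K y i j)"
  have "of_real (\<Prod>i=1..n. \<bar>cs (site l i) / real K\<bar>) * scaledI l \<tau> K (TT K y)
    = (\<Prod>i=1..n. of_real (cs (site l i) / real K)) * ((\<Prod>i=1..n. ?k (\<alpha> (site l i))) * D *
      ((\<Prod>i=1..n. pt (TT K y i)) * (B / D) * (\<Prod>i=1..n. of_real ((1 - y i / real K) ^ K) * (1 / of_real (tt K i (y i) - z (\<tau> i))))))"
  proof -
    have 1: "(\<Prod>i=1..n. \<bar>cs (site l i) / real K\<bar>) = (\<Prod>i=1..n. cs (site l i) / real K)"
    proof (intro prod.cong refl abs_of_nonneg)
      fix i assume "i \<in> {1..n}"
      then show "0 \<le> cs (site l i) / real K" using cs_site_pos[of i] by (intro divide_nonneg_nonneg) auto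
    qed
    have 2: "(\<Prod>i=1..n. of_real (((z p - TT K y i) / cs (site l i)) ^ K) * (1 / of_real (TT K y i - z (\<tau> i))) :: complex)
       = (\<Prod>i=1..n. of_real ((1 - y i / real K) ^ K) * (1 / of_real (tt K i (y i) - z (\<tau> i))))"
    proof (rule prod.cong[OF refl])
      fix i assume i: "i \<in> {1..n}"
      show "of_real (((z p - TT K y i) / cs (site l i)) ^ K) * (1 / of_real (TT K y i - z (\<tau> i)))
         = (of_real ((1 - y i / real K) ^ K) * (1 / of_real (tt K i (y i) - z (\<tau> i))) :: complex)"
        unfolding frac[OF i] unfolding TT_eq[OF i] ..
    qed
    show ?thesis unfolding scaledI_def Psi_def pt_def[symmetric] V E D_def[symmetric] B_def[symmetric] 1 2 of_real_prod ..
  qed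
  also have "\<dots> = (\<Prod>i=1..n. of_real (cs (site l i) / real K) * (?k (\<alpha> (site l i)) * pt (TT K y i)) *
       (of_real ((1 - y i / real K) ^ K) * (1 / of_real (tt K i (y i) - z (\<tau> i))))) * B"
    unfolding prod.distrib using D by (simp add: mult_ac)
  also have "(\<Prod>i=1..n. of_real (cs (site l i) / real K) * (?k (\<alpha> (site l i)) * pt (TT K y i)) *
       (of_real ((1 - y i / real K) ^ K) * (1 / of_real (tt K i (y i) - z (\<tau> i))))) = (\<Prod>i=1..n. aK K i (y i))"
  proof (rule prod.cong[OF refl])
    fix i assume i: "i \<in> {1..n}"
    have kk: "?k (\<alpha> (site l i)) \<noteq> 0" using K0 by simp
    have "?k (\<alpha> (site l i)) * pt (TT K y i) = cpw (cs (site l i) * y i) (\<alpha> (site l i)) * (\<Prod>r\<in>{1..p}-{site l i}. cpw (tt K i (y i) - z r) (\<alpha> r))"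
      unfolding pt[OF i] using kk by simp
    then show "of_real (cs (site l i) / real K) * (?k (\<alpha> (site l i)) * pt (TT K y i)) *
       (of_real ((1 - y i / real K) ^ K) * (1 / of_real (tt K i (y i) - z (\<tau> i)))) = aK K i (y i)"
      unfolding aK_def by (simp add: mult_ac)
  qed
  finally show ?thesis using True unfolding dom_iff[OF K] gK_def B_def by simp
qed

lemma near_integral:
  assumes K: "K > 0"
  shows "(\<integral>t. (if inU l t \<and> nearN l t then scaledI l \<tau> K t else 0) \<partial>Rn n) = (\<integral>y. gK K y \<partial>Rn n)" (is ?A)
    and "gK K \<in> borel_measurable (Rn n)" (is ?B)
proof -
  let ?G = "\<lambda>t. if inU l t \<and> nearN l t then scaledI l \<tau> K t else 0"
  have sm [measurable]: "scaledI l \<tau> K \<in> borel_measurable (Rn n)" by (rule measurable_scaledI[OF l \<tau>])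
  have G: "?G \<in> borel_measurable (Rn n)" by measurable
  have gG: "gK K y = of_real (\<Prod>i=1..n. \<bar>cs (site l i) / real K\<bar>) * ?G (TT K y)" for y
    using subst_scaled[OF K, of y] by simp
  have bij: "bij_betw (\<lambda>j. j) {1..n} {1..n}" by (simp add: bij_betw_def)
  have "(\<integral>t. ?G t \<partial>Rn n) = of_real (\<Prod>j\<in>{1..n}. \<bar>cs (site l j) / real K\<bar>) * (\<integral>y. ?G (\<lambda>j\<in>{1..n}. z (site l j) + cs (site l j) / real K * y j) \<partial>Rn n)"
  proof (rule integral_PiM_affine[OF bij _ _ G])
    fix j assume "j \<in> {1..n}"
    then show "cs (site l j) / real K \<noteq> 0" using cs_site_pos[of j] K by simp
  qed simp
  then show ?A unfolding gG TT_def by simp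
  have "TT K \<in> measurable (Rn n) (Rn n)" unfolding TT_def
  proof (rule measurable_restrict)
    fix j assume "j \<in> {1..n}"
    note [measurable] = Rn_component[OF this]
    show "(\<lambda>x. z (site l j) + cs (site l j) / real K * x j) \<in> measurable (Rn n) lborel" by measurable
  qed
  from measurable_compose[OF this G] show ?B unfolding gG[abs_def] by measurable
qed

definition aL :: "nat \<Rightarrow> real \<Rightarrow> complex" where
  "aL i y = of_real (cs (site l i)) * cpw (cs (site l i) * y) (\<alpha> (site l i))
     * (\<Prod>r\<in>{1..p}-{site l i}. cpw (z (site l i) - z r) (\<alpha> r)) * of_real (exp (- y))
     * (if \<tau> i = site l i then 1 / of_real (cs (site l i) * y) else 0)"

definition bL :: "(nat \<Rightarrow> real) \<Rightarrow> nat \<Rightarrow> nat \<Rightarrow> complex" where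
  "bL y i j = (if site l i = site l j then cpw (cs (site l i) * (y j - y i)) (2 * \<gamma>)
     else cpw (z (site l j) - z (site l i)) (2 * \<gamma>))"

definition gL :: "(nat \<Rightarrow> real) \<Rightarrow> complex" where
  "gL y = (if (\<forall>i\<in>{1..n}. 0 \<le> y i) \<and> (\<forall>i\<in>{1..n}. \<forall>j\<in>{1..n}. i < j \<and> site l i = site l j \<longrightarrow> y i \<le> y j)
     then (\<Prod>i=1..n. aL i (y i)) * (\<Prod>i=1..n. \<Prod>j\<in>{i<..n}. bL y i j) else 0)"

lemma tt_lim: "(\<lambda>k. tt (Suc k) i y) \<longlonglongrightarrow> z (site l i)"
proof -
  have "(\<lambda>k. z (site l i) + cs (site l i) * (1 / real (Suc k)) * y) \<longlonglongrightarrow> z (site l i) + cs (site l i) * 0 * y"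
    by (intro tendsto_intros LIMSEQ_Suc[OF lim_1_over_n])
  then show ?thesis by (simp add: tt_def)
qed

lemma cpw_lim: "f \<longlonglongrightarrow> x \<Longrightarrow> x \<noteq> 0 \<Longrightarrow> (\<lambda>k. cpw (f k) a) \<longlonglongrightarrow> cpw x a"
  using isCont_tendsto_compose[OF isCont_cpw] by blast

text \<open>If \<open>\<tau> i\<close> is the site of \<open>i\<close>, then K (t_i - z_s) is
  \<open>cs\<close> times y for every K. Otherwise the pole stays at a positive distance and the
  factor 1/K from the Jacobian sends the term to 0.\<close>

lemma aK_lim:
  assumes i: "i \<in> {1..n}"
  shows "(\<lambda>k. aK (Suc k) i y) \<longlonglongrightarrow> aL i y"
proof -
  have s: "site l i \<in> {1..p}" using site_mem[OF i] by auto
  have l1: "(\<lambda>k. 1 / (of_real (real (Suc k)) * of_real (tt (Suc k) i y - z (\<tau> i))) :: complex) \<longlonglongrightarrow> (if \<tau> i = site l i then 1 / of_real (cs (site l i) * y) else 0)"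
  proof (cases "\<tau> i = site l i")
    case True
    have "real (Suc k) * (tt (Suc k) i y - z (\<tau> i)) = cs (site l i) * y" for k
      unfolding True tt_def by (simp del: of_nat_Suc)
    then have "of_real (real (Suc k)) * of_real (tt (Suc k) i y - z (\<tau> i)) = (of_real (cs (site l i) * y) :: complex)" for k
      by (metis of_real_mult)
    then show ?thesis using True by (simp del: of_nat_Suc)
  next
    case False
    have "\<tau> i \<in> {1..p}" using \<tau>[OF i] by auto
    then have ne: "z (site l i) - z (\<tau> i) \<noteq> 0" using z_neq[of "site l i" "\<tau> i"] s False by auto
    have "(\<lambda>k. of_real (1 / real (Suc k)) * (1 / of_real (tt (Suc k) i y - z (\<tau> i))) :: complex) \<longlonglongrightarrow> of_real 0 * (1 / of_real (z (site l i) - z (\<tau> i)))"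
      using ne by (intro tendsto_intros LIMSEQ_Suc[OF lim_1_over_n] tt_lim) auto
    then show ?thesis using False by simp
  qed
  have l2: "(\<lambda>k. \<Prod>r\<in>{1..p}-{site l i}. cpw (tt (Suc k) i y - z r) (\<alpha> r)) \<longlonglongrightarrow> (\<Prod>r\<in>{1..p}-{site l i}. cpw (z (site l i) - z r) (\<alpha> r))"
  proof (rule tendsto_prod)
    fix r assume "r \<in> {1..p} - {site l i}"
    then have "z (site l i) - z r \<noteq> 0" using z_neq[of "site l i" r] s by auto
    then show "(\<lambda>k. cpw (tt (Suc k) i y - z r) (\<alpha> r)) \<longlonglongrightarrow> cpw (z (site l i) - z r) (\<alpha> r)"
      by (intro cpw_lim tendsto_intros tt_lim)
  qed
  show ?thesis unfolding aK_def aL_def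
    by (intro tendsto_mult tendsto_const l1 l2 tendsto_of_real powr_exp_lim)
qed

lemma bK_lim:
  assumes "i \<in> {1..n}" "j \<in> {1..n}"
  shows "(\<lambda>k. bK (Suc k) y i j) \<longlonglongrightarrow> bL y i j"
proof (cases "site l i = site l j")
  case False
  have "site l i \<in> {1..p}" "site l j \<in> {1..p}" using site_mem[OF assms(1)] site_mem[OF assms(2)] by auto
  then have "z (site l j) - z (site l i) \<noteq> 0" using z_neq[of "site l j" "site l i"] False by auto
  then have "(\<lambda>k. cpw (tt (Suc k) j (y j) - tt (Suc k) i (y i)) (2 * \<gamma>)) \<longlonglongrightarrow> cpw (z (site l j) - z (site l i)) (2 * \<gamma>)"
    by (intro cpw_lim tendsto_intros tt_lim)
  then show ?thesis using False by (simp add: bK_def bL_def)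
qed (simp add: bK_def bL_def)

text \<open>The cut-off \<open>y i \<le> rel * K\<close> disappears for large K, so the limiting
  domain keeps only positivity and the order within blocks.\<close>

lemma gK_lim: "(\<lambda>k. gK (Suc k) y) \<longlonglongrightarrow> gL y"
proof (cases "(\<forall>i\<in>{1..n}. 0 \<le> y i) \<and> (\<forall>i\<in>{1..n}. \<forall>j\<in>{1..n}. i < j \<and> site l i = site l j \<longrightarrow> y i \<le> y j)")
  case False
  then have nd: "\<not> domK K y" for K unfolding domK_def by blast
  have "gK K y = 0" for K unfolding gK_def if_not_P[OF nd] ..
  moreover have "gL y = 0" unfolding gL_def if_not_P[OF False] ..
  ultimately show ?thesis by simp
next
  case True
  have ev1: "\<forall>\<^sub>F k in sequentially. y i \<le> rel * real (Suc k)" for i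
  proof -
    obtain N where N: "real N > y i / rel" using reals_Archimedean2 by blast
    show ?thesis unfolding eventually_sequentially
    proof (intro exI[of _ N] allI impI)
      fix k assume "N \<le> k"
      then have "y i / rel \<le> real (Suc k)" using N by simp
      then show "y i \<le> rel * real (Suc k)" using rel(1) by (simp add: field_simps)
    qed
  qed
  have "\<forall>\<^sub>F k in sequentially. \<forall>i\<in>{1..n}. y i \<le> rel * real (Suc k)"
    using ev1 by (intro eventually_ball_finite) auto
  then have "\<forall>\<^sub>F k in sequentially. gK (Suc k) y = (\<Prod>i=1..n. aK (Suc k) i (y i)) * (\<Prod>i=1..n. \<Prod>j\<in>{i<..n}. bK (Suc k) y i j)"
  proof eventually_elim
    case (elim k)
    then have "domK (Suc k) y" using True unfolding domK_def by blast
    then show ?case by (simp only: gK_def if_True)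
  qed
  moreover have "(\<lambda>k. (\<Prod>i=1..n. aK (Suc k) i (y i)) * (\<Prod>i=1..n. \<Prod>j\<in>{i<..n}. bK (Suc k) y i j)) \<longlonglongrightarrow> (\<Prod>i=1..n. aL i (y i)) * (\<Prod>i=1..n. \<Prod>j\<in>{i<..n}. bL y i j)"
    by (intro tendsto_mult tendsto_prod aK_lim bK_lim) auto
  ultimately show ?thesis unfolding gL_def if_P[OF True] by (simp add: tendsto_cong)
qed

lemma gdom_mult: "y \<ge> 0 \<Longrightarrow> gdom a 1 y * (1 + y) powr Q = gdom a (1 + Q) y"
  by (simp add: gdom_def powr_add mult_ac)

lemma Apos': "s \<in> {1..p-1} \<Longrightarrow> Re (\<alpha> s) > 0"
  using Apos[of s] p2 by auto

definition aC :: "nat \<Rightarrow> real" where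
  "aC i = cs (site l i) * cs (site l i) powr Re (\<alpha> (site l i))
     * (\<Prod>r\<in>{1..p}-{site l i}. gap powr Re (\<alpha> r) + (z p - z 1) powr Re (\<alpha> r)) * (1 / cs (site l i) + 1 / gap)"

lemma aC_nonneg: "i \<in> {1..n} \<Longrightarrow> aC i \<ge> 0"
  unfolding aC_def using cs_pos[OF site_range[OF l]] gap(1) by (intro mult_nonneg_nonneg prod_nonneg add_nonneg_nonneg) (auto intro: less_imp_le)

lemma aK_bound:
  assumes K: "K > 0" and i: "i \<in> {1..n}" and y: "0 \<le> y" "y \<le> rel * real K"
  shows "norm (aK K i y) \<le> aC i * gdom (Re (\<alpha> (site l i))) 1 y"
proof (cases "y = 0")
  case True
  then show ?thesis using aC_nonneg[OF i] by (simp add: aK_def gdom_def)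
next
  case False
  then have y0: "y > 0" using y by simp
  let ?s = "site l i"
  define c where "c = cs ?s"
  define t where "t = tt K i y"
  have s: "?s \<in> {1..p-1}" by (rule site_range[OF l i])
  have c: "c > 0" unfolding c_def by (rule cs_pos[OF s])
  have K0: "real K > 0" using K by simp
  have te: "t = z ?s + c / real K * y" by (simp add: t_def tt_def c_def)
  have t1: "z ?s \<le> t" using c K0 y by (simp add: te)
  have t2: "t \<le> z ?s + rel * c"
  proof -
    have "c / real K * y \<le> c / real K * (rel * real K)" using c K0 y by (intro mult_left_mono) auto
    then show ?thesis using K0 by (simp add: te mult.commute)
  qed
  have away: "gap \<le> \<bar>t - z r\<bar>" "\<bar>t - z r\<bar> \<le> z p - z 1" if "r \<in> {1..p}" "r \<noteq> ?s" for r
    using near_away[OF s t1 t2[unfolded c_def] that] by auto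
  have yK: "y \<le> real K"
  proof -
    have "rel * real K \<le> 1 * real K" using rel(2) K0 by (intro mult_right_mono) auto
    then show ?thesis using y(2) by simp
  qed
  have n1: "norm (cpw (c * y) (\<alpha> ?s)) = c powr Re (\<alpha> ?s) * y powr Re (\<alpha> ?s)"
    using c y0 by (simp add: norm_cpw powr_mult)
  have n2: "norm (\<Prod>r\<in>{1..p}-{?s}. cpw (t - z r) (\<alpha> r)) \<le> (\<Prod>r\<in>{1..p}-{?s}. gap powr Re (\<alpha> r) + (z p - z 1) powr Re (\<alpha> r))"
    unfolding prod_norm[symmetric]
  proof (rule prod_mono)
    fix r assume r: "r \<in> {1..p} - {?s}"
    have "\<bar>t - z r\<bar> powr Re (\<alpha> r) \<le> gap powr Re (\<alpha> r) + (z p - z 1) powr Re (\<alpha> r)"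
      using away[of r] r gap(1) by (intro powr_between) auto
    then show "0 \<le> norm (cpw (t - z r) (\<alpha> r)) \<and> norm (cpw (t - z r) (\<alpha> r)) \<le> gap powr Re (\<alpha> r) + (z p - z 1) powr Re (\<alpha> r)"
      by (simp add: norm_cpw)
  qed
  have n3: "norm (of_real ((1 - y / real K) ^ K) :: complex) \<le> exp (- y)"
  proof -
    have "0 \<le> 1 - y / real K" using yK K0 by simp
    then have "norm (of_real ((1 - y / real K) ^ K) :: complex) = (1 - y / real K) ^ K" by (simp only: norm_of_real abs_of_nonneg zero_le_power)
    then show ?thesis using power_le_exp[OF y(1) yK] K by simp
  qed
  \<comment> \<open>A pole at the own site gives 1 / (c y), a foreign one at most 1 /
    \<open>gap\<close>. Both are below a constant times (1 + y) / y, which is why the majorant is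
    \<open>gdom\<close> with second parameter 1.\<close>
  have n4: "norm (1 / (of_real (real K) * of_real (t - z (\<tau> i))) :: complex) \<le> (1 / c + 1 / gap) * ((1 + y) / y)"
  proof -
    have e: "norm (1 / (of_real (real K) * of_real (t - z (\<tau> i))) :: complex) = 1 / (real K * \<bar>t - z (\<tau> i)\<bar>)"
      unfolding norm_divide norm_mult norm_of_real using K0 by simp
    have "1 / (real K * \<bar>t - z (\<tau> i)\<bar>) \<le> 1 / (c * y) + 1 / gap"
    proof (cases "\<tau> i = ?s")
      case True
      have "real K * \<bar>t - z (\<tau> i)\<bar> = c * y" unfolding True te using K0 c y0 by (simp add: abs_mult)
      then show ?thesis using gap(1) by simp
    next
      case False
      have "gap \<le> \<bar>t - z (\<tau> i)\<bar>" using away(1)[of "\<tau> i"] \<tau>[OF i] False by auto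
      then have "1 * gap \<le> real K * \<bar>t - z (\<tau> i)\<bar>" using K gap(1) by (intro mult_mono) auto
      then have "1 / (real K * \<bar>t - z (\<tau> i)\<bar>) \<le> 1 / gap" using gap(1) by (intro divide_left_mono) (auto intro: mult_pos_pos)
      then show ?thesis using c y0 by (simp add: add_increasing)
    qed
    also have "\<dots> \<le> (1 / c + 1 / gap) * ((1 + y) / y)"
    proof -
      have "(1 / c + 1 / gap) * ((1 + y) / y) = 1 / (c * y) + 1 / c + 1 / (gap * y) + 1 / gap"
        using c y0 gap(1) by (simp add: field_simps)
      then show ?thesis using c y0 gap(1) by simp
    qed
    finally show ?thesis unfolding e .
  qed
  have p: "0 \<le> (\<Prod>r\<in>{1..p}-{?s}. gap powr Re (\<alpha> r) + (z p - z 1) powr Re (\<alpha> r))" by (intro prod_nonneg) auto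
  have "norm (aK K i y) = c * norm (cpw (c * y) (\<alpha> ?s)) * norm (\<Prod>r\<in>{1..p}-{?s}. cpw (t - z r) (\<alpha> r))
     * norm (of_real ((1 - y / real K) ^ K) :: complex) * norm (1 / (of_real (real K) * of_real (t - z (\<tau> i))) :: complex)"
    unfolding aK_def norm_mult c_def[symmetric] t_def[symmetric] using c by simp
  also have "\<dots> \<le> c * (c powr Re (\<alpha> ?s) * y powr Re (\<alpha> ?s)) * (\<Prod>r\<in>{1..p}-{?s}. gap powr Re (\<alpha> r) + (z p - z 1) powr Re (\<alpha> r))
     * exp (- y) * ((1 / c + 1 / gap) * ((1 + y) / y))"
    unfolding n1 using c y0 p by (intro mult_mono n2 n3 n4 order_refl mult_nonneg_nonneg norm_ge_zero) auto
  also have "\<dots> = aC i * (y powr Re (\<alpha> ?s) / y * (1 + y) * exp (- y))"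
    unfolding aC_def c_def[symmetric] by simp
  also have "y powr Re (\<alpha> ?s) / y * (1 + y) * exp (- y) = gdom (Re (\<alpha> ?s)) 1 y"
    using y0 by (simp add: gdom_def powr_diff)
  finally show ?thesis .
qed

lemma bK_bound:
  assumes K: "K > 0" and d: "domK K y" and ij: "i \<in> {1..n}" "j \<in> {i<..n}"
  shows "norm (bK K y i j) \<le> (z p - z 1) powr (2 * Re \<gamma>) * ((1 + y i) * (1 + y j)) powr (2 * Re \<gamma>)"
proof -
  have j: "j \<in> {1..n}" using ij by auto
  have yij: "y i \<ge> 0" "y j \<ge> 0" using d ij(1) j unfolding domK_def by auto
  let ?L = "z p - z 1"
  have L: "?L > 0" using z1p by simp
  have one: "1 \<le> ((1 + y i) * (1 + y j)) powr (2 * Re \<gamma>)"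
  proof (rule ge_one_powr_ge_zero)
    show "1 \<le> (1 + y i) * (1 + y j)" using yij by (simp add: algebra_simps)
  qed (use Gpos in simp)
  show ?thesis
  proof (cases "site l i = site l j")
    case True
    have s: "site l i \<in> {1..p-1}" by (rule site_range[OF l ij(1)])
    have "cs (site l i) \<le> ?L" using z_le[of 1 "site l i"] s by (auto simp: cs_def)
    then have "cs (site l i) powr (2 * Re \<gamma>) \<le> ?L powr (2 * Re \<gamma>)" using cs_pos[OF s] Gpos by (intro powr_mono2) auto
    moreover have "norm (bK K y i j) = cs (site l i) powr (2 * Re \<gamma>) * norm (cpw (y j - y i) (2 * \<gamma>))"
      using True cs_pos[OF s] by (simp add: bK_def cpw_mult norm_mult norm_cpw)
    ultimately show ?thesis using cpw_diff_bound[OF yij Gpos] by (simp add: mult_mono)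
  next
    case False
    have U: "inU l (TT K y)" using dom_iff[OF K, of y] d by simp
    have "tt K i (y i) \<in> {z 1..z p}" "tt K j (y j) \<in> {z 1..z p}"
      using inU_range[OF l U ij(1)] inU_range[OF l U j] unfolding TT_eq[OF ij(1)] TT_eq[OF j] by auto
    then have "norm (bK K y i j) \<le> ?L powr (2 * Re \<gamma>)" using False norm_cpw_bound by (simp add: bK_def)
    also have "\<dots> = ?L powr (2 * Re \<gamma>) * 1" by simp
    also have "\<dots> \<le> ?L powr (2 * Re \<gamma>) * ((1 + y i) * (1 + y j)) powr (2 * Re \<gamma>)" using one by (intro mult_left_mono) auto
    finally show ?thesis .
  qed
qed

definition gC :: real where
  "gC = (\<Prod>i=1..n. aC i) * (\<Prod>i=1..n. \<Prod>j\<in>{i<..n}. (z p - z 1) powr (2 * Re \<gamma>))"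

definition gQ :: real where "gQ = 2 * Re \<gamma> * of_nat (n * n)"

lemma gC_nonneg: "gC \<ge> 0"
  unfolding gC_def by (intro mult_nonneg_nonneg prod_nonneg) (auto intro!: aC_nonneg prod_nonneg)

lemma gK_bound:
  assumes K: "K > 0"
  shows "norm (gK K y) \<le> gC * (\<Prod>i=1..n. gdom (Re (\<alpha> (site l i))) (1 + gQ) (y i))"
proof (cases "domK K y")
  case False
  show ?thesis unfolding gK_def if_not_P[OF False] norm_zero
    by (intro mult_nonneg_nonneg prod_nonneg gC_nonneg) (auto simp: gdom_nonneg)
next
  case d: True
  then have y: "0 \<le> y i" "y i \<le> rel * real K" if "i \<in> {1..n}" for i using that unfolding domK_def by auto
  have 1: "norm (\<Prod>i=1..n. aK K i (y i)) \<le> (\<Prod>i=1..n. aC i * gdom (Re (\<alpha> (site l i))) 1 (y i))"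
    unfolding prod_norm[symmetric] by (intro prod_mono conjI norm_ge_zero aK_bound[OF K] y)
  have 2: "norm (\<Prod>i=1..n. \<Prod>j\<in>{i<..n}. bK K y i j) \<le> (\<Prod>i=1..n. \<Prod>j\<in>{i<..n}. (z p - z 1) powr (2 * Re \<gamma>)) * (\<Prod>k=1..n. (1 + y k) powr gQ)"
    unfolding gQ_def by (rule prod_pairs_bound) (use y Gpos bK_bound[OF K d] in auto)
  have "norm (gK K y) \<le> (\<Prod>i=1..n. aC i * gdom (Re (\<alpha> (site l i))) 1 (y i)) * ((\<Prod>i=1..n. \<Prod>j\<in>{i<..n}. (z p - z 1) powr (2 * Re \<gamma>)) * (\<Prod>k=1..n. (1 + y k) powr gQ))"
    unfolding gK_def if_P[OF d] norm_mult
    by (intro mult_mono 1 2 prod_nonneg norm_ge_zero) (auto intro!: mult_nonneg_nonneg aC_nonneg gdom_nonneg)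
  also have "\<dots> = gC * (\<Prod>i=1..n. gdom (Re (\<alpha> (site l i))) 1 (y i) * (1 + y i) powr gQ)"
    unfolding gC_def prod.distrib by (simp add: mult_ac)
  also have "(\<Prod>i=1..n. gdom (Re (\<alpha> (site l i))) 1 (y i) * (1 + y i) powr gQ) = (\<Prod>i=1..n. gdom (Re (\<alpha> (site l i))) (1 + gQ) (y i))"
    by (intro prod.cong refl gdom_mult y)
  finally show ?thesis .
qed

lemma near_tendsto: "(\<lambda>k. \<integral>y. gK (Suc k) y \<partial>Rn n) \<longlonglongrightarrow> (\<integral>y. gL y \<partial>Rn n)"
proof (rule integral_dominated_convergence)
  show m: "gK (Suc k) \<in> borel_measurable (Rn n)" for k by (rule near_integral(2)) auto
  show "gL \<in> borel_measurable (Rn n)"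
    by (rule borel_measurable_LIMSEQ_metric[OF m]) (rule gK_lim)
  show "integrable (Rn n) (\<lambda>y. gC * (\<Prod>i=1..n. gdom (Re (\<alpha> (site l i))) (1 + gQ) (y i)))"
    using Apos'[OF site_range[OF l]] Gpos
    by (intro integrable_mult_right lb.product_integrable_prod integrable_gdom) (auto simp: gQ_def)
  show "AE y in Rn n. (\<lambda>k. gK (Suc k) y) \<longlonglongrightarrow> gL y" by (rule AE_I2) (rule gK_lim)
  show "AE y in Rn n. norm (gK (Suc k) y) \<le> gC * (\<Prod>i=1..n. gdom (Re (\<alpha> (site l i))) (1 + gQ) (y i))" for k
    by (rule AE_I2) (rule gK_bound, simp)
qed

lemma gL_eq: "gL y = (if \<forall>i\<in>{1..n}. \<tau> i = site l i then Kst l * grpI n (site l) \<alpha> \<gamma> y else 0)"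
proof (cases "(\<forall>i\<in>{1..n}. 0 \<le> y i) \<and> (\<forall>i\<in>{1..n}. \<forall>j\<in>{1..n}. i < j \<and> site l i = site l j \<longrightarrow> y i \<le> y j)")
  case False
  show ?thesis unfolding gL_def grpI_def if_not_P[OF False] by simp
next
  case dom: True
  show ?thesis
  proof (cases "\<forall>i\<in>{1..n}. \<tau> i = site l i")
    case False
    then obtain i where i: "i \<in> {1..n}" "\<tau> i \<noteq> site l i" by blast
    then have "aL i (y i) = 0" by (simp add: aL_def)
    then have "(\<Prod>i=1..n. aL i (y i)) = 0" using i by (intro prod_zero) auto
    then show ?thesis unfolding gL_def if_P[OF dom] if_not_P[OF False] by (simp only: mult_zero_left)
  next
    case True
    have a: "aL i (y i) = (cpw (cs (site l i)) (\<alpha> (site l i)) * (\<Prod>r\<in>{1..p}-{site l i}. cpw (z (site l i) - z r) (\<alpha> r)))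
        * (cpw (y i) (\<alpha> (site l i)) / of_real (y i) * of_real (exp (- y i)))" if i: "i \<in> {1..n}" for i
    proof -
      have "cs (site l i) \<noteq> 0" using cs_pos[OF site_range[OF l i]] by simp
      then show ?thesis using True i by (simp add: aL_def cpw_mult field_simps)
    qed
    have b: "bL y i j = (if site l i = site l j then cpw (cs (site l i)) (2 * \<gamma>) else cpw (z (site l j) - z (site l i)) (2 * \<gamma>))
        * (if site l i = site l j then cpw (y j - y i) (2 * \<gamma>) else 1)" for i j
      by (simp add: bL_def cpw_mult)
    have A: "(\<Prod>i=1..n. aL i (y i)) = (\<Prod>i=1..n. cpw (cs (site l i)) (\<alpha> (site l i)) * (\<Prod>r\<in>{1..p}-{site l i}. cpw (z (site l i) - z r) (\<alpha> r)))
        * (\<Prod>i=1..n. cpw (y i) (\<alpha> (site l i)) / of_real (y i) * of_real (exp (- y i)))"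
      unfolding prod.distrib[symmetric] by (rule prod.cong[OF refl]) (simp only: a)
    show ?thesis unfolding gL_def grpI_def if_P[OF dom] if_P[OF True] A b Kst_def prod.distrib by (simp only: mult_ac)
  qed
qed

lemma integrable_scaledI: "integrable (Rn n) (\<lambda>t. indU l t *\<^sub>R scaledI l \<tau> K t)"
proof (rule Bochner_Integration.integrable_bound)
  show "integrable (Rn n) (\<lambda>t. norm (cpw (real K) (expo l)) * norm (indU l t *\<^sub>R (Psi n p z \<alpha> \<gamma> t * (\<Prod>i=1..n. 1 / of_real (t i - z (\<tau> i))))))"
    by (intro integrable_mult_right integrable_norm integrable_base[OF l \<tau>])
  have [measurable]: "scaledI l \<tau> K \<in> borel_measurable (Rn n)" by (rule measurable_scaledI[OF l \<tau>])
  show "(\<lambda>t. indU l t *\<^sub>R scaledI l \<tau> K t) \<in> borel_measurable (Rn n)" by measurable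
  show "AE t in Rn n. norm (indU l t *\<^sub>R scaledI l \<tau> K t) \<le> norm (norm (cpw (real K) (expo l)) * norm (indU l t *\<^sub>R (Psi n p z \<alpha> \<gamma> t * (\<Prod>i=1..n. 1 / of_real (t i - z (\<tau> i))))))"
  proof (rule AE_I2)
    fix t
    show "norm (indU l t *\<^sub>R scaledI l \<tau> K t) \<le> norm (norm (cpw (real K) (expo l)) * norm (indU l t *\<^sub>R (Psi n p z \<alpha> \<gamma> t * (\<Prod>i=1..n. 1 / of_real (t i - z (\<tau> i))))))"
    proof (cases "inU l t")
      case True
      have "norm (scaledI l \<tau> K t) \<le> norm (cpw (real K) (expo l)) * norm (Psi n p z \<alpha> \<gamma> t * (\<Prod>i=1..n. 1 / of_real (t i - z (\<tau> i))))"
        by (rule scaledI_norm_le[OF l _ True]) (rule \<tau>)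
      then show ?thesis using True by (simp add: indU_def norm_mult)
    qed (simp add: indU_def)
  qed
qed

lemma scaled_tendsto:
  "(\<lambda>k. \<integral>t. indU l t *\<^sub>R scaledI l \<tau> (Suc k) t \<partial>Rn n)
     \<longlonglongrightarrow> (if \<forall>i\<in>{1..n}. \<tau> i = site l i then Kst l * (\<Prod>s=1..p-1. Lag (l s) (\<alpha> s) \<gamma>) else 0)"
proof -
  have nr: "(\<lambda>k. \<integral>t. (if inU l t \<and> nearN l t then scaledI l \<tau> (Suc k) t else 0) \<partial>Rn n) \<longlonglongrightarrow> (\<integral>y. gL y \<partial>Rn n)"
  proof -
    have "(\<integral>t. (if inU l t \<and> nearN l t then scaledI l \<tau> (Suc k) t else 0) \<partial>Rn n) = (\<integral>y. gK (Suc k) y \<partial>Rn n)" for k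
      by (rule near_integral(1)) auto
    then show ?thesis using near_tendsto by (simp only:)
  qed
  have split: "(\<integral>t. indU l t *\<^sub>R scaledI l \<tau> K t \<partial>Rn n) = (\<integral>t. (if inU l t \<and> nearN l t then scaledI l \<tau> K t else 0) \<partial>Rn n)
      + (\<integral>t. (if inU l t \<and> \<not> nearN l t then scaledI l \<tau> K t else 0) \<partial>Rn n)" for K
  proof -
    have [measurable]: "scaledI l \<tau> K \<in> borel_measurable (Rn n)" by (rule measurable_scaledI[OF l \<tau>])
    have i1: "integrable (Rn n) (\<lambda>t. if inU l t \<and> nearN l t then scaledI l \<tau> K t else 0)"
      by (rule Bochner_Integration.integrable_bound[OF integrable_scaledI[of K]]) (measurable, auto simp: indU_def)
    have i2: "integrable (Rn n) (\<lambda>t. if inU l t \<and> \<not> nearN l t then scaledI l \<tau> K t else 0)"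
      by (rule Bochner_Integration.integrable_bound[OF integrable_scaledI[of K]]) (measurable, auto simp: indU_def)
    have "(\<lambda>t. indU l t *\<^sub>R scaledI l \<tau> K t) = (\<lambda>t. (if inU l t \<and> nearN l t then scaledI l \<tau> K t else 0) + (if inU l t \<and> \<not> nearN l t then scaledI l \<tau> K t else 0))"
      by (auto simp: indU_def fun_eq_iff)
    then show ?thesis using Bochner_Integration.integral_add[OF i1 i2] by simp
  qed
  have "(\<integral>y. gL y \<partial>Rn n) = (if \<forall>i\<in>{1..n}. \<tau> i = site l i then Kst l * (\<Prod>s=1..p-1. Lag (l s) (\<alpha> s) \<gamma>) else 0)"
  proof -
    have "(\<integral>y. grpI n (site l) \<alpha> \<gamma> y \<partial>Rn n) = (\<Prod>s=1..p-1. Lag (l s) (\<alpha> s) \<gamma>)"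
      by (rule integral_grpI[OF l Apos' Gpos])
    then show ?thesis
    proof (cases "\<forall>i\<in>{1..n}. \<tau> i = site l i")
      case True
      have "(\<integral>y. gL y \<partial>Rn n) = Kst l * (\<integral>y. grpI n (site l) \<alpha> \<gamma> y \<partial>Rn n)"
        unfolding gL_eq if_P[OF True] by (rule integral_mult_right_zero)
      then show ?thesis using True \<open>(\<integral>y. grpI n (site l) \<alpha> \<gamma> y \<partial>Rn n) = _\<close> by simp
    next
      case False
      then show ?thesis unfolding gL_eq if_not_P[OF False] by simp
    qed
  qed
  then show ?thesis unfolding split using tendsto_add[OF nr far_tendsto_0[OF l \<tau>]] by simp
qed

end

end

text \<open>The quotient of two approximating sequences \<open>Gamma_series'\<close>; the factorials
  cancel and the powers of K combine.\<close>

lemma pochhammer_ratio_tendsto: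
  fixes x y :: complex
  assumes x: "Re x > 0" and y: "Re y > 0"
  shows "(\<lambda>k. pochhammer x (Suc k) / pochhammer y (Suc k) * cpw (real (Suc k)) (y - x)) \<longlonglongrightarrow> Gamma y / Gamma x"
proof -
  have nx: "x \<notin> \<int>\<^sub>\<le>\<^sub>0" "y \<notin> \<int>\<^sub>\<le>\<^sub>0" using x y by (auto elim!: nonpos_Ints_cases)
  have "(\<lambda>k. Gamma_series' y (Suc k) / Gamma_series' x (Suc k)) \<longlonglongrightarrow> Gamma y / Gamma x"
    using nx by (intro tendsto_divide LIMSEQ_Suc[OF Gamma_series'_LIMSEQ]) (auto simp: Gamma_eq_zero_iff)
  moreover have "Gamma_series' y (Suc k) / Gamma_series' x (Suc k) = pochhammer x (Suc k) / pochhammer y (Suc k) * cpw (real (Suc k)) (y - x)" for k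
  proof -
    have "pochhammer x (Suc k) \<noteq> 0" "pochhammer y (Suc k) \<noteq> 0" using x y by (auto simp: pochhammer_eq_0_iff)
    moreover have "exp (y * of_real (ln (real (Suc k)))) / exp (x * of_real (ln (real (Suc k)))) = cpw (real (Suc k)) (y - x)"
      by (simp add: cpw_def exp_diff[symmetric] left_diff_distrib del: of_nat_Suc)
    ultimately show ?thesis unfolding Gamma_series'_def by (simp add: divide_simps mult_ac del: of_nat_Suc pochhammer_Suc)
  qed
  ultimately show ?thesis by simp
qed

lemma prod_power_sum: "finite S \<Longrightarrow> (\<Prod>l\<in>S. g ^ f l) = (g :: 'a :: comm_monoid_mult) ^ (\<Sum>l\<in>S. f l)"
  by (simp add: power_sum)

section \<open>Limit of the normalised determinant and comparison with the recursion\<close>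

context conf
begin

abbreviation shifted :: "nat \<Rightarrow> nat \<Rightarrow> complex" where
  "shifted K \<equiv> \<alpha>(p := \<alpha> p + of_nat K)"

lemma conf_shifted: "conf p z (shifted K) \<gamma>"
  by standard (use p2 zinc Apos Ap Gpos in auto)

definition XL :: "(nat \<Rightarrow> nat) \<Rightarrow> complex" where
  "XL l = Kst l * (\<Prod>s=1..p-1. Lag (l s) (\<alpha> s) \<gamma>)"

text \<open>The normalisation depends on the row only, so it leaves the determinant as a
  product.\<close>

definition rowf :: "nat \<Rightarrow> (nat \<Rightarrow> nat) \<Rightarrow> complex" where
  "rowf K l = cpw (real K) (expo l) * (\<Prod>i=1..n. 1 / of_real (cs (site l i) ^ K))"

text \<open>In the term of \<open>omega\<close> that belongs to \<sigma>, the pole of variable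
  \<open>i\<close> sits at the point number \<open>site m (inv \<sigma> i)\<close>.\<close>

lemma entry_scaled:
  assumes l: "l \<in> Zset n (p - 1)" and m: "m \<in> Zset n (p - 1)"
  shows "rowf K l * conf.entry n p z (shifted K) \<gamma> l m
     = (\<Sum>\<sigma> | \<sigma> permutes {1..n}. mfact m * (\<integral>t. indU l t *\<^sub>R scaledI l (\<lambda>i. site m (inv \<sigma> i)) K t \<partial>Rn n))"
proof -
  interpret c: conf n p z "shifted K" \<gamma> by (rule conf_shifted)
  let ?S = "{\<sigma>. \<sigma> permutes {1..n}}"
  have Psi: "Psi n p z (shifted K) \<gamma> t = Psi n p z \<alpha> \<gamma> t * (\<Prod>i=1..n. of_real ((z p - t i) ^ K))" if "inU l t" for t
  proof -
    have "(\<Prod>s=1..p. cpw (t i - z s) ((shifted K) s)) = (\<Prod>s=1..p. cpw (t i - z s) (\<alpha> s)) * of_real ((z p - t i) ^ K)" if i: "i \<in> {1..n}" for i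
    proof -
      have "{1..p} = insert p {1..<p}" using p2 by auto
      moreover have "cpw (t i - z p) (\<alpha> p + of_nat K) = cpw (t i - z p) (\<alpha> p) * of_real ((z p - t i) ^ K)"
        using cpw_add_of_nat[of "t i - z p" "\<alpha> p" K] inU_range(2)[OF l \<open>inU l t\<close> i] by (simp add: abs_if)
      ultimately show ?thesis by simp
    qed
    then have "(\<Prod>i=1..n. \<Prod>s=1..p. cpw (t i - z s) ((shifted K) s)) = (\<Prod>i=1..n. (\<Prod>s=1..p. cpw (t i - z s) (\<alpha> s)) * of_real ((z p - t i) ^ K))"
      by (intro prod.cong refl)
    then show ?thesis unfolding Psi_def prod.distrib by (simp only: mult_ac)
  qed
  have pw: "rowf K l * (indU l t *\<^sub>R (Psi n p z (shifted K) \<gamma> t * omega n p z m t))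
     = (\<Sum>\<sigma>\<in>?S. mfact m * (indU l t *\<^sub>R scaledI l (\<lambda>i. site m (inv \<sigma> i)) K t))" for t
  proof (cases "inU l t")
    case True
    have "(\<Prod>j=1..n. ev (LF (site m j)) (t (\<sigma> j))) = (\<Prod>i=1..n. 1 / of_real (t i - z (site m (inv \<sigma> i))))" if "\<sigma> \<in> ?S" for \<sigma>
      using prod_perm_reindex[of \<sigma> "\<lambda>j. ev (LF (site m j))" t] that by simp
    then have Sy: "Symf n (\<lambda>j. ev (LF (site m j))) t = (\<Sum>\<sigma>\<in>?S. \<Prod>i=1..n. 1 / of_real (t i - z (site m (inv \<sigma> i))))"
      unfolding Symf_def by (intro sum.cong refl)
    have sc: "scaledI l \<tau> K t = rowf K l * (Psi n p z \<alpha> \<gamma> t * (\<Prod>i=1..n. of_real ((z p - t i) ^ K))) * (\<Prod>i=1..n. 1 / of_real (t i - z (\<tau> i)))" for \<tau>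
    proof -
      have "(\<Prod>i=1..n. of_real (((z p - t i) / cs (site l i)) ^ K) * (1 / of_real (t i - z (\<tau> i))) :: complex)
         = (\<Prod>i=1..n. of_real ((z p - t i) ^ K)) * (\<Prod>i=1..n. 1 / of_real (cs (site l i) ^ K)) * (\<Prod>i=1..n. 1 / of_real (t i - z (\<tau> i)))"
        unfolding prod.distrib[symmetric] by (intro prod.cong refl) (simp add: power_divide)
      then show ?thesis unfolding scaledI_def rowf_def by (simp only: mult_ac)
    qed
    show ?thesis unfolding omega_Symf[OF m] Sy sc Psi[OF True] using True
      by (simp add: indU_def sum_distrib_left mult_ac)
  qed (simp add: indU_def)
  have \<tau>: "site m (inv \<sigma> i) \<in> {1..p-1}" if "\<sigma> \<in> ?S" "i \<in> {1..n}" for \<sigma> i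
    using site_range[OF m] permutes_in_image[OF permutes_inv[of \<sigma> "{1..n}"]] that by auto
  have "rowf K l * c.entry l m = (\<integral>t. rowf K l * (indU l t *\<^sub>R (Psi n p z (shifted K) \<gamma> t * omega n p z m t)) \<partial>Rn n)"
    unfolding c.entry_def by (rule integral_mult_right_zero[symmetric])
  also have "\<dots> = (\<integral>t. (\<Sum>\<sigma>\<in>?S. mfact m * (indU l t *\<^sub>R scaledI l (\<lambda>i. site m (inv \<sigma> i)) K t)) \<partial>Rn n)"
    unfolding pw ..
  also have "\<dots> = (\<Sum>\<sigma>\<in>?S. \<integral>t. mfact m * (indU l t *\<^sub>R scaledI l (\<lambda>i. site m (inv \<sigma> i)) K t) \<partial>Rn n)"
  proof (intro Bochner_Integration.integral_sum integrable_mult_right)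
    fix \<sigma> assume "\<sigma> \<in> ?S"
    then show "integrable (Rn n) (\<lambda>t. indU l t *\<^sub>R scaledI l (\<lambda>i. site m (inv \<sigma> i)) K t)"
      by (intro integrable_scaledI[OF l] \<tau>)
  qed
  finally show ?thesis by (simp only: integral_mult_right_zero)
qed

text \<open>The surviving \<sigma> carry the blocks of \<open>m\<close> to the blocks of
  \<open>l\<close>. They exist only for \<open>m = l\<close>, when their number is the product of
  the factorials of the \<open>l s\<close>, which cancels \<open>mfact\<close>.\<close>

lemma entry_tendsto:
  assumes l: "l \<in> Zset n (p - 1)" and m: "m \<in> Zset n (p - 1)"
  shows "(\<lambda>k. rowf (Suc k) l * conf.entry n p z (shifted (Suc k)) \<gamma> l m) \<longlonglongrightarrow> (if m = l then XL l else 0)"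
proof -
  let ?S = "{\<sigma>. \<sigma> permutes {1..n}}"
  have \<tau>: "site m (inv \<sigma> i) \<in> {1..p-1}" if "\<sigma> \<in> ?S" "i \<in> {1..n}" for \<sigma> i
    using site_range[OF m] permutes_in_image[OF permutes_inv[of \<sigma> "{1..n}"]] that by auto
  let ?P = "\<lambda>\<sigma>. \<forall>i\<in>{1..n}. site m (inv \<sigma> i) = site l i"
  have lim: "(\<lambda>k. rowf (Suc k) l * conf.entry n p z (shifted (Suc k)) \<gamma> l m) \<longlonglongrightarrow> (\<Sum>\<sigma>\<in>?S. mfact m * (if ?P \<sigma> then XL l else 0))"
    unfolding entry_scaled[OF l m] XL_def
  proof (intro tendsto_sum tendsto_mult tendsto_const)
    fix \<sigma> assume "\<sigma> \<in> ?S"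
    then show "(\<lambda>k. \<integral>t. indU l t *\<^sub>R scaledI l (\<lambda>i. site m (inv \<sigma> i)) (Suc k) t \<partial>Rn n)
       \<longlonglongrightarrow> (if ?P \<sigma> then Kst l * (\<Prod>s=1..p-1. Lag (l s) (\<alpha> s) \<gamma>) else 0)"
      by (intro scaled_tendsto[OF l] \<tau>)
  qed
  have P_iff: "?P \<sigma> \<longleftrightarrow> (\<forall>j\<in>{1..n}. site m j = site l (\<sigma> j))" if "\<sigma> \<in> ?S" for \<sigma>
  proof -
    have \<sigma>: "\<sigma> permutes {1..n}" using that by simp
    note inv = permutes_inverses[OF \<sigma>]
    have in1: "\<sigma> j \<in> {1..n}" if "j \<in> {1..n}" for j using permutes_in_image[OF \<sigma>] that by simp
    have in2: "inv \<sigma> j \<in> {1..n}" if "j \<in> {1..n}" for j using permutes_in_image[OF permutes_inv[OF \<sigma>]] that by simp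
    show ?thesis
    proof
      assume a: "?P \<sigma>"
      show "\<forall>j\<in>{1..n}. site m j = site l (\<sigma> j)"
      proof
        fix j assume "j \<in> {1..n}"
        from bspec[OF a in1[OF this]] show "site m j = site l (\<sigma> j)" by (simp only: inv)
      qed
    next
      assume a: "\<forall>j\<in>{1..n}. site m j = site l (\<sigma> j)"
      show "?P \<sigma>"
      proof
        fix j assume "j \<in> {1..n}"
        from bspec[OF a in2[OF this]] show "site m (inv \<sigma> j) = site l j" by (simp only: inv)
      qed
    qed
  qed
  have "(\<Sum>\<sigma>\<in>?S. mfact m * (if ?P \<sigma> then XL l else 0)) = (if m = l then XL l else 0)"
  proof (cases "m = l")
    case False
    have nP: "\<not> ?P \<sigma>" if \<sigma>S: "\<sigma> \<in> ?S" for \<sigma>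
    proof
      assume "?P \<sigma>"
      then have a: "\<forall>j\<in>{1..n}. site m j = site l (\<sigma> j)" using P_iff[OF \<sigma>S] by simp
      have \<sigma>: "\<sigma> permutes {1..n}" using \<sigma>S by simp
      have "Abs_multiset m = image_mset (\<lambda>j. site l (\<sigma> j)) (mset_set {1..n})"
        unfolding word_site[OF m, symmetric] using a by (intro image_mset_cong) auto
      also have "\<dots> = image_mset (site l) (image_mset \<sigma> (mset_set {1..n}))" by (simp add: image_mset.compositionality o_def)
      also have "image_mset \<sigma> (mset_set {1..n}) = mset_set {1..n}"
        using image_mset_mset_set[OF permutes_inj_on[OF \<sigma>]] permutes_image[OF \<sigma>] by simp
      finally have "Abs_multiset m = Abs_multiset l" unfolding word_site[OF l] .
      then have "m = l" using Abs_multiset_count_Zset[OF l] Abs_multiset_count_Zset[OF m] by metis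
      then show False using False by simp
    qed
    have "(\<Sum>\<sigma>\<in>?S. mfact m * (if ?P \<sigma> then XL l else 0)) = (\<Sum>\<sigma>\<in>?S. 0)"
    proof (rule sum.cong[OF refl])
      fix \<sigma> assume "\<sigma> \<in> ?S"
      show "mfact m * (if ?P \<sigma> then XL l else 0) = 0" unfolding if_not_P[OF nP[OF \<open>\<sigma> \<in> ?S\<close>]] by simp
    qed
    then show ?thesis using False by simp
  next
    case True
    have fS: "finite ?S" by (simp add: finite_permutations)
    have "(\<Sum>\<sigma>\<in>?S. mfact m * (if ?P \<sigma> then XL l else 0)) = (\<Sum>\<sigma>\<in>?S. if \<forall>j\<in>{1..n}. site l (\<sigma> j) = site l j then mfact l * XL l else 0)"
      by (intro sum.cong refl) (use P_iff True in auto)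
    also have "\<dots> = of_nat (card {\<sigma>\<in>?S. \<forall>j\<in>{1..n}. site l (\<sigma> j) = site l j}) * (mfact l * XL l)"
      using fS by (simp add: sum.If_cases Int_def)
    also have "card {\<sigma>\<in>?S. \<forall>j\<in>{1..n}. site l (\<sigma> j) = site l j} = (\<Prod>s\<in>{1..p-1}. fact (card {x\<in>{1..n}. site l x = s}))"
      using card_permutes_fibre[of "{1..n}" "{1..p-1}" "site l"] site_range[OF l] by (auto simp: image_subset_iff)
    also have "\<dots> = (\<Prod>s=1..p-1. fact (l s))" by (intro prod.cong refl) (simp only: card_site_eq[OF l])
    also have "of_nat (\<Prod>s=1..p-1. fact (l s)) * (mfact l * XL l) = XL l"
    proof -
      have "l p = 0" using l p2 by (auto simp: Zset_def)
      moreover have "{1..p} = insert p {1..p-1}" "p \<notin> {1..p-1}" using p2 by auto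
      ultimately have "mfact l = (\<Prod>s=1..p-1. 1 / of_nat (fact (l s)))" unfolding mfact_def by simp
      also have "\<dots> = 1 / of_nat (\<Prod>s=1..p-1. fact (l s))" by (simp add: prod_dividef)
      finally have "mfact l = 1 / of_nat (\<Prod>s=1..p-1. fact (l s))" .
      moreover have "of_nat (\<Prod>s=1..p-1. fact (l s)) \<noteq> (0::complex)" by (simp only: of_nat_eq_0_iff prod_zero_iff finite_atLeastAtMost fact_nonzero) simp
      ultimately show ?thesis by simp
    qed
    finally show ?thesis using True by simp
  qed
  then show ?thesis using lim by (simp only:)
qed

lemma det_entry_tendsto:
  "(\<lambda>k. (\<Prod>l\<in>Zset n (p - 1). rowf (Suc k) l) * det_on (Zset n (p - 1)) (conf.entry n p z (shifted (Suc k)) \<gamma>)) \<longlonglongrightarrow> (\<Prod>l\<in>Zset n (p - 1). XL l)"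
proof -
  let ?Z = "Zset n (p - 1)"
  have f1: "(\<lambda>k. det_on ?Z (\<lambda>l m. rowf (Suc k) l * conf.entry n p z (shifted (Suc k)) \<gamma> l m)) \<longlonglongrightarrow> det_on ?Z (\<lambda>l m. if m = l then XL l else 0)"
    by (intro tendsto_det_on entry_tendsto)
  have f2: "det_on ?Z (\<lambda>l m. if m = l then XL l else 0) = (\<Prod>l\<in>?Z. XL l)"
    by (subst det_on_triangular[where key="\<lambda>_. 0"]) auto
  have f3: "det_on ?Z (\<lambda>l m. rowf K l * conf.entry n p z (shifted K) \<gamma> l m) = (\<Prod>l\<in>?Z. rowf K l) * det_on ?Z (conf.entry n p z (shifted K) \<gamma>)" for K
    using det_on_scale[of ?Z "rowf K" "conf.entry n p z (shifted K) \<gamma>" "\<lambda>_. 1"] by simp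
  show ?thesis using f1 unfolding f2 f3 .
qed

text \<open>Numerator and denominator of one shift. Raising \<alpha>_p by 1 adds 1 to both, so
  iterating the shift gives Pochhammer symbols in \<open>xs\<close> and \<open>ys\<close>.\<close>

definition xs :: "nat \<Rightarrow> complex" where "xs s = 1 + \<alpha> p + of_nat s * \<gamma>"
definition ys :: "nat \<Rightarrow> complex" where "ys s = 1 + (\<Sum>s=1..p. \<alpha> s) + (2 * of_nat n - 2 - of_nat s) * \<gamma>"
definition cprod :: complex where "cprod = (\<Prod>m\<in>Zset n (p - 1). \<Prod>s=1..p-1. of_real (cs s) ^ m s)"

lemma det_entry_iterate:
  "det_on (Zset n (p - 1)) (conf.entry n p z (shifted K) \<gamma>)
    = (\<Prod>m\<in>Zset n (p - 1). \<Prod>s<m 1. pochhammer (xs s) K / pochhammer (ys s) K) * cprod ^ K * det_on (Zset n (p - 1)) entry"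
proof (induction K)
  case 0
  then show ?case by simp
next
  case (Suc K)
  interpret c: conf n p z "shifted K" \<gamma> by (rule conf_shifted)
  have e: "(shifted K)(p := (shifted K) p + 1) = shifted (Suc K)" by (auto simp: fun_eq_iff)
  have "(\<Sum>s=1..p. (shifted K) s) = (\<Sum>s=1..p. \<alpha> s) + of_nat K"
  proof -
    have "{1..p} = insert p {1..<p}" using p2 by auto
    then show ?thesis by simp
  qed
  then have y: "1 + (\<Sum>s=1..p. (shifted K) s) + (2 * of_nat n - 2 - of_nat s) * \<gamma> = ys s + of_nat K" for s
    by (simp add: ys_def algebra_simps)
  have x: "1 + (shifted K) p + of_nat s * \<gamma> = xs s + of_nat K" for s by (simp add: xs_def)
  have "det_on (Zset n (p - 1)) (conf.entry n p z (shifted (Suc K)) \<gamma>) =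
     (\<Prod>m\<in>Zset n (p - 1). \<Prod>s<m 1. (xs s + of_nat K) / (ys s + of_nat K)) * cprod * det_on (Zset n (p - 1)) c.entry"
    using c.det_entry_shift unfolding e x y cprod_def cs_def .
  then show ?case
    unfolding Suc.IH pochhammer_Suc times_divide_times_eq[symmetric] prod.distrib power_Suc by (simp only: mult_ac)
qed

abbreviation nb :: nat where "nb \<equiv> (p + n - 2) choose (p - 1)"
abbreviation nb' :: nat where "nb' \<equiv> (p + n - 2) choose p"

text \<open>The values do not depend on the chosen coordinates, and pairs inside a block are as
  frequent as pairs from two given blocks. This is why all differences z_b - z_a carry the same two
  binomial exponents in the theorem.\<close>

lemma Zset_sums:
  assumes "s \<in> {1..p-1}"
  shows "(\<Sum>m\<in>Zset n (p - 1). m s) = nb" "(\<Sum>m\<in>Zset n (p - 1). m s choose 2) = nb'"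
    "r \<in> {1..p-1} \<Longrightarrow> r \<noteq> s \<Longrightarrow> (\<Sum>m\<in>Zset n (p - 1). m r * m s) = nb'"
proof -
  have e: "p - 1 = Suc (p - 2)" "Suc (Suc (p - 2)) = p" "n + (p - 2) = p + n - 2" using p2 by auto
  show "(\<Sum>m\<in>Zset n (p - 1). m s) = nb"
    using sum_Zset_coord[of s "p - 2" n] assms unfolding e(1)[symmetric] e(3) by simp
  show "(\<Sum>m\<in>Zset n (p - 1). m s choose 2) = nb'"
    using sum_Zset_coord_choose_2[of s "p - 2" n] assms unfolding e(2) e(3) unfolding e(1)[symmetric] by simp
  show "(\<Sum>m\<in>Zset n (p - 1). m r * m s) = nb'" if "r \<in> {1..p-1}" "r \<noteq> s"
    using sum_Zset_coord_mult[of s "p - 2" r n] assms that unfolding e(2) e(3) unfolding e(1)[symmetric] by simp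
qed

lemma prod_Zset_site:
  fixes g :: "nat \<Rightarrow> complex"
  shows "(\<Prod>l\<in>Zset n (p - 1). \<Prod>i=1..n. g (site l i)) = (\<Prod>s=1..p-1. g s) ^ nb"
proof -
  have "(\<Prod>l\<in>Zset n (p - 1). \<Prod>i=1..n. g (site l i)) = (\<Prod>l\<in>Zset n (p - 1). \<Prod>s=1..p-1. g s ^ l s)"
    by (intro prod.cong refl prod_site)
  also have "\<dots> = (\<Prod>s=1..p-1. \<Prod>l\<in>Zset n (p - 1). g s ^ l s)" by (rule prod.swap)
  also have "\<dots> = (\<Prod>s=1..p-1. g s ^ nb)"
    by (intro prod.cong refl) (simp only: prod_power_sum[OF finite_Zset] Zset_sums(1))
  finally show ?thesis by (simp add: prod_power_distrib)
qed

lemma prod_Zset_site_pairs: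
  fixes G :: "nat \<Rightarrow> nat \<Rightarrow> complex"
  shows "(\<Prod>l\<in>Zset n (p - 1). \<Prod>i=1..n. \<Prod>j\<in>{i<..n}. G (site l i) (site l j))
    = ((\<Prod>s=1..p-1. G s s) * (\<Prod>s=1..p-1. \<Prod>r=1..<s. G r s)) ^ nb'"
proof -
  let ?Z = "Zset n (p - 1)"
  have "(\<Prod>l\<in>?Z. \<Prod>i=1..n. \<Prod>j\<in>{i<..n}. G (site l i) (site l j))
     = (\<Prod>l\<in>?Z. (\<Prod>s=1..p-1. G s s ^ (l s choose 2)) * (\<Prod>s=1..p-1. \<Prod>r=1..<s. G r s ^ (l r * l s)))"
    by (intro prod.cong refl prod_site_pairs)
  also have "\<dots> = (\<Prod>s=1..p-1. \<Prod>l\<in>?Z. G s s ^ (l s choose 2)) * (\<Prod>s=1..p-1. \<Prod>r=1..<s. \<Prod>l\<in>?Z. G r s ^ (l r * l s))"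
  proof -
    have 1: "(\<Prod>l\<in>?Z. \<Prod>s=1..p-1. G s s ^ (l s choose 2)) = (\<Prod>s=1..p-1. \<Prod>l\<in>?Z. G s s ^ (l s choose 2))" by (rule prod.swap)
    have "(\<Prod>l\<in>?Z. \<Prod>s=1..p-1. \<Prod>r=1..<s. G r s ^ (l r * l s)) = (\<Prod>s=1..p-1. \<Prod>l\<in>?Z. \<Prod>r=1..<s. G r s ^ (l r * l s))" by (rule prod.swap)
    also have "\<dots> = (\<Prod>s=1..p-1. \<Prod>r=1..<s. \<Prod>l\<in>?Z. G r s ^ (l r * l s))" by (intro prod.cong refl prod.swap)
    finally show ?thesis unfolding prod.distrib 1 by simp
  qed
  also have "(\<Prod>s=1..p-1. \<Prod>l\<in>?Z. G s s ^ (l s choose 2)) = (\<Prod>s=1..p-1. G s s ^ nb')"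
    by (intro prod.cong refl) (simp only: prod_power_sum[OF finite_Zset] Zset_sums(2))
  also have "(\<Prod>s=1..p-1. \<Prod>r=1..<s. \<Prod>l\<in>?Z. G r s ^ (l r * l s)) = (\<Prod>s=1..p-1. \<Prod>r=1..<s. G r s ^ nb')"
  proof (intro prod.cong refl)
    fix s r assume "s \<in> {1..p-1}" "r \<in> {1..<s}"
    then show "(\<Prod>l\<in>?Z. G r s ^ (l r * l s)) = G r s ^ nb'"
      by (subst prod_power_sum[OF finite_Zset], subst Zset_sums(3)) auto
  qed
  finally show ?thesis by (simp add: prod_power_distrib power_mult_distrib)
qed

text \<open>The power \<open>cprod ^ K\<close> cancels the one in \<open>det_entry_iterate\<close>.
  The exponent of K is a row sum that must balance the Pochhammer quotients.\<close>

lemma prod_rowf: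
  assumes K: "K > 0"
  shows "(\<Prod>l\<in>Zset n (p - 1). rowf K l) = cpw (real K) (of_nat nb * (\<Sum>s=1..p-1. \<alpha> s) + of_nat (nb' * (p - 1)) * (2 * \<gamma>)) / cprod ^ K"
proof -
  let ?Z = "Zset n (p - 1)" and ?k = "cpw (real K)"
  have K0: "real K \<noteq> 0" using K by simp
  have e: "?k (expo l) = (\<Prod>i=1..n. ?k (\<alpha> (site l i))) * (\<Prod>i=1..n. \<Prod>j\<in>{i<..n}. ?k (if site l i = site l j then 2 * \<gamma> else 0))" for l
    unfolding expo_def cpw_add cpw_sum[OF K0] ..
  have "(\<Prod>l\<in>?Z. rowf K l) = (\<Prod>l\<in>?Z. \<Prod>i=1..n. ?k (\<alpha> (site l i))) * (\<Prod>l\<in>?Z. \<Prod>i=1..n. \<Prod>j\<in>{i<..n}. ?k (if site l i = site l j then 2 * \<gamma> else 0))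
     * (\<Prod>l\<in>?Z. \<Prod>i=1..n. 1 / of_real (cs (site l i) ^ K))"
    unfolding rowf_def e prod.distrib ..
  also have "(\<Prod>l\<in>?Z. \<Prod>i=1..n. ?k (\<alpha> (site l i))) = (\<Prod>s=1..p-1. ?k (\<alpha> s)) ^ nb" by (rule prod_Zset_site)
  also have "\<dots> = ?k (of_nat nb * (\<Sum>s=1..p-1. \<alpha> s))" unfolding cpw_sum[OF K0, symmetric] by (rule cpw_power[OF K0])
  also have "(\<Prod>l\<in>?Z. \<Prod>i=1..n. \<Prod>j\<in>{i<..n}. ?k (if site l i = site l j then 2 * \<gamma> else 0))
     = ((\<Prod>s=1..p-1. ?k (if s = s then 2 * \<gamma> else 0)) * (\<Prod>s=1..p-1. \<Prod>r=1..<s. ?k (if r = s then 2 * \<gamma> else 0))) ^ nb'"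
    by (rule prod_Zset_site_pairs)
  also have "(\<Prod>s=1..p-1. \<Prod>r=1..<s. ?k (if r = s then 2 * \<gamma> else 0)) = 1"
    using cpw_exponent_0[OF K0] by (intro prod.neutral ballI) auto
  also have "((\<Prod>s=1..p-1. ?k (if s = s then 2 * \<gamma> else 0)) * 1) ^ nb' = ?k (of_nat (nb' * (p - 1)) * (2 * \<gamma>))"
    by (simp add: cpw_power[OF K0] mult_ac flip: power_mult)
  also have "(\<Prod>l\<in>?Z. \<Prod>i=1..n. 1 / of_real (cs (site l i) ^ K)) = 1 / cprod ^ K"
  proof -
    have "(\<Prod>l\<in>?Z. \<Prod>i=1..n. 1 / of_real (cs (site l i) ^ K)) = (\<Prod>l\<in>?Z. \<Prod>s=1..p-1. (1 / of_real (cs s ^ K)) ^ l s :: complex)"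
      by (rule prod.cong[OF refl]) (rule prod_site)
    also have "\<dots> = (\<Prod>l\<in>?Z. \<Prod>s=1..p-1. (1 / (of_real (cs s) ^ l s)) ^ K)"
      by (intro prod.cong refl) (simp add: power_divide power_commutes flip: power_mult add: mult.commute)
    also have "\<dots> = 1 / cprod ^ K" unfolding cprod_def by (simp add: prod_power_distrib prod_dividef power_divide)
    finally show ?thesis .
  qed
  finally show ?thesis by (simp add: cpw_add)
qed

lemma cprod_nz: "cprod \<noteq> 0"
proof -
  have nz: "of_real (cs s) ^ k \<noteq> (0::complex)" if "s \<in> {1..p-1}" for s k using cs_pos[OF that] by simp
  show ?thesis unfolding cprod_def prod_zero_iff[OF finite_Zset] prod_zero_iff[OF finite_atLeastAtMost] using nz by blast
qed

lemma sum_alpha_split: "(\<Sum>s=1..p. \<alpha> s) = (\<Sum>s=1..p-1. \<alpha> s) + \<alpha> p"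
proof -
  have "{1..p} = insert p {1..p-1}" "p \<notin> {1..p-1}" using p2 by auto
  then show ?thesis by simp
qed

lemma Re_xs: "Re (xs s) > 0"
  using Ap Gpos by (simp add: xs_def add_pos_nonneg)

lemma Re_ys: "s < n \<Longrightarrow> Re (ys s) > 0"
proof -
  assume s: "s < n"
  have "Re (\<Sum>s=1..p-1. \<alpha> s) \<ge> 0" unfolding Re_sum using Apos p2 by (intro sum_nonneg) (auto intro!: less_imp_le)
  moreover have "(2 * of_nat n - 2 - of_nat s :: complex) = of_real (2 * real n - 2 - real s)" by simp
  then have "Re ((2 * of_nat n - 2 - of_nat s) * \<gamma>) = Re (of_real (2 * real n - 2 - real s) * \<gamma>)" by (simp only:)
  then have "Re ((2 * of_nat n - 2 - of_nat s) * \<gamma>) = (2 * real n - 2 - real s) * Re \<gamma>" by simp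
  moreover have "(2 * real n - 2 - real s) * Re \<gamma> \<ge> 0" using s Gpos by (intro mult_nonneg_nonneg) auto
  ultimately show ?thesis using Ap unfolding ys_def sum_alpha_split by simp
qed

text \<open>The normalised determinant for \<alpha>_p + K is the determinant at K = 0 times
  normalised Pochhammer quotients. Its limit is known in two ways, through
  \<open>det_entry_tendsto\<close> and through the Gamma function, and the Gamma values are
  nonzero.\<close>

theorem det_entry:
  "det_on (Zset n (p - 1)) entry = (\<Prod>l\<in>Zset n (p - 1). XL l) * (\<Prod>i<n. (Gamma (xs i) / Gamma (ys i)) ^ card (Zset (n - 1 - i) (p - 1)))"
proof -
  let ?Z = "Zset n (p - 1)" and ?D = "det_on (Zset n (p - 1)) entry"
  let ?E = "of_nat nb * (\<Sum>s=1..p-1. \<alpha> s) + of_nat (nb' * (p - 1)) * (2 * \<gamma>)"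
  have one: "1 \<in> {1..p-1}" using p2 by simp
  \<comment> \<open>The power of K in the row factors equals the sum of all
    \<open>ys i - xs i\<close>, exactly the power that \<open>pochhammer_ratio_tendsto\<close> needs
    for convergence.\<close>
  have E: "(\<Sum>m\<in>?Z. \<Sum>i<m 1. ys i - xs i) = ?E"
  proof -
    have e: "p - 1 = Suc (p - 2)" "Suc (Suc (p - 2)) = p" "n + (p - 2) = p + n - 2" using p2 by auto
    have "(\<Sum>m\<in>?Z. \<Sum>i<m 1. ys i - xs i) = (\<Sum>i<n. of_nat (card (Zset (n - 1 - i) (p - 1))) * (ys i - xs i))"
      unfolding Zset_tail_sum[OF one] by simp
    also have "\<dots> = (\<Sum>i<n. of_nat (card (Zset (n - 1 - i) (p - 1))) * (\<Sum>s=1..p-1. \<alpha> s) + of_nat (card (Zset (n - 1 - i) (p - 1)) * (n - 1 - i)) * (2 * \<gamma>))"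
    proof (rule sum.cong[OF refl])
      fix i assume "i \<in> {..<n}"
      then have d: "of_nat (n - 1 - i) = (of_nat n - 1 - of_nat i :: complex)" by (simp add: of_nat_diff)
      have yx: "ys i - xs i = (\<Sum>s=1..p-1. \<alpha> s) + (of_nat n - 1 - of_nat i) * (2 * \<gamma>)"
        unfolding xs_def ys_def sum_alpha_split by (simp add: algebra_simps)
      show "of_nat (card (Zset (n - 1 - i) (p - 1))) * (ys i - xs i) = of_nat (card (Zset (n - 1 - i) (p - 1))) * (\<Sum>s=1..p-1. \<alpha> s)
          + of_nat (card (Zset (n - 1 - i) (p - 1)) * (n - 1 - i)) * (2 * \<gamma>)"
        unfolding yx of_nat_mult d by (simp only: distrib_left mult.assoc)
    qed
    also have "\<dots> = of_nat (\<Sum>i<n. card (Zset (n - 1 - i) (p - 1))) * (\<Sum>s=1..p-1. \<alpha> s) + of_nat (\<Sum>i<n. card (Zset (n - 1 - i) (p - 1)) * (n - 1 - i)) * (2 * \<gamma>)"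
      unfolding sum.distrib sum_distrib_right[symmetric] of_nat_sum ..
    also have "(\<Sum>i<n. card (Zset (n - 1 - i) (p - 1))) = nb"
      using sum_card_Zset[of n "p - 2"] unfolding e(1)[symmetric] e(3) .
    also have "(\<Sum>i<n. card (Zset (n - 1 - i) (p - 1)) * (n - 1 - i)) = nb' * (p - 1)"
      using sum_card_Zset_weighted[of n "p - 2"] unfolding e(2,3) unfolding e(1)[symmetric] by (simp only: mult.commute)
    finally show ?thesis .
  qed
  define P where "P k = (\<Prod>m\<in>?Z. \<Prod>s<m 1. pochhammer (xs s) (Suc k) / pochhammer (ys s) (Suc k) * cpw (real (Suc k)) (ys s - xs s))" for k
  have "(\<lambda>k. P k * ?D) \<longlonglongrightarrow> (\<Prod>m\<in>?Z. \<Prod>s<m 1. Gamma (ys s) / Gamma (xs s)) * ?D"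
    unfolding P_def
  proof (intro tendsto_mult tendsto_prod tendsto_const)
    fix m s assume "m \<in> ?Z" "s \<in> {..<m 1}"
    then have "s < n" using Zset_le[OF _ one] by fastforce
    then show "(\<lambda>k. pochhammer (xs s) (Suc k) / pochhammer (ys s) (Suc k) * cpw (real (Suc k)) (ys s - xs s)) \<longlonglongrightarrow> Gamma (ys s) / Gamma (xs s)"
      by (intro pochhammer_ratio_tendsto Re_xs Re_ys)
  qed
  moreover have "(\<Prod>l\<in>?Z. rowf (Suc k) l) * det_on ?Z (conf.entry n p z (shifted (Suc k)) \<gamma>) = P k * ?D" for k
  proof -
    have K0: "real (Suc k) \<noteq> 0" by simp
    have "P k = (\<Prod>m\<in>?Z. \<Prod>s<m 1. pochhammer (xs s) (Suc k) / pochhammer (ys s) (Suc k)) * cpw (real (Suc k)) ?E"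
      unfolding P_def prod.distrib E[symmetric] cpw_sum[OF K0] ..
    then show ?thesis unfolding det_entry_iterate prod_rowf[OF zero_less_Suc] using cprod_nz by (simp add: mult_ac del: of_nat_Suc pochhammer_Suc)
  qed
  ultimately have q1: "(\<Prod>m\<in>?Z. \<Prod>s<m 1. Gamma (ys s) / Gamma (xs s)) * ?D = (\<Prod>l\<in>?Z. XL l)"
    using det_entry_tendsto LIMSEQ_unique by (simp only:)
  have q2: "(\<Prod>m\<in>?Z. \<Prod>s<m 1. Gamma (ys s) / Gamma (xs s)) * (\<Prod>m\<in>?Z. \<Prod>s<m 1. Gamma (xs s) / Gamma (ys s)) = 1"
    unfolding prod.distrib[symmetric]
  proof (intro prod.neutral ballI)
    fix m s assume "m \<in> ?Z" "s \<in> {..<m 1}"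
    then have "s < n" using Zset_le[OF _ one] by fastforce
    then have "Gamma (xs s) \<noteq> 0" "Gamma (ys s) \<noteq> 0"
      using Re_xs[of s] Re_ys[of s] by (auto simp: Gamma_eq_zero_iff elim!: nonpos_Ints_cases)
    then show "Gamma (ys s) / Gamma (xs s) * (Gamma (xs s) / Gamma (ys s)) = 1" by simp
  qed
  have gen: "D = X * H" if "G * D = X" "G * H = 1" for G D X H :: complex
  proof -
    have "X * H = D * (G * H)" unfolding that(1)[symmetric] by (simp only: mult_ac)
    then show ?thesis using that(2) by simp
  qed
  have "?D = (\<Prod>l\<in>?Z. XL l) * (\<Prod>m\<in>?Z. \<Prod>s<m 1. Gamma (xs s) / Gamma (ys s))"
    by (rule gen[OF q1 q2])
  then show ?thesis unfolding Zset_tail_prod[OF one] .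
qed

end

section \<open>Evaluation of the Laguerre--Selberg integrals\<close>

definition selI :: "nat \<Rightarrow> complex \<Rightarrow> complex \<Rightarrow> complex \<Rightarrow> (nat \<Rightarrow> real) \<Rightarrow> complex" where
  "selI n a b \<gamma> t = (if (\<forall>i\<in>{1..n}. 0 \<le> t i \<and> t i \<le> 1) \<and> (\<forall>i\<in>{1..n}. \<forall>j\<in>{1..n}. i < j \<longrightarrow> t i \<le> t j)
     then (\<Prod>i=1..n. cpw (t i) (a - 1) * cpw (t i - 1) (b - 1)) * vdm n \<gamma> t else 0)"

definition Sel :: "nat \<Rightarrow> complex \<Rightarrow> complex \<Rightarrow> complex \<Rightarrow> complex" where
  "Sel n a b \<gamma> = (\<integral>t. selI n a b \<gamma> t \<partial>Rn n)"

lemma measurable_selI: "selI n a b \<gamma> \<in> borel_measurable (Rn n)"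
proof -
  have c: "(\<lambda>y. y i) \<in> borel_measurable (Rn n)" if "i \<in> {1..n}" for i by (rule Rn_component[OF that])
  have p1: "Measurable.pred (Rn n) (\<lambda>t. \<forall>i\<in>{1..n}. 0 \<le> t i \<and> t i \<le> 1)"
  proof (rule pred_intros_finite(3))
    fix i assume "i \<in> {1..n}"
    then show "Measurable.pred (Rn n) (\<lambda>t. 0 \<le> t i \<and> t i \<le> 1)"
      by (intro pred_intros_logic(3)) (auto simp only: pred_def intro!: borel_measurable_le c borel_measurable_const)
  qed simp
  have p2: "Measurable.pred (Rn n) (\<lambda>y. \<forall>i\<in>{1..n}. \<forall>j\<in>{1..n}. i < j \<longrightarrow> y i \<le> y j)"
    by (rule pred_finite_pairs) (rule pred_le_components)
  have f1: "(\<lambda>t. \<Prod>i=1..n. cpw (t i) (a - 1) * cpw (t i - 1) (b - 1)) \<in> borel_measurable (Rn n)"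
  proof (rule borel_measurable_prod)
    fix i assume "i \<in> {1..n}"
    note [measurable] = c[OF this]
    show "(\<lambda>t. cpw (t i) (a - 1) * cpw (t i - 1) (b - 1)) \<in> borel_measurable (Rn n)" by measurable
  qed
  have f2: "vdm n \<gamma> \<in> borel_measurable (Rn n)"
    unfolding vdm_def
  proof (intro borel_measurable_prod)
    fix i j assume "i \<in> {1..n}" "j \<in> {i<..n}"
    then have [measurable]: "(\<lambda>y. y i) \<in> borel_measurable (Rn n)" "(\<lambda>y. y j) \<in> borel_measurable (Rn n)" by (auto intro: c)
    show "(\<lambda>y. cpw (y j - y i) (2 * \<gamma>)) \<in> borel_measurable (Rn n)" by measurable
  qed
  show ?thesis unfolding selI_def
    by (rule measurable_If[OF borel_measurable_times[OF f1 f2] borel_measurable_const pred_intros_logic(3)[OF p1 p2, unfolded pred_def]])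
qed

lemma Zset_one: "Zset n 1 = {\<lambda>s. if s = 1 then n else 0}"
proof -
  have "m = (\<lambda>s. if s = 1 then n else 0)" if "m \<in> Zset n 1" for m
  proof
    fix s
    have "i \<notin> {1..1} \<Longrightarrow> m i = 0" for i using that unfolding Zset_def mem_Collect_eq by (elim conjE allE impE)
    moreover have "m 1 = n" using that by (simp add: Zset_def)
    ultimately show "m s = (if s = 1 then n else 0)" by (cases "s = 1") auto
  qed
  moreover have "(\<lambda>s. if s = 1 then n else 0) \<in> Zset n 1" by (simp add: Zset_def)
  ultimately show ?thesis by blast
qed

text \<open>The points 0 and 1 with exponents \<open>a\<close> and \<open>b - 1\<close>. There is a
  single composition, so the determinant is one entry; the poles 1/t_i of \<open>omega\<close> lower
  the exponent at 0 to \<open>a - 1\<close>, and since the distance is 1 the constant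
  \<open>Kst\<close> is 1.\<close>

lemma Sel_formula:
  assumes a: "Re a > 0" and b: "Re b > 0" and g: "Re \<gamma> > 0"
  shows "Sel n a b \<gamma> = Lag n a \<gamma> * (\<Prod>i<n. Gamma (b + of_nat i * \<gamma>) / Gamma (a + b + (2 * of_nat n - 2 - of_nat i) * \<gamma>))"
proof -
  define zz :: "nat \<Rightarrow> real" where "zz s = (if s = 1 then 0 else 1)" for s
  define aa where "aa s = (if s = 1 then a else b - 1)" for s :: nat
  define l where "l s = (if s = 1 then n else 0)" for s :: nat
  interpret c: conf n 2 zz aa \<gamma> by standard (use a b g in \<open>auto simp: zz_def aa_def\<close>)
  have zz1: "zz 1 = 0" "zz 2 = 1" and aa1: "aa 1 = a" "aa 2 = b - 1" by (simp_all add: zz_def aa_def)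
  have two: "(2::nat) - 1 = 1" by simp
  have Z: "Zset n (2 - 1) = {l}" unfolding two l_def[abs_def] by (rule Zset_one)
  have l: "l \<in> Zset n (2 - 1)" unfolding Z by simp
  have st: "site l i = 1" if "i \<in> {1..n}" for i using site_range[OF l that] by simp
  have s12: "{1..2::nat} = {1, 2}" by auto
  have inU: "c.inU l t \<longleftrightarrow> (\<forall>i\<in>{1..n}. 0 \<le> t i \<and> t i \<le> 1) \<and> (\<forall>i\<in>{1..n}. \<forall>j\<in>{1..n}. i < j \<longrightarrow> t i \<le> t j)" for t
  proof -
    have "(\<forall>i\<in>{1..n}. zz (site l i) \<le> t i \<and> t i \<le> zz (site l i + 1)) \<longleftrightarrow> (\<forall>i\<in>{1..n}. 0 \<le> t i \<and> t i \<le> 1)"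
      using st zz1 by (intro ball_cong refl) (simp add: zz_def)
    then show ?thesis unfolding c.inU_def by simp
  qed
  have om: "omega n 2 zz l t = (\<Prod>i=1..n. 1 / of_real (t i))" for t
  proof -
    have "Symf n (\<lambda>j. c.ev (LF (site l j))) t = (\<Sum>\<sigma> | \<sigma> permutes {1..n}. \<Prod>i=1..n. 1 / of_real (t i))"
      unfolding Symf_def
    proof (rule sum.cong[OF refl])
      fix \<sigma> assume "\<sigma> \<in> {\<sigma>. \<sigma> permutes {1..n}}"
      then have \<sigma>: "\<sigma> permutes {1..n}" by simp
      have "(\<Prod>j=1..n. c.ev (LF (site l j)) (t (\<sigma> j))) = (\<Prod>j=1..n. 1 / of_real (t (\<sigma> j)))"
        by (intro prod.cong refl) (simp add: st zz_def)
      also have "\<dots> = (\<Prod>i=1..n. 1 / of_real (t i))"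
        using prod.permute[OF \<sigma>, of "\<lambda>i. 1 / of_real (t i) :: complex"] by (simp add: o_def)
      finally show "(\<Prod>j=1..n. c.ev (LF (site l j)) (t (\<sigma> j))) = (\<Prod>i=1..n. 1 / of_real (t i))" .
    qed
    also have "\<dots> = of_nat (fact n) * (\<Prod>i=1..n. 1 / of_real (t i))"
      using card_permutations[of "{1..n}" n] by simp
    finally have S: "Symf n (\<lambda>j. c.ev (LF (site l j))) t = of_nat (fact n) * (\<Prod>i=1..n. 1 / of_real (t i))" .
    have M: "c.mfact l = 1 / of_nat (fact n)" unfolding c.mfact_def s12 by (simp add: l_def)
    show ?thesis unfolding c.omega_Symf[OF l] S M by simp
  qed
  have int: "c.indU l t *\<^sub>R (Psi n 2 zz aa \<gamma> t * omega n 2 zz l t) = selI n a b \<gamma> t" for t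
  proof (cases "c.inU l t")
    case False
    then show ?thesis unfolding selI_def inU[symmetric] if_not_P[OF False] by (simp add: c.indU_def)
  next
    case True
    have "(\<Prod>i=1..n. \<Prod>s=1..2. cpw (t i - zz s) (aa s)) * (\<Prod>i=1..n. 1 / of_real (t i)) = (\<Prod>i=1..n. cpw (t i) (a - 1) * cpw (t i - 1) (b - 1))"
      unfolding prod.distrib[symmetric]
    proof (rule prod.cong[OF refl])
      fix i assume i: "i \<in> {1..n}"
      have t0: "0 \<le> t i" using True i unfolding inU by simp
      have "cpw (t i) a = cpw (t i) (a - 1) * of_real (t i)"
        using cpw_add_of_nat[of "t i" "a - 1" 1] t0 by simp
      then have q1: "cpw (t i) a * (1 / of_real (t i)) = cpw (t i) (a - 1)" by (cases "t i = 0") auto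
      have q2: "(\<Prod>s=1..2. cpw (t i - zz s) (aa s)) = cpw (t i) a * cpw (t i - 1) (b - 1)"
        unfolding s12 by (simp add: zz_def aa_def)
      show "(\<Prod>s=1..2. cpw (t i - zz s) (aa s)) * (1 / of_real (t i)) = cpw (t i) (a - 1) * cpw (t i - 1) (b - 1)"
        unfolding q2 q1[symmetric] by (simp only: mult_ac)
    qed
    then show ?thesis unfolding selI_def inU[symmetric] if_P[OF True] Psi_def om using True by (simp add: c.indU_def mult_ac)
  qed
  have "det_on (Zset n (2 - 1)) c.entry = c.entry l l"
    unfolding Z by (subst det_on_triangular[where key="\<lambda>_. 0"]) auto
  also have "\<dots> = Sel n a b \<gamma>" unfolding c.entry_def int Sel_def ..
  finally have D: "det_on (Zset n (2 - 1)) c.entry = Sel n a b \<gamma>" .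
  have cs1: "c.cs 1 = 1" by (simp add: c.cs_def zz_def)
  have K: "c.Kst l = 1"
  proof -
    have d: "{1..2::nat} - {1} = {2}" by auto
    have 1: "(\<Prod>i=1..n. cpw (c.cs (site l i)) (aa (site l i)) * (\<Prod>r\<in>{1..2}-{site l i}. cpw (zz (site l i) - zz r) (aa r))) = 1"
      by (intro prod.neutral ballI) (use cs1 cpw_minus[of 1] in \<open>simp add: st d zz_def del: One_nat_def\<close>)
    have 2: "(\<Prod>i=1..n. \<Prod>j\<in>{i<..n}. if site l i = site l j then cpw (c.cs (site l i)) (2 * \<gamma>) else cpw (zz (site l j) - zz (site l i)) (2 * \<gamma>)) = 1"
    proof (intro prod.neutral ballI)
      fix i j assume "i \<in> {1..n}" "j \<in> {i<..n}"
      then have "site l i = 1" "site l j = 1" using st[of i] st[of j] by auto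
      then show "(if site l i = site l j then cpw (c.cs (site l i)) (2 * \<gamma>) else cpw (zz (site l j) - zz (site l i)) (2 * \<gamma>)) = 1"
        using cs1 by (simp del: One_nat_def)
    qed
    show ?thesis unfolding c.Kst_def 1 2 by simp
  qed
  have X: "(\<Prod>l\<in>Zset n (2 - 1). c.XL l) = Lag n a \<gamma>"
  proof -
    have s11: "{1..2 - 1::nat} = {1}" by auto
    have l1: "l 1 = n" "aa 1 = a" by (simp_all add: l_def aa_def)
    have "c.XL l = Lag n a \<gamma>" unfolding c.XL_def K s11 using l1 by (simp del: One_nat_def)
    then show ?thesis unfolding Z by simp
  qed
  have G: "(Gamma (c.xs i) / Gamma (c.ys i)) ^ card (Zset (n - 1 - i) (2 - 1)) = Gamma (b + of_nat i * \<gamma>) / Gamma (a + b + (2 * of_nat n - 2 - of_nat i) * \<gamma>)" for i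
  proof -
    have "card (Zset (n - 1 - i) (2 - 1)) = 1" using card_Zset[of "n - 1 - i" 0] by simp
    moreover have "c.xs i = b + of_nat i * \<gamma>" by (simp add: c.xs_def aa_def)
    moreover have "c.ys i = a + b + (2 * of_nat n - 2 - of_nat i) * \<gamma>" unfolding c.ys_def s12 by (simp add: aa_def)
    ultimately show ?thesis by (simp only: power_one_right)
  qed
  show ?thesis using c.det_entry unfolding D X G .
qed

text \<open>The substitution t_i = 1 - y_(n+1-i) exchanges the two ends; reversing the numbering
  restores the order of the variables.\<close>

lemma Sel_sym: "Sel n a b \<gamma> = Sel n b a \<gamma>"
proof -
  have bij: "bij_betw (\<lambda>j. n + 1 - j) {1..n} {1..n}"
    by (rule bij_betw_byWitness[where f'="\<lambda>j. n + 1 - j"]) auto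
  have "Sel n a b \<gamma> = of_real (\<Prod>j\<in>{1..n}. \<bar>-1\<bar>) * (\<integral>y. selI n a b \<gamma> (\<lambda>j\<in>{1..n}. 1 + (-1) * y (n + 1 - j)) \<partial>Rn n)"
    unfolding Sel_def by (rule integral_PiM_affine[OF bij _ _ measurable_selI]) auto
  also have "(\<lambda>y. selI n a b \<gamma> (\<lambda>j\<in>{1..n}. 1 + (-1) * y (n + 1 - j))) = selI n b a \<gamma>"
  proof
    fix y :: "nat \<Rightarrow> real"
    let ?t = "\<lambda>j\<in>{1..n}. 1 + (-1) * y (n + 1 - j)"
    have t: "?t j = 1 - y (n + 1 - j)" if "j \<in> {1..n}" for j using that by simp
    have refl_all: "(\<forall>i\<in>{1..n}. P (n + 1 - i)) \<longleftrightarrow> (\<forall>i\<in>{1..n}. P i)" for P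
    proof
      assume *: "\<forall>i\<in>{1..n}. P (n + 1 - i)"
      show "\<forall>i\<in>{1..n}. P i"
      proof
        fix i assume i: "i \<in> {1..n}"
        then have "n + 1 - i \<in> {1..n}" "n + 1 - (n + 1 - i) = i" by auto
        then show "P i" using * by metis
      qed
    next
      assume *: "\<forall>i\<in>{1..n}. P i"
      show "\<forall>i\<in>{1..n}. P (n + 1 - i)"
      proof
        fix i assume i: "i \<in> {1..n}"
        then have "n + 1 - i \<in> {1..n}" by auto
        then show "P (n + 1 - i)" using * by blast
      qed
    qed
    have c1: "(\<forall>i\<in>{1..n}. 0 \<le> ?t i \<and> ?t i \<le> 1) \<longleftrightarrow> (\<forall>i\<in>{1..n}. 0 \<le> y i \<and> y i \<le> 1)"
    proof -
      have "(\<forall>i\<in>{1..n}. 0 \<le> ?t i \<and> ?t i \<le> 1) \<longleftrightarrow> (\<forall>i\<in>{1..n}. 0 \<le> y (n + 1 - i) \<and> y (n + 1 - i) \<le> 1)"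
        by (intro ball_cong refl) (simp only: t, auto)
      also have "\<dots> \<longleftrightarrow> (\<forall>i\<in>{1..n}. 0 \<le> y i \<and> y i \<le> 1)" by (rule refl_all)
      finally show ?thesis .
    qed
    have c2: "(\<forall>i\<in>{1..n}. \<forall>j\<in>{1..n}. i < j \<longrightarrow> ?t i \<le> ?t j) \<longleftrightarrow> (\<forall>i\<in>{1..n}. \<forall>j\<in>{1..n}. i < j \<longrightarrow> y i \<le> y j)"
    proof -
      have "(\<forall>i\<in>{1..n}. \<forall>j\<in>{1..n}. i < j \<longrightarrow> ?t i \<le> ?t j) \<longleftrightarrow> (\<forall>i\<in>{1..n}. \<forall>j\<in>{1..n}. n + 1 - j < n + 1 - i \<longrightarrow> y (n + 1 - j) \<le> y (n + 1 - i))"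
      proof (intro ball_cong refl)
        fix i j assume ij: "i \<in> {1..n}" "j \<in> {1..n}"
        then have "i < j \<longleftrightarrow> n + 1 - j < n + 1 - i" by auto
        then show "(i < j \<longrightarrow> ?t i \<le> ?t j) = (n + 1 - j < n + 1 - i \<longrightarrow> y (n + 1 - j) \<le> y (n + 1 - i))"
          unfolding t[OF ij(1)] t[OF ij(2)] by auto
      qed
      also have "\<dots> \<longleftrightarrow> (\<forall>i\<in>{1..n}. \<forall>j\<in>{1..n}. n + 1 - j < i \<longrightarrow> y (n + 1 - j) \<le> y i)"
        by (rule refl_all)
      also have "\<dots> \<longleftrightarrow> (\<forall>i\<in>{1..n}. \<forall>j\<in>{1..n}. j < i \<longrightarrow> y j \<le> y i)"
      proof -
        have "(\<forall>j\<in>{1..n}. n + 1 - j < i \<longrightarrow> y (n + 1 - j) \<le> y i) \<longleftrightarrow> (\<forall>j\<in>{1..n}. j < i \<longrightarrow> y j \<le> y i)" for i by (rule refl_all)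
        then show ?thesis by simp
      qed
      also have "\<dots> \<longleftrightarrow> (\<forall>i\<in>{1..n}. \<forall>j\<in>{1..n}. i < j \<longrightarrow> y i \<le> y j)" by blast
      finally show ?thesis .
    qed
    have p1: "(\<Prod>i=1..n. cpw (?t i) (a - 1) * cpw (?t i - 1) (b - 1)) = (\<Prod>i=1..n. cpw (y i) (b - 1) * cpw (y i - 1) (a - 1))"
    proof -
      have "(\<Prod>i=1..n. cpw (?t i) (a - 1) * cpw (?t i - 1) (b - 1)) = (\<Prod>i=1..n. cpw (y (n + 1 - i)) (b - 1) * cpw (y (n + 1 - i) - 1) (a - 1))"
      proof (rule prod.cong[OF refl])
        fix i assume i: "i \<in> {1..n}"
        show "cpw (?t i) (a - 1) * cpw (?t i - 1) (b - 1) = cpw (y (n + 1 - i)) (b - 1) * cpw (y (n + 1 - i) - 1) (a - 1)"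
          unfolding t[OF i] using cpw_commute[of 1 "y (n + 1 - i)" "a - 1"] by simp
      qed
      also have "\<dots> = (\<Prod>i=1..n. cpw (y i) (b - 1) * cpw (y i - 1) (a - 1))"
        using prod.reindex_bij_betw[OF bij, of "\<lambda>i. cpw (y i) (b - 1) * cpw (y i - 1) (a - 1)"] .
      finally show ?thesis .
    qed
    have p2: "vdm n \<gamma> ?t = vdm n \<gamma> y"
    proof -
      have "vdm n \<gamma> ?t = (\<Prod>(i, j)\<in>(SIGMA i:{1..n}. {i<..n}). cpw (?t j - ?t i) (2 * \<gamma>))"
        unfolding vdm_def by (rule prod.Sigma) auto
      also have "\<dots> = (\<Prod>(i, j)\<in>(SIGMA i:{1..n}. {i<..n}). cpw (y j - y i) (2 * \<gamma>))"
      proof (rule prod.reindex_bij_witness[where i="\<lambda>(i, j). (n + 1 - j, n + 1 - i)" and j="\<lambda>(i, j). (n + 1 - j, n + 1 - i)"])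
        fix x assume "x \<in> (SIGMA i:{1..n}. {i<..n})"
        then obtain i j where x: "x = (i, j)" "i \<in> {1..n}" "j \<in> {1..n}" "i < j" by auto
        show "(case case x of (i, j) \<Rightarrow> (n + 1 - j, n + 1 - i) of (i, j) \<Rightarrow> cpw (y j - y i) (2 * \<gamma>)) = (case x of (i, j) \<Rightarrow> cpw (?t j - ?t i) (2 * \<gamma>))"
          unfolding x(1) prod.case t[OF x(2)] t[OF x(3)] by simp
      qed auto
      also have "\<dots> = vdm n \<gamma> y" unfolding vdm_def by (rule prod.Sigma[symmetric]) auto
      finally show ?thesis .
    qed
    show "selI n a b \<gamma> ?t = selI n b a \<gamma> y" unfolding selI_def c1 c2 p1 p2 ..
  qed
  finally show ?thesis by (simp add: Sel_def)
qed

lemma integral_exp_half_line: "c > 0 \<Longrightarrow> (\<integral>u. (if u > 0 then of_real (exp (- c * u)) else 0) \<partial>lborel) = (of_real (1 / c) :: complex)"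
proof -
  assume c: "c > 0"
  have "((\<lambda>u. if u \<in> {0..} then exp (- c * u) else 0) has_integral exp (- c * 0) / c) UNIV"
    unfolding has_integral_restrict_UNIV using has_integral_exp_minus_to_infinity[OF c, of 0] by simp
  then have "((\<lambda>u. if u \<in> {0..} then exp (- c * u) else 0) has_integral 1 / c) UNIV" by simp
  then have "(\<integral>\<^sup>+u. ennreal (if u \<in> {0..} then exp (- c * u) else 0) \<partial>lborel) = ennreal (1 / c)"
    by (intro nn_integral_has_integral_lborel) auto
  then have "(\<integral>u. (if u \<in> {0..} then exp (- c * u) else 0) \<partial>lborel) = 1 / c"
    using c by (subst integral_eq_nn_integral) auto
  then have "(\<integral>u. (of_real (if u \<in> {0..} then exp (- c * u) else 0) :: complex) \<partial>lborel) = of_real (1 / c)"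
    by (simp only: integral_complex_of_real)
  moreover have "(\<integral>u. (if u > 0 then of_real (exp (- c * u)) else 0) \<partial>lborel) = (\<integral>u. (of_real (if u \<in> {0..} then exp (- c * u) else 0) :: complex) \<partial>lborel)"
  proof (rule integral_cong_AE)
    show "AE u in lborel. (if u > 0 then of_real (exp (- c * u)) else 0) = (of_real (if u \<in> {0..} then exp (- c * u) else 0) :: complex)"
      using AE_lborel_singleton[of 0] by eventually_elim auto
  qed measurable
  ultimately show ?thesis by simp
qed

lemma prod_first_shift: "(\<Prod>i=1..Suc k. f i) = f 1 * (\<Prod>j=1..k. f (Suc j))" for f :: "nat \<Rightarrow> complex"
  by (induction k) (simp_all add: mult.assoc)

lemma vdm_shift: "vdm (Suc k) \<gamma> m = (\<Prod>j=1..k. cpw (m (Suc j) - m 1) (2 * \<gamma>)) * vdm k \<gamma> (\<lambda>j. m (Suc j))"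
proof -
  have sh: "(\<Prod>j\<in>{Suc i<..Suc k}. f j) = (\<Prod>j\<in>{i<..k}. f (Suc j))" for i and f :: "nat \<Rightarrow> complex"
    by (rule prod.reindex_bij_witness[where i=Suc and j="\<lambda>j. j - 1"]) auto
  have "(\<Prod>j\<in>{1<..Suc k}. cpw (m j - m 1) (2 * \<gamma>)) = (\<Prod>j\<in>{0<..k}. cpw (m (Suc j) - m 1) (2 * \<gamma>))"
    using sh[where i=0 and f="\<lambda>j. cpw (m j - m 1) (2 * \<gamma>)"] by simp
  also have "{0<..k} = {1..k}" by auto
  finally show ?thesis unfolding vdm_def prod_first_shift sh by simp
qed

text \<open>For a = 1 the power of y_1 disappears, so after y_(j+1) = y_1 + w_j the variable y_1
  occurs only in an exponential with rate k + 1. The pairs with index 1 become w_j^(2 \<gamma>) and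
  raise the parameter to 1 + 2 \<gamma>.\<close>

lemma Lag_shift:
  assumes g: "Re \<gamma> > 0"
  shows "Lag (Suc k) 1 \<gamma> = Lag k (1 + 2 * \<gamma>) \<gamma> / of_nat (Suc k)"
proof -
  let ?n = "Suc k" and ?I = "{1::nat}" and ?J = "{2..Suc k}"
  \<comment> \<open>The value at u = 0 is 0 to agree with \<open>cpw 0 a = 0\<close>; the
    exponential is the product of the k + 1 factors exp(-u), and its integral is 1 / (k +
    1).\<close>
  define E :: "real \<Rightarrow> complex" where "E u = (if u > 0 then of_real (exp (- real (Suc k) * u)) else 0)" for u
  have U: "{1..?n} = ?I \<union> ?J" and D: "?I \<inter> ?J = {}" by auto
  have int: "integrable (Rn ?n) (lagI ?n 1 \<gamma>)"
  proof -
    have "lagI ?n 1 \<gamma> = grpI ?n (\<lambda>_. 0) (\<lambda>_. 1) \<gamma>" by (rule ext) (rule lagI_eq_grpI)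
    moreover have "integrable (Rn ?n) (grpI ?n (\<lambda>_. 0) (\<lambda>_. 1) \<gamma>)" by (rule integrable_grpI) (use g in auto)
    ultimately show ?thesis by (simp only:)
  qed
  have pw: "lagI ?n 1 \<gamma> (merge ?I ?J (x, \<lambda>j\<in>?J. x 1 + 1 * w (j - 1))) = E (x 1) * lagI k (1 + 2 * \<gamma>) \<gamma> w" for x w
  proof -
    define u where "u = x 1"
    define m where "m = merge ?I ?J (x, \<lambda>j\<in>?J. u + 1 * w (j - 1))"
    have m1: "m 1 = u" by (simp add: m_def merge_def u_def)
    have m2: "m (Suc j) = u + w j" if "j \<in> {1..k}" for j using that by (auto simp: m_def merge_def)
    show ?thesis unfolding u_def[symmetric] m_def[symmetric]
    proof (cases "u > 0")
      case False
      have "lagI ?n 1 \<gamma> m = 0"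
      proof (cases "u = 0")
        case True
        then have "cpw (m 1) 1 / of_real (m 1) * of_real (exp (- m 1)) = 0" using m1 by simp
        then show ?thesis unfolding lagI_def prod_first_shift by simp
      next
        case False
        then have "\<not> 0 \<le> m 1" using \<open>\<not> u > 0\<close> m1 by simp
        then have "\<not> ((\<forall>i\<in>{1..?n}. 0 \<le> m i) \<and> (\<forall>i\<in>{1..?n}. \<forall>j\<in>{1..?n}. i < j \<longrightarrow> m i \<le> m j))" by force
        then show ?thesis unfolding lagI_def by (simp only: if_False)
      qed
      then show "lagI ?n 1 \<gamma> m = E u * lagI k (1 + 2 * \<gamma>) \<gamma> w" using False by (simp add: E_def)
    next
      case u: True
      have all: "(\<forall>i\<in>{1..?n}. P i) \<longleftrightarrow> P 1 \<and> (\<forall>j\<in>{1..k}. P (Suc j))" for P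
      proof -
        have "{1..?n} = insert 1 (Suc ` {1..k})" by (auto simp: image_iff)
        then show ?thesis by (simp only: ball_simps)
      qed
      have cond: "(\<forall>i\<in>{1..?n}. 0 \<le> m i) \<and> (\<forall>i\<in>{1..?n}. \<forall>j\<in>{1..?n}. i < j \<longrightarrow> m i \<le> m j)
         \<longleftrightarrow> (\<forall>i\<in>{1..k}. 0 \<le> w i) \<and> (\<forall>i\<in>{1..k}. \<forall>j\<in>{1..k}. i < j \<longrightarrow> w i \<le> w j)"
      proof
        assume a: "(\<forall>i\<in>{1..?n}. 0 \<le> m i) \<and> (\<forall>i\<in>{1..?n}. \<forall>j\<in>{1..?n}. i < j \<longrightarrow> m i \<le> m j)"
        have "0 \<le> w j" if j: "j \<in> {1..k}" for j
        proof -
          have "m 1 \<le> m (Suc j)" using a j by auto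
          then show ?thesis using m1 m2[OF j] by simp
        qed
        moreover have "w i \<le> w j" if ij: "i \<in> {1..k}" "j \<in> {1..k}" "i < j" for i j
        proof -
          have "m (Suc i) \<le> m (Suc j)" using a ij by auto
          then show ?thesis using m2[OF ij(1)] m2[OF ij(2)] by simp
        qed
        ultimately show "(\<forall>i\<in>{1..k}. 0 \<le> w i) \<and> (\<forall>i\<in>{1..k}. \<forall>j\<in>{1..k}. i < j \<longrightarrow> w i \<le> w j)" by blast
      next
        assume a: "(\<forall>i\<in>{1..k}. 0 \<le> w i) \<and> (\<forall>i\<in>{1..k}. \<forall>j\<in>{1..k}. i < j \<longrightarrow> w i \<le> w j)"
        then have w0: "0 \<le> w i" if "i \<in> {1..k}" for i using that by simp
        have ws: "w i \<le> w j" if "i \<in> {1..k}" "j \<in> {1..k}" "i < j" for i j using a that by simp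
        show "(\<forall>i\<in>{1..?n}. 0 \<le> m i) \<and> (\<forall>i\<in>{1..?n}. \<forall>j\<in>{1..?n}. i < j \<longrightarrow> m i \<le> m j)"
          unfolding all using u w0 ws by (auto simp: m1[simplified] m2[simplified] add_nonneg_nonneg)
      qed
      show "lagI ?n 1 \<gamma> m = E u * lagI k (1 + 2 * \<gamma>) \<gamma> w"
      proof (cases "(\<forall>i\<in>{1..k}. 0 \<le> w i) \<and> (\<forall>i\<in>{1..k}. \<forall>j\<in>{1..k}. i < j \<longrightarrow> w i \<le> w j)")
        case False
        show ?thesis unfolding lagI_def cond if_not_P[OF False] by simp
      next
        case True
        then have w0: "0 \<le> w i" if "i \<in> {1..k}" for i using that by simp
        have f: "cpw y 1 / of_real y * of_real (exp (- y)) = of_real (exp (- y))" if "y > 0" for y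
          using cpw_add_of_nat[of y 0 1] cpw_exponent_0[of y] that by simp
        have P: "(\<Prod>i=1..?n. cpw (m i) 1 / of_real (m i) * of_real (exp (- m i)))
           = of_real (exp (- u)) * (\<Prod>j=1..k. of_real (exp (- u)) * of_real (exp (- w j)))"
        proof -
          have "cpw (m (Suc j)) 1 / of_real (m (Suc j)) * of_real (exp (- m (Suc j))) = (of_real (exp (- u)) * of_real (exp (- w j)) :: complex)" if j: "j \<in> {1..k}" for j
          proof -
            have "u + w j > 0" using u w0[OF j] by simp
            have "exp (- (u + w j)) = exp (- u) * exp (- w j)" by (simp add: exp_add[symmetric])
            with f[OF \<open>u + w j > 0\<close>] show ?thesis unfolding m2[OF j] by (simp only: of_real_mult)
          qed
          then have "(\<Prod>j=1..k. cpw (m (Suc j)) 1 / of_real (m (Suc j)) * of_real (exp (- m (Suc j)))) = (\<Prod>j=1..k. of_real (exp (- u)) * of_real (exp (- w j)))"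
            by (intro prod.cong refl)
          then show ?thesis unfolding prod_first_shift m1 f[OF u] by (simp only:)
        qed
        have V: "vdm ?n \<gamma> m = (\<Prod>j=1..k. cpw (w j) (2 * \<gamma>)) * vdm k \<gamma> w"
        proof -
          have "(\<Prod>j=1..k. cpw (m (Suc j) - m 1) (2 * \<gamma>)) = (\<Prod>j=1..k. cpw (w j) (2 * \<gamma>))"
            by (intro prod.cong refl) (simp only: m1 m2, simp)
          moreover have "vdm k \<gamma> (\<lambda>j. m (Suc j)) = vdm k \<gamma> w" unfolding vdm_def
          proof (intro prod.cong refl)
            fix i j assume "i \<in> {1..k}" "j \<in> {i<..k}"
            then have "i \<in> {1..k}" "j \<in> {1..k}" by auto
            then show "cpw (m (Suc j) - m (Suc i)) (2 * \<gamma>) = cpw (w j - w i) (2 * \<gamma>)" by (simp only: m2, simp)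
          qed
          ultimately show ?thesis unfolding vdm_shift by simp
        qed
        have W: "(\<Prod>i=1..k. cpw (w i) (1 + 2 * \<gamma>) / of_real (w i) * of_real (exp (- w i))) = (\<Prod>i=1..k. cpw (w i) (2 * \<gamma>) * of_real (exp (- w i)))"
        proof (rule prod.cong[OF refl])
          fix i assume "i \<in> {1..k}"
          have "cpw (w i) (1 + 2 * \<gamma>) = cpw (w i) (2 * \<gamma>) * of_real (w i)"
            using cpw_add_of_nat[of "w i" "2 * \<gamma>" 1] w0[OF \<open>i \<in> {1..k}\<close>] by (simp add: add.commute)
          then show "cpw (w i) (1 + 2 * \<gamma>) / of_real (w i) * of_real (exp (- w i)) = cpw (w i) (2 * \<gamma>) * of_real (exp (- w i))"
            by (cases "w i = 0") auto
        qed
        have Eu: "E u = of_real (exp (- u)) * of_real (exp (- u)) ^ k"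
        proof -
          have "exp (- u) ^ Suc k = exp (- real (Suc k) * u)" using exp_of_nat_mult[of "Suc k" "- u"] by (simp del: of_nat_Suc)
          then have "E u = of_real (exp (- u) ^ Suc k)" using u by (simp only: E_def if_True)
          then show ?thesis by simp
        qed
        show ?thesis unfolding lagI_def cond if_P[OF True] unfolding P V W Eu unfolding prod.distrib by (simp add: mult_ac)
      qed
    qed
  qed
  have "Lag ?n 1 \<gamma> = (\<integral>y. lagI ?n 1 \<gamma> y \<partial>PiM (?I \<union> ?J) (\<lambda>_. lborel))" unfolding Lag_def U ..
  also have "\<dots> = (\<integral>x. (\<integral>y. lagI ?n 1 \<gamma> (merge ?I ?J (x, y)) \<partial>PiM ?J (\<lambda>_. lborel)) \<partial>PiM ?I (\<lambda>_. lborel))"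
    by (rule lb.product_integral_fold[OF D]) (use int in \<open>simp_all only: U finite_insert finite.emptyI finite_atLeastAtMost\<close>)
  also have "\<dots> = (\<integral>x. E (x 1) * Lag k (1 + 2 * \<gamma>) \<gamma> \<partial>PiM ?I (\<lambda>_. lborel))"
  proof (rule Bochner_Integration.integral_cong[OF refl])
    fix x assume x: "x \<in> space (PiM ?I (\<lambda>_. lborel :: real measure))"
    have bij: "bij_betw (\<lambda>j. j - 1) ?J {1..k}" by (rule bij_betw_byWitness[where f'=Suc]) auto
    have m: "(\<lambda>y. lagI ?n 1 \<gamma> (merge ?I ?J (x, y))) \<in> borel_measurable (PiM ?J (\<lambda>_. lborel))"
    proof -
      have "lagI ?n 1 \<gamma> \<in> borel_measurable (PiM (?I \<union> ?J) (\<lambda>_. lborel))" unfolding U[symmetric] by (rule measurable_lagI)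
      from measurable_compose[OF measurable_compose[OF measurable_Pair1'[OF x] measurable_merge] this] show ?thesis .
    qed
    have "(\<integral>y. lagI ?n 1 \<gamma> (merge ?I ?J (x, y)) \<partial>PiM ?J (\<lambda>_. lborel))
       = of_real (\<Prod>j\<in>?J. \<bar>1\<bar>) * (\<integral>w. lagI ?n 1 \<gamma> (merge ?I ?J (x, \<lambda>j\<in>?J. x 1 + 1 * w (j - 1))) \<partial>Rn k)"
      by (rule integral_PiM_affine[OF bij _ _ m]) auto
    also have "\<dots> = (\<integral>w. E (x 1) * lagI k (1 + 2 * \<gamma>) \<gamma> w \<partial>Rn k)" unfolding pw by simp
    finally show "(\<integral>y. lagI ?n 1 \<gamma> (merge ?I ?J (x, y)) \<partial>PiM ?J (\<lambda>_. lborel)) = E (x 1) * Lag k (1 + 2 * \<gamma>) \<gamma>"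
      by (simp only: integral_mult_right_zero Lag_def)
  qed
  also have "\<dots> = (\<integral>x. E (x 1) \<partial>PiM ?I (\<lambda>_. lborel)) * Lag k (1 + 2 * \<gamma>) \<gamma>" by (rule integral_mult_left_zero)
  also have "(\<integral>x. E (x 1) \<partial>PiM ?I (\<lambda>_. lborel)) = (\<integral>u. E u \<partial>lborel)"
  proof (rule lb.product_integral_singleton)
    show "E \<in> borel_measurable lborel" unfolding E_def by measurable
  qed
  also have "\<dots> = of_real (1 / real (Suc k))" unfolding E_def by (rule integral_exp_half_line) simp
  finally show ?thesis by simp
qed

text \<open>The symmetry of \<open>Sel\<close> in \<open>a\<close> and 1 gives the dependence on
  \<open>a\<close>. The value at a = 1 then comes from \<open>Lag_shift\<close> and the induction
  hypothesis at 1 + 2 \<gamma>, so the induction must be over arbitrary \<open>a\<close>.\<close>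

theorem Lag_formula:
  assumes g: "Re \<gamma> > 0" and a: "Re a > 0"
  shows "Lag n a \<gamma> = (\<Prod>s<n. Gamma (a + of_nat s * \<gamma>) * (Gamma (of_nat (s + 1) * \<gamma>) / Gamma \<gamma>))"
  using a
proof (induction n arbitrary: a)
  case 0
  have "lagI 0 a \<gamma> = (\<lambda>x. \<Prod>i\<in>({}::nat set). 1)" by (simp add: lagI_def vdm_def fun_eq_iff)
  moreover have "(\<integral>x. (\<Prod>i\<in>({}::nat set). 1) \<partial>PiM ({}::nat set) (\<lambda>_. lborel :: real measure)) = (1::complex)"
    using lb.product_integral_prod[of "{}" "\<lambda>_ _. 1 :: complex"] by simp
  ultimately show ?case by (simp add: Lag_def)
next
  case (Suc n)
  have nI: "x \<notin> \<int>\<^sub>\<le>\<^sub>0" if "Re x > 0" for x :: complex using that by (auto elim!: nonpos_Ints_cases)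
  have nz: "Gamma (x + of_nat s * \<gamma>) \<noteq> 0" if "Re x > 0" for x s
  proof -
    have "Re (x + of_nat s * \<gamma>) > 0" using that g by (simp add: add_pos_nonneg)
    from nI[OF this] show ?thesis by (simp add: Gamma_eq_zero_iff)
  qed
  define P where "P x = (\<Prod>s<Suc n. Gamma (x + of_nat s * \<gamma>))" for x
  have Pnz: "P x \<noteq> 0" if "Re x > 0" for x unfolding P_def using nz[OF that] by (simp only: prod_zero_iff finite_lessThan) blast
  \<comment> \<open>Both orders of the parameters \<open>a\<close> and 1 in
    \<open>Sel_formula\<close> have the same denominator, which cancels.\<close>
  have sym: "Lag (Suc n) a \<gamma> * P 1 = Lag (Suc n) 1 \<gamma> * P a"
  proof -
    define Q where "Q = (\<Prod>i<Suc n. Gamma (a + 1 + (2 * of_nat (Suc n) - 2 - of_nat i) * \<gamma>))"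
    have Q': "(\<Prod>i<Suc n. Gamma (1 + a + (2 * of_nat (Suc n) - 2 - of_nat i) * \<gamma>)) = Q" unfolding Q_def by (simp only: add.commute[of 1 a])
    have Qnz: "Q \<noteq> 0"
    proof -
      have "Gamma (a + 1 + (2 * of_nat (Suc n) - 2 - of_nat i) * \<gamma>) \<noteq> 0" if "i < Suc n" for i
      proof -
        have "2 * of_nat (Suc n) - 2 - of_nat i = (of_nat (2 * n - i) :: complex)" using that by (simp add: of_nat_diff)
        then show ?thesis using nz[of "a + 1" "2 * n - i"] Suc.prems by simp
      qed
      then show ?thesis unfolding Q_def prod_zero_iff[OF finite_lessThan] by blast
    qed
    have "Sel (Suc n) a 1 \<gamma> = Lag (Suc n) a \<gamma> * (P 1 / Q)"
      unfolding P_def Q_def prod_dividef[symmetric] using Suc.prems g by (intro Sel_formula) auto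
    moreover have "Sel (Suc n) 1 a \<gamma> = Lag (Suc n) 1 \<gamma> * (P a / Q)"
      unfolding P_def Q'[symmetric] prod_dividef[symmetric] using Suc.prems g by (intro Sel_formula) auto
    ultimately show ?thesis using Sel_sym[of "Suc n" a 1 \<gamma>] Qnz by simp
  qed
  define R where "R = (\<Prod>s<n. Gamma (of_nat (s + 1) * \<gamma>) / Gamma \<gamma>)"
  have "Re (1 + 2 * \<gamma>) > 0" using g by simp
  then have L1: "Lag (Suc n) 1 \<gamma> = (\<Prod>s<n. Gamma (1 + 2 * \<gamma> + of_nat s * \<gamma>)) * R / of_nat (Suc n)"
    unfolding Lag_shift[OF g] R_def prod.distrib[symmetric] by (simp only: Suc.IH)
  \<comment> \<open>Both sides are the product of Gamma(1 + s \<gamma>) over 0 \<le> s \<le> n + 1,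
    as Gamma(1) = 1. Afterwards Gamma(1 + x) = x Gamma(x) at x = \<gamma> and at x = (n + 1)
    \<gamma> yields the new factor and an n + 1 that cancels the division in
    \<open>Lag_shift\<close>.\<close>
  have tel: "Gamma (1 + \<gamma>) * (\<Prod>s<n. Gamma (1 + 2 * \<gamma> + of_nat s * \<gamma>)) = P 1 * Gamma (1 + of_nat (Suc n) * \<gamma>)"
  proof -
    have "P 1 * Gamma (1 + of_nat (Suc n) * \<gamma>) = (\<Prod>s<Suc (Suc n). Gamma (1 + of_nat s * \<gamma>))" by (simp add: P_def)
    also have "\<dots> = Gamma 1 * (Gamma (1 + \<gamma>) * (\<Prod>s<n. Gamma (1 + of_nat (Suc (Suc s)) * \<gamma>)))"
      by (simp only: prod.lessThan_Suc_shift) simp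
    also have "(\<Prod>s<n. Gamma (1 + of_nat (Suc (Suc s)) * \<gamma>)) = (\<Prod>s<n. Gamma (1 + 2 * \<gamma> + of_nat s * \<gamma>))"
      by (intro prod.cong refl arg_cong[of _ _ Gamma]) (simp add: algebra_simps)
    finally show ?thesis by simp
  qed
  have nI: "x \<notin> \<int>\<^sub>\<le>\<^sub>0" if "Re x > 0" for x :: complex using that by (auto elim!: nonpos_Ints_cases)
  have Rk: "Re (of_nat (Suc n) * \<gamma>) > 0" using g by (simp del: of_nat_Suc)
  have G1: "Gamma (1 + \<gamma>) = \<gamma> * Gamma \<gamma>" using Gamma_plus1[OF nI[OF g]] by (simp add: add.commute)
  have G2: "Gamma (1 + of_nat (Suc n) * \<gamma>) = of_nat (Suc n) * \<gamma> * Gamma (of_nat (Suc n) * \<gamma>)"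
    using Gamma_plus1[OF nI[OF Rk]] by (simp add: add.commute)
  have \<gamma>0: "\<gamma> \<noteq> 0" using g by auto
  have G\<gamma>: "Gamma \<gamma> \<noteq> 0" using nI[OF g] by (simp add: Gamma_eq_zero_iff)
  define T where "T = (\<Prod>s<n. Gamma (1 + 2 * \<gamma> + of_nat s * \<gamma>))"
  define N :: complex where "N = of_nat (Suc n)"
  define H where "H = Gamma (N * \<gamma>)"
  have N0: "N \<noteq> 0" unfolding N_def by (simp del: of_nat_Suc)
  have t2: "\<gamma> * Gamma \<gamma> * T = P 1 * (N * \<gamma> * H)" using tel unfolding G1 G2 T_def N_def H_def .
  have "T = P 1 * N * H / Gamma \<gamma>"
  proof -
    have "\<gamma> * (Gamma \<gamma> * T) = \<gamma> * (P 1 * N * H)" using t2 by (simp only: mult_ac)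
    then have "Gamma \<gamma> * T = P 1 * N * H" using \<gamma>0 by simp
    then show ?thesis using G\<gamma> by (simp add: field_simps)
  qed
  then have "Lag (Suc n) 1 \<gamma> = P 1 * H / Gamma \<gamma> * R"
    unfolding L1 T_def[symmetric] N_def[symmetric] using N0 by simp
  then have "P 1 * Lag (Suc n) a \<gamma> = P 1 * (P a * (R * (H / Gamma \<gamma>)))"
    using sym by (simp add: mult_ac)
  then have "Lag (Suc n) a \<gamma> = P a * (R * (H / Gamma \<gamma>))"
    using Pnz[of 1] by (simp only: mult_cancel_left) simp
  then show ?case unfolding P_def R_def H_def N_def prod.distrib by simp
qed

section \<open>Phases and assembly\<close>

text \<open>The chosen branch is cut along the negative imaginary axis, so negative reals have
  argument \<pi> and positive reals argument 0.\<close>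

lemma br_pow_of_real: "br_pow (of_real x) a = cpw x a * (if x < 0 then exp (\<i> * pi * a) else 1)"
proof -
  consider "x = 0" | "x > 0" | "x < 0" by linarith
  then show ?thesis
  proof cases
    case 1
    then show ?thesis by (simp add: br_pow_def)
  next
    case 2
    have "br_log (of_real x) = of_real (ln x)" using 2 pi_gt_zero by (simp add: br_log_def Ln_of_real not_le)
    then show ?thesis using 2 by (simp add: br_pow_def cpw_def)
  next
    case 3
    have L: "Ln (of_real x) = of_real (ln (- x)) + \<i> * pi"
      using Ln_minus[of "of_real (- x)"] 3 Ln_of_real[of "- x"] by simp
    have "\<not> Im (Ln (of_real x)) \<le> - pi / 2" unfolding L by simp (use pi_gt_zero in linarith)
    then have "br_log (of_real x) = of_real (ln (- x)) + \<i> * pi" unfolding br_log_def using L by simp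
    then show ?thesis using 3 by (simp add: br_pow_def cpw_def distrib_left exp_add mult_ac)
  qed
qed

lemma prod_off_diagonal:
  fixes F :: "nat \<Rightarrow> nat \<Rightarrow> complex"
  shows "(\<Prod>s=1..p. \<Prod>r\<in>{1..p}-{s}. F s r) = (\<Prod>b=1..p. \<Prod>a=1..<b. F b a * F a b)"
proof (induction p)
  case (Suc p)
  have last: "(\<Prod>s=1..Suc p. f s) = (\<Prod>s=1..p. f s) * f (Suc p)" for f :: "nat \<Rightarrow> complex" by simp
  have "(\<Prod>s=1..p. \<Prod>r\<in>{1..Suc p}-{s}. F s r) = (\<Prod>s=1..p. F s (Suc p) * (\<Prod>r\<in>{1..p}-{s}. F s r))"
  proof (rule prod.cong[OF refl])
    fix s assume "s \<in> {1..p}"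
    then have "{1..Suc p} - {s} = insert (Suc p) ({1..p} - {s})" by auto
    then show "(\<Prod>r\<in>{1..Suc p}-{s}. F s r) = F s (Suc p) * (\<Prod>r\<in>{1..p}-{s}. F s r)" by simp
  qed
  moreover have "{1..Suc p} - {Suc p} = {1..p}" "{1..<Suc p} = {1..p}" by auto
  ultimately show ?case unfolding last prod.distrib by (simp only: Suc.IH prod.distrib mult_ac)
qed simp

context conf
begin

text \<open>The factor due to a variable in the interval from z_r to z_(r+1): the differences t -
  z_s that are negative there are those with s > r.\<close>

definition phase :: "nat \<Rightarrow> complex" where
  "phase r = (\<Prod>s=1..p. if r < s then exp (\<i> * pi * \<alpha> s) else 1)"

text \<open>The differences t_j - t_i with i < j are nonnegative on the domain, so only the factors
  at the z_s contribute phases. On the boundary, where t_i = z_s, both powers are 0 by convention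
  and the phase does not matter.\<close>

lemma Phi_eq_phase_Psi:
  assumes l: "l \<in> Zset n (p - 1)" and t: "inU l t"
  shows "Phi n p z \<alpha> \<gamma> t = (\<Prod>i=1..n. phase (site l i)) * Psi n p z \<alpha> \<gamma> t"
proof -
  have 1: "br_pow (of_real (t i - z s)) (\<alpha> s) = (if site l i < s then exp (\<i> * pi * \<alpha> s) else 1) * cpw (t i - z s) (\<alpha> s)"
    if i: "i \<in> {1..n}" and s: "s \<in> {1..p}" for i s
  proof (cases "t i = z s")
    case False
    have st: "site l i \<in> {1..p-1}" by (rule site_range[OF l i])
    note b = inU_bounds[OF t i]
    have "t i - z s < 0 \<longleftrightarrow> site l i < s"
    proof
      assume "t i - z s < 0"
      show "site l i < s"
      proof (rule ccontr)
        assume "\<not> site l i < s"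
        then have "z s \<le> z (site l i)" using z_le[of s "site l i"] s st by auto
        then show False using b \<open>t i - z s < 0\<close> by linarith
      qed
    next
      assume "site l i < s"
      then have "z (site l i + 1) \<le> z s" using z_le[of "site l i + 1" s] s by auto
      then show "t i - z s < 0" using b False by linarith
    qed
    then show ?thesis unfolding br_pow_of_real by (simp only: mult.commute)
  qed (simp add: br_pow_def)
  have 2: "br_pow (of_real (t j - t i)) (2 * \<gamma>) = cpw (t j - t i) (2 * \<gamma>)" if "i \<in> {1..n}" "j \<in> {i<..n}" for i j
    using inU_sorted[OF t, of i j] that unfolding br_pow_of_real by auto
  have "(\<Prod>s=1..p. \<Prod>i=1..n. br_pow (of_real (t i - z s)) (\<alpha> s)) = (\<Prod>i=1..n. \<Prod>s=1..p. br_pow (of_real (t i - z s)) (\<alpha> s))"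
    by (rule prod.swap)
  also have "\<dots> = (\<Prod>i=1..n. \<Prod>s=1..p. (if site l i < s then exp (\<i> * pi * \<alpha> s) else 1) * cpw (t i - z s) (\<alpha> s))"
    by (intro prod.cong[OF refl] 1)
  also have "\<dots> = (\<Prod>i=1..n. phase (site l i)) * (\<Prod>i=1..n. \<Prod>s=1..p. cpw (t i - z s) (\<alpha> s))"
    unfolding phase_def prod.distrib ..
  finally have A: "(\<Prod>s=1..p. \<Prod>i=1..n. br_pow (of_real (t i - z s)) (\<alpha> s)) = (\<Prod>i=1..n. phase (site l i)) * (\<Prod>i=1..n. \<Prod>s=1..p. cpw (t i - z s) (\<alpha> s))" .
  have B: "(\<Prod>i=1..n. \<Prod>j\<in>{i<..n}. br_pow (of_real (t j - t i)) (2 * \<gamma>)) = vdm n \<gamma> t"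
    unfolding vdm_def by (intro prod.cong[OF refl] 2)
  show ?thesis unfolding Phi_def Psi_def A B by (simp only: mult.assoc)
qed

lemma integral_Phi_omega:
  assumes l: "l \<in> Zset n (p - 1)"
  shows "set_lebesgue_integral (Rn n) (Uset n p z l) (\<lambda>t. Phi n p z \<alpha> \<gamma> t * omega n p z m t)
    = (\<Prod>i=1..n. phase (site l i)) * entry l m"
proof -
  have "indicator (Uset n p z l) t *\<^sub>R (Phi n p z \<alpha> \<gamma> t * omega n p z m t)
      = (\<Prod>i=1..n. phase (site l i)) * (indU l t *\<^sub>R (Psi n p z \<alpha> \<gamma> t * omega n p z m t))" for t
  proof (cases "inU l t")
    case True
    then have "t \<in> Uset n p z l" using Uset_iff[OF l] by simp
    then show ?thesis using True Phi_eq_phase_Psi[OF l True] by (simp add: indU_def mult_ac)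
  next
    case False
    then have "t \<notin> Uset n p z l" using Uset_iff[OF l] by simp
    then show ?thesis using False by (simp add: indU_def)
  qed
  then show ?thesis unfolding set_lebesgue_integral_def entry_def by (simp only: integral_mult_right_zero)
qed

text \<open>The exponent s - 1 counts the intervals to the left of z_s, and each interval occurs
  \<open>nb\<close> times over all rows and variables.\<close>

lemma prod_phase: "(\<Prod>r=1..p-1. phase r) ^ nb = exp (\<i> * pi * of_nat nb * (\<Sum>s=1..p. of_nat (s - 1) * \<alpha> s))"
proof -
  have "(\<Prod>r=1..p-1. phase r) = (\<Prod>s=1..p. \<Prod>r=1..p-1. if r < s then exp (\<i> * pi * \<alpha> s) else 1)"
    unfolding phase_def by (rule prod.swap)
  also have "\<dots> = (\<Prod>s=1..p. exp (\<i> * pi * (of_nat (s - 1) * \<alpha> s)))"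
  proof (rule prod.cong[OF refl])
    fix s assume "s \<in> {1..p}"
    then have e: "{r \<in> {1..p-1}. r < s} = {1..<s}" by auto
    have "(\<Prod>r=1..p-1. if r < s then exp (\<i> * pi * \<alpha> s) else 1) = (\<Prod>r\<in>{r \<in> {1..p-1}. r < s}. exp (\<i> * pi * \<alpha> s))"
      by (rule prod.inter_filter[symmetric]) simp
    also have "\<dots> = exp (\<i> * pi * \<alpha> s) ^ (s - 1)" unfolding e by simp
    also have "\<dots> = exp (of_nat (s - 1) * (\<i> * pi * \<alpha> s))" by (rule exp_of_nat_mult[symmetric])
    finally show "(\<Prod>r=1..p-1. if r < s then exp (\<i> * pi * \<alpha> s) else 1) = exp (\<i> * pi * (of_nat (s - 1) * \<alpha> s))"
      by (simp only: mult_ac)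
  qed
  also have "\<dots> = exp (\<i> * pi * (\<Sum>s=1..p. of_nat (s - 1) * \<alpha> s))"
    by (simp only: exp_sum[OF finite_atLeastAtMost] sum_distrib_left)
  finally have "(\<Prod>r=1..p-1. phase r) ^ nb = exp (of_nat nb * (\<i> * pi * (\<Sum>s=1..p. of_nat (s - 1) * \<alpha> s)))"
    by (simp only: exp_of_nat_mult)
  then show ?thesis by (simp only: mult_ac)
qed

lemma prod_last: "(\<Prod>s=1..p. f s) = (\<Prod>s=1..p-1. f s) * f p" for f :: "nat \<Rightarrow> complex"
proof -
  have "{1..p} = insert p {1..p-1}" "p \<notin> {1..p-1}" using p2 by auto
  then show ?thesis by (simp add: mult.commute)
qed

text \<open>The powers of c_s = z_p - z_s with exponent \<alpha>_s supply the missing row s = p of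
  the off-diagonal product, and those with exponent 2 \<gamma> supply the pairs with b = p. So the
  asymmetric role of z_p in the substitution disappears. The bases are positive, so
  \<open>br_pow\<close> equals \<open>cpw\<close>.\<close>

lemma prod_Kst:
  "(\<Prod>l\<in>Zset n (p - 1). Kst l) = (\<Prod>b=1..p. \<Prod>a=1..<b. br_pow (of_real (z b - z a)) ((\<alpha> a + \<alpha> b) * of_nat nb + 2 * \<gamma> * of_nat nb'))"
proof -
  define g where "g s = cpw (cs s) (\<alpha> s) * (\<Prod>r\<in>{1..p}-{s}. cpw (z s - z r) (\<alpha> r))" for s
  define G where "G r s = (if r = s then cpw (cs r) (2 * \<gamma>) else cpw (z s - z r) (2 * \<gamma>))" for r s
  have pm: "{1..p} - {p} = {1..p-1}" "{1..<p} = {1..p-1}" using p2 by auto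
  have "(\<Prod>s=1..p-1. g s) = (\<Prod>s=1..p. \<Prod>r\<in>{1..p}-{s}. cpw (z s - z r) (\<alpha> r))"
    unfolding g_def prod_last pm prod.distrib cs_def by (simp only: mult.commute)
  also have "\<dots> = (\<Prod>b=1..p. \<Prod>a=1..<b. cpw (z b - z a) (\<alpha> a) * cpw (z a - z b) (\<alpha> b))"
    by (rule prod_off_diagonal)
  also have "\<dots> = (\<Prod>b=1..p. \<Prod>a=1..<b. cpw (z b - z a) (\<alpha> a + \<alpha> b))"
    by (intro prod.cong[OF refl]) (simp only: cpw_add cpw_commute[of "z _" "z _" "\<alpha> _"])
  finally have g: "(\<Prod>s=1..p-1. g s) = (\<Prod>b=1..p. \<Prod>a=1..<b. cpw (z b - z a) (\<alpha> a + \<alpha> b))" .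
  have G1: "(\<Prod>s=1..p-1. \<Prod>r=1..<s. G r s) = (\<Prod>s=1..p-1. \<Prod>r=1..<s. cpw (z s - z r) (2 * \<gamma>))"
    unfolding G_def by (intro prod.cong[OF refl]) simp
  have G2: "(\<Prod>s=1..p-1. G s s) = (\<Prod>r=1..p-1. cpw (z p - z r) (2 * \<gamma>))" unfolding G_def cs_def by simp
  have G: "(\<Prod>s=1..p-1. G s s) * (\<Prod>s=1..p-1. \<Prod>r=1..<s. G r s) = (\<Prod>b=1..p. \<Prod>a=1..<b. cpw (z b - z a) (2 * \<gamma>))"
    unfolding G1 G2 prod_last pm by (simp only: mult.commute)
  have "(\<Prod>l\<in>Zset n (p - 1). Kst l) = (\<Prod>l\<in>Zset n (p - 1). \<Prod>i=1..n. g (site l i)) * (\<Prod>l\<in>Zset n (p - 1). \<Prod>i=1..n. \<Prod>j\<in>{i<..n}. G (site l i) (site l j))"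
    unfolding Kst_def g_def G_def by (rule prod.distrib)
  also have "\<dots> = (\<Prod>b=1..p. \<Prod>a=1..<b. cpw (z b - z a) (\<alpha> a + \<alpha> b) ^ nb * cpw (z b - z a) (2 * \<gamma>) ^ nb')"
    unfolding prod_Zset_site prod_Zset_site_pairs g G by (simp only: prod_power_distrib prod.distrib)
  also have "\<dots> = (\<Prod>b=1..p. \<Prod>a=1..<b. br_pow (of_real (z b - z a)) ((\<alpha> a + \<alpha> b) * of_nat nb + 2 * \<gamma> * of_nat nb'))"
  proof (intro prod.cong[OF refl])
    fix b a assume "b \<in> {1..p}" "a \<in> {1..<b}"
    then have d: "z b - z a > 0" using z_less[of a b] by simp
    then have "z b - z a \<noteq> 0" by simp
    then have "cpw (z b - z a) (\<alpha> a + \<alpha> b) ^ nb * cpw (z b - z a) (2 * \<gamma>) ^ nb' = cpw (z b - z a) ((\<alpha> a + \<alpha> b) * of_nat nb + 2 * \<gamma> * of_nat nb')"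
      unfolding cpw_power[OF \<open>z b - z a \<noteq> 0\<close>] cpw_add[symmetric] by (simp only: mult.commute)
    then show "cpw (z b - z a) (\<alpha> a + \<alpha> b) ^ nb * cpw (z b - z a) (2 * \<gamma>) ^ nb' = br_pow (of_real (z b - z a)) ((\<alpha> a + \<alpha> b) * of_nat nb + 2 * \<gamma> * of_nat nb')"
      unfolding br_pow_of_real using d by simp
  qed
  finally show ?thesis .
qed

text \<open>The factors of \<open>Lag_formula\<close> do not depend on the length of the block, only
  their number does; \<open>Zset_tail_prod\<close> collects equal factors over all rows.\<close>

lemma prod_Lag:
  "(\<Prod>l\<in>Zset n (p - 1). \<Prod>s=1..p-1. Lag (l s) (\<alpha> s) \<gamma>)
    = (\<Prod>i<n. ((\<Prod>s=1..p-1. Gamma (\<alpha> s + of_nat i * \<gamma>)) * (Gamma (of_nat (i + 1) * \<gamma>) ^ (p - 1) / Gamma \<gamma> ^ (p - 1))) ^ card (Zset (n - 1 - i) (p - 1)))"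
proof -
  define R where "R s i = Gamma (\<alpha> s + of_nat i * \<gamma>) * (Gamma (of_nat (i + 1) * \<gamma>) / Gamma \<gamma>)" for s i
  have "(\<Prod>l\<in>Zset n (p - 1). \<Prod>s=1..p-1. Lag (l s) (\<alpha> s) \<gamma>) = (\<Prod>l\<in>Zset n (p - 1). \<Prod>s=1..p-1. \<Prod>i<l s. R s i)"
  proof (rule prod.cong[OF refl], rule prod.cong[OF refl])
    fix l :: "nat \<Rightarrow> nat" and s assume "s \<in> {1..p-1}"
    then have "Re (\<alpha> s) > 0" using Apos[of s] p2 by auto
    then show "Lag (l s) (\<alpha> s) \<gamma> = (\<Prod>i<l s. R s i)" unfolding R_def by (rule Lag_formula[OF Gpos])
  qed
  also have "\<dots> = (\<Prod>s=1..p-1. \<Prod>l\<in>Zset n (p - 1). \<Prod>i<l s. R s i)" by (rule prod.swap)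
  also have "\<dots> = (\<Prod>s=1..p-1. \<Prod>i<n. R s i ^ card (Zset (n - 1 - i) (p - 1)))"
    by (rule prod.cong[OF refl], rule Zset_tail_prod)
  also have "\<dots> = (\<Prod>i<n. \<Prod>s=1..p-1. R s i ^ card (Zset (n - 1 - i) (p - 1)))" by (rule prod.swap)
  also have "\<dots> = (\<Prod>i<n. ((\<Prod>s=1..p-1. Gamma (\<alpha> s + of_nat i * \<gamma>)) * (Gamma (of_nat (i + 1) * \<gamma>) ^ (p - 1) / Gamma \<gamma> ^ (p - 1))) ^ card (Zset (n - 1 - i) (p - 1)))"
  proof (rule prod.cong[OF refl])
    fix i
    have "(\<Prod>s=1..p-1. R s i) = (\<Prod>s=1..p-1. Gamma (\<alpha> s + of_nat i * \<gamma>)) * (Gamma (of_nat (i + 1) * \<gamma>) ^ (p - 1) / Gamma \<gamma> ^ (p - 1))"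
      unfolding R_def prod.distrib prod_constant power_divide[symmetric] by simp
    then show "(\<Prod>s=1..p-1. R s i ^ card (Zset (n - 1 - i) (p - 1))) = ((\<Prod>s=1..p-1. Gamma (\<alpha> s + of_nat i * \<gamma>)) * (Gamma (of_nat (i + 1) * \<gamma>) ^ (p - 1) / Gamma \<gamma> ^ (p - 1))) ^ card (Zset (n - 1 - i) (p - 1))"
      by (metis prod_power_distrib)
  qed
  finally show ?thesis .
qed

text \<open>Phases leave the determinant row by row. In \<open>det_entry\<close> the constants
  \<open>Kst\<close> give the powers of z_b - z_a, while the integrals \<open>Lag\<close> and the
  quotients of \<open>xs\<close> and \<open>ys\<close> share the same binomial exponents and merge
  into one bracket.\<close>

lemma det_integral_Phi_omega:
  "det_on (Zset n (p - 1)) (\<lambda>l m. set_lebesgue_integral (Rn n) (Uset n p z l) (\<lambda>t. Phi n p z \<alpha> \<gamma> t * omega n p z m t))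
    = (\<Prod>s=0..<n.
         ((Gamma (of_nat (s + 1) * \<gamma>) ^ (p - 1) / Gamma \<gamma> ^ (p - 1)) *
          (Gamma (1 + \<alpha> p + of_nat s * \<gamma>) * (\<Prod>j=1..p-1. Gamma (\<alpha> j + of_nat s * \<gamma>)) /
           Gamma (1 + (\<Sum>j=1..p. \<alpha> j) + (2 * of_nat n - 2 - of_nat s) * \<gamma>)))
         ^ ((p + n - s - 3) choose (p - 2)))
      * exp (\<i> * pi * of_nat nb * (\<Sum>s=1..p. of_nat (s - 1) * \<alpha> s))
      * (\<Prod>b=1..p. \<Prod>a=1..<b. br_pow (of_real (z b - z a)) ((\<alpha> a + \<alpha> b) * of_nat nb + 2 * \<gamma> * of_nat nb'))"
    (is "?L = ?G * ?E * ?B")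
proof -
  let ?Z = "Zset n (p - 1)"
  have "?L = det_on ?Z (\<lambda>l m. (\<Prod>i=1..n. phase (site l i)) * entry l m * 1)"
    by (rule det_on_cong) (simp only: integral_Phi_omega mult_1_right)
  also have "\<dots> = (\<Prod>l\<in>?Z. \<Prod>i=1..n. phase (site l i)) * det_on ?Z entry"
    unfolding det_on_scale by simp
  also have "(\<Prod>l\<in>?Z. \<Prod>i=1..n. phase (site l i)) = ?E" unfolding prod_Zset_site prod_phase ..
  also have "det_on ?Z entry = ?B * ?G"
  proof -
    have c: "card (Zset (n - 1 - i) (p - 1)) = (p + n - i - 3) choose (p - 2)" if "i < n" for i
    proof -
      have e: "p - 1 = Suc (p - 2)" "n - 1 - i + (p - 2) = p + n - i - 3" using that p2 by auto
      show ?thesis using card_Zset[of "n - 1 - i" "p - 2"] unfolding e(2) unfolding e(1)[symmetric] .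
    qed
    have "(\<Prod>l\<in>?Z. \<Prod>s=1..p-1. Lag (l s) (\<alpha> s) \<gamma>) * (\<Prod>i<n. (Gamma (xs i) / Gamma (ys i)) ^ card (Zset (n - 1 - i) (p - 1))) = ?G"
      unfolding prod_Lag prod.distrib[symmetric] atLeast0LessThan
    proof (rule prod.cong[OF refl])
      fix i assume "i \<in> {..<n}"
      then have "i < n" by simp
      show "((\<Prod>s=1..p-1. Gamma (\<alpha> s + of_nat i * \<gamma>)) * (Gamma (of_nat (i + 1) * \<gamma>) ^ (p - 1) / Gamma \<gamma> ^ (p - 1))) ^ card (Zset (n - 1 - i) (p - 1))
          * (Gamma (xs i) / Gamma (ys i)) ^ card (Zset (n - 1 - i) (p - 1))
        = ((Gamma (of_nat (i + 1) * \<gamma>) ^ (p - 1) / Gamma \<gamma> ^ (p - 1)) *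
          (Gamma (1 + \<alpha> p + of_nat i * \<gamma>) * (\<Prod>j=1..p-1. Gamma (\<alpha> j + of_nat i * \<gamma>)) /
           Gamma (1 + (\<Sum>j=1..p. \<alpha> j) + (2 * of_nat n - 2 - of_nat i) * \<gamma>)))
         ^ ((p + n - i - 3) choose (p - 2))"
        unfolding c[OF \<open>i < n\<close>] power_mult_distrib[symmetric] xs_def ys_def by (simp only: divide_inverse mult_ac)
    qed
    then show ?thesis unfolding det_entry XL_def prod.distrib prod_Kst by (simp only: mult.assoc)
  qed
  finally show ?thesis by (simp only: mult_ac)
qed

end

theorem theorem4:
  fixes n p :: nat and z :: "nat \<Rightarrow> real" and \<alpha> :: "nat \<Rightarrow> complex" and \<gamma> :: complex
  assumes "p \<ge> 2"
    and "\<And>s. s \<in> {1..<p} \<Longrightarrow> z s < z (s + 1)"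
    and "\<And>s. s \<in> {1..p} \<Longrightarrow> Re (\<alpha> s) > 0"
    and "Re \<gamma> > 0"
  shows "det_on (Zset n (p - 1))
           (\<lambda>l m. set_lebesgue_integral (Rn n) (Uset n p z l)
                    (\<lambda>t. Phi n p z \<alpha> \<gamma> t * omega n p z m t))
    = (\<Prod>s=0..<n.
         ((Gamma (of_nat (s + 1) * \<gamma>) ^ (p - 1) / Gamma \<gamma> ^ (p - 1)) *
          (Gamma (1 + \<alpha> p + of_nat s * \<gamma>) * (\<Prod>j=1..p-1. Gamma (\<alpha> j + of_nat s * \<gamma>)) /
           Gamma (1 + (\<Sum>j=1..p. \<alpha> j) + (2 * of_nat n - 2 - of_nat s) * \<gamma>)))
         ^ ((p + n - s - 3) choose (p - 2)))
      * exp (\<i> * pi * of_nat ((p + n - 2) choose (p - 1)) * (\<Sum>s=1..p. of_nat (s - 1) * \<alpha> s))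
      * (\<Prod>b=1..p. \<Prod>a=1..<b.
           br_pow (complex_of_real (z b - z a))
             ((\<alpha> a + \<alpha> b) * of_nat ((p + n - 2) choose (p - 1))
              + 2 * \<gamma> * of_nat ((p + n - 2) choose p)))"
proof -
  have "Re (\<alpha> p) > 0" by (rule assms(3)) (use assms(1) in simp)
  then interpret conf n p z \<alpha> \<gamma>
    by unfold_locales (use assms in \<open>auto intro: less_trans[of "- 1" 0]\<close>)
  show ?thesis by (rule det_integral_Phi_omega)
qed

end
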